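(* Let $f:2^V\to\mathbb{R}$ be a submodular function with $u_f\in\mathbb{R}^V_{\ge0}$, let $k\in\mathbb{Z}_{>0}$, let $\phi\ge|f^*|$ and let $0<\delta\le\phi$. Assume $\phi=\Omega(\|u_f\|_\infty/k)$. Then there is a randomized algorithm which outputs a set of permutations $\{\pi^{(t)}\}_{t\in[m]}$ of $V$ in time $\widetilde{O}(m)\cdot(\mathsf{EO}+\mathsf{poly}(n))$, where $$m=\widetilde{O}\big(k^6\delta^{-4}\phi^2(\|u_f\|_\infty+\phi)(\|u_f\|_1+\phi)\big),$$ such that $y:=\frac1m\sum_{t\in[m]}g_{\pi^{(t)}}$ is a $(\delta,k)$ dual certificate for $f$ with high probability.
   Context: $V$ is a finite set, $n=|V|$; $f:2^V\to\mathbb{R}$ is submodular with $f(\emptyset)=0$, accessed via an evaluation oracle with cost $\mathsf{EO}$ per query; $f^*=\min_S f(S)$. $u_f\in\mathbb{R}^V$ is defined by $(u_f)_p=f(\{p\})$. For a bijection $\pi:[n]\to V$ let $\pi[i]=\{\pi(1),\dots,\pi(i)\}$, $\pi[0]=\emptyset$, and define $g_\pi\in\mathbb{R}^V$ by $(g_\pi)_{\pi(i)}=f(\pi[i])-f(\pi[i-1])$. For $y\in\mathbb{R}^V$ and $S\subseteq V$, $y(S)=\sum_{p\in S}y_p$; for an integer $\ell>0$, $y^\ell_-(V)$ denotes the sum of the $\ell$ most negative coordinates of $\min\{y,0\}$ (equivalently $\min\{y^\top w: w\in[0,1]^V,\|w\|_1\le\ell\}$). A vector $y\in\mathbb{R}^V$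 is a $(\delta,k)$ dual certificate for $f$ if (1) $f^*\le y^{k+1}_-(V)+\delta$ and (2) $f(S)\ge y(S)$ for every $S\subseteq V$ with $|S|\le k$. "With high probability" means probability $1-n^{-C}$ for a constant $C>0$; $\widetilde{O}$ hides $\mathsf{poly}(\log n)$ factors. *)

theory Defs
  imports
    "HOL-Probability.Probability"
    "HOL-Library.Multiset"
    "HOL-Library.Landau_Symbols"
begin

section \<open>Submodular functions and dual certificates\<close>

definition submodular_on :: "'a set \<Rightarrow> ('a set \<Rightarrow> real) \<Rightarrow> bool" where
  "submodular_on V f \<longleftrightarrow>
     (\<forall>S T. S \<subseteq> V \<longrightarrow> T \<subseteq> V \<longrightarrow> f (S \<union> T) + f (S \<inter> T) \<le> f S + f T)"

definition min_value :: "'a set \<Rightarrow> ('a set \<Rightarrow> real) \<Rightarrow> real" where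
  "min_value V f = Min (f ` Pow V)"

definition singleton_vec :: "('a set \<Rightarrow> real) \<Rightarrow> 'a \<Rightarrow> real" where
  "singleton_vec f p = f {p}"

definition norm1 :: "'a set \<Rightarrow> ('a \<Rightarrow> real) \<Rightarrow> real" where
  "norm1 V y = (\<Sum>p\<in>V. \<bar>y p\<bar>)"

text \<open>The inserted \<open>0\<close> only matters for empty \<open>V\<close>.\<close>

definition norm_inf :: "'a set \<Rightarrow> ('a \<Rightarrow> real) \<Rightarrow> real" where
  "norm_inf V y = Max (insert 0 ((\<lambda>p. \<bar>y p\<bar>) ` V))"

text \<open>A permutation of \<open>V\<close> is a bijection \<open>\<pi>\<close> from \<open>{1..card V}\<close> to \<open>V\<close>.\<close>

definition greedy_vec :: "'a set \<Rightarrow> ('a set \<Rightarrow> real) \<Rightarrow> (nat \<Rightarrow> 'a) \<Rightarrow> 'a \<Rightarrow> real" where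
  "greedy_vec V f \<pi> p =
     (let i = inv_into {1..card V} \<pi> p in f (\<pi> ` {1..i}) - f (\<pi> ` {1..i - 1}))"

text \<open>\<open>neg_sum V l y\<close> is $y^l_-(V)$: the coordinates of $\min\{y,0\}$ are sorted in
  increasing order, with multiplicity, and the first \<open>l\<close> of them are added up (all of them if
  \<open>l\<close> exceeds \<open>card V\<close>).\<close>

definition neg_sum :: "'a set \<Rightarrow> nat \<Rightarrow> ('a \<Rightarrow> real) \<Rightarrow> real" where
  "neg_sum V l y =
     sum_list (take l (sorted_list_of_multiset (image_mset (\<lambda>p. min (y p) 0) (mset_set V))))"

definition dual_certificate ::
    "'a set \<Rightarrow> ('a set \<Rightarrow> real) \<Rightarrow> real \<Rightarrow> nat \<Rightarrow> ('a \<Rightarrow> real) \<Rightarrow> bool" where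
  "dual_certificate V f \<delta> k y \<longleftrightarrow>
     min_value V f \<le> neg_sum V (k + 1) y + \<delta> \<and>
     (\<forall>S. S \<subseteq> V \<longrightarrow> card S \<le> k \<longrightarrow> f S \<ge> (\<Sum>p\<in>S. y p))"

section \<open>Factors hidden by asymptotic notation\<close>

definition polylog :: "(nat \<Rightarrow> real) \<Rightarrow> bool" where
  "polylog L \<longleftrightarrow> (\<exists>a. L \<in> O(\<lambda>n. ln (real n) ^ a))"

definition poly_bounded :: "(nat \<Rightarrow> real) \<Rightarrow> bool" where
  "poly_bounded q \<longleftrightarrow> (\<exists>d. q \<in> O(\<lambda>n. real n ^ d))"

section \<open>Randomized real-RAM programs with an evaluation oracle\<close>

text \<open>
  Programs work on natural-number and real scalars and arrays (infinitely many cells each,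
  initially \<open>0\<close>). They are finite syntactic objects that do not depend on \<open>n\<close>. Two restrictions
  keep the unit-cost measure honest. The only constants are natural numbers, so that no real
  constant can carry infinitely much advice. Naturals have no multiplication and reals cannot be
  rounded to naturals, so that no superpolynomial amount of work fits into a single operation.
  Expressions have a size fixed by the program, hence evaluating one counts as one time unit.
\<close>

type_synonym vname = string

datatype nexp =
    NConst nat
  | NVar vname
  | NArr vname nexp
  | NAdd nexp nexp
  | NSub nexp nexp

datatype rexp =
    RNat nexp
  | RVar vname
  | RArr vname nexp
  | RAdd rexp rexp
  | RSub rexp rexp
  | RMul rexp rexp
  | RDiv rexp rexp

datatype bexp =
    NLess nexp nexp
  | RLess rexp rexp
  | BNot bexp
  | BAnd bexp bexp

text \<open>
  \<^item> \<open>Flip x p\<close> sets the natural scalar \<open>x\<close> to \<open>1\<close> with probability \<open>p\<close> (clamped to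
    \<open>[0,1]\<close>) and to \<open>0\<close> otherwise, independently of everything before.
  \<^item> \<open>Query x A\<close> stores in the real scalar \<open>x\<close> the oracle value at the set of all \<open>i < n\<close> for
    which the natural array \<open>A\<close> is nonzero at \<open>i\<close>.
  \<^item> \<open>Emit A\<close> appends the first \<open>n\<close> cells of the natural array \<open>A\<close> to the output.
\<close>

datatype com =
    SKIP
  | NAssign vname nexp
  | NStore vname nexp nexp
  | RAssign vname rexp
  | RStore vname nexp rexp
  | Flip vname rexp
  | Query vname vname
  | Emit vname
  | Seq com com
  | If bexp com com
  | While bexp com

record state =
  nvar :: "vname \<Rightarrow> nat"
  narr :: "vname \<Rightarrow> nat \<Rightarrow> nat"
  rvar :: "vname \<Rightarrow> real"
  rarr :: "vname \<Rightarrow> nat \<Rightarrow> real"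
  ticks :: nat
  queries :: nat
  out :: "nat list list"

primrec nval :: "nexp \<Rightarrow> state \<Rightarrow> nat" where
  "nval (NConst c) s = c"
| "nval (NVar x) s = nvar s x"
| "nval (NArr A e) s = narr s A (nval e s)"
| "nval (NAdd e1 e2) s = nval e1 s + nval e2 s"
| "nval (NSub e1 e2) s = nval e1 s - nval e2 s"

primrec rval :: "rexp \<Rightarrow> state \<Rightarrow> real" where
  "rval (RNat e) s = real (nval e s)"
| "rval (RVar x) s = rvar s x"
| "rval (RArr A e) s = rarr s A (nval e s)"
| "rval (RAdd e1 e2) s = rval e1 s + rval e2 s"
| "rval (RSub e1 e2) s = rval e1 s - rval e2 s"
| "rval (RMul e1 e2) s = rval e1 s * rval e2 s"
| "rval (RDiv e1 e2) s = rval e1 s / rval e2 s"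

primrec bval :: "bexp \<Rightarrow> state \<Rightarrow> bool" where
  "bval (NLess e1 e2) s \<longleftrightarrow> nval e1 s < nval e2 s"
| "bval (RLess e1 e2) s \<longleftrightarrow> rval e1 s < rval e2 s"
| "bval (BNot b) s \<longleftrightarrow> \<not> bval b s"
| "bval (BAnd b1 b2) s \<longleftrightarrow> bval b1 s \<and> bval b2 s"

definition tick :: "nat \<Rightarrow> state \<Rightarrow> state" where
  "tick t s = s\<lparr>ticks := ticks s + t\<rparr>"

text \<open>
  One transition on inputs of size \<open>n\<close> with oracle \<open>F\<close>. The configuration \<open>(SKIP, s)\<close> is
  halted. Handling the \<open>n\<close> array cells in \<open>Query\<close> and \<open>Emit\<close> takes \<open>n\<close> ticks; the price of
  the oracle call itself is accounted for by the separate counter \<open>queries\<close>.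
\<close>

primrec step :: "nat \<Rightarrow> (nat set \<Rightarrow> real) \<Rightarrow> com \<Rightarrow> state \<Rightarrow> (com \<times> state) pmf" where
  "step n F SKIP s = return_pmf (SKIP, s)"
| "step n F (NAssign x e) s =
     return_pmf (SKIP, tick 1 (s\<lparr>nvar := (nvar s)(x := nval e s)\<rparr>))"
| "step n F (NStore A i e) s =
     return_pmf (SKIP, tick 1 (s\<lparr>narr := (narr s)(A := (narr s A)(nval i s := nval e s))\<rparr>))"
| "step n F (RAssign x e) s =
     return_pmf (SKIP, tick 1 (s\<lparr>rvar := (rvar s)(x := rval e s)\<rparr>))"
| "step n F (RStore A i e) s =
     return_pmf (SKIP, tick 1 (s\<lparr>rarr := (rarr s)(A := (rarr s A)(nval i s := rval e s))\<rparr>))"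
| "step n F (Flip x p) s =
     map_pmf (\<lambda>b. (SKIP, tick 1 (s\<lparr>nvar := (nvar s)(x := of_bool b)\<rparr>)))
       (bernoulli_pmf (max 0 (min 1 (rval p s))))"
| "step n F (Query x A) s =
     return_pmf (SKIP, tick (n + 1)
       (s\<lparr>rvar := (rvar s)(x := F {i. i < n \<and> narr s A i \<noteq> 0}), queries := queries s + 1\<rparr>))"
| "step n F (Emit A) s =
     return_pmf (SKIP, tick (n + 1) (s\<lparr>out := out s @ [map (narr s A) [0..<n]]\<rparr>))"
| "step n F (Seq c1 c2) s =
     (if c1 = SKIP then return_pmf (c2, tick 1 s)
      else map_pmf (\<lambda>(c, s'). (Seq c c2, s')) (step n F c1 s))"
| "step n F (If b c1 c2) s = return_pmf (if bval b s then c1 else c2, tick 1 s)"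
| "step n F (While b c) s =
     return_pmf (if bval b s then Seq c (While b c) else SKIP, tick 1 s)"

primrec run :: "nat \<Rightarrow> (nat set \<Rightarrow> real) \<Rightarrow> nat \<Rightarrow> com \<times> state \<Rightarrow> (com \<times> state) pmf" where
  "run n F 0 cfg = return_pmf cfg"
| "run n F (Suc N) cfg = bind_pmf (step n F (fst cfg) (snd cfg)) (run n F N)"

text \<open>The input consists of \<open>n\<close>, \<open>k\<close>, \<open>\<phi>\<close> and \<open>\<delta>\<close>; nothing about the function is
  supplied except through the oracle.\<close>

definition init_state :: "nat \<Rightarrow> nat \<Rightarrow> real \<Rightarrow> real \<Rightarrow> state" where
  "init_state n k \<phi> \<delta> =
     \<lparr>nvar = (\<lambda>x. 0)(''n'' := n, ''k'' := k), narr = (\<lambda>A i. 0),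
      rvar = (\<lambda>x. 0)(''phi'' := \<phi>, ''delta'' := \<delta>), rarr = (\<lambda>A i. 0),
      ticks = 0, queries = 0, out = []\<rparr>"

definition running_time :: "real \<Rightarrow> state \<Rightarrow> real" where
  "running_time eo s = eo * real (queries s) + real (ticks s)"

text \<open>Elements of \<open>V\<close> are named by their index under an enumeration \<open>v\<close> of \<open>V\<close>, a bijection
  from \<open>{..<card V}\<close>. An output list \<open>w\<close> of indices denotes the map
  \<open>i \<mapsto> v (w ! (i - 1))\<close> on \<open>{1..card V}\<close>.\<close>

definition perm_of :: "(nat \<Rightarrow> 'a) \<Rightarrow> nat list \<Rightarrow> nat \<Rightarrow> 'a" where
  "perm_of v w i = v (w ! (i - 1))"

definition average_greedy ::
    "'a set \<Rightarrow> ('a set \<Rightarrow> real) \<Rightarrow> (nat \<Rightarrow> 'a) \<Rightarrow> nat list list \<Rightarrow> 'a \<Rightarrow> real" where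
  "average_greedy V f v ws p =
     (1 / real (length ws)) * (\<Sum>t<length ws. greedy_vec V f (perm_of v (ws ! t)) p)"

end

theory Submission
  imports Defs
begin

text \<open>
  The ground set is padded to \<open>2 ^ l\<close> elements and cut into dyadic blocks. A node of the dyadic tree
  becomes a block if it is a singleton or if its value and the values of \<open>O(k l)\<close> random subsets of
  density \<open>1 / (k + 2)\<close> all lie below \<open>z\<close>, of order \<open>\<delta> / k\<^sup>2\<close>. If \<open>S\<close> has at most \<open>k + 1\<close> elements
  and \<open>G (B - S) > (k + 2) z\<close>, then by submodularity one random subset of \<open>B\<close> reveals a value above
  \<open>z\<close> with probability at least \<open>1 / (4 (k + 2))\<close>, so with high probability no block \<open>B\<close> has such
  an \<open>S\<close>. A rejected node has total singleton weight at least \<open>z\<close>, so only about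
  \<open>1 + 2 l \<parallel>u\<parallel> / z\<close> (with the 1-norm) nodes are ever tested.

  Multiplicative weights then run on the blocks. Each round orders the blocks by the scores \<open>Y\<close>, emits
  the resulting permutation, and adds to \<open>Y\<close> an unbiased estimate of its greedy vector \<open>g\<close>: the vector
  \<open>U\<close> of block values, minus \<open>Z\<close> at a block \<open>p\<close> drawn with probability proportional to
  \<open>U p - g p \<ge> 0\<close>. Binary search draws \<open>p\<close> with \<open>l\<close> queries. Two exponential supermartingales control
  the run: one keeps every sum of at most \<open>k + 1\<close> scores above about \<open>T (f* - \<delta> / 4)\<close> after \<open>T\<close>
  rounds, the other keeps the true gains below the estimated ones. Passing from a set \<open>S\<close> to the
  blocks it meets loses at most \<open>(k + 1) (k + 2) z = \<delta> / 2\<close>.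
\<close>

text \<open>The number of rounds should scale with the 1-norm of the singleton values and not with
  \<open>n\<close>. It grows with the total weight \<open>Z\<close> sampled from, which is at most
  twice the number of visited nodes times a bound \<open>Kb\<close> on the entries of
  \<open>U\<close>. Hence the blocks: they are few, and composite ones have small value. The norms
  are no input, so \<open>Kb\<close> is a multiple of \<open>k * \<phi>\<close>; this is where
  \<phi> = \<Omega>(norm / k) enters.

  The first potential is a generating function over sets: expanding the product of
  \<open>1 + exp (- \<eta> * (Y q + \<epsilon> * T + \<theta>))\<close> gives one term per set of
  blocks, so a single bound controls all sums of scores. Cardinality enters as the price
  \<open>\<epsilon> * T + \<theta>\<close> per element: \<open>\<theta>\<close> makes the product
  over \<open>2 ^ l\<close> factors start below 3, and \<open>\<epsilon>\<close> pays for
  second-order errors.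

  The second inequality of a certificate holds surely and for sets of every size, since greedy
  vectors lie in the base polytope; only the first one is random. Time, queries and output length
  are sure bounds as well; only the failure indicator is bounded in expectation.\<close>

section \<open>A program logic for expected potentials\<close>

text \<open>Assertions and potentials see every state with its clock reset to \<open>0\<close>. The bound \<open>t\<close> limits the
  number of transitions as well as the ticks; \<open>r\<close> bounds the expectation of the final potential \<open>\<phi>\<close>.\<close>

definition Wp :: "nat \<Rightarrow> (nat set \<Rightarrow> real) \<Rightarrow> nat \<Rightarrow> com \<Rightarrow> state \<Rightarrow>
    (state \<Rightarrow> bool) \<Rightarrow> (state \<Rightarrow> ennreal) \<Rightarrow> ennreal \<Rightarrow> bool" where
  "Wp n F t c s Q \<phi> r \<longleftrightarrow> (\<forall>x. \<exists>D. run n F t (c, s\<lparr>ticks := x\<rparr>) = map_pmf (Pair SKIP) D \<and>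
     (\<forall>s'\<in>set_pmf D. Q (s'\<lparr>ticks := 0\<rparr>) \<and> ticks s' \<le> x + t) \<and>
     (\<integral>\<^sup>+s'. \<phi> (s'\<lparr>ticks := 0\<rparr>) \<partial>measure_pmf D) \<le> r)"

lemma run_SKIP: "run n F t (SKIP, s) = return_pmf (SKIP, s)"
  by (induction t) (auto simp: bind_return_pmf)

lemma run_add: "run n F (a + b) cfg = bind_pmf (run n F a cfg) (run n F b)"
  by (induction a arbitrary: cfg) (simp_all add: bind_return_pmf bind_assoc_pmf cong: bind_pmf_cong)

lemma nval_ticks [simp]: "nval e (s\<lparr>ticks := x\<rparr>) = nval e s"
  by (induction e) auto
lemma rval_ticks [simp]: "rval e (s\<lparr>ticks := x\<rparr>) = rval e s"
  by (induction e) auto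
lemma bval_ticks [simp]: "bval e (s\<lparr>ticks := x\<rparr>) = bval e s"
  by (induction e) auto

lemma map_run_halted:
  assumes "run n F a cfg = map_pmf (Pair SKIP) D"
  shows "run n F (a + b) cfg = map_pmf (Pair SKIP) D"
  unfolding run_add assms by (simp add: bind_map_pmf run_SKIP) (simp add: map_pmf_def)

lemma Wp_weaken:
  assumes "Wp n F t c s Q \<phi> r" "t \<le> t'" "\<And>s'. Q s' \<Longrightarrow> Q' s'"
    "\<And>s'. Q s' \<Longrightarrow> \<phi>' s' \<le> \<phi> s'" "r \<le> r'"
  shows "Wp n F t' c s Q' \<phi>' r'"
  unfolding Wp_def
proof
  fix x
  obtain D where D: "run n F t (c, s\<lparr>ticks := x\<rparr>) = map_pmf (Pair SKIP) D"
     "\<forall>s'\<in>set_pmf D. Q (s'\<lparr>ticks := 0\<rparr>) \<and> ticks s' \<le> x + t"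
     "(\<integral>\<^sup>+s'. \<phi> (s'\<lparr>ticks := 0\<rparr>) \<partial>measure_pmf D) \<le> r"
    using assms(1) unfolding Wp_def by blast
  have "run n F t' (c, s\<lparr>ticks := x\<rparr>) = map_pmf (Pair SKIP) D"
    using map_run_halted[OF D(1), of "t' - t"] assms(2) by simp
  moreover have "\<forall>s'\<in>set_pmf D. Q' (s'\<lparr>ticks := 0\<rparr>) \<and> ticks s' \<le> x + t'"
    using D(2) assms by fastforce
  moreover have "(\<integral>\<^sup>+s'. \<phi>' (s'\<lparr>ticks := 0\<rparr>) \<partial>measure_pmf D) \<le> (\<integral>\<^sup>+s'. \<phi> (s'\<lparr>ticks := 0\<rparr>) \<partial>measure_pmf D)"
    using D(2) assms(4) by (intro nn_integral_mono_AE AE_pmfI) auto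
  ultimately show "\<exists>D. run n F t' (c, s\<lparr>ticks := x\<rparr>) = map_pmf (Pair SKIP) D \<and>
     (\<forall>s'\<in>set_pmf D. Q' (s'\<lparr>ticks := 0\<rparr>) \<and> ticks s' \<le> x + t') \<and>
     (\<integral>\<^sup>+s'. \<phi>' (s'\<lparr>ticks := 0\<rparr>) \<partial>measure_pmf D) \<le> r'"
    using D(3) assms(5) by (meson order_trans)
qed

abbreviation Ws where "Ws n F t c s Q \<equiv> Wp n F t c s Q (\<lambda>_. 0) 0"

text \<open>A sure fact bounds the potential pointwise on the support; deterministic parts of the
  program enter expectation arguments this way.\<close>

lemma Wp_of_Ws:
  assumes "Ws n F t c s Q" "\<And>s'. Q s' \<Longrightarrow> \<phi> s' \<le> r"
  shows "Wp n F t c s Q \<phi> r"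
  unfolding Wp_def
proof
  fix x
  obtain D where D: "run n F t (c, s\<lparr>ticks := x\<rparr>) = map_pmf (Pair SKIP) D"
     "\<forall>s'\<in>set_pmf D. Q (s'\<lparr>ticks := 0\<rparr>) \<and> ticks s' \<le> x + t"
    using assms(1) unfolding Wp_def by blast
  have "(\<integral>\<^sup>+s'. \<phi> (s'\<lparr>ticks := 0\<rparr>) \<partial>measure_pmf D) \<le> (\<integral>\<^sup>+s'. r \<partial>measure_pmf D)"
    using D(2) assms(2) by (intro nn_integral_mono_AE AE_pmfI) auto
  then show "\<exists>D. run n F t (c, s\<lparr>ticks := x\<rparr>) = map_pmf (Pair SKIP) D \<and>
     (\<forall>s'\<in>set_pmf D. Q (s'\<lparr>ticks := 0\<rparr>) \<and> ticks s' \<le> x + t) \<and>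
     (\<integral>\<^sup>+s'. \<phi> (s'\<lparr>ticks := 0\<rparr>) \<partial>measure_pmf D) \<le> r"
    using D by (intro exI[of _ D]) auto
qed

lemma Wp_SKIP: "Q (s\<lparr>ticks := 0\<rparr>) \<Longrightarrow> \<phi> (s\<lparr>ticks := 0\<rparr>) \<le> r \<Longrightarrow> Wp n F 0 SKIP s Q \<phi> r"
  unfolding Wp_def by (intro allI exI[of _ "return_pmf (s\<lparr>ticks := _\<rparr>)"]) auto

lemma Wp_det_step:
  assumes "\<And>x. step n F c (s\<lparr>ticks := x\<rparr>) = return_pmf (SKIP, u\<lparr>ticks := x + t\<rparr>)"
    "Q (u\<lparr>ticks := 0\<rparr>)" "\<phi> (u\<lparr>ticks := 0\<rparr>) \<le> r" "t > 0"
  shows "Wp n F t c s Q \<phi> r"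
proof -
  \<comment> \<open>One transition does all the work, even when it costs several ticks as in
    \<open>Query\<close> and \<open>Emit\<close>; the other \<open>t - 1\<close> transitions idle in
    the halted configuration.\<close>
  have "run n F t (c, s\<lparr>ticks := x\<rparr>) = map_pmf (Pair SKIP) (return_pmf (u\<lparr>ticks := x + t\<rparr>))" for x
    using assms(1,4) by (cases t) (auto simp: bind_return_pmf run_SKIP)
  then show ?thesis unfolding Wp_def using assms(2,3)
    by (intro allI exI[of _ "return_pmf (u\<lparr>ticks := _ + t\<rparr>)"]) auto
qed

lemma Wp_NAssign:
  "Q (s\<lparr>nvar := (nvar s)(x := nval e s), ticks := 0\<rparr>) \<Longrightarrow>
   \<phi> (s\<lparr>nvar := (nvar s)(x := nval e s), ticks := 0\<rparr>) \<le> r \<Longrightarrow> Wp n F 1 (NAssign x e) s Q \<phi> r"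
  by (rule Wp_det_step[where u = "s\<lparr>nvar := (nvar s)(x := nval e s)\<rparr>"]) (auto simp: tick_def)
lemma Wp_NStore:
  "Q (s\<lparr>narr := (narr s)(A := (narr s A)(nval i s := nval e s)), ticks := 0\<rparr>) \<Longrightarrow>
   \<phi> (s\<lparr>narr := (narr s)(A := (narr s A)(nval i s := nval e s)), ticks := 0\<rparr>) \<le> r \<Longrightarrow> Wp n F 1 (NStore A i e) s Q \<phi> r"
  by (rule Wp_det_step[where u = "s\<lparr>narr := (narr s)(A := (narr s A)(nval i s := nval e s))\<rparr>"]) (auto simp: tick_def)
lemma Wp_RAssign:
  "Q (s\<lparr>rvar := (rvar s)(x := rval e s), ticks := 0\<rparr>) \<Longrightarrow>
   \<phi> (s\<lparr>rvar := (rvar s)(x := rval e s), ticks := 0\<rparr>) \<le> r \<Longrightarrow> Wp n F 1 (RAssign x e) s Q \<phi> r"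
  by (rule Wp_det_step[where u = "s\<lparr>rvar := (rvar s)(x := rval e s)\<rparr>"]) (auto simp: tick_def)
lemma Wp_RStore:
  "Q (s\<lparr>rarr := (rarr s)(A := (rarr s A)(nval i s := rval e s)), ticks := 0\<rparr>) \<Longrightarrow>
   \<phi> (s\<lparr>rarr := (rarr s)(A := (rarr s A)(nval i s := rval e s)), ticks := 0\<rparr>) \<le> r \<Longrightarrow> Wp n F 1 (RStore A i e) s Q \<phi> r"
  by (rule Wp_det_step[where u = "s\<lparr>rarr := (rarr s)(A := (rarr s A)(nval i s := rval e s))\<rparr>"]) (auto simp: tick_def)
lemma Wp_Query:
  "Q (s\<lparr>rvar := (rvar s)(x := F {i. i < n \<and> narr s A i \<noteq> 0}), queries := queries s + 1, ticks := 0\<rparr>) \<Longrightarrow>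
   \<phi> (s\<lparr>rvar := (rvar s)(x := F {i. i < n \<and> narr s A i \<noteq> 0}), queries := queries s + 1, ticks := 0\<rparr>) \<le> r \<Longrightarrow>
   Wp n F (n + 1) (Query x A) s Q \<phi> r"
  by (rule Wp_det_step[where u = "s\<lparr>rvar := (rvar s)(x := F {i. i < n \<and> narr s A i \<noteq> 0}), queries := queries s + 1\<rparr>"])
     (auto simp: tick_def)
lemma Wp_Emit:
  "Q (s\<lparr>out := out s @ [map (narr s A) [0..<n]], ticks := 0\<rparr>) \<Longrightarrow>
   \<phi> (s\<lparr>out := out s @ [map (narr s A) [0..<n]], ticks := 0\<rparr>) \<le> r \<Longrightarrow> Wp n F (n + 1) (Emit A) s Q \<phi> r"
  by (rule Wp_det_step[where u = "s\<lparr>out := out s @ [map (narr s A) [0..<n]]\<rparr>"]) (auto simp: tick_def)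

text \<open>The outcome \<open>b\<close> has to satisfy \<open>Q\<close> only if it has positive
  probability. The binary search relies on this to avoid intervals without mass.\<close>

lemma Wp_Flip:
  fixes s x p
  defines "u \<equiv> \<lambda>b. s\<lparr>nvar := (nvar s)(x := of_bool b), ticks := 0\<rparr>"
  assumes "\<And>b. (b \<Longrightarrow> 0 < rval p s) \<Longrightarrow> (\<not> b \<Longrightarrow> rval p s < 1) \<Longrightarrow> Q (u b)" "0 \<le> rval p s" "rval p s \<le> 1"
    "ennreal (rval p s) * \<phi> (u True) + ennreal (1 - rval p s) * \<phi> (u False) \<le> r"
  shows "Wp n F 1 (Flip x p) s Q \<phi> r"
  unfolding Wp_def
proof
  fix t
  let ?p = "rval p s"
  let ?D = "map_pmf (\<lambda>b. (u b)\<lparr>ticks := t + 1\<rparr>) (bernoulli_pmf ?p)"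
  have "run n F 1 (Flip x p, s\<lparr>ticks := t\<rparr>) = map_pmf (Pair SKIP) ?D"
    using assms(3,4) by (simp add: u_def map_pmf_def bind_assoc_pmf bind_return_pmf tick_def)
  moreover have "(\<integral>\<^sup>+s'. \<phi> (s'\<lparr>ticks := 0\<rparr>) \<partial>measure_pmf ?D) \<le> r"
    using assms(3-5) by (simp add: u_def ac_simps)
  moreover have "\<forall>s'\<in>set_pmf ?D. Q (s'\<lparr>ticks := 0\<rparr>) \<and> ticks s' \<le> t + 1"
  proof -
    have "Q (u b)" if "b \<in> set_pmf (bernoulli_pmf ?p)" for b
      using that assms(2)[of b] assms(3,4) by (cases b) (auto simp: set_pmf_iff)
    then show ?thesis by (auto simp: u_def)
  qed
  ultimately show "\<exists>D. run n F 1 (Flip x p, s\<lparr>ticks := t\<rparr>) = map_pmf (Pair SKIP) D \<and>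
     (\<forall>s'\<in>set_pmf D. Q (s'\<lparr>ticks := 0\<rparr>) \<and> ticks s' \<le> t + 1) \<and>
     (\<integral>\<^sup>+s'. \<phi> (s'\<lparr>ticks := 0\<rparr>) \<partial>measure_pmf D) \<le> r" by blast
qed

lemma Wp_first_step:
  assumes "\<And>x. step n F c (s\<lparr>ticks := x\<rparr>) = return_pmf (c', s\<lparr>ticks := x + 1\<rparr>)"
    "Wp n F t c' s Q \<phi> r"
  shows "Wp n F (t + 1) c s Q \<phi> r"
  unfolding Wp_def
proof
  fix x
  obtain D where D: "run n F t (c', s\<lparr>ticks := x + 1\<rparr>) = map_pmf (Pair SKIP) D"
     "\<forall>s'\<in>set_pmf D. Q (s'\<lparr>ticks := 0\<rparr>) \<and> ticks s' \<le> x + 1 + t"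
     "(\<integral>\<^sup>+s'. \<phi> (s'\<lparr>ticks := 0\<rparr>) \<partial>measure_pmf D) \<le> r"
    using assms(2) unfolding Wp_def by blast
  then show "\<exists>D. run n F (t + 1) (c, s\<lparr>ticks := x\<rparr>) = map_pmf (Pair SKIP) D \<and>
     (\<forall>s'\<in>set_pmf D. Q (s'\<lparr>ticks := 0\<rparr>) \<and> ticks s' \<le> x + (t + 1)) \<and>
     (\<integral>\<^sup>+s'. \<phi> (s'\<lparr>ticks := 0\<rparr>) \<partial>measure_pmf D) \<le> r"
    using assms(1)[of x] by (intro exI[of _ D]) (auto simp: bind_return_pmf)
qed

lemma Wp_If:
  assumes "bval b s \<Longrightarrow> Wp n F t c1 s Q \<phi> r" "\<not> bval b s \<Longrightarrow> Wp n F t c2 s Q \<phi> r"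
  shows "Wp n F (t + 1) (If b c1 c2) s Q \<phi> r"
  by (rule Wp_first_step[where c' = "if bval b s then c1 else c2"]) (use assms in \<open>auto simp: tick_def\<close>)

text \<open>The extra transition removes the \<open>SKIP\<close> in front of \<open>c2\<close>. If
  \<open>c1\<close> halts before its \<open>t1\<close> transitions are used up, the surplus is spent
  idling after \<open>c2\<close>, so upper bounds on durations compose.\<close>

lemma run_Seq:
  assumes "run n F t1 (c1, s) = map_pmf (Pair SKIP) D"
    "\<And>s'. s' \<in> set_pmf D \<Longrightarrow> run n F t2 (c2, tick 1 s') = map_pmf (Pair SKIP) (E s')"
  shows "run n F (t1 + 1 + t2) (Seq c1 c2, s) = map_pmf (Pair SKIP) (bind_pmf D E)"
  using assms
proof (induction t1 arbitrary: c1 s D)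
  case 0
  have "return_pmf (c1, s) = map_pmf (Pair SKIP) D" using 0(1) by simp
  then have "set_pmf (map_pmf (Pair SKIP) D) = {(c1, s)}" by (metis set_return_pmf)
  then have *: "c1 = SKIP" "set_pmf D = {s}" by (auto 0 3)
  then have D: "D = return_pmf s" by (simp add: set_pmf_subset_singleton[symmetric])
  show ?case using 0(2)[of s] * D by (simp add: bind_return_pmf)
next
  case (Suc t1)
  show ?case
  proof (cases "c1 = SKIP")
    case True
    then have "map_pmf (Pair SKIP) D = return_pmf (SKIP, s)" using Suc(2) by (simp add: bind_return_pmf run_SKIP)
    then have "set_pmf (map_pmf (Pair SKIP) D) = {(SKIP, s)}" by (metis set_return_pmf)
    then have *: "set_pmf D = {s}" by (auto 0 3)
    then have D: "D = return_pmf s" by (simp add: set_pmf_subset_singleton[symmetric])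
    have "run n F t2 (c2, tick 1 s) = map_pmf (Pair SKIP) (E s)" using Suc(3)[of s] * by simp
    from map_run_halted[OF this, of "Suc t1"]
    show ?thesis using True D by (simp add: bind_return_pmf add.commute)
  next
    case False
    define S where "S = step n F c1 s"
    have eq: "bind_pmf S (run n F t1) = map_pmf (Pair SKIP) D" using Suc(2) by (simp add: S_def)
    \<comment> \<open>The mixture over the first step is supported on halted configurations, hence
      so is each of its components; \<open>D\<close> splits accordingly.\<close>
    have ex: "\<exists>D'. run n F t1 cfg = map_pmf (Pair SKIP) D' \<and> set_pmf D' \<subseteq> set_pmf D" if "cfg \<in> set_pmf S" for cfg
    proof -
      have sub: "set_pmf (run n F t1 cfg) \<subseteq> Pair SKIP ` set_pmf D"
        using that eq by (metis (no_types, lifting) UN_upper set_bind_pmf set_map_pmf)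
      have "run n F t1 cfg = map_pmf (Pair SKIP) (map_pmf snd (run n F t1 cfg))"
        unfolding map_pmf_comp by (rule map_pmf_idI[symmetric]) (use sub in auto)
      then show ?thesis using sub by (intro exI[of _ "map_pmf snd (run n F t1 cfg)"]) auto
    qed
    then obtain D' where D': "\<And>cfg. cfg \<in> set_pmf S \<Longrightarrow> run n F t1 cfg = map_pmf (Pair SKIP) (D' cfg)"
      "\<And>cfg. cfg \<in> set_pmf S \<Longrightarrow> set_pmf (D' cfg) \<subseteq> set_pmf D" by metis
    have Deq: "D = bind_pmf S D'"
    proof -
      have "D = map_pmf snd (map_pmf (Pair SKIP) D)" by (simp add: map_pmf_comp)
      also have "\<dots> = bind_pmf S (\<lambda>cfg. map_pmf snd (run n F t1 cfg))" unfolding eq[symmetric] by (simp add: map_bind_pmf)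
      also have "\<dots> = bind_pmf S D'" by (rule bind_pmf_cong) (auto simp: D'(1) map_pmf_comp)
      finally show ?thesis .
    qed
    have "run n F (Suc t1 + 1 + t2) (Seq c1 c2, s) =
       bind_pmf (map_pmf (\<lambda>(c, s'). (Seq c c2, s')) S) (run n F (t1 + 1 + t2))"
      using False by (simp add: S_def)
    also have "\<dots> = bind_pmf S (\<lambda>(c, s'). run n F (t1 + 1 + t2) (Seq c c2, s'))"
      unfolding bind_map_pmf by (rule arg_cong[where f = "bind_pmf S"]) (auto simp: fun_eq_iff)
    also have "\<dots> = bind_pmf S (\<lambda>cfg. map_pmf (Pair SKIP) (bind_pmf (D' cfg) E))"
    proof (rule bind_pmf_cong[OF refl])
      fix cfg assume c: "cfg \<in> set_pmf S"
      obtain c s' where cfg: "cfg = (c, s')" by force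
      show "(case cfg of (c, s') \<Rightarrow> run n F (t1 + 1 + t2) (Seq c c2, s')) = map_pmf (Pair SKIP) (bind_pmf (D' cfg) E)"
        unfolding cfg prod.case
        by (rule Suc.IH) (use D'[OF c] cfg Suc(3) in auto)
    qed
    also have "\<dots> = map_pmf (Pair SKIP) (bind_pmf D E)"
      unfolding Deq by (simp add: map_bind_pmf bind_assoc_pmf)
    finally show ?thesis .
  qed
qed

text \<open>Tower rule: \<open>\<psi>\<close> bounds the conditional expectation of
  \<open>\<phi>\<close> given the intermediate state.\<close>

lemma Wp_Seq:
  assumes "Wp n F t1 c1 s P \<psi> r" "\<And>s1. P s1 \<Longrightarrow> Wp n F t2 c2 s1 Q \<phi> (\<psi> s1)"
  shows "Wp n F (t1 + 1 + t2) (Seq c1 c2) s Q \<phi> r"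
  unfolding Wp_def
proof
  fix x
  obtain D where D: "run n F t1 (c1, s\<lparr>ticks := x\<rparr>) = map_pmf (Pair SKIP) D"
     "\<forall>s'\<in>set_pmf D. P (s'\<lparr>ticks := 0\<rparr>) \<and> ticks s' \<le> x + t1"
     "(\<integral>\<^sup>+s'. \<psi> (s'\<lparr>ticks := 0\<rparr>) \<partial>measure_pmf D) \<le> r"
    using assms(1) unfolding Wp_def by blast
  have "\<exists>E. run n F t2 (c2, tick 1 s') = map_pmf (Pair SKIP) E \<and>
     (\<forall>s''\<in>set_pmf E. Q (s''\<lparr>ticks := 0\<rparr>) \<and> ticks s'' \<le> x + (t1 + 1 + t2)) \<and>
     (\<integral>\<^sup>+s''. \<phi> (s''\<lparr>ticks := 0\<rparr>) \<partial>measure_pmf E) \<le> \<psi> (s'\<lparr>ticks := 0\<rparr>)" if "s' \<in> set_pmf D" for s'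
  proof -
    have "P (s'\<lparr>ticks := 0\<rparr>)" "ticks s' \<le> x + t1" using D(2) that by auto
    from assms(2)[OF this(1), unfolded Wp_def, rule_format, of "ticks s' + 1"] this(2)
    show ?thesis by (force simp: tick_def)
  qed
  then obtain E where E: "\<And>s'. s' \<in> set_pmf D \<Longrightarrow> run n F t2 (c2, tick 1 s') = map_pmf (Pair SKIP) (E s')"
    "\<And>s' s''. s' \<in> set_pmf D \<Longrightarrow> s''\<in>set_pmf (E s') \<Longrightarrow> Q (s''\<lparr>ticks := 0\<rparr>) \<and> ticks s'' \<le> x + (t1 + 1 + t2)"
    "\<And>s'. s' \<in> set_pmf D \<Longrightarrow> (\<integral>\<^sup>+s''. \<phi> (s''\<lparr>ticks := 0\<rparr>) \<partial>measure_pmf (E s')) \<le> \<psi> (s'\<lparr>ticks := 0\<rparr>)"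
    by metis
  have "(\<integral>\<^sup>+s''. \<phi> (s''\<lparr>ticks := 0\<rparr>) \<partial>measure_pmf (bind_pmf D E)) =
      (\<integral>\<^sup>+s'. (\<integral>\<^sup>+s''. \<phi> (s''\<lparr>ticks := 0\<rparr>) \<partial>measure_pmf (E s')) \<partial>measure_pmf D)"
    by simp
  also have "\<dots> \<le> (\<integral>\<^sup>+s'. \<psi> (s'\<lparr>ticks := 0\<rparr>) \<partial>measure_pmf D)"
    using E(3) by (intro nn_integral_mono_AE AE_pmfI) auto
  finally have "(\<integral>\<^sup>+s''. \<phi> (s''\<lparr>ticks := 0\<rparr>) \<partial>measure_pmf (bind_pmf D E)) \<le> r" using D(3) by simp
  with run_Seq[OF D(1) E(1)] E(2)
  show "\<exists>D. run n F (t1 + 1 + t2) (Seq c1 c2, s\<lparr>ticks := x\<rparr>) = map_pmf (Pair SKIP) D \<and>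
     (\<forall>s'\<in>set_pmf D. Q (s'\<lparr>ticks := 0\<rparr>) \<and> ticks s' \<le> x + (t1 + 1 + t2)) \<and>
     (\<integral>\<^sup>+s'. \<phi> (s'\<lparr>ticks := 0\<rparr>) \<partial>measure_pmf D) \<le> r"
    by (intro exI[of _ "bind_pmf D E"]) auto
qed

text \<open>A supermartingale rule: \<open>\<phi> i\<close> is the potential before round
  \<open>i\<close>, and the number of rounds \<open>m\<close> is fixed in advance by the invariant.
  Per round, one tick tests the guard and one removes the \<open>SKIP\<close> left by the body; the
  last test costs one more.\<close>

lemma Wp_While:
  assumes "\<And>i s. i < m \<Longrightarrow> I i s \<Longrightarrow> bval b s"
    "\<And>i s. i < m \<Longrightarrow> I i s \<Longrightarrow> Wp n F t c s (I (Suc i)) (\<phi> (Suc i)) (\<phi> i s)"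
    "\<And>s. I m s \<Longrightarrow> \<not> bval b s"
    "I 0 s" "\<And>i s. I i s \<Longrightarrow> I i (s\<lparr>ticks := 0\<rparr>)" "\<And>i s. \<phi> i (s\<lparr>ticks := 0\<rparr>) = \<phi> i s"
  shows "Wp n F (m * (t + 2) + 1) (While b c) s (I m) (\<phi> m) (\<phi> 0 s)"
proof -
  have "Wp n F (j * (t + 2) + 1) (While b c) s (I m) (\<phi> m) (\<phi> (m - j) s)" if "j \<le> m" "I (m - j) s" for j s
    using that
  proof (induction j arbitrary: s)
    case 0
    have "Wp n F (0 + 1) (While b c) s (I m) (\<phi> m) (\<phi> m s)"
      by (rule Wp_first_step[where c' = SKIP])
         (use 0 assms in \<open>auto simp: tick_def intro!: Wp_SKIP\<close>)
    then show ?case by simp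
  next
    case (Suc j)
    let ?i = "m - Suc j"
    have i: "?i < m" "Suc ?i = m - j" using Suc by auto
    have "Wp n F (t + 1 + (j * (t + 2) + 1)) (Seq c (While b c)) s (I m) (\<phi> m) (\<phi> ?i s)"
      by (rule Wp_Seq[where P = "I (m - j)" and \<psi> = "\<phi> (m - j)"])
         (use assms(2)[OF i(1) Suc(3)] i Suc in auto)
    then have "Wp n F (t + 1 + (j * (t + 2) + 1) + 1) (While b c) s (I m) (\<phi> m) (\<phi> ?i s)"
      by (rule Wp_first_step[rotated]) (use assms(1)[OF i(1) Suc(3)] in \<open>auto simp: tick_def\<close>)
    then show ?case by (simp add: algebra_simps)
  qed
  from this[of m s] assms(4) show ?thesis by simp
qed

section \<open>Frame properties\<close>

primrec nmod :: "com \<Rightarrow> vname set" where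
  "nmod SKIP = {}"
| "nmod (NAssign x e) = {x}"
| "nmod (NStore A i e) = {}"
| "nmod (RAssign x e) = {}"
| "nmod (RStore A i e) = {}"
| "nmod (Flip x p) = {x}"
| "nmod (Query x A) = {}"
| "nmod (Emit A) = {}"
| "nmod (Seq c d) = nmod c \<union> nmod d"
| "nmod (If b c d) = nmod c \<union> nmod d"
| "nmod (While b c) = nmod c"

primrec namod :: "com \<Rightarrow> vname set" where
  "namod SKIP = {}"
| "namod (NAssign x e) = {}"
| "namod (NStore A i e) = {A}"
| "namod (RAssign x e) = {}"
| "namod (RStore A i e) = {}"
| "namod (Flip x p) = {}"
| "namod (Query x A) = {}"
| "namod (Emit A) = {}"
| "namod (Seq c d) = namod c \<union> namod d"
| "namod (If b c d) = namod c \<union> namod d"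
| "namod (While b c) = namod c"

primrec rmod :: "com \<Rightarrow> vname set" where
  "rmod SKIP = {}"
| "rmod (NAssign x e) = {}"
| "rmod (NStore A i e) = {}"
| "rmod (RAssign x e) = {x}"
| "rmod (RStore A i e) = {}"
| "rmod (Flip x p) = {}"
| "rmod (Query x A) = {x}"
| "rmod (Emit A) = {}"
| "rmod (Seq c d) = rmod c \<union> rmod d"
| "rmod (If b c d) = rmod c \<union> rmod d"
| "rmod (While b c) = rmod c"

primrec ramod :: "com \<Rightarrow> vname set" where
  "ramod SKIP = {}"
| "ramod (NAssign x e) = {}"
| "ramod (NStore A i e) = {}"
| "ramod (RAssign x e) = {}"
| "ramod (RStore A i e) = {A}"
| "ramod (Flip x p) = {}"
| "ramod (Query x A) = {}"
| "ramod (Emit A) = {}"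
| "ramod (Seq c d) = ramod c \<union> ramod d"
| "ramod (If b c d) = ramod c \<union> ramod d"
| "ramod (While b c) = ramod c"

primrec asks :: "com \<Rightarrow> bool" where
  "asks SKIP = False"
| "asks (NAssign x e) = False"
| "asks (NStore A i e) = False"
| "asks (RAssign x e) = False"
| "asks (RStore A i e) = False"
| "asks (Flip x p) = False"
| "asks (Query x A) = True"
| "asks (Emit A) = False"
| "asks (Seq c d) = (asks c \<or> asks d)"
| "asks (If b c d) = (asks c \<or> asks d)"
| "asks (While b c) = asks c"

primrec emits :: "com \<Rightarrow> bool" where
  "emits SKIP = False"
| "emits (NAssign x e) = False"
| "emits (NStore A i e) = False"
| "emits (RAssign x e) = False"
| "emits (RStore A i e) = False"
| "emits (Flip x p) = False"
| "emits (Query x A) = False"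
| "emits (Emit A) = True"
| "emits (Seq c d) = (emits c \<or> emits d)"
| "emits (If b c d) = (emits c \<or> emits d)"
| "emits (While b c) = emits c"

definition frm :: "com \<Rightarrow> state \<Rightarrow> state \<Rightarrow> bool" where
  "frm c s s' \<longleftrightarrow> (\<forall>x. x \<notin> nmod c \<longrightarrow> nvar s' x = nvar s x) \<and>
     (\<forall>x. x \<notin> namod c \<longrightarrow> narr s' x = narr s x) \<and>
     (\<forall>x. x \<notin> rmod c \<longrightarrow> rvar s' x = rvar s x) \<and>
     (\<forall>x. x \<notin> ramod c \<longrightarrow> rarr s' x = rarr s x) \<and>
     (\<not> asks c \<longrightarrow> queries s' = queries s) \<and> (\<not> emits c \<longrightarrow> out s' = out s)"

text \<open>A loop steps to \<open>Seq c (While b c)\<close>, which is larger than the loop itself;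
  what can only shrink along an execution is the set of written variables.\<close>

definition subcom :: "com \<Rightarrow> com \<Rightarrow> bool" where
  "subcom c' c \<longleftrightarrow> nmod c' \<subseteq> nmod c \<and> namod c' \<subseteq> namod c \<and> rmod c' \<subseteq> rmod c \<and>
     ramod c' \<subseteq> ramod c \<and> (asks c' \<longrightarrow> asks c) \<and> (emits c' \<longrightarrow> emits c)"

lemma step_frm: "(c', s') \<in> set_pmf (step n F c s) \<Longrightarrow> frm c s s' \<and> subcom c' c"
proof (induction c arbitrary: c' s')
  case (Seq c1 c2)
  show ?case
  proof (cases "c1 = SKIP")
    case True then have "c' = c2" "s' = tick 1 s" using Seq by auto
    then show ?thesis by (simp add: frm_def subcom_def tick_def)
  next
    case False
    then obtain d where "(d, s') \<in> set_pmf (step n F c1 s)" "c' = Seq d c2" using Seq(3) by auto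
    with Seq(1)[OF this(1)] show ?thesis by (auto simp: frm_def subcom_def)
  qed
next
  case (While b c)
  then have "s' = tick 1 s" "c' = Seq c (While b c) \<or> c' = SKIP" by (auto split: if_splits)
  then show ?case by (auto simp: frm_def subcom_def tick_def)
next
  case (If b c d)
  then have "s' = tick 1 s" "c' = c \<or> c' = d" by (auto split: if_splits)
  then show ?case by (auto simp: frm_def subcom_def tick_def)
qed (simp add: frm_def subcom_def tick_def | (elim imageE exE, simp add: frm_def subcom_def tick_def))+

lemma frm_trans:
  assumes 1: "frm c s u" and 2: "subcom d c" and 3: "frm d u s'"
  shows "frm c s s'"
proof -
  have "nvar s' x = nvar s x" if "x \<notin> nmod c" for x
    using that 2 1[unfolded frm_def, THEN conjunct1] 3[unfolded frm_def, THEN conjunct1]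
    unfolding subcom_def by (metis subsetD)
  moreover have "narr s' x = narr s x" if "x \<notin> namod c" for x
    using that 2 1[unfolded frm_def, THEN conjunct2, THEN conjunct1] 3[unfolded frm_def, THEN conjunct2, THEN conjunct1]
    unfolding subcom_def by (metis subsetD)
  moreover have "rvar s' x = rvar s x" if "x \<notin> rmod c" for x
    using that 2 1[unfolded frm_def, THEN conjunct2, THEN conjunct2, THEN conjunct1] 
      3[unfolded frm_def, THEN conjunct2, THEN conjunct2, THEN conjunct1]
    unfolding subcom_def by (metis subsetD)
  moreover have "rarr s' x = rarr s x" if "x \<notin> ramod c" for x
    using that 2 1[unfolded frm_def, THEN conjunct2, THEN conjunct2, THEN conjunct2, THEN conjunct1] 
      3[unfolded frm_def, THEN conjunct2, THEN conjunct2, THEN conjunct2, THEN conjunct1]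
    unfolding subcom_def by (metis subsetD)
  moreover have "\<not> asks c \<longrightarrow> queries s' = queries s" "\<not> emits c \<longrightarrow> out s' = out s"
    using 1 2 3 unfolding frm_def subcom_def by auto
  ultimately show ?thesis unfolding frm_def by blast
qed

lemma run_frm: "(c', s') \<in> set_pmf (run n F t (c, s)) \<Longrightarrow> frm c s s'"
proof (induction t arbitrary: c s)
  case 0 then show ?case by (auto simp: frm_def)
next
  case (Suc t)
  then obtain d u where d: "(d, u) \<in> set_pmf (step n F c s)" "(c', s') \<in> set_pmf (run n F t (d, u))" by auto
  have "frm c s u" "subcom d c" "frm d u s'" using step_frm[OF d(1)] Suc.IH[OF d(2)] by auto
  then show ?case by (rule frm_trans)
qed

text \<open>Specifications list only the changes of interest; everything else is recovered from the
  syntactic write sets.\<close>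

lemma Wp_frame:
  assumes "Wp n F t c s Q \<phi> r"
  shows "Wp n F t c s (\<lambda>s'. Q s' \<and> frm c s s') \<phi> r"
  unfolding Wp_def
proof
  fix x
  obtain D where D: "run n F t (c, s\<lparr>ticks := x\<rparr>) = map_pmf (Pair SKIP) D"
     "\<forall>s'\<in>set_pmf D. Q (s'\<lparr>ticks := 0\<rparr>) \<and> ticks s' \<le> x + t"
     "(\<integral>\<^sup>+s'. \<phi> (s'\<lparr>ticks := 0\<rparr>) \<partial>measure_pmf D) \<le> r"
    using assms(1) unfolding Wp_def by blast
  have "frm c s (s'\<lparr>ticks := 0\<rparr>)" if "s' \<in> set_pmf D" for s'
  proof -
    have "(SKIP, s') \<in> set_pmf (run n F t (c, s\<lparr>ticks := x\<rparr>))" using that D(1) by simp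
    from run_frm[OF this] show ?thesis by (auto simp: frm_def)
  qed
  then show "\<exists>D. run n F t (c, s\<lparr>ticks := x\<rparr>) = map_pmf (Pair SKIP) D \<and>
     (\<forall>s'\<in>set_pmf D. (Q (s'\<lparr>ticks := 0\<rparr>) \<and> frm c s (s'\<lparr>ticks := 0\<rparr>)) \<and> ticks s' \<le> x + t) \<and>
     (\<integral>\<^sup>+s'. \<phi> (s'\<lparr>ticks := 0\<rparr>) \<partial>measure_pmf D) \<le> r"
    using D by blast
qed

section \<open>Greedy vectors\<close>

lemma submodularD:
  "submodular_on UNIV G \<Longrightarrow> G (S \<union> T) + G (S \<inter> T) \<le> G S + (G T :: real)"
  unfolding submodular_on_def by blast

text \<open>For \<open>A = {}\<close> this is the greedy vector of the order \<open>ys\<close>; the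
  start set \<open>A\<close> is a parameter so that inductions on the list go through.\<close>

primrec marg :: "('b set \<Rightarrow> real) \<Rightarrow> 'b set \<Rightarrow> 'b list \<Rightarrow> 'b \<Rightarrow> real" where
  "marg G A [] x = 0"
| "marg G A (y # ys) x = (if x = y then G (insert y A) - G A else marg G (insert y A) ys x)"

lemma sum_marg: "distinct ys \<Longrightarrow> (\<Sum>x\<in>set ys. marg G A ys x) = G (A \<union> set ys) - G A"
proof (induction ys arbitrary: A)
  case (Cons y ys)
  have "(\<Sum>x\<in>set ys. marg G A (y # ys) x) = (\<Sum>x\<in>set ys. marg G (insert y A) ys x)"
    using Cons.prems by (intro sum.cong) auto
  then show ?case using Cons by simp
qed simp

text \<open>Greedy vectors lie in the base polytope. If the head \<open>y\<close> is not in
  \<open>S\<close>, submodularity for \<open>insert y A\<close> and \<open>A \<union> S\<close>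
  takes \<open>y\<close> out of the base again.\<close>

lemma marg_base_polytope:
  assumes sm: "submodular_on UNIV G"
  shows "distinct ys \<Longrightarrow> A \<inter> set ys = {} \<Longrightarrow> S \<subseteq> set ys \<Longrightarrow> (\<Sum>x\<in>S. marg G A ys x) \<le> G (A \<union> S) - G A"
proof (induction ys arbitrary: A S)
  case (Cons y ys)
  have fin: "finite S" using Cons.prems finite_subset by blast
  let ?S = "S - {y}"
  have IH: "(\<Sum>x\<in>?S. marg G (insert y A) ys x) \<le> G (insert y A \<union> ?S) - G (insert y A)"
    using Cons.prems by (intro Cons.IH) auto
  have eq: "(\<Sum>x\<in>?S. marg G A (y # ys) x) = (\<Sum>x\<in>?S. marg G (insert y A) ys x)"
    by (intro sum.cong) auto
  show ?case
  proof (cases "y \<in> S")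
    case True
    then have "insert y A \<union> ?S = A \<union> S" by auto
    then show ?thesis using IH eq True by (simp add: sum.remove[OF fin True])
  next
    case False
    then have S: "?S = S" by auto
    have "insert y A \<union> (A \<union> S) = insert y A \<union> S" "insert y A \<inter> (A \<union> S) = A" using False Cons.prems by auto
    with submodularD[OF sm, of "insert y A" "A \<union> S"]
    show ?thesis using IH eq unfolding S by simp
  qed
qed simp

lemma marg_append:
  "marg G A (xs @ ys) x = (if x \<in> set xs then marg G A xs x else marg G (A \<union> set xs) ys x)"
  by (induction xs arbitrary: A) auto

text \<open>Elements of one block are consecutive, so their marginals telescope: block sums of a
  greedy vector form the greedy vector of the function contracted to blocks.\<close>

lemma marg_concat:
  assumes "distinct (concat (map el bs))" "distinct bs" "b \<in> set bs"
  shows "(\<Sum>x\<in>set (el b). marg G (\<Union>c\<in>B. set (el c)) (concat (map el bs)) x) =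
    marg (\<lambda>I. G (\<Union>c\<in>I. set (el c))) B bs b"
  using assms
proof (induction bs arbitrary: B)
  case (Cons c bs)
  show ?case
  proof (cases "b = c")
    case True
    have "(\<Sum>x\<in>set (el b). marg G (\<Union>c\<in>B. set (el c)) (concat (map el (c # bs))) x) =
       (\<Sum>x\<in>set (el b). marg G (\<Union>c\<in>B. set (el c)) (el b) x)"
      using True by (intro sum.cong) (auto simp: marg_append)
    also have "\<dots> = G ((\<Union>c\<in>B. set (el c)) \<union> set (el b)) - G (\<Union>c\<in>B. set (el c))"
      using Cons.prems True by (intro sum_marg) auto
    finally show ?thesis using True by (simp add: Un_commute)
  next
    case False
    then have b: "b \<in> set bs" using Cons.prems by auto
    have "x \<notin> set (el c)" if "x \<in> set (el b)" for x
      using that Cons.prems b by auto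
    then have "(\<Sum>x\<in>set (el b). marg G (\<Union>c\<in>B. set (el c)) (concat (map el (c # bs))) x) =
       (\<Sum>x\<in>set (el b). marg G (\<Union>c\<in>insert c B. set (el c)) (concat (map el bs)) x)"
      by (intro sum.cong) (auto simp: marg_append Un_commute)
    also have "\<dots> = marg (\<lambda>I. G (\<Union>c\<in>I. set (el c))) (insert c B) bs b"
      using Cons.prems b by (intro Cons.IH) auto
    finally show ?thesis using False by simp
  qed
qed simp

text \<open>Abel summation: weights that decrease along the order turn the sum into a positive combination of
  values \<open>G S - G A\<close>.\<close>

lemma marg_sorted_ge:
  assumes lb: "\<And>S. fs \<le> G S"
  shows "sorted_wrt (\<lambda>x y. w x \<ge> w y) ys \<Longrightarrow> distinct ys \<Longrightarrow> (\<And>x. x \<in> set ys \<Longrightarrow> 0 \<le> w x \<and> w x \<le> c) \<Longrightarrow> 0 \<le> c \<Longrightarrow>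
    c * (fs - G A) \<le> (\<Sum>x\<in>set ys. w x * marg G A ys x)"
proof (induction ys arbitrary: A c)
  case Nil
  have "c * (fs - G A) \<le> 0" using lb[of A] Nil by (simp add: mult_nonneg_nonpos)
  then show ?case by simp
next
  case (Cons y ys)
  have "w y * (fs - G (insert y A)) \<le> (\<Sum>x\<in>set ys. w x * marg G (insert y A) ys x)"
    using Cons.prems by (intro Cons.IH) auto
  moreover have "(\<Sum>x\<in>set ys. w x * marg G A (y # ys) x) = (\<Sum>x\<in>set ys. w x * marg G (insert y A) ys x)"
    using Cons.prems by (intro sum.cong) auto
  moreover have "c * (fs - G A) \<le> w y * (fs - G A)"
    using Cons.prems(3)[of y] lb[of A] by (intro mult_right_mono_neg) auto
  ultimately show ?case using Cons.prems(2) by (simp add: algebra_simps)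
qed

lemma marg_nth:
  assumes "distinct ys" "i < length ys"
  shows "marg G A ys (ys ! i) = G (A \<union> set (take (Suc i) ys)) - G (A \<union> set (take i ys))"
  using assms
proof (induction ys arbitrary: A i)
  case (Cons y ys)
  show ?case
  proof (cases i)
    case (Suc j)
    then have "ys ! j \<noteq> y" using Cons.prems by auto
    then show ?thesis using Cons.IH[of j "insert y A"] Cons.prems Suc by simp
  qed simp
qed simp

lemma marg_le_singleton:
  assumes "submodular_on UNIV G" "distinct ys" "A \<inter> set ys = {}" "G {} = 0" "x \<in> set ys"
  shows "marg G A ys x \<le> G {x}"
proof -
  have "marg G A ys x \<le> G (A \<union> {x}) - G A"
    using marg_base_polytope[OF assms(1-3), of "{x}"] assms(5) by simp
  also have "\<dots> \<le> G {x}" 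
  proof -
    have "A \<inter> {x} = {}" using assms by auto
    then show ?thesis using submodularD[OF assms(1), of A "{x}"] assms(4) by simp
  qed
  finally show ?thesis .
qed

text \<open>Elements outside \<open>R\<close> never change \<open>G\<close>, so deleting them from
  an order keeps all other marginals. With \<open>R = {..<card V}\<close> this removes the
  padding.\<close>

lemma marg_filter_irrelevant:
  assumes irr: "\<And>S. G S = G (S \<inter> R)"
  shows "x \<in> R \<Longrightarrow> A \<inter> R = A' \<inter> R \<Longrightarrow> marg G A (filter (\<lambda>y. y \<in> R) ys) x = marg G A' ys x"
proof (induction ys arbitrary: A A')
  case (Cons y ys)
  have e: "G A = G A'" using irr[of A] irr[of A'] Cons.prems by simp
  show ?case
  proof (cases "y \<in> R")
    case True
    then have i: "insert y A \<inter> R = insert y A' \<inter> R" using Cons.prems by auto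
    then have "G (insert y A) = G (insert y A')" using irr by metis
    then show ?thesis using Cons.IH[OF Cons.prems(1) i] e True by simp
  next
    case False
    then have i: "A \<inter> R = insert y A' \<inter> R" using Cons.prems by auto
    then show ?thesis using Cons.IH[OF Cons.prems(1) i] False Cons.prems by auto
  qed
qed simp

text \<open>Disjointness makes the union over \<open>S \<inter> T\<close> equal to the intersection
  of the two unions.\<close>

lemma submodular_on_union_blocks:
  assumes sm: "submodular_on UNIV G" and dj: "\<And>b c. b \<noteq> c \<Longrightarrow> X b \<inter> X c = {}"
  shows "submodular_on UNIV (\<lambda>I. G (\<Union>b\<in>I. X b))"
  unfolding submodular_on_def
proof (intro allI impI)
  fix S T
  have "(\<Union>b\<in>S \<inter> T. X b) = (\<Union>b\<in>S. X b) \<inter> (\<Union>b\<in>T. X b)"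
  proof (intro equalityI subsetI)
    fix x assume "x \<in> (\<Union>b\<in>S. X b) \<inter> (\<Union>b\<in>T. X b)"
    then obtain b c where "b \<in> S" "x \<in> X b" "c \<in> T" "x \<in> X c" by auto
    then show "x \<in> (\<Union>b\<in>S \<inter> T. X b)" using dj[of b c] by (cases "b = c") auto
  qed auto
  then show "G (\<Union>b\<in>S \<union> T. X b) + G (\<Union>b\<in>S \<inter> T. X b) \<le> G (\<Union>b\<in>S. X b) + G (\<Union>b\<in>T. X b)"
    using submodularD[OF sm, of "\<Union>b\<in>S. X b" "\<Union>b\<in>T. X b"] by (simp add: UN_Un)
qed

lemma submodular_le_sum_singletons:
  assumes sm: "submodular_on UNIV G" "G {} = 0" and "finite S"
  shows "G S \<le> (\<Sum>x\<in>S. G {x})"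
  using assms(3)
proof induction
  case (insert x S)
  have "S \<inter> {x} = {}" using insert by auto
  with submodularD[OF sm(1), of S "{x}"] insert sm(2) show ?case by simp
qed (use sm in simp)

lemma submodular_UN_le:
  assumes sm: "submodular_on UNIV G" "G {} = 0" and "finite I"
    and "\<And>i j. i \<in> I \<Longrightarrow> j \<in> I \<Longrightarrow> i \<noteq> j \<Longrightarrow> B i \<inter> B j = {}"
  shows "G (\<Union>i\<in>I. B i) \<le> (\<Sum>i\<in>I. G (B i))"
  using assms(3,4)
proof induction
  case (insert i I)
  have "B i \<inter> (\<Union>i\<in>I. B i) = {}" using insert by blast
  moreover have "G (\<Union>i\<in>I. B i) \<le> (\<Sum>i\<in>I. G (B i))" using insert by auto
  ultimately show ?case using submodularD[OF sm(1), of "B i" "\<Union>i\<in>I. B i"] insert sm(2) by simp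
qed (use sm in simp)

section \<open>Random subsets\<close>

text \<open>The expectation of \<open>\<phi> A\<close> when \<open>A\<close> takes each element of
  \<open>X\<close> independently with probability \<open>p\<close>, written as a finite sum.\<close>

definition rsub :: "real \<Rightarrow> 'b set \<Rightarrow> ('b set \<Rightarrow> real) \<Rightarrow> real" where
  "rsub p X \<phi> = (\<Sum>A\<in>Pow X. p ^ card A * (1 - p) ^ card (X - A) * \<phi> A)"

lemma rsub_empty [simp]: "rsub p {} \<phi> = \<phi> {}" by (simp add: rsub_def)

text \<open>Conditioning on the coin of \<open>x\<close>; the sampling loop of the program unfolds
  the expectation in the same way, one coin per round.\<close>

lemma rsub_insert:
  assumes "finite X" "x \<notin> X"
  shows "rsub p (insert x X) \<phi> = p * rsub p X (\<lambda>A. \<phi> (insert x A)) + (1 - p) * rsub p X \<phi>"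
proof -
  have "rsub p (insert x X) \<phi> =
     (\<Sum>A\<in>Pow X. p ^ card A * (1 - p) ^ card (insert x X - A) * \<phi> A) +
     (\<Sum>A\<in>insert x ` Pow X. p ^ card A * (1 - p) ^ card (insert x X - A) * \<phi> A)"
    unfolding rsub_def Pow_insert using assms by (intro sum.union_disjoint) auto
  also have "(\<Sum>A\<in>Pow X. p ^ card A * (1 - p) ^ card (insert x X - A) * \<phi> A) = (1 - p) * rsub p X \<phi>"
    unfolding rsub_def sum_distrib_left
  proof (rule sum.cong[OF refl])
    fix A assume "A \<in> Pow X"
    then have "insert x X - A = insert x (X - A)" using assms by auto
    then show "p ^ card A * (1 - p) ^ card (insert x X - A) * \<phi> A = (1 - p) * (p ^ card A * (1 - p) ^ card (X - A) * \<phi> A)"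
      using assms by simp
  qed
  also have "(\<Sum>A\<in>insert x ` Pow X. p ^ card A * (1 - p) ^ card (insert x X - A) * \<phi> A) =
     (\<Sum>A\<in>Pow X. p ^ card (insert x A) * (1 - p) ^ card (insert x X - insert x A) * \<phi> (insert x A))"
    using assms by (intro sum.reindex_cong[where l = "insert x"]) (auto simp: inj_on_def)
  also have "\<dots> = p * rsub p X (\<lambda>A. \<phi> (insert x A))"
    unfolding rsub_def sum_distrib_left
  proof (rule sum.cong[OF refl])
    fix A assume A: "A \<in> Pow X"
    then have "insert x X - insert x A = X - A" using assms by auto
    moreover have "finite A" "x \<notin> A" using A assms finite_subset by auto
    ultimately show "p ^ card (insert x A) * (1 - p) ^ card (insert x X - insert x A) * \<phi> (insert x A) =
      p * (p ^ card A * (1 - p) ^ card (X - A) * \<phi> (insert x A))" by simp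
  qed
  finally show ?thesis by simp
qed

lemma rsub_const: "finite X \<Longrightarrow> rsub p X (\<lambda>_. c) = c"
  by (induction X rule: finite_induct) (auto simp: rsub_insert algebra_simps)

lemma rsub_mono:
  assumes "0 \<le> p" "p \<le> 1" "\<And>A. A \<subseteq> X \<Longrightarrow> \<phi> A \<le> \<psi> A"
  shows "rsub p X \<phi> \<le> rsub p X \<psi>"
  unfolding rsub_def using assms by (intro sum_mono mult_left_mono) auto

lemma rsub_cong: "(\<And>A. A \<subseteq> X \<Longrightarrow> \<phi> A = \<psi> A) \<Longrightarrow> rsub p X \<phi> = rsub p X \<psi>"
  unfolding rsub_def by (intro sum.cong) auto

lemma rsub_nonneg: "0 \<le> p \<Longrightarrow> p \<le> 1 \<Longrightarrow> (\<And>A. 0 \<le> \<phi> A) \<Longrightarrow> 0 \<le> rsub p X \<phi>"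
  unfolding rsub_def by (intro sum_nonneg) auto

lemma rsub_scale: "rsub p X (\<lambda>A. c * \<phi> A) = c * rsub p X \<phi>"
  unfolding rsub_def sum_distrib_left by (intro sum.cong) auto

text \<open>Independence of the coins on disjoint sets.\<close>

lemma rsub_prod:
  assumes "finite X" "finite Y" "X \<inter> Y = {}"
  shows "rsub p (X \<union> Y) (\<lambda>A. \<phi> (A \<inter> X) * \<psi> (A \<inter> Y)) = rsub p X \<phi> * rsub p Y \<psi>"
  using assms(2,1,3)
proof (induction Y arbitrary: \<psi> rule: finite_induct)
  case empty
  have "rsub p X (\<lambda>A. \<phi> (A \<inter> X) * \<psi> {}) = rsub p X (\<lambda>A. \<psi> {} * \<phi> A)"
    by (rule rsub_cong) (simp add: Int_absorb2)
  then show ?case by (simp add: rsub_scale)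
next
  case (insert y Y)
  have y: "y \<notin> X \<union> Y" "X \<inter> Y = {}" using insert by auto
  have 1: "rsub p (X \<union> Y) (\<lambda>A. \<phi> (insert y A \<inter> X) * \<psi> (insert y A \<inter> insert y Y)) =
     rsub p (X \<union> Y) (\<lambda>A. \<phi> (A \<inter> X) * \<psi> (insert y (A \<inter> Y)))"
    using y by (intro rsub_cong) (simp add: insert_Diff_if)
  have 2: "rsub p (X \<union> Y) (\<lambda>A. \<phi> (A \<inter> X) * \<psi> (A \<inter> insert y Y)) =
     rsub p (X \<union> Y) (\<lambda>A. \<phi> (A \<inter> X) * \<psi> (A \<inter> Y))"
    using y by (intro rsub_cong) (auto simp: subset_iff Int_insert_right intro!: arg_cong2[where f = times])
  have fin: "finite (X \<union> Y)" using insert by auto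
  have "rsub p (X \<union> insert y Y) (\<lambda>A. \<phi> (A \<inter> X) * \<psi> (A \<inter> insert y Y)) =
    p * rsub p (X \<union> Y) (\<lambda>A. \<phi> (A \<inter> X) * \<psi> (insert y (A \<inter> Y))) +
    (1 - p) * rsub p (X \<union> Y) (\<lambda>A. \<phi> (A \<inter> X) * \<psi> (A \<inter> Y))"
    unfolding Un_insert_right rsub_insert[OF fin y(1)] 1 2 ..
  also have "\<dots> = p * (rsub p X \<phi> * rsub p Y (\<lambda>A. \<psi> (insert y A))) + (1 - p) * (rsub p X \<phi> * rsub p Y \<psi>)"
    using insert.IH[OF insert.prems(1) y(2), of \<psi>] insert.IH[OF insert.prems(1) y(2), of "\<lambda>A. \<psi> (insert y A)"] by simp
  also have "\<dots> = rsub p X \<phi> * rsub p (insert y Y) \<psi>"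
    unfolding rsub_insert[OF insert(1,2)] by (simp add: algebra_simps)
  finally show ?case .
qed

text \<open>Assigning the elements of \<open>X\<close> to \<open>d\<close> classes uniformly at random, some class is heavy,
  and each class is a random subset of density \<open>1/d\<close>.\<close>

lemma rsub_class_heavy:
  fixes d :: nat
  assumes sm: "submodular_on UNIV G" "G {} = 0" and d: "d > 0" and "finite X"
    and "\<And>i j. i < d \<Longrightarrow> j < d \<Longrightarrow> i \<noteq> j \<Longrightarrow> B i \<inter> B j = {}" "\<And>i. i < d \<Longrightarrow> B i \<inter> X = {}"
    and "real d * z \<le> G ((\<Union>i<d. B i) \<union> X)"
  shows "1 \<le> (\<Sum>i<d. rsub (1 / d) X (\<lambda>A. of_bool (z \<le> G (B i \<union> A))))"
  using assms(4-)
proof (induction X arbitrary: B rule: finite_induct)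
  case empty
  \<comment> \<open>All elements are placed; by subadditivity some class carries at least the
    average value.\<close>
  have "\<exists>i<d. z \<le> G (B i)"
  proof (rule ccontr)
    assume "\<not> ?thesis"
    then have "(\<Sum>i<d. G (B i)) < (\<Sum>i<d. z)" using d by (intro sum_strict_mono) auto
    moreover have "G (\<Union>i<d. B i) \<le> (\<Sum>i<d. G (B i))"
      using empty by (intro submodular_UN_le[OF sm]) auto
    ultimately show False using empty by simp
  qed
  then obtain i where i: "i < d" "z \<le> G (B i)" by blast
  have "(1::real) = of_bool (z \<le> G (B i))" using i by simp
  also have "\<dots> \<le> (\<Sum>i<d. of_bool (z \<le> G (B i)))" using i by (intro member_le_sum) auto
  finally show ?case by simp
next
  case (insert x X)
  let ?R = "\<lambda>i. rsub (1 / d) X (\<lambda>A. of_bool (z \<le> G (B i \<union> A)))"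
  let ?Rx = "\<lambda>i. rsub (1 / d) X (\<lambda>A. of_bool (z \<le> G (B i \<union> insert x A)))"
  \<comment> \<open>The case where \<open>x\<close> goes to class \<open>j\<close>; averaging over
    the \<open>d\<close> choices of \<open>j\<close> yields exactly the expectations for
    \<open>insert x X\<close>.\<close>
  have "1 \<le> (\<Sum>i<d. ?R i) - ?R j + ?Rx j" if j: "j < d" for j
  proof -
    let ?B = "B(j := insert x (B j))"
    have U: "(\<Union>i<d. ?B i) \<union> X = (\<Union>i<d. B i) \<union> insert x X" using j by (auto split: if_splits)
    have "1 \<le> (\<Sum>i<d. rsub (1 / d) X (\<lambda>A. of_bool (z \<le> G (?B i \<union> A))))"
    proof (rule insert.IH)
      show "?B i \<inter> ?B i' = {}" if "i < d" "i' < d" "i \<noteq> i'" for i i'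
        using that insert.prems(1)[OF that] insert.prems(2)[of i] insert.prems(2)[of i'] by auto
      show "?B i \<inter> X = {}" if "i < d" for i using that insert.prems(2)[of i] insert.hyps by auto
      show "real d * z \<le> G ((\<Union>i<d. ?B i) \<union> X)" unfolding U by (rule insert.prems)
    qed
    also have "\<dots> = ?Rx j + (\<Sum>i\<in>{..<d} - {j}. ?R i)"
      using j by (subst sum.remove[of _ j]) (auto intro!: sum.cong)
    also have "(\<Sum>i\<in>{..<d} - {j}. ?R i) = (\<Sum>i<d. ?R i) - ?R j" using j by (simp add: sum_diff1)
    finally show ?thesis by simp
  qed
  then have "(\<Sum>j<d. 1) \<le> (\<Sum>j<d. (\<Sum>i<d. ?R i) - ?R j + ?Rx j)" by (intro sum_mono) auto
  then have "real d \<le> real d * (\<Sum>i<d. ?R i) - (\<Sum>i<d. ?R i) + (\<Sum>i<d. ?Rx i)"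
    by (simp add: sum.distrib sum_subtractf)
  then have "1 \<le> (\<Sum>i<d. ?R i) - (1 / d) * (\<Sum>i<d. ?R i) + (1 / d) * (\<Sum>i<d. ?Rx i)"
    using d by (simp add: field_simps)
  also have "\<dots> = (\<Sum>i<d. rsub (1 / d) (insert x X) (\<lambda>A. of_bool (z \<le> G (B i \<union> A))))"
    unfolding rsub_insert[OF insert.hyps]
    by (simp add: algebra_simps sum.distrib sum_subtractf sum_divide_distrib)
  finally show ?case .
qed

text \<open>\<open>(1 - 1 / d) ^ (d - 1)\<close> is the inverse of
  \<open>(1 + 1 / (d - 1)) ^ (d - 1)\<close>, which is at most \<open>exp 1\<close>.\<close>

lemma one_minus_inverse_power_ge:
  fixes d :: nat assumes "d \<ge> 2" "m < d"
  shows "1 / 4 \<le> (1 - 1 / real d) ^ m"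
proof -
  have "1 / 4 \<le> (1 - 1 / real d) ^ (d - 1)"
  proof -
    define m where "m = d - 1"
    have m: "m \<ge> 1" "real d = real m + 1" using assms by (auto simp: m_def)
    have e: "1 - 1 / real d = inverse (1 + 1 / real m)" using m by (simp add: field_simps)
    have "(1 + 1 / real m) ^ m \<le> exp (1 / real m) ^ m"
      by (intro power_mono exp_ge_add_one_self) auto
    also have "\<dots> = exp 1" using m by (simp add: exp_of_nat_mult[symmetric])
    also have "\<dots> \<le> 4" using exp_le by simp
    finally have "inverse 4 \<le> inverse ((1 + 1 / real m) ^ m)" 
      by (intro le_imp_inverse_le) (auto simp: add_pos_nonneg)
    then show ?thesis unfolding e m_def[symmetric] by (simp add: power_inverse)
  qed
  also have "\<dots> \<le> (1 - 1 / real d) ^ m" using assms by (intro power_decreasing) auto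
  finally show ?thesis .
qed

text \<open>Three independent groups of coins: the sample misses \<open>S\<close> with probability
  at least 1/4, it is heavy on \<open>Y - S\<close> with probability at least \<open>1 / d\<close>,
  and the coins outside \<open>Y\<close> are free.\<close>

lemma rsub_detects:
  fixes d :: nat
  assumes sm: "submodular_on UNIV G" "G {} = 0" and d: "d \<ge> 2" and X: "finite X"
    and S: "S \<subseteq> X" "card S < d" and Y: "Y \<subseteq> X" "S \<subseteq> Y" and heavy: "real d * z \<le> G (Y - S)"
  shows "1 / (4 * real d) \<le> rsub (1 / d) X (\<lambda>A. of_bool (z \<le> G (A \<inter> Y)))"
proof -
  let ?p = "1 / real d" and ?T = "Y - S" and ?R = "X - Y"
  have p: "0 \<le> ?p" "?p \<le> 1" using d by auto
  have fin: "finite S" "finite ?T" "finite ?R" using X S Y finite_subset by (blast, blast, blast)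
  have "1 \<le> (\<Sum>i<d. rsub ?p ?T (\<lambda>A. of_bool (z \<le> G ({} \<union> A))))"
    using d heavy by (intro rsub_class_heavy[OF sm _ fin(2)]) auto
  then have 1: "?p \<le> rsub ?p ?T (\<lambda>A. of_bool (z \<le> G A))" using d by (simp add: field_simps)
  have 2: "rsub ?p S (\<lambda>A. of_bool (A = {})) = (1 - ?p) ^ card S"
  proof -
    have "rsub ?p S (\<lambda>A. of_bool (A = {})) = (\<Sum>A\<in>Pow S. if A = {} then (1 - ?p) ^ card S else 0)"
      unfolding rsub_def by (intro sum.cong) auto
    then show ?thesis using fin by simp
  qed
  have "(1 / 4) * ?p \<le> (1 - ?p) ^ card S * rsub ?p ?T (\<lambda>A. of_bool (z \<le> G A))"
    using one_minus_inverse_power_ge[OF d S(2)] 1 p by (intro mult_mono) auto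
  also have "\<dots> = rsub ?p (S \<union> ?T) (\<lambda>A. of_bool (A \<inter> S = {}) * of_bool (z \<le> G (A \<inter> ?T)))"
    using fin 2 by (subst rsub_prod) auto
  also have "\<dots> = \<dots> * rsub ?p ?R (\<lambda>_. 1)" by (simp add: rsub_const fin)
  also have "\<dots> = rsub ?p ((S \<union> ?T) \<union> ?R) (\<lambda>A. (of_bool (A \<inter> (S \<union> ?T) \<inter> S = {}) * of_bool (z \<le> G (A \<inter> (S \<union> ?T) \<inter> ?T))) * 1)"
    using fin S Y by (subst rsub_prod) auto
  also have "(S \<union> ?T) \<union> ?R = X" using S Y by auto
  also have "rsub ?p X (\<lambda>A. (of_bool (A \<inter> (S \<union> ?T) \<inter> S = {}) * of_bool (z \<le> G (A \<inter> (S \<union> ?T) \<inter> ?T))) * 1) \<le>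
      rsub ?p X (\<lambda>A. of_bool (z \<le> G (A \<inter> Y)))"
  proof (rule rsub_mono[OF p])
    fix A assume "A \<subseteq> X"
    show "(of_bool (A \<inter> (S \<union> ?T) \<inter> S = {}) * of_bool (z \<le> G (A \<inter> (S \<union> ?T) \<inter> ?T))) * 1 \<le> (of_bool (z \<le> G (A \<inter> Y)) :: real)"
    proof (cases "A \<inter> S = {}")
      case True
      then have "A \<inter> (S \<union> ?T) \<inter> ?T = A \<inter> Y" using Y by auto
      then show ?thesis by simp
    next
      case False
      have "A \<inter> (S \<union> ?T) \<inter> S = A \<inter> S" by auto
      then show ?thesis using False by simp
    qed
  qed
  finally show ?thesis by simp
qed

section \<open>Multiplicative weights with coupled sampling\<close>

lemma exp_le_quadratic:
  fixes x :: real assumes "x \<le> 1" shows "exp x \<le> 1 + x + x\<^sup>2"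
proof (cases "x \<ge> 0")
  case True then show ?thesis using exp_bound[of x] assms by simp
next
  case False
  define y where "y = - x"
  have y: "y \<ge> 0" using False by (simp add: y_def)
  have "exp x = inverse (exp y)" by (simp add: y_def exp_minus)
  also have "\<dots> \<le> inverse (1 + y)" using y exp_ge_add_one_self[of y] by (intro le_imp_inverse_le) (auto simp: add.commute)
  also have "\<dots> \<le> 1 - y + y\<^sup>2"
  proof -
    have "1 \<le> (1 - y + y\<^sup>2) * (1 + y)" using y by (simp add: algebra_simps power2_eq_square)
    then show ?thesis using y by (simp add: field_simps)
  qed
  finally show ?thesis by (simp add: y_def)
qed

text \<open>\<open>E\<close> is the change of one weight without the sampled loss,
  \<open>exp y\<close> the extra change when this coordinate is sampled. The bound is linear in
  \<open>w * y\<close>, so it can be summed over the random coordinate; the \<open>3 * x\<close>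
  comes from two factors \<open>1 + x\<close>, one for \<open>E\<close> against the mixture and one
  for \<open>exp y - 1\<close> against \<open>y\<close>.\<close>

lemma mwu_factor_bound:
  fixes w E x y :: real
  assumes w: "0 \<le> w" "w \<le> 1" and E: "0 < E" "E \<le> 1 + x" and y: "0 \<le> y" "y \<le> x" and x: "x \<le> 1"
  shows "1 - w + w * (E * exp y) \<le> (1 - w + w * E) * (1 + w * (y * (1 + 3 * x)))"
proof -
  have x0: "0 \<le> x" using y by simp
  \<comment> \<open>For \<open>E \<le> 1\<close> the mixture \<open>1 - w + w * E\<close> is at
    least \<open>E\<close>, otherwise it is at least 1.\<close>
  have E2: "E \<le> (1 - w + w * E) * (1 + x)"
  proof (cases "E \<le> 1")
    case True
    have "(1 - w + w * E) - E = (1 - w) * (1 - E)" by (simp add: algebra_simps)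
    also have "\<dots> \<ge> 0" using True w by simp
    finally have "E \<le> 1 - w + w * E" by simp
    also have "\<dots> \<le> (1 - w + w * E) * (1 + x)" using w E x0 mult_left_mono[of 1 "1 + x" "1 - w + w * E"] by simp
    finally show ?thesis .
  next
    case False
    then have "w * (E - 1) \<ge> 0" using w by simp
    then have "1 \<le> 1 - w + w * E" by (simp add: algebra_simps)
    then have "1 * (1 + x) \<le> (1 - w + w * E) * (1 + x)" using x0 by (intro mult_right_mono) auto
    moreover have "E \<le> 1 * (1 + x)" using E by simp
    ultimately show ?thesis by (rule order_trans[rotated])
  qed
  have "exp y - 1 \<le> y + y\<^sup>2" using exp_le_quadratic[of y] x y by simp
  also have "\<dots> \<le> y * (1 + x)" using mult_right_mono[OF y(2,1)] by (simp add: algebra_simps power2_eq_square)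
  finally have e: "exp y - 1 \<le> y * (1 + x)" .
  have "E * (exp y - 1) \<le> ((1 - w + w * E) * (1 + x)) * (y * (1 + x))"
    using E2 e y E x0 by (intro mult_mono) auto
  also have "\<dots> = (1 - w + w * E) * (y * (1 + x)\<^sup>2)" by (simp add: power2_eq_square algebra_simps)
  also have "\<dots> \<le> (1 - w + w * E) * (y * (1 + 3 * x))"
  proof -
    have "x\<^sup>2 \<le> x" using x x0 by (simp add: power2_eq_square mult_left_le)
    then have "(1 + x)\<^sup>2 \<le> 1 + 3 * x" by (simp add: power2_eq_square algebra_simps)
    moreover have "0 \<le> 1 - w + w * E" using w E by simp
    ultimately show ?thesis using y by (intro mult_left_mono) auto
  qed
  finally have "w * (E * (exp y - 1)) \<le> w * ((1 - w + w * E) * (y * (1 + 3 * x)))"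
    using w by (intro mult_left_mono) auto
  then show ?thesis by (simp add: algebra_simps)
qed

text \<open>\<open>K\<close> bounds the entries of \<open>U\<close>, \<open>Zb\<close> the total
  weight sampled from. The 7 in \<open>\<eta>\<close> leaves room for the second-order terms of one
  round: with \<open>c = \<eta> * \<eta> * Zb * K\<close> they amount to at most
  \<open>5 * c\<close> per unit of weight plus \<open>3 * c\<close>, while
  \<open>\<eta> * \<epsilon> = 7 * c\<close>.\<close>

locale mwu_params =
  fixes K Zb \<epsilon> \<eta> :: real
  assumes \<epsilon>: "0 < \<epsilon>" "\<epsilon> \<le> K" and Zb: "2 * K \<le> Zb" and \<eta>_def: "\<eta> = \<epsilon> / (7 * Zb * K)"
begin

lemma K_pos: "0 < K" and Zb_pos: "0 < Zb" using \<epsilon> Zb by auto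

lemma \<eta>_pos: "0 < \<eta>" unfolding \<eta>_def using \<epsilon> K_pos Zb_pos by simp

lemma \<eta>_Zb: "\<eta> * Zb \<le> 1"
proof -
  have "\<eta> * Zb = \<epsilon> / (7 * K)" unfolding \<eta>_def using Zb_pos by (simp add: field_simps)
  also have "\<dots> \<le> 1" using \<epsilon> K_pos by (simp add: field_simps)
  finally show ?thesis .
qed

text \<open>\<open>P p\<close> is the factor by which the product potential changes if
  \<open>p\<close> is sampled, which happens with probability \<open>a p / Z\<close>; the claim is
  multiplied by \<open>Z\<close> to avoid the division, and \<open>Z = 0\<close> is a case of its
  own. To first order the expected change is \<open>- \<eta>\<close> times the weighted sum of
  \<open>U q - a q\<close>, hence at most \<open>- \<eta> * fs\<close>; the drift
  \<open>\<epsilon>\<close> pays for the rest.\<close>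

lemma mwu_step:
  fixes w a U :: "'b \<Rightarrow> real"
  assumes fin: "finite I" and w: "\<And>q. q \<in> I \<Longrightarrow> 0 \<le> w q \<and> w q \<le> 1" and a: "\<And>q. q \<in> I \<Longrightarrow> 0 \<le> a q"
    and Z: "(\<Sum>q\<in>I. a q) = Z" "Z \<le> Zb" and U: "\<And>q. q \<in> I \<Longrightarrow> \<bar>U q\<bar> \<le> K"
    and fs: "fs \<le> (\<Sum>q\<in>I. w q * (U q - a q))" "- K \<le> fs"
  defines "P \<equiv> \<lambda>p. \<Prod>q\<in>I. (1 - w q + w q * exp (- \<eta> * (U q + \<epsilon> - (if q = p then Z else 0))))"
  shows "(\<Sum>p\<in>I. a p * P p) \<le> Z * exp (\<eta> * (\<epsilon> - fs))"
    and "Z = 0 \<Longrightarrow> p \<in> I \<Longrightarrow> P p \<le> exp (\<eta> * (\<epsilon> - fs))"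
proof -
  let ?x = "\<eta> * Zb"
  have Z0: "0 \<le> Z" using Z a by (metis sum_nonneg)
  have x: "0 \<le> ?x" "?x \<le> 1" using \<eta>_pos Zb_pos \<eta>_Zb by auto
  have y: "0 \<le> \<eta> * Z" "\<eta> * Z \<le> ?x" using \<eta>_pos Z0 Z by (auto intro: mult_left_mono)
  define E where "E q = exp (- \<eta> * (U q + \<epsilon>))" for q
  define P0 where "P0 = (\<Prod>q\<in>I. 1 - w q + w q * E q)"
  define \<kappa> where "\<kappa> = \<eta> * (1 + 3 * ?x)"
  have Ebd: "0 < E q" "E q \<le> 1 + ?x" "E q \<le> 1 - \<eta> * (U q + \<epsilon>) + (\<eta> * (2 * K))\<^sup>2" if "q \<in> I" for q
  proof -
    show "0 < E q" by (simp add: E_def)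
    let ?u = "- \<eta> * (U q + \<epsilon>)"
    have b: "\<bar>U q + \<epsilon>\<bar> \<le> 2 * K" "- (U q + \<epsilon>) \<le> K" using U[OF that] \<epsilon> by auto
    have "\<eta> * (2 * K) \<le> ?x" using \<eta>_pos Zb by (intro mult_left_mono) auto
    have absu: "\<bar>?u\<bar> \<le> \<eta> * (2 * K)" using b(1) \<eta>_pos by (simp add: abs_mult)
    then have u: "\<bar>?u\<bar> \<le> 1" using \<open>\<eta> * (2 * K) \<le> ?x\<close> x by linarith
    have q: "E q \<le> 1 + ?u + ?u\<^sup>2" unfolding E_def using u by (intro exp_le_quadratic) auto
    moreover have "?u\<^sup>2 \<le> (\<eta> * (2 * K))\<^sup>2" using absu by (intro abs_le_square_iff[THEN iffD1]) auto
    ultimately show "E q \<le> 1 - \<eta> * (U q + \<epsilon>) + (\<eta> * (2 * K))\<^sup>2" by simp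
    have "?u \<le> \<eta> * K" using b(2) \<eta>_pos by (metis mult_left_mono less_imp_le minus_mult_commute)
    moreover have "\<eta> * K \<le> ?x / 2" using \<eta>_pos Zb by (simp add: field_simps)
    ultimately have v: "?u \<le> ?x / 2" by linarith
    have "E q \<le> exp (?x / 2)" unfolding E_def using v by simp
    also have "\<dots> \<le> 1 + ?x / 2 + (?x / 2)\<^sup>2" using x by (intro exp_le_quadratic) auto
    also have "\<dots> \<le> 1 + ?x"
    proof -
      have "(?x / 2)\<^sup>2 \<le> ?x / 2 * 1" unfolding power2_eq_square using x by (intro mult_left_mono) auto
      then show ?thesis by simp
    qed
    finally show "E q \<le> 1 + ?x" .
  qed
  have f0: "0 \<le> 1 - w q + w q * E q" if "q \<in> I" for q
    using w[OF that] Ebd(1)[OF that] by simp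
  have P0: "0 \<le> P0" unfolding P0_def using f0 by (intro prod_nonneg) auto
  \<comment> \<open>Only the factor of \<open>p\<close> contains \<open>Z\<close>; bounding it
    linearly makes the weighted sum over \<open>p\<close> depend on \<open>p\<close> only through
    \<open>aw\<close>.\<close>
  have Pp: "P p \<le> P0 * (1 + \<kappa> * (w p * Z))" if p: "p \<in> I" for p
  proof -
    have "P p = (1 - w p + w p * (E p * exp (\<eta> * Z))) * (\<Prod>q\<in>I - {p}. 1 - w q + w q * E q)"
      unfolding P_def prod.remove[OF fin p] E_def
      by (intro arg_cong2[where f = times] prod.cong) (auto simp: exp_add[symmetric] algebra_simps)
    also have "\<dots> \<le> ((1 - w p + w p * E p) * (1 + w p * (\<eta> * Z * (1 + 3 * ?x)))) * (\<Prod>q\<in>I - {p}. 1 - w q + w q * E q)"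
      using w[OF p] Ebd[OF p] x y f0 by (intro mult_right_mono mwu_factor_bound prod_nonneg) auto
    also have "\<dots> = P0 * (1 + \<kappa> * (w p * Z))"
      unfolding P0_def prod.remove[OF fin p] \<kappa>_def by (simp add: algebra_simps)
    finally show ?thesis .
  qed
  define W1 where "W1 = (\<Sum>q\<in>I. w q)"
  define aw where "aw = (\<Sum>q\<in>I. a q * w q)"
  have W1: "0 \<le> W1" unfolding W1_def using w by (intro sum_nonneg) auto
  have uw: "(\<Sum>q\<in>I. w q * U q) \<le> K * W1"
    unfolding W1_def sum_distrib_left
  proof (rule sum_mono)
    fix q assume q: "q \<in> I"
    have "w q * U q \<le> w q * K" using w[OF q] U[OF q] by (intro mult_left_mono) auto
    then show "w q * U q \<le> K * w q" by (simp add: mult.commute)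
  qed
  have fs': "fs \<le> (\<Sum>q\<in>I. w q * U q) - aw"
    using fs(1) unfolding aw_def by (simp add: algebra_simps sum_subtractf)
  \<comment> \<open>The lower bound on \<open>fs\<close> limits \<open>aw\<close>, so that its
    second-order share is covered by \<open>W1\<close> and a constant.\<close>
  then have aw: "aw \<le> K * W1 + K" using uw fs(2) by linarith
  have "P0 \<le> exp (\<Sum>q\<in>I. w q * (- \<eta> * (U q + \<epsilon>) + (\<eta> * (2 * K))\<^sup>2))"
    unfolding P0_def exp_sum[OF fin]
  proof (rule prod_mono, intro conjI)
    fix q assume q: "q \<in> I"
    show "0 \<le> 1 - w q + w q * E q" by (rule f0[OF q])
    have "w q * E q \<le> w q * (1 - \<eta> * (U q + \<epsilon>) + (\<eta> * (2 * K))\<^sup>2)"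
      using w[OF q] Ebd(3)[OF q] by (intro mult_left_mono) auto
    then have "1 - w q + w q * E q \<le> 1 + w q * (- \<eta> * (U q + \<epsilon>) + (\<eta> * (2 * K))\<^sup>2)"
      by (simp add: algebra_simps)
    also have "\<dots> \<le> exp (w q * (- \<eta> * (U q + \<epsilon>) + (\<eta> * (2 * K))\<^sup>2))" by (rule exp_ge_add_one_self)
    finally show "1 - w q + w q * E q \<le> exp (w q * (- \<eta> * (U q + \<epsilon>) + (\<eta> * (2 * K))\<^sup>2))" .
  qed
  also have "(\<Sum>q\<in>I. w q * (- \<eta> * (U q + \<epsilon>) + (\<eta> * (2 * K))\<^sup>2)) =
      - \<eta> * (\<Sum>q\<in>I. w q * U q) - \<eta> * \<epsilon> * W1 + (\<eta> * (2 * K))\<^sup>2 * W1"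
  proof -
    have "(\<Sum>q\<in>I. w q * (- \<eta> * (U q + \<epsilon>) + (\<eta> * (2 * K))\<^sup>2)) =
      (\<Sum>q\<in>I. - \<eta> * (w q * U q) - \<eta> * \<epsilon> * w q + (\<eta> * (2 * K))\<^sup>2 * w q)"
      by (intro sum.cong refl) (simp add: ring_distribs mult.left_commute mult.assoc)
    then show ?thesis unfolding W1_def sum_distrib_left by (simp add: sum.distrib sum_subtractf)
  qed
  finally have P0le: "P0 \<le> exp (- \<eta> * (\<Sum>q\<in>I. w q * U q) - \<eta> * \<epsilon> * W1 + (\<eta> * (2 * K))\<^sup>2 * W1)" .
  have aw0: "0 \<le> aw" unfolding aw_def using w a by (intro sum_nonneg) auto
  have \<kappa>0: "0 \<le> \<kappa>" unfolding \<kappa>_def using \<eta>_pos x by simp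
  have "P0 * (1 + \<kappa> * aw) \<le> exp (- \<eta> * (\<Sum>q\<in>I. w q * U q) - \<eta> * \<epsilon> * W1 + (\<eta> * (2 * K))\<^sup>2 * W1) * exp (\<kappa> * aw)"
    using P0le exp_ge_add_one_self[of "\<kappa> * aw"] \<kappa>0 aw0 by (intro mult_mono) auto
  also have "\<dots> \<le> exp (\<eta> * (\<epsilon> - fs))"
  proof -
    have "\<eta> * Zb * (7 * K) = \<epsilon>" unfolding \<eta>_def using K_pos Zb_pos by (simp add: field_simps)
    then have key: "\<eta> * \<epsilon> = 7 * (\<eta> * \<eta> * Zb * K)" by (metis mult.assoc mult.commute)
    have c0: "0 \<le> \<eta> * \<eta> * Zb * K" using K_pos Zb_pos \<eta>_pos by simp
    have t1: "(\<eta> * (2 * K))\<^sup>2 * W1 \<le> 2 * (\<eta> * \<eta> * Zb * K) * W1"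
    proof -
      have "(\<eta> * (2 * K))\<^sup>2 = 2 * (\<eta> * \<eta> * (2 * K) * K)" by (simp add: power2_eq_square)
      also have "\<dots> \<le> 2 * (\<eta> * \<eta> * Zb * K)" using Zb K_pos \<eta>_pos by simp
      finally show ?thesis using W1 by (intro mult_right_mono) auto
    qed
    have t2: "3 * (\<eta> * \<eta> * Zb) * aw \<le> 3 * (\<eta> * \<eta> * Zb * K) * W1 + 3 * (\<eta> * \<eta> * Zb * K)"
    proof -
      have "3 * (\<eta> * \<eta> * Zb) * aw \<le> 3 * (\<eta> * \<eta> * Zb) * (K * W1 + K)"
        using aw \<eta>_pos Zb_pos by (intro mult_left_mono) auto
      then show ?thesis by (simp add: algebra_simps)
    qed
    have t3: "\<eta> * aw - \<eta> * (\<Sum>q\<in>I. w q * U q) \<le> - \<eta> * fs"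
    proof -
      have "\<eta> * fs \<le> \<eta> * ((\<Sum>q\<in>I. w q * U q) - aw)" using fs' \<eta>_pos by (intro mult_left_mono) auto
      then show ?thesis by (simp add: algebra_simps)
    qed
    have e1: "\<kappa> * aw = \<eta> * aw + 3 * (\<eta> * \<eta> * Zb) * aw" by (simp add: \<kappa>_def algebra_simps)
    have e2: "\<eta> * \<epsilon> * W1 = 7 * (\<eta> * \<eta> * Zb * K) * W1" using key by simp
    have "0 \<le> (\<eta> * \<eta> * Zb * K) * W1" using c0 W1 by simp
    then have "- \<eta> * (\<Sum>q\<in>I. w q * U q) - \<eta> * \<epsilon> * W1 + (\<eta> * (2 * K))\<^sup>2 * W1 + \<kappa> * aw \<le> \<eta> * (\<epsilon> - fs)"
      using t1 t2 t3 e1 e2 key c0 unfolding right_diff_distrib by linarith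
    then show ?thesis by (simp add: exp_add[symmetric])
  qed
  finally have main: "P0 * (1 + \<kappa> * aw) \<le> exp (\<eta> * (\<epsilon> - fs))" .
  have "(\<Sum>p\<in>I. a p * P p) \<le> (\<Sum>p\<in>I. a p * (P0 * (1 + \<kappa> * (w p * Z))))"
    using Pp a by (intro sum_mono mult_left_mono) auto
  also have "\<dots> = (\<Sum>p\<in>I. P0 * a p + P0 * \<kappa> * Z * (a p * w p))"
    by (intro sum.cong) (auto simp: algebra_simps)
  also have "\<dots> = P0 * Z + P0 * \<kappa> * Z * aw"
    by (simp add: sum.distrib sum_distrib_left[symmetric] Z(1) aw_def)
  also have "\<dots> = Z * (P0 * (1 + \<kappa> * aw))" by (simp add: algebra_simps)
  also have "\<dots> \<le> Z * exp (\<eta> * (\<epsilon> - fs))" using main Z0 by (rule mult_left_mono)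
  finally show "(\<Sum>p\<in>I. a p * P p) \<le> Z * exp (\<eta> * (\<epsilon> - fs))" .
  show "P p \<le> exp (\<eta> * (\<epsilon> - fs))" if "Z = 0" "p \<in> I" 
  proof -
    have "P p \<le> P0 * (1 + \<kappa> * (w p * Z))" by (rule Pp[OF that(2)])
    also have "\<dots> \<le> P0 * (1 + \<kappa> * aw)" using that P0 \<kappa>0 aw0 by (intro mult_left_mono) auto
    finally show ?thesis using main by simp
  qed
qed

end

text \<open>The estimated gain of a coordinate grows by \<open>Z\<close> with probability
  \<open>ap / Z\<close> and stays put otherwise, so its mean is the true gain \<open>ap\<close>. The
  discount \<open>1 - \<nu>\<close> on the true gain absorbs the quadratic term of
  \<open>exp (- \<gamma> * Z)\<close>, because \<open>\<gamma> * Z \<le> 2 * \<nu>\<close>: a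
  lower-tail Chernoff bound in multiplicative form.\<close>

lemma sampling_step:
  fixes \<gamma> \<nu> Z Zb ap :: real
  assumes "0 \<le> ap" "ap \<le> Z" "Z \<le> Zb" "0 \<le> \<gamma>" "\<gamma> * Zb = 2 * \<nu>" "\<nu> \<le> 1 / 2"
  shows "ap * exp (\<gamma> * (1 - \<nu>) * ap - \<gamma> * Z) + (Z - ap) * exp (\<gamma> * (1 - \<nu>) * ap) \<le> Z"
proof (cases "Z = 0")
  case True then show ?thesis using assms by simp
next
  case False
  then have Z: "Z > 0" using assms by simp
  let ?x = "\<gamma> * Z"
  have x: "0 \<le> ?x" "?x \<le> 2 * \<nu>" using assms Z by (auto simp: assms(5)[symmetric] mult_left_mono)
  have e: "exp (- ?x) \<le> 1 - ?x + ?x\<^sup>2 / 2"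
  proof -
    have "exp (- ?x) = inverse (exp ?x)" by (simp add: exp_minus)
    also have "\<dots> \<le> inverse (1 + ?x + ?x\<^sup>2 / 2)"
      using x exp_lower_Taylor_quadratic[of ?x] by (intro le_imp_inverse_le) (auto simp: add_pos_nonneg)
    also have "\<dots> \<le> 1 - ?x + ?x\<^sup>2 / 2"
    proof -
      have "(1 - ?x + ?x\<^sup>2 / 2) * (1 + ?x + ?x\<^sup>2 / 2) = 1 + ?x ^ 4 / 4"
        by (simp add: algebra_simps power2_eq_square power4_eq_xxxx)
      then have "1 \<le> (1 - ?x + ?x\<^sup>2 / 2) * (1 + ?x + ?x\<^sup>2 / 2)" by simp
      moreover have "0 < 1 + ?x + ?x\<^sup>2 / 2" using x by (simp add: add_pos_nonneg)
      ultimately show ?thesis by (simp add: field_simps)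
    qed
    finally show ?thesis .
  qed
  have "?x\<^sup>2 / 2 \<le> ?x * \<nu>" using mult_left_mono[OF x(2,1)] by (simp add: power2_eq_square)
  with e have e': "exp (- ?x) - 1 \<le> - ?x * (1 - \<nu>)" by (simp add: algebra_simps)
  have "ap * exp (\<gamma> * (1 - \<nu>) * ap - \<gamma> * Z) + (Z - ap) * exp (\<gamma> * (1 - \<nu>) * ap) =
     Z * (exp (\<gamma> * (1 - \<nu>) * ap) * (1 + (ap / Z) * (exp (- ?x) - 1)))"
  proof -
    have "exp (\<gamma> * (1 - \<nu>) * ap - \<gamma> * Z) = exp (\<gamma> * (1 - \<nu>) * ap) * exp (- ?x)"
      by (simp add: exp_add[symmetric])
    then show ?thesis using Z by (simp only: field_simps) (simp add: field_simps)
  qed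
  also have "\<dots> \<le> Z * (exp (\<gamma> * (1 - \<nu>) * ap) * exp ((ap / Z) * (exp (- ?x) - 1)))"
    using Z by (intro mult_left_mono exp_ge_add_one_self) auto
  also have "\<dots> \<le> Z * (exp (\<gamma> * (1 - \<nu>) * ap) * exp ((ap / Z) * (- ?x * (1 - \<nu>))))"
    using Z e' assms by (intro mult_left_mono exp_le_cancel_iff[THEN iffD2]) auto
  also have "\<dots> = Z" using Z by (simp add: exp_add[symmetric] field_simps)
  finally show ?thesis .
qed

section \<open>From the two potentials to the inequalities of a certificate\<close>

lemma neg_sum_ge:
  assumes "finite V" and X: "\<And>S. S \<subseteq> V \<Longrightarrow> card S \<le> l \<Longrightarrow> X \<le> (\<Sum>p\<in>S. y p)"
  shows "X \<le> neg_sum V l y"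
proof -
  let ?g = "\<lambda>p. min (y p) 0"
  obtain xs0 where xs0: "mset xs0 = mset_set V" using ex_mset by blast
  define xs where "xs = sort_key ?g xs0"
  have m: "mset xs = mset_set V" by (simp add: xs_def xs0)
  have "sorted (map ?g xs)" unfolding xs_def by simp
  then have "sorted_list_of_multiset (mset (map ?g xs)) = map ?g xs"
    by (metis sorted_list_of_multiset_mset sorted_sort_id)
  then have e: "neg_sum V l y = sum_list (map ?g (take l xs))"
    unfolding neg_sum_def by (simp add: m[symmetric] take_map)
  have d: "distinct xs" "set xs = V"
  proof -
    show "set xs = V" using m assms(1) by (metis finite_set_mset_mset_set set_mset_mset)
    show "distinct xs" using m assms(1) by (metis distinct_count_atmost_1 count_mset_set(1) count_mset_set(3) mset_set.infinite set_mset_mset finite_set_mset_mset_set)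
  qed
  \<comment> \<open>Sorting the elements by key, instead of the values, keeps track of which
    coordinates are summed; the negative ones among the first \<open>l\<close> form a set whose sum
    is the \<open>neg_sum\<close>.\<close>
  let ?S = "{p \<in> set (take l xs). y p < 0}"
  have "X \<le> (\<Sum>p\<in>?S. y p)"
  proof (rule X)
    show "?S \<subseteq> V" using d set_take_subset by fastforce
    have "card ?S \<le> card (set (take l xs))" by (intro card_mono) auto
    also have "\<dots> \<le> l" by (metis card_length length_take min.cobounded2 order_trans)
    finally show "card ?S \<le> l" .
  qed
  also have "\<dots> = (\<Sum>p\<in>set (take l xs). ?g p)"
    by (intro sum.mono_neutral_cong_left) auto
  also have "\<dots> = neg_sum V l y" unfolding e using d by (simp add: sum_list_distinct_conv_sum_set)
  finally show ?thesis .
qed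

text \<open>\<open>c p\<close> is the estimated and \<open>A p\<close> the true total gain after
  \<open>T\<close> rounds, so the scores are \<open>T * U p - c p\<close>. The loss
  \<open>T * \<delta> / 2\<close> has four equal shares: the drift \<epsilon>, the start value and
  deviation of the first potential, the discount \<nu>, and the deviation of the second potential.
  The value of \<epsilon> gives the first share through \<open>1 + card S \<le> 3 * k\<close>, the
  value of \<nu> the third through \<open>D \<le> T * (4 * k * K)\<close>, and 2688 is
  \<open>8 * 336\<close>, where
  \<open>1 / \<eta> = 336 * v * k * K\<^sup>2 / \<delta>\<close>.\<close>

lemma certificate_from_event:
  fixes U A c :: "'b \<Rightarrow> real" and k l :: nat and v \<delta> \<phi> K fs \<sigma> T \<epsilon> Zb \<eta> \<nu> \<gamma> \<theta> :: real
  assumes k: "k > 0" and v: "v > 0" and \<delta>: "0 < \<delta>" "\<delta> \<le> \<phi>" "\<phi> \<le> K" and fs: "- \<phi> \<le> fs" and \<sigma>: "\<sigma> \<ge> 0"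
    and T: "2688 * (\<sigma> + 2) * (real l + 1) * v * k\<^sup>2 * K\<^sup>2 / \<delta>\<^sup>2 \<le> T"
    and \<epsilon>: "\<epsilon> = \<delta> / (24 * k)" and Zb: "Zb = 2 * v * K" and \<eta>: "\<eta> = \<epsilon> / (7 * Zb * K)" and \<nu>: "\<nu> = \<delta> / (64 * k * K)"
    and \<gamma>: "\<gamma> = 2 * \<nu> / Zb" and \<theta>: "\<theta> = real l * ln 2 / \<eta>"
    and fin: "finite I" and U: "\<And>p. p \<in> I \<Longrightarrow> U p \<le> K" and c: "\<And>p. p \<in> I \<Longrightarrow> 0 \<le> c p"
    and ev1: "(\<Prod>p\<in>I. 1 + exp (- \<eta> * (T * U p - c p + \<epsilon> * T + \<theta>))) * exp (\<eta> * T * (fs - \<epsilon>)) < exp (\<sigma> * (real l + 1))"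
    and ev2: "\<And>p. p \<in> I \<Longrightarrow> exp (\<gamma> * (1 - \<nu>) * A p - \<gamma> * c p) < exp (\<sigma> * (real l + 1))"
    and S: "S \<subseteq> I" "card S \<le> k + 1"
  shows "T * (fs - \<delta> / 2) \<le> (\<Sum>p\<in>S. T * U p - A p)"
proof -
  have pos: "0 < K" "0 < Zb" "0 < \<epsilon>" "0 < \<eta>" "0 < \<nu>" "0 < \<gamma>"
  proof -
    show "0 < K" using \<delta> by simp
    then show z: "0 < Zb" using v unfolding Zb by simp
    show e: "0 < \<epsilon>" using \<delta> k by (simp add: \<epsilon>)
    show "0 < \<eta>" using e z \<open>0 < K\<close> by (simp add: \<eta>)
    show "0 < \<nu>" using \<delta> k by (simp add: \<nu>)
    then show "0 < \<gamma>" using z by (simp add: \<gamma>)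
  qed
  have T0: "0 \<le> T"
  proof -
    have "0 \<le> 2688 * (\<sigma> + 2) * (real l + 1) * v * k\<^sup>2 * K\<^sup>2 / \<delta>\<^sup>2" using \<sigma> v by simp
    then show ?thesis using T by linarith
  qed
  define s where "s = \<sigma> * (real l + 1)"
  have s0: "0 \<le> s" using \<sigma> by (simp add: s_def)
  have k1: "1 \<le> real k" using k by simp
  have finS: "finite S" using S fin finite_subset by blast
  let ?c = "real (card S)"
  have cS: "?c \<le> 2 * k" "?c \<le> k + 1" using S(2) k by auto
  let ?Y = "\<lambda>p. T * U p - c p"
  define YS where "YS = (\<Sum>p\<in>S. ?Y p)"
  have \<theta>0: "0 \<le> \<theta>" using pos by (simp add: \<theta>)
  have a: "YS \<ge> T * (fs - \<epsilon>) - s / \<eta> - (\<epsilon> * T + \<theta>) * ?c"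
  proof -
    have "exp (- \<eta> * (YS + (\<epsilon> * T + \<theta>) * ?c)) = exp (\<Sum>p\<in>S. - \<eta> * (?Y p + \<epsilon> * T + \<theta>))"
    proof -
      have "(\<Sum>p\<in>S. - \<eta> * (?Y p + \<epsilon> * T + \<theta>)) = (\<Sum>p\<in>S. - \<eta> * ?Y p + - \<eta> * (\<epsilon> * T + \<theta>))"
        by (intro sum.cong refl) (simp add: algebra_simps)
      also have "\<dots> = - \<eta> * YS + ?c * (- \<eta> * (\<epsilon> * T + \<theta>))"
        unfolding sum.distrib sum_constant YS_def sum_distrib_left ..
      also have "\<dots> = - \<eta> * (YS + (\<epsilon> * T + \<theta>) * ?c)" by (simp add: algebra_simps)
      finally show ?thesis by simp
    qed
    also have "\<dots> = (\<Prod>p\<in>S. exp (- \<eta> * (?Y p + \<epsilon> * T + \<theta>)))" by (rule exp_sum[OF finS])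
    \<comment> \<open>The set \<open>S\<close> is one term in the expansion of the product over all
      blocks.\<close>
    also have "\<dots> \<le> (\<Prod>p\<in>S. 1 + exp (- \<eta> * (?Y p + \<epsilon> * T + \<theta>)))" by (intro prod_mono) auto
    also have "\<dots> \<le> (\<Prod>p\<in>I. 1 + exp (- \<eta> * (?Y p + \<epsilon> * T + \<theta>)))"
      using fin S by (intro prod_mono2) (auto intro: less_imp_le)
    finally have "exp (- \<eta> * (YS + (\<epsilon> * T + \<theta>) * ?c)) * exp (\<eta> * T * (fs - \<epsilon>)) < exp s"
      using ev1 unfolding s_def by (meson exp_ge_zero mult_right_mono order_le_less_trans)
    then have "- \<eta> * (YS + (\<epsilon> * T + \<theta>) * ?c) + \<eta> * T * (fs - \<epsilon>) < s"
      by (simp only: exp_add[symmetric] exp_less_cancel_iff)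
    then have "\<eta> * (T * (fs - \<epsilon>) - (\<epsilon> * T + \<theta>) * ?c - YS) < s" by (simp add: algebra_simps)
    then have "T * (fs - \<epsilon>) - (\<epsilon> * T + \<theta>) * ?c - YS < s / \<eta>" using pos by (simp add: field_simps)
    then show ?thesis by simp
  qed
  have loss1: "\<epsilon> * T * (1 + ?c) \<le> T * \<delta> / 8"
  proof -
    have "\<epsilon> * T * (1 + ?c) \<le> \<epsilon> * T * (3 * k)" using cS k1 T0 pos by (intro mult_left_mono) auto
    also have "\<dots> = T * \<delta> / 8" using k by (simp add: \<epsilon> field_simps)
    finally show ?thesis .
  qed
  have Tbig: "2688 * (\<sigma> + 2) * (real l + 1) * v * k\<^sup>2 * K\<^sup>2 \<le> T * \<delta>\<^sup>2"
    using T \<delta> by (simp add: field_simps)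
  have loss2: "s / \<eta> + \<theta> * ?c \<le> T * \<delta> / 8"
  proof -
    have "\<theta> * ?c + s / \<eta> = (real l * ln 2 * ?c + s) / \<eta>" by (simp add: \<theta> add_divide_distrib)
    also have "\<dots> \<le> (real k * (\<sigma> + 2) * (real l + 1)) / \<eta>"
    proof -
      have "ln 2 \<le> (1::real)" using ln_le_minus_one[of 2] by simp
      then have "real l * ln 2 * ?c \<le> real l * 1 * (2 * k)" using cS by (intro mult_mono) auto
      also have "\<dots> \<le> 2 * k * (real l + 1)" by (simp add: algebra_simps)
      finally have "real l * ln 2 * ?c + s \<le> 2 * k * (real l + 1) + k * s" using s0 k1 mult_right_mono[of 1 k s] by simp
      then have "real l * ln 2 * ?c + s \<le> real k * (\<sigma> + 2) * (real l + 1)" by (simp add: s_def algebra_simps)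
      then show ?thesis using pos by (simp add: divide_right_mono)
    qed
    also have "\<dots> = (real k * (\<sigma> + 2) * (real l + 1)) * (336 * v * k * K\<^sup>2 / \<delta>)"
      unfolding \<eta> \<epsilon> Zb using pos \<delta> k v by (simp add: field_simps power2_eq_square)
    also have "\<dots> = 2688 * (\<sigma> + 2) * (real l + 1) * v * k\<^sup>2 * K\<^sup>2 / (8 * \<delta>)"
      using \<delta> by (simp add: field_simps power2_eq_square)
    also have "\<dots> \<le> T * \<delta>\<^sup>2 / (8 * \<delta>)" using Tbig \<delta> by (intro divide_right_mono) auto
    also have "\<dots> = T * \<delta> / 8" using \<delta> by (simp add: power2_eq_square)
    finally show ?thesis by simp
  qed
  have YSge: "YS \<ge> T * fs - T * \<delta> / 4"
  proof -
    have "T * (fs - \<epsilon>) - s / \<eta> - (\<epsilon> * T + \<theta>) * ?c = T * fs - \<epsilon> * T * (1 + ?c) - (s / \<eta> + \<theta> * ?c)"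
      by (simp add: algebra_simps)
    then show ?thesis using a loss1 loss2 by linarith
  qed
  define D where "D = (\<Sum>p\<in>S. c p)"
  have D0: "0 \<le> D" unfolding D_def using c S by (intro sum_nonneg) auto
  have YSD: "YS = T * (\<Sum>p\<in>S. U p) - D" by (simp add: YS_def D_def sum_subtractf sum_distrib_left)
  have US: "(\<Sum>p\<in>S. U p) \<le> 2 * k * K"
  proof -
    have "(\<Sum>p\<in>S. U p) \<le> (\<Sum>p\<in>S. K)" using S U by (intro sum_mono) auto
    also have "\<dots> \<le> 2 * k * K" using cS pos by simp
    finally show ?thesis .
  qed
  have kK: "K \<le> k * K" using k1 pos by simp
  \<comment> \<open>\<open>D\<close> measures how far the scores on \<open>S\<close> fell below
    \<open>T * U\<close>, and \<open>YSge\<close> limits that fall; this turns the relative error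
    \<nu> into an absolute one.\<close>
  have Dle: "D \<le> T * (4 * k * K)"
  proof -
    have "T * (\<Sum>p\<in>S. U p) \<le> T * (2 * k * K)" using US T0 by (intro mult_left_mono) auto
    moreover have "T * fs - T * \<delta> / 4 \<ge> - (T * (2 * (k * K)))"
    proof -
      have "0 \<le> fs - \<delta> / 4 + 2 * (k * K)" using fs \<delta> kK by linarith
      then have "0 \<le> T * (fs - \<delta> / 4 + 2 * (k * K))" using T0 by simp
      then show ?thesis by (simp add: algebra_simps)
    qed
    ultimately show ?thesis using YSge YSD by (simp add: algebra_simps)
  qed
  have \<nu>1: "\<nu> \<le> 1 / 2"
  proof -
    have "\<delta> \<le> 32 * (k * K)" using \<delta> kK by linarith
    then show ?thesis unfolding \<nu> using k pos by (simp add: field_simps)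
  qed
  define AS where "AS = (\<Sum>p\<in>S. A p)"
  have "(1 - \<nu>) * AS \<le> D + ?c * (s / \<gamma>)"
  proof -
    have "(1 - \<nu>) * A p \<le> c p + s / \<gamma>" if "p \<in> S" for p
    proof -
      have "\<gamma> * (1 - \<nu>) * A p - \<gamma> * c p < s" using ev2[of p] that S unfolding s_def by (auto simp only: exp_less_cancel_iff)
      then have "\<gamma> * ((1 - \<nu>) * A p - c p) < s" by (simp add: algebra_simps)
      then have "(1 - \<nu>) * A p - c p < s / \<gamma>" using pos(6) by (simp add: pos_less_divide_eq mult.commute)
      then show ?thesis by simp
    qed
    then have "(\<Sum>p\<in>S. (1 - \<nu>) * A p) \<le> (\<Sum>p\<in>S. c p + s / \<gamma>)" by (intro sum_mono) auto
    then show ?thesis by (simp add: AS_def D_def sum_distrib_left sum.distrib)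
  qed
  then have "(1 + 2 * \<nu>) * ((1 - \<nu>) * AS) \<le> (1 + 2 * \<nu>) * (D + ?c * (s / \<gamma>))"
    using pos by (intro mult_left_mono) auto
  \<comment> \<open>The discount is undone by \<open>(1 + 2 * \<nu>) * (1 - \<nu>) \<ge> 1\<close>,
    which holds for \<open>\<nu> \<le> 1 / 2\<close>.\<close>
  moreover have "AS \<le> (1 + 2 * \<nu>) * ((1 - \<nu>) * AS) \<or> AS \<le> 0"
  proof (cases "AS \<ge> 0")
    case True
    have "(1 + 2 * \<nu>) * (1 - \<nu>) = 1 + \<nu> * (1 - 2 * \<nu>)" by (simp add: algebra_simps)
    also have "\<dots> \<ge> 1" using pos \<nu>1 by simp
    finally have "1 * AS \<le> ((1 + 2 * \<nu>) * (1 - \<nu>)) * AS" using True by (intro mult_right_mono) auto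
    then show ?thesis by (simp add: mult.assoc)
  qed auto
  moreover have nn: "0 \<le> (1 + 2 * \<nu>) * (D + ?c * (s / \<gamma>))" using pos D0 s0 by simp
  ultimately have "AS \<le> (1 + 2 * \<nu>) * (D + ?c * (s / \<gamma>))" by linarith
  also have "\<dots> \<le> D + 2 * \<nu> * D + 2 * (?c * (s / \<gamma>))"
  proof -
    have "2 * \<nu> * (?c * (s / \<gamma>)) \<le> 1 * (?c * (s / \<gamma>))" using \<nu>1 s0 pos by (intro mult_right_mono) auto
    moreover have "(1 + 2 * \<nu>) * (D + u) = D + 2 * \<nu> * D + u + 2 * \<nu> * u" for u by (simp add: algebra_simps)
    note this[of "?c * (s / \<gamma>)"]
    ultimately show ?thesis by linarith
  qed
  also have "2 * \<nu> * D \<le> T * \<delta> / 8"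
  proof -
    have "2 * \<nu> * D \<le> 2 * \<nu> * (T * (4 * k * K))" using Dle pos by (intro mult_left_mono) auto
    also have "\<dots> = T * \<delta> / 8" unfolding \<nu> using k pos by (simp add: field_simps)
    finally show ?thesis .
  qed
  also have "2 * (?c * (s / \<gamma>)) \<le> T * \<delta> / 8"
  proof -
    have "2 * (?c * (s / \<gamma>)) \<le> 2 * ((2 * k) * (s / \<gamma>))" using cS s0 pos by (intro mult_left_mono mult_right_mono) auto
    also have "\<dots> = 256 * s * v * k\<^sup>2 * K\<^sup>2 / \<delta>"
      unfolding \<gamma> \<nu> Zb using k pos \<delta> v by (simp add: field_simps power2_eq_square)
    also have "\<dots> \<le> (T * \<delta>\<^sup>2 / 8) / \<delta>"
    proof (rule divide_right_mono)
      have "256 * s * v * k\<^sup>2 * K\<^sup>2 = 256 * (\<sigma> * (real l + 1) * v * k\<^sup>2 * K\<^sup>2)" by (simp add: s_def)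
      also have "\<dots> \<le> 336 * ((\<sigma> + 2) * (real l + 1) * v * k\<^sup>2 * K\<^sup>2)"
        using \<sigma> v by (intro mult_mono mult_right_mono) auto
      finally show "256 * s * v * k\<^sup>2 * K\<^sup>2 \<le> T * \<delta>\<^sup>2 / 8" using Tbig by linarith
    qed (use \<delta> in auto)
    also have "\<dots> = T * \<delta> / 8" using \<delta> by (simp add: power2_eq_square)
    finally show ?thesis .
  qed
  finally have "AS \<le> D + T * \<delta> / 8 + T * \<delta> / 8" by simp
  moreover have "(\<Sum>p\<in>S. T * U p - A p) = YS + D - AS"
    by (simp add: YSD AS_def sum_subtractf sum_distrib_left)
  ultimately show ?thesis using YSge by (simp add: algebra_simps)
qed

section \<open>Certificates from blocks\<close>

locale sfm =
  fixes V :: "'a set" and f :: "'a set \<Rightarrow> real" and v :: "nat \<Rightarrow> 'a"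
  assumes finite_V: "finite V" and bij_v: "bij_betw v {..<card V} V"
    and submod: "submodular_on V f" and f_empty: "f {} = 0"
begin

text \<open>The function in terms of indices. Indices from \<open>card V\<close> on are ignored,
  which extends it to a submodular function on all sets of naturals and lets padding elements
  contribute nothing.\<close>

definition G :: "nat set \<Rightarrow> real" where "G S = f (v ` (S \<inter> {..<card V}))"

lemma v_image: "v ` {..<card V} = V" and v_inj: "inj_on v {..<card V}"
  using bij_v by (auto simp: bij_betw_def)

lemma G_restrict: "G S = G (S \<inter> {..<card V})" by (simp add: G_def Int_assoc)

lemma G_empty [simp]: "G {} = 0" by (simp add: G_def f_empty)

lemma submodular_G: "submodular_on UNIV G"
  unfolding submodular_on_def
proof (intro allI impI)
  fix S T :: "nat set"
  let ?n = "{..<card V}"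
  have 1: "v ` ((S \<union> T) \<inter> ?n) = v ` (S \<inter> ?n) \<union> v ` (T \<inter> ?n)" by auto
  have 2: "v ` ((S \<inter> T) \<inter> ?n) = v ` (S \<inter> ?n) \<inter> v ` (T \<inter> ?n)"
    using inj_on_image_Int[OF v_inj, of "S \<inter> ?n" "T \<inter> ?n"] by (simp add: Int_ac)
  have "v ` (S \<inter> ?n) \<subseteq> V" "v ` (T \<inter> ?n) \<subseteq> V" using v_image by auto
  then show "G (S \<union> T) + G (S \<inter> T) \<le> G S + G T"
    using submod unfolding submodular_on_def G_def 1 2 by blast
qed

lemma min_value_le: "S \<subseteq> V \<Longrightarrow> min_value V f \<le> f S"
  unfolding min_value_def using finite_V by (intro Min_le) auto

lemma min_value_le_G: "min_value V f \<le> G S"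
  unfolding G_def using v_image by (intro min_value_le) auto

lemma perm_of_bij:
  assumes "distinct w" "set w = {..<card V}"
  shows "bij_betw (perm_of v w) {1..card V} V"
proof -
  have len: "length w = card V" using assms distinct_card[of w] by simp
  have "bij_betw (\<lambda>i. i - 1) {1..card V} {..<card V}"
    unfolding bij_betw_def
  proof
    show "inj_on (\<lambda>i. i - 1) {1..card V}" by (rule inj_onI) (unfold atLeastAtMost_iff, arith)
    have "{1..card V} = Suc ` {0..<card V}"
      by (metis image_Suc_atLeastLessThan atLeastLessThanSuc_atLeastAtMost One_nat_def)
    then show "(\<lambda>i. i - 1) ` {1..card V} = {..<card V}"
      by (simp only: image_image diff_Suc_1 image_ident lessThan_atLeast0)
  qed
  moreover have "bij_betw ((!) w) {..<card V} {..<card V}"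
    by (rule bij_betw_nth[OF assms(1)]) (simp_all only: len assms(2))
  ultimately have "bij_betw (v \<circ> ((!) w \<circ> (\<lambda>i. i - 1))) {1..card V} V"
    using bij_v by (intro bij_betw_trans)
  then show ?thesis by (simp add: perm_of_def[abs_def] o_def)
qed

text \<open>\<open>perm_of\<close> counts from 1 and lists from 0, so position \<open>Suc i\<close>
  corresponds to \<open>w ! i\<close>.\<close>

lemma greedy_vec_eq_marg:
  assumes w: "distinct w" "set w = {..<card V}" and x: "x < card V"
  shows "greedy_vec V f (perm_of v w) (v x) = marg G {} w x"
proof -
  have len: "length w = card V" using w distinct_card[of w] by simp
  obtain i where i: "i < card V" "x = w ! i" using w x len by (metis in_set_conv_nth lessThan_iff)
  have inj: "inj_on (perm_of v w) {1..card V}" using perm_of_bij[OF w] by (simp add: bij_betw_def)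
  have "perm_of v w (Suc i) = v x" using i by (simp add: perm_of_def)
  then have inv: "inv_into {1..card V} (perm_of v w) (v x) = Suc i"
    using inv_into_f_f[OF inj, of "Suc i"] i by simp
  have img: "perm_of v w ` {1..j} = v ` (set (take j w) \<inter> {..<card V})" if "j \<le> card V" for j
  proof -
    have "set (take j w) \<subseteq> {..<card V}" using w set_take_subset by fastforce
    moreover have "(\<lambda>i. w ! (i - 1)) ` {1..j} = set (take j w)"
    proof -
      have "(\<lambda>i. w ! (i - 1)) ` {1..j} = (!) w ` {0..<j}"
      proof -
        have e: "{1..j} = Suc ` {0..<j}"
          by (metis image_Suc_atLeastLessThan atLeastLessThanSuc_atLeastAtMost One_nat_def)
        show ?thesis by (simp only: e image_image diff_Suc_1)
      qed
      also have "\<dots> = set (take j w)" using that len by (simp add: nth_image)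
      finally show ?thesis .
    qed
    then have "perm_of v w ` {1..j} = v ` set (take j w)"
      unfolding perm_of_def[abs_def] by (metis image_image)
    ultimately show ?thesis by (simp add: Int_absorb2)
  qed
  have "greedy_vec V f (perm_of v w) (v x) = G (set (take (Suc i) w)) - G (set (take i w))"
    unfolding greedy_vec_def Let_def inv using img[of i] img[of "Suc i"] i by (simp add: G_def)
  also have "\<dots> = marg G {} w x" using marg_nth[of w i G "{}"] w i len by simp
  finally show ?thesis .
qed

text \<open>For a block B that meets S, y(B \<inter> S) = y(B) - y(B - S), and the last term is at
  most \<open>T * G (B - S)\<close> because \<open>y / T\<close> lies in the base polytope. This is
  why \<open>light\<close> speaks of the value of the complement.\<close>

lemma dual_certificate_from_blocks:
  assumes n: "card V \<le> N" and el: "\<And>b c. b \<noteq> c \<Longrightarrow> set (el b) \<inter> set (el c) = {}"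
    and el_d: "\<And>b. distinct (el b)" and el_U: "(\<Union>b<N. set (el b)) = {..<N}"
    and bs: "\<And>t. t < T \<Longrightarrow> distinct (bs t) \<and> set (bs t) = {..<N}"
    and ws: "length ws = T" "\<And>t. t < T \<Longrightarrow> ws ! t = filter (\<lambda>y. y < card V) (concat (map el (bs t)))"
    and T: "T > 0"
    and low: "\<And>S. S \<subseteq> {..<N} \<Longrightarrow> card S \<le> k + 1 \<Longrightarrow> real T * (min_value V f - \<delta> / 2) \<le>
       (\<Sum>b\<in>S. \<Sum>t<T. marg (\<lambda>I. G (\<Union>c\<in>I. set (el c))) {} (bs t) b)"
    and light: "\<And>b S. b < N \<Longrightarrow> S \<noteq> {} \<Longrightarrow> S \<subseteq> set (el b) \<Longrightarrow> card S \<le> k + 1 \<Longrightarrow> G (set (el b) - S) \<le> h"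
    and h: "real (k + 1) * h \<le> \<delta> / 2" "0 \<le> h"
  shows "dual_certificate V f \<delta> k (average_greedy V f v ws)"
proof -
  let ?n = "card V" and ?F = "\<lambda>I. G (\<Union>c\<in>I. set (el c))"
  let ?L = "\<lambda>t. concat (map el (bs t))"
  have Lset: "set (?L t) = {..<N}" and Ld: "distinct (?L t)" if "t < T" for t
  proof -
    show "set (?L t) = {..<N}" using bs[OF that] el_U by simp
    \<comment> \<open>Indices that carry no block all have the empty list, so
      \<open>map el (bs t)\<close> may repeat entries; \<open>distinct_concat\<close> is applied
      after dropping them.\<close>
    have "distinct (map el (filter (\<lambda>b. el b \<noteq> []) (bs t)))"
      unfolding distinct_map
    proof (intro conjI inj_onI)
      show "distinct (filter (\<lambda>b. el b \<noteq> []) (bs t))" using bs[OF that] by simp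
    next
      fix x y assume "x \<in> set (filter (\<lambda>b. el b \<noteq> []) (bs t))" "y \<in> set (filter (\<lambda>b. el b \<noteq> []) (bs t))" "el x = el y"
      then show "x = y" using el[of x y] by (cases "x = y") auto
    qed
    then have "distinct (concat (map el (filter (\<lambda>b. el b \<noteq> []) (bs t))))"
    proof (rule distinct_concat)
      fix ys assume "ys \<in> set (map el (filter (\<lambda>b. el b \<noteq> []) (bs t)))"
      then show "distinct ys" using el_d by auto
    next
      fix ys zs assume "ys \<in> set (map el (filter (\<lambda>b. el b \<noteq> []) (bs t)))"
        "zs \<in> set (map el (filter (\<lambda>b. el b \<noteq> []) (bs t)))" "ys \<noteq> zs"
      then obtain b c where "ys = el b" "zs = el c" "b \<noteq> c" by auto
      then show "set ys \<inter> set zs = {}" using el by simp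
    qed
    moreover have "concat (map el (filter (\<lambda>b. el b \<noteq> []) xs)) = concat (map el xs)" for xs
      by (induction xs) auto
    ultimately show "distinct (?L t)" by simp
  qed
  define m where "m t x = marg G {} (?L t) x" for t x
  have ws': "distinct (ws ! t)" "set (ws ! t) = {..<?n}" if "t < T" for t
    using that ws(2)[OF that] Ld[OF that] Lset[OF that] n by auto
  have mw: "marg G {} (ws ! t) x = m t x" if "t < T" "x < ?n" for t x
    unfolding ws(2)[OF that(1)] m_def
    using marg_filter_irrelevant[of G "{..<?n}" x "{}" "{}" "?L t"] G_restrict that by simp
  have m0: "m t x = 0" if "t < T" "?n \<le> x" for t x
  proof (cases "x \<in> set (?L t)")
    case True
    then obtain i where i: "i < length (?L t)" "x = ?L t ! i" by (metis in_set_conv_nth)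
    have "set (take (Suc i) (?L t)) \<inter> {..<?n} = set (take i (?L t)) \<inter> {..<?n}"
      using i that by (auto simp: take_Suc_conv_app_nth)
    then have "G (set (take (Suc i) (?L t))) = G (set (take i (?L t)))" using G_restrict by metis
    then show ?thesis unfolding m_def i(2) using marg_nth[OF Ld[OF that(1)] i(1), of G "{}"] by simp
  next
    case False
    have "marg G A ys x = 0" if "x \<notin> set ys" for A ys using that by (induction ys arbitrary: A) auto
    then show ?thesis using False by (simp add: m_def)
  qed
  define y where "y x = (\<Sum>t<T. m t x)" for x
  have avg: "average_greedy V f v ws (v x) = y x / T" if "x < ?n" for x
    unfolding average_greedy_def y_def ws(1)
    using greedy_vec_eq_marg[OF ws'(1) ws'(2) that] mw that by simp
  have ysum: "(\<Sum>x\<in>A. y x) \<le> T * G A" if "A \<subseteq> {..<N}" for A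
  proof -
    have "(\<Sum>x\<in>A. m t x) \<le> G A" if "t < T" for t
      using marg_base_polytope[OF submodular_G Ld[OF that], of "{}" A] Lset[OF that] \<open>A \<subseteq> _\<close> by (simp add: m_def)
    then have "(\<Sum>t<T. \<Sum>x\<in>A. m t x) \<le> (\<Sum>t<T. G A)" by (intro sum_mono) auto
    then show ?thesis unfolding y_def by (subst sum.swap) simp
  qed
  have yblock: "(\<Sum>x\<in>set (el b). y x) = (\<Sum>t<T. marg ?F {} (bs t) b)" if b: "b < N" for b
  proof -
    have "(\<Sum>x\<in>set (el b). m t x) = marg ?F {} (bs t) b" if "t < T" for t
      using marg_concat[of el "bs t" b G "{}"] Ld[OF that] bs[OF that] b by (simp add: m_def)
    then show ?thesis unfolding y_def by (subst sum.swap) simp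
  qed
  have fin_el: "set (el b) \<subseteq> {..<N}" if "b < N" for b using el_U that by auto
  have main: "T * (min_value V f - \<delta>) \<le> (\<Sum>x\<in>S. y x)" if S: "S \<subseteq> {..<?n}" "card S \<le> k + 1" for S
  proof -
    have finS: "finite S" using S finite_subset by blast
    define H where "H = {b. b < N \<and> set (el b) \<inter> S \<noteq> {}}"
    have finH: "finite H" unfolding H_def by simp
    have SH: "S = (\<Union>b\<in>H. set (el b) \<inter> S)"
    proof (intro equalityI subsetI)
      fix x assume x: "x \<in> S"
      then have "x \<in> {..<N}" using S n by auto
      then have "x \<in> (\<Union>b<N. set (el b))" using el_U by simp
      then obtain b where "b < N" "x \<in> set (el b)" by auto
      then show "x \<in> (\<Union>b\<in>H. set (el b) \<inter> S)" using x unfolding H_def by auto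
    qed auto
    \<comment> \<open>Blocks are disjoint, so choosing a point of \<open>S\<close> in each block met
      is injective; the bound on \<open>card S\<close> passes to sets of blocks.\<close>
    have cH: "card H \<le> card S"
    proof -
      have "\<forall>b\<in>H. \<exists>x. x \<in> set (el b) \<inter> S" unfolding H_def by auto
      then obtain g where g: "\<And>b. b \<in> H \<Longrightarrow> g b \<in> set (el b) \<inter> S" by metis
      have "inj_on g H"
        by (rule inj_onI) (metis el g Int_iff disjoint_iff)
      then show ?thesis using g finS by (intro card_inj_on_le[of g]) auto
    qed
    have "(\<Sum>x\<in>S. y x) = (\<Sum>b\<in>H. \<Sum>x\<in>set (el b) \<inter> S. y x)"
    proof -
      have "sum y (\<Union>b\<in>H. set (el b) \<inter> S) = (\<Sum>b\<in>H. sum y (set (el b) \<inter> S))"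
      proof (rule sum.UNION_disjoint[OF finH])
        show "\<forall>b\<in>H. \<forall>c\<in>H. b \<noteq> c \<longrightarrow> (set (el b) \<inter> S) \<inter> (set (el c) \<inter> S) = {}"
        proof (intro ballI impI)
          fix b c :: nat assume "b \<noteq> c"
          from el[OF this] show "(set (el b) \<inter> S) \<inter> (set (el c) \<inter> S) = {}" by blast
        qed
      qed simp
      then show ?thesis using SH by simp
    qed
    also have "\<dots> \<ge> (\<Sum>b\<in>H. (\<Sum>t<T. marg ?F {} (bs t) b) - T * h)"
    proof (rule sum_mono)
      fix b assume "b \<in> H"
      then have b: "b < N" and ne: "set (el b) \<inter> S \<noteq> {}" by (simp_all add: H_def)
      have "(\<Sum>x\<in>set (el b). y x) = (\<Sum>x\<in>set (el b) \<inter> S. y x) + (\<Sum>x\<in>set (el b) - (set (el b) \<inter> S). y x)"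
        by (intro sum.subset_diff[THEN trans]) (auto simp: add.commute)
      moreover have "(\<Sum>x\<in>set (el b) - (set (el b) \<inter> S). y x) \<le> T * G (set (el b) - (set (el b) \<inter> S))"
        using fin_el[OF b] by (intro ysum) auto
      moreover have "G (set (el b) - (set (el b) \<inter> S)) \<le> h"
        using S(2) card_mono[OF finS, of "set (el b) \<inter> S"] by (intro light[OF b ne]) auto
      then have "T * G (set (el b) - (set (el b) \<inter> S)) \<le> T * h" by (intro mult_left_mono) auto
      ultimately show "(\<Sum>t<T. marg ?F {} (bs t) b) - T * h \<le> (\<Sum>x\<in>set (el b) \<inter> S. y x)"
        using yblock[OF b] by linarith
    qed
    also have "(\<Sum>b\<in>H. (\<Sum>t<T. marg ?F {} (bs t) b) - T * h) =
        (\<Sum>b\<in>H. \<Sum>t<T. marg ?F {} (bs t) b) - card H * (T * h)"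
      by (simp add: sum_subtractf)
    also have "\<dots> \<ge> T * (min_value V f - \<delta> / 2) - T * (\<delta> / 2)"
    proof -
      have "T * (min_value V f - \<delta> / 2) \<le> (\<Sum>b\<in>H. \<Sum>t<T. marg ?F {} (bs t) b)"
        using cH S(2) by (intro low) (auto simp: H_def)
      moreover have "card H * (T * h) \<le> T * (\<delta> / 2)"
      proof -
        have "card H * h \<le> (k + 1) * h" using cH S(2) h by (intro mult_right_mono) auto
        then have "card H * h \<le> \<delta> / 2" using h by simp
        then have "T * (card H * h) \<le> T * (\<delta> / 2)" by (intro mult_left_mono) auto
        then show ?thesis by (simp add: ac_simps)
      qed
      ultimately show ?thesis by linarith
    qed
    finally show ?thesis by (simp add: algebra_simps)
  qed
  have pull: "\<exists>S'. S' \<subseteq> {..<?n} \<and> S = v ` S' \<and> card S' = card S \<and> (\<Sum>p\<in>S. average_greedy V f v ws p) = (\<Sum>x\<in>S'. y x) / T"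
    if S: "S \<subseteq> V" for S
  proof -
    obtain S' where S': "S' \<subseteq> {..<?n}" "S = v ` S'" using S v_image by (metis subset_imageE)
    have inj: "inj_on v S'" using v_inj S' inj_on_subset by blast
    have "(\<Sum>p\<in>S. average_greedy V f v ws p) = (\<Sum>x\<in>S'. average_greedy V f v ws (v x))"
      unfolding S'(2) by (simp add: sum.reindex[OF inj])
    also have "\<dots> = (\<Sum>x\<in>S'. y x / T)" using S' avg by (intro sum.cong) auto
    also have "\<dots> = (\<Sum>x\<in>S'. y x) / T" by (simp only: sum_divide_distrib)
    finally have "(\<Sum>p\<in>S. average_greedy V f v ws p) = (\<Sum>x\<in>S'. y x) / T" .
    moreover have "card S' = card S" using S'(2) card_image[OF inj] by simp
    ultimately show ?thesis using S' by blast
  qed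
  show ?thesis unfolding dual_certificate_def
  proof (intro conjI allI impI)
    have "min_value V f - \<delta> \<le> neg_sum V (k + 1) (average_greedy V f v ws)"
    proof (rule neg_sum_ge[OF finite_V])
      fix S assume S: "S \<subseteq> V" "card S \<le> k + 1"
      obtain S' where S': "S' \<subseteq> {..<?n}" "card S' = card S" "(\<Sum>p\<in>S. average_greedy V f v ws p) = (\<Sum>x\<in>S'. y x) / T"
        using pull[OF S(1)] by blast
      show "min_value V f - \<delta> \<le> (\<Sum>p\<in>S. average_greedy V f v ws p)"
      proof -
        have "T * (min_value V f - \<delta>) \<le> (\<Sum>x\<in>S'. y x)" using main[OF S'(1)] S'(2) S(2) by simp
        then have "min_value V f - \<delta> \<le> (\<Sum>x\<in>S'. y x) / T" using T by (simp add: pos_le_divide_eq mult.commute)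
        then show ?thesis using S'(3) by simp
      qed
    qed
    then show "min_value V f \<le> neg_sum V (k + 1) (average_greedy V f v ws) + \<delta>" by simp
  next
    fix S assume S: "S \<subseteq> V"
    obtain S' where S': "S' \<subseteq> {..<?n}" "S = v ` S'" "(\<Sum>p\<in>S. average_greedy V f v ws p) = (\<Sum>x\<in>S'. y x) / T"
      using pull[OF S(1)] by blast
    have "(\<Sum>x\<in>S'. y x) \<le> T * G S'" using S'(1) n by (intro ysum) auto
    then have "(\<Sum>x\<in>S'. y x) / T \<le> G S'" using T by (simp add: pos_divide_le_eq mult.commute)
    moreover have "G S' = f S" using S'(1,2) by (simp add: G_def Int_absorb2)
    ultimately show "(\<Sum>p\<in>S. average_greedy V f v ws p) \<le> f S" using S'(3) by simp
  qed
qed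

end

section \<open>The algorithm\<close>

definition For :: "vname \<Rightarrow> nexp \<Rightarrow> com \<Rightarrow> com" where
  "For x e c = Seq (NAssign x (NConst 0)) (While (NLess (NVar x) e) (Seq c (NAssign x (NAdd (NVar x) (NConst 1)))))"

lemma mods_For [simp]:
  "nmod (For x e c) = insert x (nmod c)" "namod (For x e c) = namod c" "rmod (For x e c) = rmod c"
  "ramod (For x e c) = ramod c" "asks (For x e c) = asks c" "emits (For x e c) = emits c"
  by (auto simp: For_def)

text \<open>The increment of the counter is folded into the postcondition of the body, so invariants
  are stated only at the loop head.\<close>

lemma Wp_For:
  fixes s :: state
  assumes "I 0 (s\<lparr>nvar := (nvar s)(x := 0), ticks := 0\<rparr>)"
    and "\<And>i s. i \<le> m \<Longrightarrow> I i s \<Longrightarrow> nval e s = m \<and> nvar s x = i"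
    and "\<And>i s. i < m \<Longrightarrow> I i s \<Longrightarrow>
      Wp n F t c s (\<lambda>s'. nvar s' x = i \<and> I (Suc i) (s'\<lparr>nvar := (nvar s')(x := Suc i), ticks := 0\<rparr>))
        (\<lambda>s'. \<phi> (Suc i) (s'\<lparr>nvar := (nvar s')(x := Suc i), ticks := 0\<rparr>)) (\<phi> i s)"
    and "\<And>i s. I i s \<Longrightarrow> I i (s\<lparr>ticks := 0\<rparr>)" "\<And>i s. \<phi> i (s\<lparr>ticks := 0\<rparr>) = \<phi> i s"
  shows "Wp n F (m * (t + 4) + 3) (For x e c) s (I m) (\<phi> m) (\<phi> 0 (s\<lparr>nvar := (nvar s)(x := 0), ticks := 0\<rparr>))"
proof -
  let ?s = "s\<lparr>nvar := (nvar s)(x := 0), ticks := 0\<rparr>"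
  have "Wp n F (1 + 1 + (m * ((t + 1 + 1) + 2) + 1)) (For x e c) s (I m) (\<phi> m) (\<phi> 0 ?s)"
    unfolding For_def
  proof (rule Wp_Seq[where P = "\<lambda>s'. s' = ?s" and \<psi> = "\<phi> 0"])
    show "Wp n F 1 (NAssign x (NConst 0)) s (\<lambda>s'. s' = ?s) (\<phi> 0) (\<phi> 0 ?s)"
      by (rule Wp_NAssign) auto
    fix s1 assume "s1 = ?s"
    then show "Wp n F (m * ((t + 1 + 1) + 2) + 1) (While (NLess (NVar x) e) (Seq c (NAssign x (NAdd (NVar x) (NConst 1)))))
        s1 (I m) (\<phi> m) (\<phi> 0 s1)"
    proof (intro Wp_While)
      fix i and s :: state assume "i < m" "I i s"
      then show "bval (NLess (NVar x) e) s" using assms(2)[of i s] by simp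
      show "Wp n F (t + 1 + 1) (Seq c (NAssign x (NAdd (NVar x) (NConst 1)))) s (I (Suc i)) (\<phi> (Suc i)) (\<phi> i s)"
        by (rule Wp_Seq[OF assms(3)[OF \<open>i < m\<close> \<open>I i s\<close>]]) (rule Wp_NAssign, auto)
    next
      fix s assume "I m s" then show "\<not> bval (NLess (NVar x) e) s" using assms(2)[of m s] by simp
    qed (use assms in auto)
  qed
  then show ?thesis by (rule Wp_weaken) (auto simp: algebra_simps)
qed

lemma Ws_For:
  fixes s :: state
  assumes "I 0 (s\<lparr>nvar := (nvar s)(x := 0), ticks := 0\<rparr>)"
    and "\<And>i s. i \<le> m \<Longrightarrow> I i s \<Longrightarrow> nval e s = m \<and> nvar s x = i"
    and "\<And>i s. i < m \<Longrightarrow> I i s \<Longrightarrow>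
      Ws n F t c s (\<lambda>s'. nvar s' x = i \<and> I (Suc i) (s'\<lparr>nvar := (nvar s')(x := Suc i), ticks := 0\<rparr>))"
    and "\<And>i s. I i s \<Longrightarrow> I i (s\<lparr>ticks := 0\<rparr>)"
  shows "Ws n F (m * (t + 4) + 3) (For x e c) s (I m)"
  using Wp_For[where I = I and \<phi> = "\<lambda>_ _. 0" and s = s and x = x and m = m and e = e and n = n and F = F and t = t and c = c] assms
  by simp

lemma Ws_Seq:
  assumes "Ws n F t1 c1 s P" "\<And>s1. P s1 \<Longrightarrow> Ws n F t2 c2 s1 Q"
  shows "Ws n F (t1 + 1 + t2) (Seq c1 c2) s Q"
  using Wp_Seq[OF assms] .

lemma Ws_mono: "Ws n F t c s Q \<Longrightarrow> t \<le> t' \<Longrightarrow> (\<And>s'. Q s' \<Longrightarrow> Q' s') \<Longrightarrow> Ws n F t' c s Q'"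
  by (erule Wp_weaken) auto

lemma Wp_Seq_det:
  assumes "Ws n F 1 c1 s (\<lambda>s'. s' = u)" "Wp n F t c u Q \<phi> r"
  shows "Wp n F (t + 2) (Seq c1 c) s Q \<phi> r"
proof -
  have "Wp n F (1 + 1 + t) (Seq c1 c) s Q \<phi> r"
    by (rule Wp_Seq[OF Wp_of_Ws[OF assms(1), of "\<lambda>_. r" r]]) (use assms(2) in auto)
  then show ?thesis by simp
qed

lemma Wp_Seq_NAssign:
  "Wp n F t c (s\<lparr>nvar := (nvar s)(x := nval e s), ticks := 0\<rparr>) Q \<phi> r \<Longrightarrow> Wp n F (t + 2) (Seq (NAssign x e) c) s Q \<phi> r"
  by (rule Wp_Seq_det[rotated], assumption) (rule Wp_NAssign, auto)
lemma Wp_Seq_NStore: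
  "Wp n F t c (s\<lparr>narr := (narr s)(A := (narr s A)(nval i s := nval e s)), ticks := 0\<rparr>) Q \<phi> r \<Longrightarrow> Wp n F (t + 2) (Seq (NStore A i e) c) s Q \<phi> r"
  by (rule Wp_Seq_det[rotated], assumption) (rule Wp_NStore, auto)
lemma Wp_Seq_RAssign:
  "Wp n F t c (s\<lparr>rvar := (rvar s)(x := rval e s), ticks := 0\<rparr>) Q \<phi> r \<Longrightarrow> Wp n F (t + 2) (Seq (RAssign x e) c) s Q \<phi> r"
  by (rule Wp_Seq_det[rotated], assumption) (rule Wp_RAssign, auto)
lemma Wp_Seq_RStore:
  "Wp n F t c (s\<lparr>rarr := (rarr s)(A := (rarr s A)(nval i s := rval e s)), ticks := 0\<rparr>) Q \<phi> r \<Longrightarrow> Wp n F (t + 2) (Seq (RStore A i e) c) s Q \<phi> r"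
  by (rule Wp_Seq_det[rotated], assumption) (rule Wp_RStore, auto)

text \<open>Truncated subtraction gives minima, and hence conjunctions of nonzero tests.\<close>

definition nmin :: "nexp \<Rightarrow> nexp \<Rightarrow> nexp" where "nmin e d = NSub e (NSub e d)"

lemma nval_nmin [simp]: "nval (nmin e d) s = min (nval e s) (nval d s)"
  by (simp add: nmin_def min_def)

text \<open>The queried set is described by an expression in the loop counter \<open>''y''\<close>;
  blocks, prefixes of the order and the full set are all queried this way.\<close>

definition ask :: "nexp \<Rightarrow> com" where
  "ask e = Seq (For ''y'' (NVar ''n'') (NStore ''A'' (NVar ''y'') e)) (Query ''q'' ''A'')"

text \<open>Nonzero iff \<open>a \<le> y < a + m\<close>, by truncated subtraction.\<close>

definition in_block :: nexp where
  "in_block = nmin (NSub (NAdd (NVar ''a'') (NVar ''m'')) (NVar ''y'')) (NSub (NAdd (NVar ''y'') (NConst 1)) (NVar ''a''))"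

definition ask_random :: com where
  "ask_random = Seq (For ''y'' (NVar ''n'')
     (Seq (Flip ''g'' (RDiv (RNat (NConst 1)) (RNat (NAdd (NVar ''k'') (NConst 2)))))
          (NStore ''A'' (NVar ''y'') (nmin (NVar ''g'') in_block)))) (Query ''q'' ''A'')"

definition note_heavy :: com where
  "note_heavy = If (BNot (RLess (RVar ''q'') (RVar ''z''))) (NAssign ''f'' (NConst 1)) SKIP"

text \<open>\<open>''v''\<close> counts visits, \<open>''u''\<close> is the value of the node,
  \<open>''f''\<close> records that some tested set reached \<open>z\<close>. On acceptance
  \<open>''sz''\<close> stores the size at the first index of the block, \<open>''acc''\<close>
  marks its elements, \<open>''U''\<close> stores the value and \<open>''S''\<close> the sum of all
  values. A singleton is accepted whatever \<open>''f''\<close> says.\<close>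

definition visit :: com where
  "visit = Seq (NAssign ''v'' (NAdd (NVar ''v'') (NConst 1))) (Seq (ask in_block) (Seq (RAssign ''u'' (RVar ''q''))
    (Seq (NAssign ''f'' (NConst 0)) (Seq note_heavy
    (Seq (Seq (NAssign ''t'' (NConst 0)) (While (RLess (RNat (NVar ''t'')) (RVar ''K''))
       (Seq ask_random (Seq note_heavy (NAssign ''t'' (NAdd (NVar ''t'') (NConst 1)))))))
    (If (BNot (BAnd (NLess (NConst 0) (NVar ''f'')) (NLess (NConst 1) (NVar ''m''))))
      (Seq (NStore ''sz'' (NVar ''a'') (NVar ''m'')) (Seq (RStore ''U'' (NVar ''a'') (RVar ''u''))
        (Seq (RAssign ''S'' (RAdd (RVar ''S'') (RVar ''u'')))
          (For ''y'' (NVar ''m'') (NStore ''acc'' (NAdd (NVar ''a'') (NVar ''y'')) (NConst 1))))))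
      SKIP))))))"

definition level :: com where
  "level = Seq (NAssign ''h'' (NSub (NVar ''h'') (NConst 1))) (Seq (NAssign ''m'' (NArr ''p'' (NVar ''h'')))
    (Seq (NAssign ''a'' (NConst 0)) (While (NLess (NVar ''a'') (NVar ''N''))
      (Seq (If (NLess (NArr ''acc'' (NVar ''a'')) (NConst 1)) visit SKIP)
        (NAssign ''a'' (NAdd (NVar ''a'') (NVar ''m'')))))))"

text \<open>\<open>level\<close> starts by decrementing \<open>''h''\<close>, hence the start at
  \<open>l + 1\<close>; large nodes are tried first.\<close>

definition partition_com :: com where
  "partition_com = Seq (NAssign ''h'' (NAdd (NVar ''l'') (NConst 1))) (While (NLess (NConst 0) (NVar ''h'')) level)"

text \<open>\<open>''N''\<close> becomes the least power of two not below \<open>n\<close>, and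
  \<open>''p''\<close> tabulates the powers, as naturals can be neither multiplied nor halved in one
  operation. \<open>''K''\<close> and \<open>''J''\<close>, the numbers of tests per node and of
  rounds per visited node, stay real because reals cannot be rounded; loops compare them with a
  counter.\<close>

definition init_com :: "nat \<Rightarrow> nat \<Rightarrow> com" where
  "init_com C0 C1 = Seq (NAssign ''N'' (NConst 1)) (Seq (NAssign ''l'' (NConst 0)) (Seq (NStore ''p'' (NConst 0) (NConst 1))
    (Seq (While (NLess (NVar ''N'') (NVar ''n''))
       (Seq (NAssign ''N'' (NAdd (NVar ''N'') (NVar ''N''))) (Seq (NAssign ''l'' (NAdd (NVar ''l'') (NConst 1)))
         (NStore ''p'' (NVar ''l'') (NVar ''N'')))))
    (Seq (RAssign ''z'' (RDiv (RVar ''delta'') (RMul (RNat (NConst 2)) (RMul (RNat (NAdd (NVar ''k'') (NConst 1))) (RNat (NAdd (NVar ''k'') (NConst 2)))))))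
    (Seq (RAssign ''K'' (RMul (RNat (NConst C1)) (RMul (RNat (NAdd (NVar ''l'') (NConst 1))) (RNat (NVar ''k'')))))
      (RAssign ''J'' (RDiv (RMul (RMul (RNat (NConst C0)) (RNat (NAdd (NVar ''l'') (NConst 1))))
         (RMul (RMul (RMul (RNat (NVar ''k'')) (RNat (NVar ''k''))) (RMul (RNat (NVar ''k'')) (RNat (NVar ''k''))))
           (RMul (RVar ''phi'') (RVar ''phi'')))) (RMul (RVar ''delta'') (RVar ''delta'')))))))))"

text \<open>The gains along an order sum to the sum of \<open>U\<close> minus \<open>f V\<close>,
  whatever the order; so \<open>''Z''\<close> is computed once.\<close>

definition total_com :: com where
  "total_com = Seq (ask (NConst 1)) (RAssign ''Z'' (RSub (RVar ''S'') (RVar ''q'')))"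

text \<open>Blocks with equal scores are ordered by their index.\<close>

definition precedes :: bexp where
  "precedes = BAnd (BNot (RLess (RArr ''Y'' (NVar ''i'')) (RArr ''Y'' (NVar ''t''))))
     (BNot (BAnd (BNot (RLess (RArr ''Y'' (NVar ''t'')) (RArr ''Y'' (NVar ''i'')))) (BNot (NLess (NVar ''t'') (NVar ''i'')))))"

text \<open>Sorting by counting: the position of a block is the number of blocks that precede it,
  and \<open>''ord''\<close> inverts this map.\<close>

definition rank_com :: com where
  "rank_com = For ''i'' (NVar ''N'') (Seq (NAssign ''c'' (NConst 0))
    (Seq (For ''t'' (NVar ''N'') (If precedes (NAssign ''c'' (NAdd (NVar ''c'') (NConst 1))) SKIP))
      (NStore ''ord'' (NVar ''c'') (NVar ''i''))))"

text \<open>\<open>''W''\<close> lists the elements in block order; its write position moves on only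
  past elements below \<open>n\<close>, so padding is overwritten or ends up in cell
  \<open>n\<close>, which \<open>Emit\<close> does not read. \<open>''rk''\<close> maps an element
  to the position of its block, and \<open>''up''\<close> holds the prefix sums of \<open>U\<close>
  along the order.\<close>

definition build_com :: com where
  "build_com = Seq (NAssign ''x'' (NConst 0)) (Seq (RStore ''up'' (NConst 0) (RNat (NConst 0)))
    (For ''i'' (NVar ''N'') (Seq (NAssign ''b'' (NArr ''ord'' (NVar ''i'')))
      (Seq (For ''t'' (NArr ''sz'' (NVar ''b''))
        (Seq (NStore ''W'' (NVar ''x'') (NAdd (NVar ''b'') (NVar ''t'')))
        (Seq (NAssign ''x'' (NAdd (NVar ''x'') (nmin (NConst 1) (NSub (NVar ''n'') (NAdd (NVar ''b'') (NVar ''t''))))))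
          (NStore ''rk'' (NAdd (NVar ''b'') (NVar ''t'')) (NVar ''i'')))))
      (RStore ''up'' (NAdd (NVar ''i'') (NConst 1)) (RAdd (RArr ''up'' (NVar ''i'')) (RArr ''U'' (NVar ''b''))))))))"

text \<open>The cumulative gain of the first \<open>c\<close> blocks is \<open>up c\<close> minus
  the value of their union, one query each. The search keeps an interval of \<open>2 ^ d\<close>
  positions with the cumulative gains at its ends in \<open>''Sl''\<close> and
  \<open>''Sh''\<close>, and enters a half with probability proportional to its mass.\<close>

definition sample_com :: com where
  "sample_com = Seq (NAssign ''lo'' (NConst 0)) (Seq (RAssign ''Sl'' (RNat (NConst 0))) (Seq (RAssign ''Sh'' (RVar ''Z''))
    (Seq (NAssign ''d'' (NVar ''l'')) (While (NLess (NConst 0) (NVar ''d''))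
      (Seq (NAssign ''d'' (NSub (NVar ''d'') (NConst 1))) (Seq (NAssign ''c'' (NAdd (NVar ''lo'') (NArr ''p'' (NVar ''d''))))
      (Seq (ask (NSub (NVar ''c'') (NArr ''rk'' (NVar ''y''))))
      (Seq (RAssign ''Sm'' (RSub (RArr ''up'' (NVar ''c'')) (RVar ''q'')))
      (Seq (Flip ''g'' (RDiv (RSub (RVar ''Sm'') (RVar ''Sl'')) (RSub (RVar ''Sh'') (RVar ''Sl''))))
        (If (NLess (NConst 0) (NVar ''g'')) (RAssign ''Sh'' (RVar ''Sm''))
          (Seq (NAssign ''lo'' (NVar ''c'')) (RAssign ''Sl'' (RVar ''Sm'')))))))))))))"

definition update_com :: com where
  "update_com = Seq (For ''i'' (NVar ''N'') (RStore ''Y'' (NVar ''i'') (RAdd (RArr ''Y'' (NVar ''i'')) (RArr ''U'' (NVar ''i'')))))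
    (RStore ''Y'' (NArr ''ord'' (NVar ''lo'')) (RSub (RArr ''Y'' (NArr ''ord'' (NVar ''lo''))) (RVar ''Z'')))"

definition iter_com :: com where
  "iter_com = Seq rank_com (Seq build_com (Seq (Emit ''W'') (Seq sample_com update_com)))"

text \<open>The number of rounds is proportional to the measured number of visited nodes, which
  stands in for the unknown 1-norm of the singleton values.\<close>

definition main_com :: com where
  "main_com = Seq (NAssign ''r'' (NConst 0)) (While (NLess (NVar ''r'') (NVar ''v''))
     (Seq (Seq (NAssign ''e'' (NConst 0)) (While (RLess (RNat (NVar ''e'')) (RVar ''J''))
        (Seq iter_com (NAssign ''e'' (NAdd (NVar ''e'') (NConst 1))))))
      (NAssign ''r'' (NAdd (NVar ''r'') (NConst 1)))))"

definition sfm_alg :: "nat \<Rightarrow> nat \<Rightarrow> com" where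
  "sfm_alg C0 C1 = Seq (init_com C0 C1) (Seq partition_com (Seq total_com main_com))"

lemma Ws_ask:
  assumes "nvar s ''n'' = n"
    and "\<And>y A. nval e (s\<lparr>nvar := (nvar s)(''y'' := y), narr := (narr s)(''A'' := A), ticks := 0\<rparr>) = E y"
  shows "Ws n F (6 * n + 5) (ask e) s (\<lambda>s'. \<exists>A. s' = s\<lparr>nvar := (nvar s)(''y'' := n), narr := (narr s)(''A'' := A),
     rvar := (rvar s)(''q'' := F {y. y < n \<and> E y \<noteq> 0}), queries := queries s + 1, ticks := 0\<rparr>)"
proof -
  let ?st = "\<lambda>y A. s\<lparr>nvar := (nvar s)(''y'' := y), narr := (narr s)(''A'' := A), ticks := 0\<rparr>"
  let ?I = "\<lambda>i s'. \<exists>A. s' = ?st i A \<and> (\<forall>y<i. A y = E y)"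
  have 1: "Ws n F (n * (1 + 4) + 3) (For ''y'' (NVar ''n'') (NStore ''A'' (NVar ''y'') e)) s (?I n)"
  proof (rule Ws_For[where I = ?I])
    show "?I 0 (s\<lparr>nvar := (nvar s)(''y'' := 0), ticks := 0\<rparr>)"
      by (rule exI[of _ "narr s ''A''"]) simp
  next
    fix i and s' :: state assume "i < n" "?I i s'"
    then obtain A where A: "s' = ?st i A" "\<forall>y<i. A y = E y" by blast
    show "Ws n F 1 (NStore ''A'' (NVar ''y'') e) s' (\<lambda>s'. nvar s' ''y'' = i \<and>
            ?I (Suc i) (s'\<lparr>nvar := (nvar s')(''y'' := Suc i), ticks := 0\<rparr>))"
    proof (rule Wp_NStore, unfold A(1), intro conjI)
      show "?I (Suc i) ((?st i A)\<lparr>narr := (narr (?st i A))(''A'' := (narr (?st i A) ''A'')(nval (NVar ''y'') (?st i A) := nval e (?st i A))), ticks := 0,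
         nvar := (nvar ((?st i A)\<lparr>narr := (narr (?st i A))(''A'' := (narr (?st i A) ''A'')(nval (NVar ''y'') (?st i A) := nval e (?st i A))), ticks := 0\<rparr>))(''y'' := Suc i), ticks := 0\<rparr>)"
        by (rule exI[of _ "A(i := E i)"]) (use A(2) assms(2) in \<open>auto simp: less_Suc_eq\<close>)
    qed auto
  qed (use assms in auto)
  have 2: "Ws n F (n * (1 + 4) + 3 + 1 + (n + 1)) (ask e) s (\<lambda>s'. \<exists>A. s' = s\<lparr>nvar := (nvar s)(''y'' := n), narr := (narr s)(''A'' := A),
     rvar := (rvar s)(''q'' := F {y. y < n \<and> E y \<noteq> 0}), queries := queries s + 1, ticks := 0\<rparr>)"
    unfolding ask_def
  proof (rule Ws_Seq[OF 1])
    fix s1 assume "?I n s1"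
    then obtain A where A: "s1 = ?st n A" "\<forall>y<n. A y = E y" by blast
    have "{i. i < n \<and> A i \<noteq> 0} = {y. y < n \<and> E y \<noteq> 0}" using A by auto
    then show "Ws n F (n + 1) (Query ''q'' ''A'') s1 (\<lambda>s'. \<exists>A. s' = s\<lparr>nvar := (nvar s)(''y'' := n), narr := (narr s)(''A'' := A),
     rvar := (rvar s)(''q'' := F {y. y < n \<and> E y \<noteq> 0}), queries := queries s + 1, ticks := 0\<rparr>)"
      unfolding A(1) by (intro Wp_Query) auto
  qed
  show ?thesis by (rule Ws_mono[OF 2]) auto
qed

section \<open>Sorting the blocks by score\<close>

definition prec :: "(nat \<Rightarrow> real) \<Rightarrow> nat \<Rightarrow> nat \<Rightarrow> bool" where
  "prec Y t i \<longleftrightarrow> Y t < Y i \<or> (Y t = Y i \<and> t < i)"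

definition rank :: "(nat \<Rightarrow> real) \<Rightarrow> nat \<Rightarrow> nat \<Rightarrow> nat" where
  "rank Y N i = card {t. t < N \<and> prec Y t i}"

lemma rank_less: "i < N \<Longrightarrow> prec Y i j \<Longrightarrow> rank Y N i < rank Y N j"
  unfolding rank_def by (rule psubset_card_mono) (auto simp: prec_def)

lemma prec_linear: "i \<noteq> j \<Longrightarrow> prec Y i j \<or> prec Y j i" by (auto simp: prec_def)

lemma rank_inj: "inj_on (rank Y N) {..<N}"
  by (rule inj_onI) (metis lessThan_iff nat_neq_iff prec_linear rank_less)

lemma rank_bound: "i < N \<Longrightarrow> rank Y N i < N"
proof -
  assume i: "i < N"
  have "rank Y N i < card {..<N}"
    unfolding rank_def by (rule psubset_card_mono) (use i in \<open>auto simp: prec_def\<close>)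
  then show ?thesis by simp
qed

lemma rank_image: "rank Y N ` {..<N} = {..<N}"
  by (rule card_subset_eq) (auto simp: rank_bound card_image rank_inj)

lemma sorted_by_rank:
  assumes "\<And>i. i < N \<Longrightarrow> ord (rank Y N i) = i"
  defines "bs \<equiv> map ord [0..<N]"
  shows "distinct bs" "set bs = {..<N}" "sorted_wrt (\<lambda>x y. Y x \<le> Y y) bs"
proof -
  have ex: "\<exists>i<N. a = rank Y N i \<and> ord a = i" if "a < N" for a
    using that rank_image[of Y N] assms(1) by (metis imageE lessThan_iff)
  have "inj_on ord {0..<N}" by (rule inj_onI) (metis ex atLeastLessThan_iff)
  then show "distinct bs" by (simp add: bs_def distinct_map)
  show "set bs = {..<N}"
  proof
    show "set bs \<subseteq> {..<N}" using ex by (auto simp: bs_def)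
    show "{..<N} \<subseteq> set bs"
    proof
      fix i assume "i \<in> {..<N}"
      then show "i \<in> set bs" using assms(1)[of i] rank_bound[of i N Y] by (auto simp: bs_def image_iff intro!: bexI[of _ "rank Y N i"])
    qed
  qed
  show "sorted_wrt (\<lambda>x y. Y x \<le> Y y) bs"
    unfolding sorted_wrt_iff_nth_less
  proof (intro allI impI)
    fix a b assume ab: "a < b" "b < length bs"
    then obtain i j where ij: "i < N" "a = rank Y N i" "ord a = i" "j < N" "b = rank Y N j" "ord b = j"
      using ex[of a] ex[of b] by (auto simp: bs_def)
    then have "\<not> prec Y j i" using rank_less[of j N Y i] ab by auto
    then show "Y (bs ! a) \<le> Y (bs ! b)" using ij ab by (auto simp: bs_def prec_def)
  qed
qed

lemma bval_precedes:
  "bval precedes s \<longleftrightarrow> prec (rarr s ''Y'') (nvar s ''t'') (nvar s ''i'')"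
  by (auto simp: precedes_def prec_def)

lemma Ws_rank_com:
  assumes "nvar s ''N'' = N"
  shows "Ws n F (N * (6 * N + 12) + 3) rank_com s (\<lambda>s'. \<forall>i<N. narr s' ''ord'' (rank (rarr s ''Y'') N i) = i)"
proof -
  define Y where "Y = rarr s ''Y''"
  let ?B = "\<lambda>s'. nvar s' ''N'' = N \<and> rarr s' ''Y'' = Y"
  let ?I = "\<lambda>i s'. ?B s' \<and> nvar s' ''i'' = i \<and> (\<forall>j<i. narr s' ''ord'' (rank Y N j) = j)"
  have "Ws n F (N * ((2 + (N * (2 + 4) + 3) + 1 + 1) + 4) + 3) rank_com s (?I N)"
    unfolding rank_com_def
  proof (rule Ws_For[where I = "?I"])
    fix i and s :: state assume i: "i < N" "?I i s"
    let ?c = "\<lambda>t. card {t'. t' < t \<and> prec Y t' i}"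
    let ?s = "s\<lparr>nvar := (nvar s)(''c'' := 0), ticks := 0\<rparr>"
    let ?J = "\<lambda>t s'. ?I i s' \<and> nvar s' ''t'' = t \<and> nvar s' ''c'' = ?c t"
    have 1: "Ws n F (N * (2 + 4) + 3) (For ''t'' (NVar ''N'') (If precedes (NAssign ''c'' (NAdd (NVar ''c'') (NConst 1))) SKIP))
       ?s (?J N)"
    proof (rule Ws_For[where I = "?J"])
      fix t and s :: state assume t: "t < N" "?J t s"
      have e: "{t'. t' < Suc t \<and> prec Y t' i} = (if prec Y t i then insert t {t'. t' < t \<and> prec Y t' i} else {t'. t' < t \<and> prec Y t' i})"
        by (auto simp: less_Suc_eq)
      show "Ws n F 2 (If precedes (NAssign ''c'' (NAdd (NVar ''c'') (NConst 1))) SKIP) s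
        (\<lambda>s'. nvar s' ''t'' = t \<and> ?J (Suc t) (s'\<lparr>nvar := (nvar s')(''t'' := Suc t), ticks := 0\<rparr>))"
      proof (rule Ws_mono[OF Wp_If[where t = 1]])
        show "Ws n F 1 (NAssign ''c'' (NAdd (NVar ''c'') (NConst 1))) s
          (\<lambda>s'. nvar s' ''t'' = t \<and> ?J (Suc t) (s'\<lparr>nvar := (nvar s')(''t'' := Suc t), ticks := 0\<rparr>))" if "bval precedes s"
          by (rule Wp_NAssign) (use t that in \<open>auto simp: bval_precedes e\<close>)
        show "Ws n F 1 SKIP s
          (\<lambda>s'. nvar s' ''t'' = t \<and> ?J (Suc t) (s'\<lparr>nvar := (nvar s')(''t'' := Suc t), ticks := 0\<rparr>))" if "\<not> bval precedes s"
          by (rule Ws_mono[OF Wp_SKIP]) (use t that in \<open>auto simp: bval_precedes e\<close>)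
      qed auto
    qed (use i in auto)
    have "Ws n F (N * (2 + 4) + 3 + 1 + 1) (Seq (For ''t'' (NVar ''N'') (If precedes (NAssign ''c'' (NAdd (NVar ''c'') (NConst 1))) SKIP))
      (NStore ''ord'' (NVar ''c'') (NVar ''i''))) ?s
      (\<lambda>s'. nvar s' ''i'' = i \<and> ?I (Suc i) (s'\<lparr>nvar := (nvar s')(''i'' := Suc i), ticks := 0\<rparr>))"
    proof (rule Ws_Seq[OF 1])
      fix s1 :: state assume J: "?J N s1"
      then have c: "nvar s1 ''c'' = rank Y N i" by (simp add: rank_def)
      \<comment> \<open>Ranks are distinct, so this store keeps the entries written earlier.\<close>
      have "rank Y N j \<noteq> rank Y N i" if "j < i" for j
        using rank_inj[of Y N] that i by (auto simp: inj_on_def)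
      then show "Ws n F 1 (NStore ''ord'' (NVar ''c'') (NVar ''i'')) s1
        (\<lambda>s'. nvar s' ''i'' = i \<and> ?I (Suc i) (s'\<lparr>nvar := (nvar s')(''i'' := Suc i), ticks := 0\<rparr>))"
        by (intro Wp_NStore) (use J c in \<open>auto simp: less_Suc_eq\<close>)
    qed
    then show "Ws n F (2 + (N * (2 + 4) + 3) + 1 + 1) (Seq (NAssign ''c'' (NConst 0)) (Seq (For ''t'' (NVar ''N'') (If precedes (NAssign ''c'' (NAdd (NVar ''c'') (NConst 1))) SKIP))
      (NStore ''ord'' (NVar ''c'') (NVar ''i'')))) s
      (\<lambda>s'. nvar s' ''i'' = i \<and> ?I (Suc i) (s'\<lparr>nvar := (nvar s')(''i'' := Suc i), ticks := 0\<rparr>))"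
      by (intro Ws_mono[OF Wp_Seq_NAssign]) auto
  qed (use assms in \<open>auto simp: Y_def\<close>)
  then show ?thesis by (rule Ws_mono) (auto simp: Y_def algebra_simps)
qed

section \<open>Building the emitted order from the blocks\<close>

definition blk :: "(nat \<Rightarrow> nat) \<Rightarrow> nat \<Rightarrow> nat list" where "blk sz b = [b..<b + sz b]"

definition flat :: "nat \<Rightarrow> (nat \<Rightarrow> nat) \<Rightarrow> nat list \<Rightarrow> nat list" where
  "flat n sz bs = filter (\<lambda>y. y < n) (concat (map (blk sz) bs))"

lemma flat_snoc: "flat n sz (bs @ [b]) = flat n sz bs @ filter (\<lambda>y. y < n) (blk sz b)"
  by (simp add: flat_def)

lemma Ws_build_com:
  assumes "nvar s ''N'' = N" "nvar s ''n'' = n"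
    and bs: "map (narr s ''ord'') [0..<N] = bs" "distinct bs"
    and sz: "narr s ''sz'' = sz" and dj: "\<And>b c. b \<noteq> c \<Longrightarrow> set (blk sz b) \<inter> set (blk sz c) = {}" "\<And>b. sz b \<le> N"
  shows "Ws n F (N * (10 * N + 12) + 10) build_com s (\<lambda>s'.
     map (narr s' ''W'') [0..<length (flat n sz bs)] = flat n sz bs \<and>
     (\<forall>i<N. \<forall>y\<in>set (blk sz (bs ! i)). narr s' ''rk'' y = i) \<and>
     (\<forall>i\<le>N. rarr s' ''up'' i = (\<Sum>j<i. rarr s ''U'' (bs ! j))))"
proof -
  define U where "U = rarr s ''U''"
  define od where "od = narr s ''ord''"
  have len: "length bs = N" using bs(1) by auto
  have odn: "od i = bs ! i" if "i < N" for i using bs(1) that by (auto simp: od_def)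
  let ?B = "\<lambda>s'. nvar s' ''N'' = N \<and> nvar s' ''n'' = n \<and> narr s' ''ord'' = od \<and> narr s' ''sz'' = sz \<and> rarr s' ''U'' = U"
  let ?W = "\<lambda>s' L. nvar s' ''x'' = length L \<and> (\<forall>j<length L. narr s' ''W'' j = L ! j)"
  let ?R = "\<lambda>s' i. (\<forall>j<i. \<forall>y\<in>set (blk sz (bs ! j)). narr s' ''rk'' y = j)"
  let ?up = "\<lambda>s' i. (\<forall>k\<le>i. rarr s' ''up'' k = (\<Sum>j<k. U (bs ! j)))"
  let ?I = "\<lambda>i s'. ?B s' \<and> nvar s' ''i'' = i \<and> ?W s' (flat n sz (take i bs)) \<and> ?R s' i \<and> ?up s' i"
  let ?in = "Seq (NStore ''W'' (NVar ''x'') (NAdd (NVar ''b'') (NVar ''t'')))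
        (Seq (NAssign ''x'' (NAdd (NVar ''x'') (nmin (NConst 1) (NSub (NVar ''n'') (NAdd (NVar ''b'') (NVar ''t''))))))
          (NStore ''rk'' (NAdd (NVar ''b'') (NVar ''t'')) (NVar ''i'')))"
  let ?loop = "For ''i'' (NVar ''N'') (Seq (NAssign ''b'' (NArr ''ord'' (NVar ''i'')))
      (Seq (For ''t'' (NArr ''sz'' (NVar ''b'')) ?in)
      (RStore ''up'' (NAdd (NVar ''i'') (NConst 1)) (RAdd (RArr ''up'' (NVar ''i'')) (RArr ''U'' (NVar ''b''))))))"
  let ?s0 = "s\<lparr>nvar := (nvar s)(''x'' := 0), rarr := (rarr s)(''up'' := (rarr s ''up'')(0 := 0)), ticks := 0\<rparr>"
  have loop: "Ws n F (N * ((2 + (N * (5 + 4) + 3) + 1 + 1) + 4) + 3) ?loop ?s0 (?I N)"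
  proof (rule Ws_For[where I = "?I"])
    show "?I 0 (?s0\<lparr>nvar := (nvar ?s0)(''i'' := 0), ticks := 0\<rparr>)"
      using assms by (simp add: od_def U_def flat_def)
  next
    fix i and s :: state assume i: "i < N" and I: "?I i s"
    define b where "b = bs ! i"
    have ordi: "narr s ''ord'' i = b" using I odn[OF i] by (simp add: b_def)
    let ?s = "s\<lparr>nvar := (nvar s)(''b'' := b), ticks := 0\<rparr>"
    let ?L = "\<lambda>t. flat n sz (take i bs) @ filter (\<lambda>y. y < n) [b..<b + t]"
    let ?J = "\<lambda>t s'. ?B s' \<and> nvar s' ''i'' = i \<and> nvar s' ''b'' = b \<and> nvar s' ''t'' = t \<and> ?W s' (?L t) \<and> ?R s' i \<and>
      (\<forall>y. b \<le> y \<and> y < b + t \<longrightarrow> narr s' ''rk'' y = i) \<and> ?up s' i"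
    have 1: "Ws n F (sz b * (1 + 2 + 2 + 4) + 3) (For ''t'' (NArr ''sz'' (NVar ''b'')) ?in) ?s (?J (sz b))"
    proof (rule Ws_For[where I = "?J"])
      show "?J 0 (?s\<lparr>nvar := (nvar ?s)(''t'' := 0), ticks := 0\<rparr>)" using I by simp
    next
      fix t and s :: state assume t: "t < sz b" and J: "?J t s"
      have Lt: "?L (Suc t) = ?L t @ (if b + t < n then [b + t] else [])" by simp
      \<comment> \<open>Blocks are disjoint, so writing \<open>''rk''\<close> here leaves the ranks
        of earlier blocks intact.\<close>
      have nb: "b + t \<notin> set (blk sz (bs ! j))" if "j < i" for j
      proof -
        have "bs ! j \<noteq> b" using that i bs(2) len by (simp add: b_def nth_eq_iff_index_eq)
        moreover have "b + t \<in> set (blk sz b)" using t by (simp add: blk_def)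
        ultimately show ?thesis using dj by blast
      qed
      let ?s1 = "s\<lparr>narr := (narr s)(''W'' := (narr s ''W'')(length (?L t) := b + t)), ticks := 0\<rparr>"
      let ?s2 = "?s1\<lparr>nvar := (nvar ?s1)(''x'' := length (?L (Suc t))), ticks := 0\<rparr>"
      let ?s3 = "?s2\<lparr>narr := (narr ?s2)(''rk'' := (narr ?s2 ''rk'')(b + t := i)), ticks := 0\<rparr>"
      let ?Q = "\<lambda>s'. nvar s' ''t'' = t \<and> ?J (Suc t) (s'\<lparr>nvar := (nvar s')(''t'' := Suc t), ticks := 0\<rparr>)"
      have "?Q ?s3"
        using J nb unfolding Lt by (auto simp: nth_append less_Suc_eq)
      then have "Ws n F 1 (NStore ''rk'' (NAdd (NVar ''b'') (NVar ''t'')) (NVar ''i'')) ?s2 ?Q"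
        using J by (intro Wp_NStore) simp_all
      then have "Ws n F (1 + 2) (Seq (NAssign ''x'' (NAdd (NVar ''x'') (nmin (NConst 1) (NSub (NVar ''n'') (NAdd (NVar ''b'') (NVar ''t''))))))
          (NStore ''rk'' (NAdd (NVar ''b'') (NVar ''t'')) (NVar ''i''))) ?s1 ?Q"
      proof (rule Wp_Seq_det[rotated])
        show "Ws n F 1 (NAssign ''x'' (NAdd (NVar ''x'') (nmin (NConst 1) (NSub (NVar ''n'') (NAdd (NVar ''b'') (NVar ''t'')))))) ?s1 (\<lambda>s'. s' = ?s2)"
          unfolding Lt by (rule Wp_NAssign) (use J in \<open>auto simp: min_def\<close>)
      qed
      then have "Ws n F (1 + 2 + 2) ?in s ?Q"
      proof (rule Wp_Seq_det[rotated])
        show "Ws n F 1 (NStore ''W'' (NVar ''x'') (NAdd (NVar ''b'') (NVar ''t''))) s (\<lambda>s'. s' = ?s1)"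
          by (rule Wp_NStore) (use J in auto)
      qed
      then show "Ws n F (1 + 2 + 2) ?in s ?Q" .
    qed auto
    have 2: "Ws n F (N * (5 + 4) + 3) (For ''t'' (NArr ''sz'' (NVar ''b'')) ?in) ?s (?J (sz b))"
      by (rule Ws_mono[OF 1]) (use dj(2)[of b] in auto)
    let ?Q = "\<lambda>s'. nvar s' ''i'' = i \<and> ?I (Suc i) (s'\<lparr>nvar := (nvar s')(''i'' := Suc i), ticks := 0\<rparr>)"
    have tk: "take (Suc i) bs = take i bs @ [b]" using i len by (simp add: take_Suc_conv_app_nth b_def)
    have "Ws n F (N * (5 + 4) + 3 + 1 + 1) (Seq (For ''t'' (NArr ''sz'' (NVar ''b'')) ?in)
      (RStore ''up'' (NAdd (NVar ''i'') (NConst 1)) (RAdd (RArr ''up'' (NVar ''i'')) (RArr ''U'' (NVar ''b''))))) ?s ?Q"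
    proof (rule Ws_Seq[OF 2])
      fix s1 :: state assume J: "?J (sz b) s1"
      have R: "\<forall>y\<in>set (blk sz b). narr s1 ''rk'' y = i" using J by (auto simp: blk_def)
      show "Ws n F 1 (RStore ''up'' (NAdd (NVar ''i'') (NConst 1)) (RAdd (RArr ''up'' (NVar ''i'')) (RArr ''U'' (NVar ''b'')))) s1 ?Q"
        by (rule Wp_RStore) (use J R in \<open>simp_all add: tk flat_snoc blk_def[symmetric] less_Suc_eq le_Suc_eq b_def[symmetric] all_conj_distrib imp_conjL\<close>)
    qed
    then show "Ws n F (2 + (N * (5 + 4) + 3) + 1 + 1) (Seq (NAssign ''b'' (NArr ''ord'' (NVar ''i''))) (Seq (For ''t'' (NArr ''sz'' (NVar ''b'')) ?in)
      (RStore ''up'' (NAdd (NVar ''i'') (NConst 1)) (RAdd (RArr ''up'' (NVar ''i'')) (RArr ''U'' (NVar ''b'')))))) s ?Q"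
      by (intro Ws_mono[OF Wp_Seq_NAssign]) (use I ordi in auto)
  qed auto
  have "Ws n F (N * ((2 + (N * (5 + 4) + 3) + 1 + 1) + 4) + 3 + 2 + 2) build_com s (?I N)"
    unfolding build_com_def by (rule Wp_Seq_NAssign, rule Wp_Seq_RStore) (use loop in simp)
  then show ?thesis
  proof (rule Ws_mono)
    fix s' assume "?I N s'"
    then show "map (narr s' ''W'') [0..<length (flat n sz bs)] = flat n sz bs \<and>
     (\<forall>i<N. \<forall>y\<in>set (blk sz (bs ! i)). narr s' ''rk'' y = i) \<and>
     (\<forall>i\<le>N. rarr s' ''up'' i = (\<Sum>j<i. rarr s ''U'' (bs ! j)))"
      using len by (auto intro!: nth_equalityI simp: U_def)
  qed (simp add: algebra_simps)
qed

lemma Ws_update_com: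
  assumes "nvar s ''N'' = N" "nvar s ''lo'' < N" "narr s ''ord'' (nvar s ''lo'') = p" "p < N"
  shows "Ws n F (5 * N + 5) update_com s (\<lambda>s'. \<forall>i<N. rarr s' ''Y'' i =
     rarr s ''Y'' i + rarr s ''U'' i - (if i = p then rvar s ''Z'' else 0))"
proof -
  let ?I = "\<lambda>i s'. \<exists>Y'. s' = s\<lparr>nvar := (nvar s)(''i'' := i), rarr := (rarr s)(''Y'' := Y'), ticks := 0\<rparr> \<and>
     (\<forall>j. Y' j = rarr s ''Y'' j + (if j < i then rarr s ''U'' j else 0))"
  have 1: "Ws n F (N * (1 + 4) + 3) (For ''i'' (NVar ''N'') (RStore ''Y'' (NVar ''i'') (RAdd (RArr ''Y'' (NVar ''i'')) (RArr ''U'' (NVar ''i''))))) s (?I N)"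
  proof (rule Ws_For[where I = "?I"])
    show "?I 0 (s\<lparr>nvar := (nvar s)(''i'' := 0), ticks := 0\<rparr>)"
      by (rule exI[of _ "rarr s ''Y''"]) simp
  next
    fix i and s' :: state assume "i < N" "?I i s'"
    then obtain Y' where s': "s' = s\<lparr>nvar := (nvar s)(''i'' := i), rarr := (rarr s)(''Y'' := Y'), ticks := 0\<rparr>"
      "\<forall>j. Y' j = rarr s ''Y'' j + (if j < i then rarr s ''U'' j else 0)" by blast
    show "Ws n F 1 (RStore ''Y'' (NVar ''i'') (RAdd (RArr ''Y'' (NVar ''i'')) (RArr ''U'' (NVar ''i'')))) s'
      (\<lambda>s'. nvar s' ''i'' = i \<and> ?I (Suc i) (s'\<lparr>nvar := (nvar s')(''i'' := Suc i), ticks := 0\<rparr>))"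
    proof (rule Wp_RStore, rule conjI, goal_cases)
      case 2
      show ?case unfolding s'(1)
        by (rule exI[of _ "Y'(i := Y' i + rarr s ''U'' i)"]) (use s'(2) in \<open>simp add: fun_eq_iff less_Suc_eq\<close>)
    qed (auto simp: s')
  qed (use assms in auto)
  have "Ws n F (N * (1 + 4) + 3 + 1 + 1) update_com s (\<lambda>s'. \<forall>i<N. rarr s' ''Y'' i =
     rarr s ''Y'' i + rarr s ''U'' i - (if i = p then rvar s ''Z'' else 0))"
    unfolding update_com_def
  proof (rule Ws_Seq[OF 1])
    fix s1 :: state assume "?I N s1"
    then obtain Y' where s1: "s1 = s\<lparr>nvar := (nvar s)(''i'' := N), rarr := (rarr s)(''Y'' := Y'), ticks := 0\<rparr>"
      "\<forall>j. Y' j = rarr s ''Y'' j + (if j < N then rarr s ''U'' j else 0)" by blast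
    show "Ws n F 1 (RStore ''Y'' (NArr ''ord'' (NVar ''lo'')) (RSub (RArr ''Y'' (NArr ''ord'' (NVar ''lo''))) (RVar ''Z''))) s1
     (\<lambda>s'. \<forall>i<N. rarr s' ''Y'' i = rarr s ''Y'' i + rarr s ''U'' i - (if i = p then rvar s ''Z'' else 0))"
      by (rule Wp_RStore) (use assms s1 in auto)
  qed
  then show ?thesis by (rule Ws_mono) auto
qed

section \<open>Sampling a block by binary search\<close>

lemma Wp_Seq_Ws:
  assumes "Ws n F t1 c1 s P" "\<And>s1. P s1 \<Longrightarrow> Wp n F t2 c2 s1 Q \<phi> r"
  shows "Wp n F (t1 + 1 + t2) (Seq c1 c2) s Q \<phi> r"
  by (rule Wp_Seq[OF Wp_of_Ws[OF assms(1), of "\<lambda>_. r" r]]) (use assms(2) in auto)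

text \<open>The conditional means of the two halves, weighted by their shares of the mass, give the
  conditional mean of the whole. A half of mass 0 has the formal mean \<open>0 / 0 = 0\<close> and
  weight 0.\<close>

lemma weighted_average_split:
  fixes a b u v :: real
  assumes "0 \<le> a" "0 \<le> b" "0 < a + b" "0 \<le> u" "0 \<le> v" "a = 0 \<Longrightarrow> u = 0" "b = 0 \<Longrightarrow> v = 0"
  shows "ennreal (a / (a + b)) * ennreal (u / a) + ennreal (1 - a / (a + b)) * ennreal (v / b) = ennreal ((u + v) / (a + b))"
proof -
  have e: "1 - a / (a + b) = b / (a + b)" using assms by (simp add: field_simps)
  have "ennreal (a / (a + b)) * ennreal (u / a) = ennreal (u / (a + b))"
    using assms by (cases "a = 0") (auto simp: ennreal_mult[symmetric])
  moreover have "ennreal (b / (a + b)) * ennreal (v / b) = ennreal (v / (a + b))"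
    using assms by (cases "b = 0") (auto simp: ennreal_mult[symmetric])
  ultimately show ?thesis unfolding e using assms by (simp add: ennreal_plus[symmetric] add_divide_distrib del: ennreal_plus)
qed

text \<open>\<open>S c\<close> is the mass of the first \<open>c\<close> positions. While the search
  runs, the potential is the mean of \<open>g\<close> over the current interval under the masses;
  entering a half with probability proportional to its mass makes this a martingale, so the final
  position has expected \<open>g\<close> at most \<open>r\<close>. If \<open>Z = 0\<close> no masses
  guide the search, and \<open>g \<le> r\<close> is required at every position.\<close>

lemma Wp_sample_com:
  fixes S g :: "nat \<Rightarrow> real" and l :: nat
  assumes nv: "nvar s ''n'' = n" "nvar s ''l'' = l" and p: "\<And>d. d \<le> l \<Longrightarrow> narr s ''p'' d = 2 ^ d"
    and S: "\<And>c. c \<le> 2 ^ l \<Longrightarrow> rarr s ''up'' c - F {y. y < n \<and> c - narr s ''rk'' y \<noteq> 0} = S c"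
    and S0: "S 0 = 0" and SN: "S (2 ^ l) = rvar s ''Z''"
    and mono: "\<And>i. i < 2 ^ l \<Longrightarrow> S i \<le> S (Suc i)"
    and g: "\<And>i. 0 \<le> g i" and r: "0 \<le> r"
    and pos: "0 < rvar s ''Z'' \<Longrightarrow> (\<Sum>i<2 ^ l. (S (Suc i) - S i) * g i) \<le> rvar s ''Z'' * r"
    and zero: "\<And>i. rvar s ''Z'' = 0 \<Longrightarrow> i < 2 ^ l \<Longrightarrow> g i \<le> r"
  shows "Wp n F (l * (6 * n + 22) + 12) sample_com s
    (\<lambda>s'. nvar s' ''lo'' < 2 ^ l \<and> queries s' = queries s + l) (\<lambda>s'. ennreal (g (nvar s' ''lo''))) (ennreal r)"
proof -
  define Z where "Z = rvar s ''Z''"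
  define up where "up = rarr s ''up''"
  define rk where "rk = narr s ''rk''"
  define q0 where "q0 = queries s"
  have Smono: "S i \<le> S j" if "i \<le> j" "j \<le> 2 ^ l" for i j
    using that
  proof (induction j)
    case (Suc j)
    then show ?case using mono[of j] by (cases "i = Suc j") auto
  qed simp
  have Z0: "0 \<le> Z" using Smono[of 0 "2 ^ l"] S0 SN by (simp add: Z_def)
  have const: "S i = 0" if "Z = 0" "i \<le> 2 ^ l" for i
    using Smono[of 0 i] Smono[of i "2 ^ l"] that S0 SN by (simp add: Z_def)
  define num where "num lo d = (\<Sum>i=lo..<lo + 2 ^ d. (S (Suc i) - S i) * g i)" for lo d :: nat
  define val where "val lo d = (if 0 < Z then ennreal (num lo d / (S (lo + 2 ^ d) - S lo)) else ennreal r)" for lo d :: nat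
  have num0: "0 \<le> num lo d" if "lo + 2 ^ d \<le> 2 ^ l" for lo d
    unfolding num_def using that g mono by (intro sum_nonneg mult_nonneg_nonneg) auto
  have numz: "num lo d = 0" if "lo + 2 ^ d \<le> 2 ^ l" "S (lo + 2 ^ d) = S lo" for lo d
    unfolding num_def
  proof (rule sum.neutral, rule ballI)
    fix i assume "i \<in> {lo..<lo + 2 ^ d}"
    then have "lo \<le> i" "Suc i \<le> lo + 2 ^ d" by auto
    then have "S lo \<le> S i" "S i \<le> S (Suc i)" "S (Suc i) \<le> S (lo + 2 ^ d)" using that(1) by (intro Smono; linarith)+
    then show "(S (Suc i) - S i) * g i = 0" using that by simp
  qed
  have nums: "num lo (Suc d) = num lo d + num (lo + 2 ^ d) d" for lo d
    unfolding num_def using sum.atLeastLessThan_concat[of lo "lo + 2 ^ d" "lo + 2 ^ d + 2 ^ d" "\<lambda>i. (S (Suc i) - S i) * g i"]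
    by (simp add: add.assoc mult_2[symmetric])
  let ?B = "\<lambda>s'. nvar s' ''n'' = n \<and> nvar s' ''l'' = l \<and> (\<forall>d\<le>l. narr s' ''p'' d = 2 ^ d) \<and> rarr s' ''up'' = up \<and> narr s' ''rk'' = rk"
  \<comment> \<open>For \<open>Z > 0\<close> the interval always has positive mass, because
    \<open>Flip\<close> yields only outcomes of positive probability; the divisions are then
    genuine.\<close>
  let ?I = "\<lambda>j s'. ?B s' \<and> nvar s' ''d'' = l - j \<and> nvar s' ''lo'' + 2 ^ (l - j) \<le> 2 ^ l \<and> rvar s' ''Sl'' = S (nvar s' ''lo'') \<and>
     rvar s' ''Sh'' = S (nvar s' ''lo'' + 2 ^ (l - j)) \<and> (0 < Z \<longrightarrow> rvar s' ''Sl'' < rvar s' ''Sh'') \<and> queries s' = q0 + j"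
  let ?\<phi> = "\<lambda>j s'. val (nvar s' ''lo'') (l - j)"
  let ?fin = "If (NLess (NConst 0) (NVar ''g'')) (RAssign ''Sh'' (RVar ''Sm''))
          (Seq (NAssign ''lo'' (NVar ''c'')) (RAssign ''Sl'' (RVar ''Sm'')))"
  let ?body = "(Seq (NAssign ''d'' (NSub (NVar ''d'') (NConst 1))) (Seq (NAssign ''c'' (NAdd (NVar ''lo'') (NArr ''p'' (NVar ''d''))))
      (Seq (ask (NSub (NVar ''c'') (NArr ''rk'' (NVar ''y''))))
      (Seq (RAssign ''Sm'' (RSub (RArr ''up'' (NVar ''c'')) (RVar ''q'')))
      (Seq (Flip ''g'' (RDiv (RSub (RVar ''Sm'') (RVar ''Sl'')) (RSub (RVar ''Sh'') (RVar ''Sl''))))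
        ?fin)))))"
  let ?s0 = "s\<lparr>rvar := (rvar s)(''Sl'' := 0, ''Sh'' := Z), nvar := (nvar s)(''lo'' := 0, ''d'' := l), ticks := 0\<rparr>"
  have loop: "Wp n F (l * ((6 * n + 18) + 2) + 1) (While (NLess (NConst 0) (NVar ''d'')) ?body) ?s0 (?I l) (?\<phi> l) (?\<phi> 0 ?s0)"
  proof (rule Wp_While[where I = ?I and \<phi> = ?\<phi>])
    show "?I 0 ?s0" using nv p S0 SN by (simp add: up_def rk_def q0_def Z_def)
  next
    fix j and s :: state assume j: "j < l" and I: "?I j s"
    define d where "d = l - Suc j"
    have d: "l - j = Suc d" "d \<le> l" using j by (auto simp: d_def)
    define lo where "lo = nvar s ''lo''"
    define mid where "mid = lo + 2 ^ d"
    have bd: "lo + 2 ^ d + 2 ^ d \<le> 2 ^ l" using I d by (simp add: lo_def)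
    define Sl Sm Sh where "Sl = S lo" "Sm = S mid" "Sh = S (lo + 2 ^ d + 2 ^ d)"
    note defs = \<open>Sl = S lo\<close> \<open>Sm = S mid\<close> \<open>Sh = S (lo + 2 ^ d + 2 ^ d)\<close>
    have ord: "Sl \<le> Sm" "Sm \<le> Sh" unfolding defs mid_def using bd by (auto intro!: Smono)
    have Sls: "rvar s ''Sl'' = Sl" and Shs: "rvar s ''Sh'' = Sh" using I d by (simp_all add: defs lo_def add.assoc mult_2)
    let ?pr = "(Sm - Sl) / (Sh - Sl)"
    let ?post = "\<lambda>b s'. ?B s' \<and> nvar s' ''g'' = of_bool b \<and> nvar s' ''d'' = d \<and> nvar s' ''lo'' = lo \<and> nvar s' ''c'' = mid \<and>
       rvar s' ''Sl'' = Sl \<and> rvar s' ''Sh'' = Sh \<and> rvar s' ''Sm'' = Sm \<and> queries s' = q0 + Suc j"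
    let ?ok = "\<lambda>b. (b \<longrightarrow> 0 < ?pr) \<and> (\<not> b \<longrightarrow> ?pr < 1)"
    have fin: "Wp n F 4 ?fin s' (?I (Suc j)) (?\<phi> (Suc j)) (if b then val lo d else val mid d)"
      if s': "?post b s'" and ok: "?ok b" for s' :: state and b
    proof (rule Wp_weaken[OF Wp_If[where t = "1 + 2"]])
      show "Wp n F (1 + 2) (RAssign ''Sh'' (RVar ''Sm'')) s' (?I (Suc j)) (?\<phi> (Suc j)) (if b then val lo d else val mid d)"
        if "bval (NLess (NConst 0) (NVar ''g'')) s'"
      proof (rule Wp_weaken[OF Wp_RAssign[where Q = "?I (Suc j)" and \<phi> = "?\<phi> (Suc j)"]])
        have b: "b" using s' that by (cases b) auto
        have "Sl < Sm" if "0 < Z"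
        proof -
          have "0 < Sh - Sl" using I that Sls Shs by simp
          moreover have "0 < ?pr" using ok b by simp
          ultimately show ?thesis by (simp add: zero_less_divide_iff)
        qed
        then show "?I (Suc j) (s'\<lparr>rvar := (rvar s')(''Sh'' := rval (RVar ''Sm'') s'), ticks := 0\<rparr>)"
          using s' bd by (simp add: d_def[symmetric] defs mid_def)
        show "?\<phi> (Suc j) (s'\<lparr>rvar := (rvar s')(''Sh'' := rval (RVar ''Sm'') s'), ticks := 0\<rparr>) \<le> (if b then val lo d else val mid d)"
          using s' b by (simp add: d_def[symmetric])
      qed auto
      show "Wp n F (1 + 2) (Seq (NAssign ''lo'' (NVar ''c'')) (RAssign ''Sl'' (RVar ''Sm''))) s' (?I (Suc j)) (?\<phi> (Suc j)) (if b then val lo d else val mid d)"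
        if nb: "\<not> bval (NLess (NConst 0) (NVar ''g'')) s'"
      proof -
        have b: "\<not> b" using s' nb by (cases b) auto
        have lt: "Sm < Sh" if "0 < Z"
        proof -
          have "0 < Sh - Sl" using I that Sls Shs by simp
          moreover have "?pr < 1" using ok b by simp
          ultimately show ?thesis by (simp add: divide_less_eq)
        qed
        let ?s1 = "s'\<lparr>nvar := (nvar s')(''lo'' := nval (NVar ''c'') s'), ticks := 0\<rparr>"
        have "Wp n F 1 (RAssign ''Sl'' (RVar ''Sm'')) ?s1 (?I (Suc j)) (?\<phi> (Suc j)) (if b then val lo d else val mid d)"
        proof (rule Wp_RAssign)
          show "?I (Suc j) (?s1\<lparr>rvar := (rvar ?s1)(''Sl'' := rval (RVar ''Sm'') ?s1), ticks := 0\<rparr>)"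
            using s' bd lt by (simp add: d_def[symmetric] defs mid_def)
          show "?\<phi> (Suc j) (?s1\<lparr>rvar := (rvar ?s1)(''Sl'' := rval (RVar ''Sm'') ?s1), ticks := 0\<rparr>) \<le> (if b then val lo d else val mid d)"
            using s' b by (simp add: d_def[symmetric])
        qed
        then have "Wp n F (1 + 2) (Seq (NAssign ''lo'' (NVar ''c'')) (RAssign ''Sl'' (RVar ''Sm''))) s' (?I (Suc j)) (?\<phi> (Suc j)) (if b then val lo d else val mid d)"
          by (rule Wp_Seq_NAssign)
        then show ?thesis .
      qed
    qed auto
    let ?s1 = "s\<lparr>nvar := (nvar s)(''d'' := d, ''c'' := mid), ticks := 0\<rparr>"
    have flip: "Wp n F (1 + 1 + 4) (Seq (Flip ''g'' (RDiv (RSub (RVar ''Sm'') (RVar ''Sl'')) (RSub (RVar ''Sh'') (RVar ''Sl'')))) ?fin)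
        s' (?I (Suc j)) (?\<phi> (Suc j)) (?\<phi> j s)"
      if s': "?B s' \<and> nvar s' ''d'' = d \<and> nvar s' ''lo'' = lo \<and> nvar s' ''c'' = mid \<and>
       rvar s' ''Sl'' = Sl \<and> rvar s' ''Sh'' = Sh \<and> rvar s' ''Sm'' = Sm \<and> queries s' = q0 + Suc j" for s' :: state
    proof (rule Wp_Seq[where P = "\<lambda>s'. \<exists>b. ?post b s' \<and> ?ok b" and \<psi> = "\<lambda>s'. if nvar s' ''g'' = 1 then val lo d else val mid d"])
      fix s1 :: state assume "\<exists>b. ?post b s1 \<and> ?ok b"
      then obtain b where b: "?post b s1" "?ok b" by blast
      have "(if nvar s1 ''g'' = 1 then val lo d else val mid d) = (if b then val lo d else val mid d)" using b(1) by simp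
      with fin[OF b] show "Wp n F 4 ?fin s1 (?I (Suc j)) (?\<phi> (Suc j)) (if nvar s1 ''g'' = 1 then val lo d else val mid d)" by simp
    next
      have rv: "rval (RDiv (RSub (RVar ''Sm'') (RVar ''Sl'')) (RSub (RVar ''Sh'') (RVar ''Sl''))) s' = ?pr" using s' by simp
      have pr01: "0 \<le> ?pr" "?pr \<le> 1" using ord by (auto simp: divide_le_eq)
      show "Wp n F 1 (Flip ''g'' (RDiv (RSub (RVar ''Sm'') (RVar ''Sl'')) (RSub (RVar ''Sh'') (RVar ''Sl'')))) s'
        (\<lambda>s'. \<exists>b. ?post b s' \<and> ?ok b) (\<lambda>s'. if nvar s' ''g'' = 1 then val lo d else val mid d) (?\<phi> j s)"
      proof (rule Wp_Flip, unfold rv)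
        fix b assume ok: "b \<Longrightarrow> 0 < ?pr" "\<not> b \<Longrightarrow> ?pr < 1"
        show "\<exists>b'. ?post b' (s'\<lparr>nvar := (nvar s')(''g'' := of_bool b), ticks := 0\<rparr>) \<and> ?ok b'"
          by (rule exI[of _ b]) (use s' ok in simp)
      next
        have "ennreal ?pr * val lo d + ennreal (1 - ?pr) * val mid d \<le> val lo (Suc d)"
        proof (cases "0 < Z")
          case True
          then have "Sl < Sh" using I Sls Shs by simp
          then have "ennreal ((Sm - Sl) / ((Sm - Sl) + (Sh - Sm))) * ennreal (num lo d / (Sm - Sl)) +
             ennreal (1 - (Sm - Sl) / ((Sm - Sl) + (Sh - Sm))) * ennreal (num mid d / (Sh - Sm)) =
             ennreal ((num lo d + num mid d) / ((Sm - Sl) + (Sh - Sm)))"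
            using ord bd numz[of lo d] numz[of mid d] num0[of lo d] num0[of mid d]
            by (intro weighted_average_split) (auto simp: defs mid_def)
          then show ?thesis using True by (simp add: val_def nums[of lo d] defs mid_def add.assoc mult_2)
        next
          \<comment> \<open>All masses vanish, the quotient is \<open>0 / 0 = 0\<close>, and both
            halves have potential \<open>r\<close>.\<close>
          case False
          then have "Z = 0" using Z0 by simp
          then have "ennreal ?pr * val lo d + ennreal (1 - ?pr) * val mid d = ennreal r" 
            using const[of lo] const[of mid] bd by (simp add: val_def defs mid_def)
          then show ?thesis using False by (simp add: val_def)
        qed
        then show "ennreal ?pr * (if nvar (s'\<lparr>nvar := (nvar s')(''g'' := of_bool True), ticks := 0\<rparr>) ''g'' = 1 then val lo d else val mid d) +
          ennreal (1 - ?pr) * (if nvar (s'\<lparr>nvar := (nvar s')(''g'' := of_bool False), ticks := 0\<rparr>) ''g'' = 1 then val lo d else val mid d) \<le> ?\<phi> j s"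
          by (simp add: d(1) lo_def[symmetric])
      qed (use pr01 in auto)
    qed
    have "Wp n F ((6 * n + 5) + 1 + ((1 + 1 + 4) + 2)) (Seq (ask (NSub (NVar ''c'') (NArr ''rk'' (NVar ''y''))))
      (Seq (RAssign ''Sm'' (RSub (RArr ''up'' (NVar ''c'')) (RVar ''q'')))
      (Seq (Flip ''g'' (RDiv (RSub (RVar ''Sm'') (RVar ''Sl'')) (RSub (RVar ''Sh'') (RVar ''Sl'')))) ?fin))) ?s1 (?I (Suc j)) (?\<phi> (Suc j)) (?\<phi> j s)"
    proof (rule Wp_Seq_Ws[OF Ws_ask[where E = "\<lambda>y. mid - rk y"]])
      show "nvar ?s1 ''n'' = n" using I by simp
      show "nval (NSub (NVar ''c'') (NArr ''rk'' (NVar ''y''))) (?s1\<lparr>nvar := (nvar ?s1)(''y'' := y), narr := (narr ?s1)(''A'' := A), ticks := 0\<rparr>) = mid - rk y" for y A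
        using I by simp
    next
      fix s2 :: state assume "\<exists>A. s2 = ?s1\<lparr>nvar := (nvar ?s1)(''y'' := n), narr := (narr ?s1)(''A'' := A),
           rvar := (rvar ?s1)(''q'' := F {y. y < n \<and> mid - rk y \<noteq> 0}), queries := queries ?s1 + 1, ticks := 0\<rparr>"
      then obtain A where s2: "s2 = ?s1\<lparr>nvar := (nvar ?s1)(''y'' := n), narr := (narr ?s1)(''A'' := A),
           rvar := (rvar ?s1)(''q'' := F {y. y < n \<and> mid - rk y \<noteq> 0}), queries := queries ?s1 + 1, ticks := 0\<rparr>" by blast
      have Sm: "up mid - F {y. y < n \<and> mid - rk y \<noteq> 0} = Sm"
        unfolding defs using S[of mid] bd by (simp add: up_def rk_def mid_def)
      show "Wp n F ((1 + 1 + 4) + 2) (Seq (RAssign ''Sm'' (RSub (RArr ''up'' (NVar ''c'')) (RVar ''q'')))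
        (Seq (Flip ''g'' (RDiv (RSub (RVar ''Sm'') (RVar ''Sl'')) (RSub (RVar ''Sh'') (RVar ''Sl'')))) ?fin)) s2 (?I (Suc j)) (?\<phi> (Suc j)) (?\<phi> j s)"
        by (rule Wp_Seq_RAssign, rule flip) (use I Sm Sls Shs in \<open>simp add: s2 lo_def\<close>)
    qed
    then have "Wp n F ((6 * n + 5) + 1 + ((1 + 1 + 4) + 2) + 2 + 2) ?body s (?I (Suc j)) (?\<phi> (Suc j)) (?\<phi> j s)"
    proof (intro Wp_Seq_NAssign, goal_cases)
      case 1
      have "nval (NSub (NVar ''d'') (NConst 1)) s = d" using I d by simp
      moreover have "narr s ''p'' d = 2 ^ d" using I d by simp
      ultimately show ?case using 1 by (simp add: mid_def lo_def)
    qed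
    then show "Wp n F (6 * n + 18) ?body s (?I (Suc j)) (?\<phi> (Suc j)) (?\<phi> j s)"
      by (rule Wp_weaken) auto
  qed (auto simp: zero_less_diff)
  have "Wp n F (l * ((6 * n + 18) + 2) + 1 + 2 + 2 + 2 + 2) sample_com s (?I l) (?\<phi> l) (?\<phi> 0 ?s0)"
    unfolding sample_com_def
    by (rule Wp_Seq_NAssign, rule Wp_Seq_RAssign, rule Wp_Seq_RAssign, rule Wp_Seq_NAssign) (use loop nv in \<open>simp add: Z_def\<close>)
  then show ?thesis
  proof (rule Wp_weaken)
    show "l * ((6 * n + 18) + 2) + 1 + 2 + 2 + 2 + 2 \<le> l * (6 * n + 22) + 12" by (simp add: algebra_simps)
    fix s' assume I: "?I l s'"
    then show "nvar s' ''lo'' < 2 ^ l \<and> queries s' = queries s + l" by (simp add: q0_def)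
    show "ennreal (g (nvar s' ''lo'')) \<le> ?\<phi> l s'"
    proof (cases "0 < Z")
      case True
      then have "S (nvar s' ''lo'') < S (Suc (nvar s' ''lo''))" using I by simp
      then show ?thesis using True by (simp add: val_def num_def)
    next
      case False
      then have "Z = 0" using Z0 by simp
      then show ?thesis using zero[of "nvar s' ''lo''"] I by (simp add: val_def Z_def ennreal_leI)
    qed
  next
    show "?\<phi> 0 ?s0 \<le> ennreal r"
    proof (cases "0 < Z")
      case True
      then have "num 0 l \<le> Z * r" using pos by (simp add: num_def Z_def lessThan_atLeast0)
      then have "num 0 l / Z \<le> r" using True by (simp add: divide_le_eq mult.commute)
      then show ?thesis using True S0 SN by (simp add: val_def Z_def[symmetric] ennreal_leI)
    qed (simp add: val_def)
  qed
qed

section \<open>Testing a block\<close>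

text \<open>Coins are tossed for all indices below \<open>n\<close> and the result is cut down to
  the block. The potential of the loop is the expectation over the coins still to come, given the
  cells already written; \<open>rsub_insert\<close> resolves one coin per round.\<close>

lemma Wp_ask_random:
  fixes \<Psi> :: "real \<Rightarrow> real"
  assumes nv: "nvar s ''n'' = n" "nvar s ''k'' = k" "nvar s ''a'' = a" "nvar s ''m'' = m"
    and \<Psi>: "\<And>x. 0 \<le> \<Psi> x"
  shows "Wp n F (8 * n + 5) ask_random s
    (\<lambda>s'. \<exists>A g Q. Q \<subseteq> {a..<a + m} \<and> Q \<subseteq> {..<n} \<and> s' = s\<lparr>nvar := (nvar s)(''y'' := n, ''g'' := g), narr := (narr s)(''A'' := A),
       rvar := (rvar s)(''q'' := F Q), queries := queries s + 1, ticks := 0\<rparr>)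
    (\<lambda>s'. ennreal (\<Psi> (rvar s' ''q''))) (ennreal (rsub (1 / real (k + 2)) {..<n} (\<lambda>Q. \<Psi> (F (Q \<inter> {a..<a + m})))))"
proof -
  let ?X = "{a..<a + m}" and ?p = "1 / real (k + 2)"
  have p01: "0 \<le> ?p" "?p \<le> 1" by auto
  let ?st = "\<lambda>y g A. s\<lparr>nvar := (nvar s)(''y'' := y, ''g'' := g), narr := (narr s)(''A'' := A), ticks := 0\<rparr>"
  let ?cur = "\<lambda>i s'. {y. y < i \<and> narr s' ''A'' y \<noteq> 0}"
  let ?I = "\<lambda>i s'. (\<exists>g A. s' = ?st i g A \<and> (\<forall>y<i. A y \<noteq> 0 \<longrightarrow> y \<in> ?X))"
  let ?\<phi> = "\<lambda>i s'. ennreal (rsub ?p {i..<n} (\<lambda>B. \<Psi> (F (?cur i s' \<union> (B \<inter> ?X)))))"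
  let ?body = "Seq (Flip ''g'' (RDiv (RNat (NConst 1)) (RNat (NAdd (NVar ''k'') (NConst 2)))))
          (NStore ''A'' (NVar ''y'') (nmin (NVar ''g'') in_block))"
  have 1: "Wp n F (n * ((1 + 1 + 1) + 4) + 3) (For ''y'' (NVar ''n'') ?body) s (?I n) (?\<phi> n)
     (?\<phi> 0 (s\<lparr>nvar := (nvar s)(''y'' := 0), ticks := 0\<rparr>))"
  proof (rule Wp_For[where I = ?I and \<phi> = ?\<phi>])
    show "?I 0 (s\<lparr>nvar := (nvar s)(''y'' := 0), ticks := 0\<rparr>)"
    proof -
      have "(nvar s)(''y'' := 0, ''g'' := nvar s ''g'') = (nvar s)(''y'' := 0)" by (simp add: fun_eq_iff)
      then show ?thesis
        by (intro exI[of _ "nvar s ''g''"] exI[of _ "narr s ''A''"]) (simp only: fun_upd_triv, simp)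
    qed
  next
    fix i and s' :: state assume i: "i < n" and "?I i s'"
    then obtain g A where s': "s' = ?st i g A" "\<forall>y<i. A y \<noteq> 0 \<longrightarrow> y \<in> ?X" by blast
    define c where "c b = min (of_bool b) (min (a + m - i) (i + 1 - a))" for b :: bool
    have c: "c b \<noteq> 0 \<longleftrightarrow> b \<and> i \<in> ?X" for b by (cases b) (auto simp: c_def)
    let ?Q = "\<lambda>s'. nvar s' ''y'' = i \<and> ?I (Suc i) (s'\<lparr>nvar := (nvar s')(''y'' := Suc i), ticks := 0\<rparr>)"
    let ?\<phi>' = "\<lambda>s'. ?\<phi> (Suc i) (s'\<lparr>nvar := (nvar s')(''y'' := Suc i), ticks := 0\<rparr>)"
    let ?u = "\<lambda>b. ?st i (of_bool b) A"
    let ?val = "\<lambda>b. rsub ?p {Suc i..<n} (\<lambda>B. \<Psi> (F ({y. y < i \<and> A y \<noteq> 0} \<union> ((if b then insert i B else B) \<inter> ?X))))"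
    have v0: "0 \<le> ?val b" for b using p01 \<Psi> by (intro rsub_nonneg) auto
    show "Wp n F (1 + 1 + 1) ?body s' ?Q ?\<phi>' (?\<phi> i s')"
    proof (rule Wp_Seq[where P = "\<lambda>s1. \<exists>b. s1 = ?u b" and \<psi> = "\<lambda>s1. if nvar s1 ''g'' = 1 then ennreal (?val True) else ennreal (?val False)"])
      have rv: "rval (RDiv (RNat (NConst 1)) (RNat (NAdd (NVar ''k'') (NConst 2)))) s' = ?p" using nv by (simp add: s'(1))
      show "Wp n F 1 (Flip ''g'' (RDiv (RNat (NConst 1)) (RNat (NAdd (NVar ''k'') (NConst 2))))) s'
        (\<lambda>s1. \<exists>b. s1 = ?u b) (\<lambda>s1. if nvar s1 ''g'' = 1 then ennreal (?val True) else ennreal (?val False)) (?\<phi> i s')"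
      proof (rule Wp_Flip, unfold rv)
        fix b show "\<exists>b'. s'\<lparr>nvar := (nvar s')(''g'' := of_bool b), ticks := 0\<rparr> = ?u b'"
          by (rule exI[of _ b]) (simp add: s'(1))
      next
        have "{i..<n} = insert i {Suc i..<n}" using i by auto
        then have "rsub ?p {i..<n} (\<lambda>B. \<Psi> (F ({y. y < i \<and> A y \<noteq> 0} \<union> (B \<inter> ?X)))) = ?p * ?val True + (1 - ?p) * ?val False"
          by (simp add: rsub_insert)
        then have "ennreal (rsub ?p {i..<n} (\<lambda>B. \<Psi> (F ({y. y < i \<and> A y \<noteq> 0} \<union> (B \<inter> ?X))))) =
          ennreal ?p * ennreal (?val True) + ennreal (1 - ?p) * ennreal (?val False)"
          using v0[of True] v0[of False] p01 by (simp only: ennreal_plus mult_nonneg_nonneg diff_ge_0_iff_ge ennreal_mult)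
        then show "ennreal ?p * (if nvar (s'\<lparr>nvar := (nvar s')(''g'' := of_bool True), ticks := 0\<rparr>) ''g'' = 1 then ennreal (?val True) else ennreal (?val False)) +
          ennreal (1 - ?p) * (if nvar (s'\<lparr>nvar := (nvar s')(''g'' := of_bool False), ticks := 0\<rparr>) ''g'' = 1 then ennreal (?val True) else ennreal (?val False)) \<le> ?\<phi> i s'"
          by (simp add: s'(1))
      qed (use p01 in auto)
    next
      fix s1 :: state assume "\<exists>b. s1 = ?u b"
      then obtain b where s1: "s1 = ?u b" by blast
      have cur: "{y. y < Suc i \<and> (A(i := c b)) y \<noteq> 0} = {y. y < i \<and> A y \<noteq> 0} \<union> (if b then {i} \<inter> ?X else {})"
        using c[of b] by (auto simp: less_Suc_eq)
      have nvb: "nval (nmin (NVar ''g'') in_block) s1 = c b" using nv by (simp add: s1 in_block_def c_def)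
      show "Wp n F 1 (NStore ''A'' (NVar ''y'') (nmin (NVar ''g'') in_block)) s1 ?Q ?\<phi>'
         (if nvar s1 ''g'' = 1 then ennreal (?val True) else ennreal (?val False))"
      proof (rule Wp_NStore, unfold nvb)
        show "?Q (s1\<lparr>narr := (narr s1)(''A'' := (narr s1 ''A'')(nval (NVar ''y'') s1 := c b)), ticks := 0\<rparr>)"
        proof (intro conjI exI[of _ "of_bool b"] exI[of _ "A(i := c b)"])
          show "\<forall>y<Suc i. (A(i := c b)) y \<noteq> 0 \<longrightarrow> y \<in> ?X" using s'(2) c[of b] by (auto simp: less_Suc_eq)
        qed (simp_all add: s1 fun_upd_twist)
        have e: "{y. y < i \<and> A y \<noteq> 0} \<union> (if b then {i} \<inter> ?X else {}) \<union> (B \<inter> ?X) =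
            {y. y < i \<and> A y \<noteq> 0} \<union> ((if b then insert i B else B) \<inter> ?X)" for B by auto
        show "?\<phi>' (s1\<lparr>narr := (narr s1)(''A'' := (narr s1 ''A'')(nval (NVar ''y'') s1 := c b)), ticks := 0\<rparr>) \<le>
          (if nvar s1 ''g'' = 1 then ennreal (?val True) else ennreal (?val False))"
        proof -
          let ?t = "s1\<lparr>narr := (narr s1)(''A'' := (narr s1 ''A'')(nval (NVar ''y'') s1 := c b)), ticks := 0\<rparr>"
          have e1: "narr (?t\<lparr>nvar := (nvar ?t)(''y'' := Suc i), ticks := 0\<rparr>) ''A'' = A(i := c b)" by (simp add: s1)
          have "?\<phi>' ?t = ennreal (?val b)"
            unfolding e1 cur e ..
          moreover have "nvar s1 ''g'' = 1 \<longleftrightarrow> b" by (cases b) (simp_all add: s1)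
          ultimately show ?thesis by (cases b) simp_all
        qed
      qed
    qed
  next
    fix i and s' :: state assume "?I i s'"
    then obtain g A where s': "s' = ?st i g A" "\<forall>y<i. A y \<noteq> 0 \<longrightarrow> y \<in> ?X" by blast
    show "?I i (s'\<lparr>ticks := 0\<rparr>)"
      by (rule exI[of _ g], rule exI[of _ A]) (use s'(2) in \<open>simp add: s'(1)\<close>)
  next
    fix i and s' :: state assume "?I i s'"
    then show "nval (NVar ''n'') s' = n \<and> nvar s' ''y'' = i" using nv by auto
  next
    fix i and s' :: state
    show "?\<phi> i (s'\<lparr>ticks := 0\<rparr>) = ?\<phi> i s'" by simp
  qed
  let ?Q = "\<lambda>s'. \<exists>A g Q. Q \<subseteq> ?X \<and> Q \<subseteq> {..<n} \<and> s' = s\<lparr>nvar := (nvar s)(''y'' := n, ''g'' := g), narr := (narr s)(''A'' := A),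
       rvar := (rvar s)(''q'' := F Q), queries := queries s + 1, ticks := 0\<rparr>"
  have "Wp n F (n * ((1 + 1 + 1) + 4) + 3 + 1 + (n + 1)) ask_random s ?Q (\<lambda>s'. ennreal (\<Psi> (rvar s' ''q'')))
     (?\<phi> 0 (s\<lparr>nvar := (nvar s)(''y'' := 0), ticks := 0\<rparr>))"
    unfolding ask_random_def
  proof (rule Wp_Seq[OF 1])
    fix s1 assume "?I n s1"
    then obtain g A where s1: "s1 = ?st n g A" "\<forall>y<n. A y \<noteq> 0 \<longrightarrow> y \<in> ?X" by blast
    show "Wp n F (n + 1) (Query ''q'' ''A'') s1 ?Q (\<lambda>s'. ennreal (\<Psi> (rvar s' ''q''))) (?\<phi> n s1)"
    proof (rule Wp_Query)
      show "?Q (s1\<lparr>rvar := (rvar s1)(''q'' := F {i. i < n \<and> narr s1 ''A'' i \<noteq> 0}), queries := queries s1 + 1, ticks := 0\<rparr>)"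
        by (rule exI[of _ A], rule exI[of _ g], rule exI[of _ "{i. i < n \<and> A i \<noteq> 0}"]) (use s1 in auto)
    qed (simp add: s1(1))
  qed
  then show ?thesis
    by (rule Wp_weaken) (auto simp: lessThan_atLeast0)
qed

lemma Ws_note_heavy:
  "Ws n F 2 note_heavy s (\<lambda>s'. s' = s\<lparr>nvar := (nvar s)(''f'' := (if rvar s ''z'' \<le> rvar s ''q'' then 1 else nvar s ''f'')), ticks := 0\<rparr>)"
  unfolding note_heavy_def
proof (rule Ws_mono[OF Wp_If[where t = 1]])
  assume "\<not> bval (BNot (RLess (RVar ''q'') (RVar ''z''))) s"
  then show "Ws n F 1 SKIP s (\<lambda>s'. s' = s\<lparr>nvar := (nvar s)(''f'' := (if rvar s ''z'' \<le> rvar s ''q'' then 1 else nvar s ''f'')), ticks := 0\<rparr>)"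
    by (intro Ws_mono[OF Wp_SKIP]) auto
next
  assume "bval (BNot (RLess (RVar ''q'') (RVar ''z''))) s"
  then show "Ws n F 1 (NAssign ''f'' (NConst 1)) s (\<lambda>s'. s' = s\<lparr>nvar := (nvar s)(''f'' := (if rvar s ''z'' \<le> rvar s ''q'' then 1 else nvar s ''f'')), ticks := 0\<rparr>)"
    by (intro Wp_NAssign) auto
qed auto

context sfm begin

abbreviation n where "n \<equiv> card V"
abbreviation F where "F \<equiv> (\<lambda>I. f (v ` I))"

text \<open>The event that the random tests of a block must exclude.\<close>

definition bad :: "nat \<Rightarrow> real \<Rightarrow> nat \<Rightarrow> nat \<Rightarrow> bool" where
  "bad k z b m \<longleftrightarrow> (\<exists>S. S \<noteq> {} \<and> S \<subseteq> {b..<b + m} \<and> card S \<le> k + 1 \<and> real (k + 2) * z < G ({b..<b + m} - S))"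

text \<open>A nonempty subset of a singleton is the whole of it, which leaves
  \<open>G {} = 0\<close>; so a singleton may be accepted without regard to its tests.\<close>

lemma bad_1: "0 < z \<Longrightarrow> \<not> bad k z b (Suc 0)"
proof
  assume z: "0 < z" and "bad k z b (Suc 0)"
  then obtain S where S: "S \<noteq> {}" "S \<subseteq> {b}" "real (k + 2) * z < G ({b} - S)" by (auto simp: bad_def)
  then have "{b} - S = {}" by auto
  then have "real (k + 2) * z < 0" using S(3) G_empty by simp
  then show False using z by (simp add: mult_less_0_iff)
qed

lemma F_eq_G: "Q \<subseteq> {..<n} \<Longrightarrow> F Q = G Q" by (simp add: G_def Int_absorb2)

text \<open>Padding is first removed from the block and from \<open>S\<close>, as only indices below
  \<open>n\<close> are sampled. The density \<open>1 / (k + 2)\<close> fits since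
  \<open>card S < k + 2\<close>.\<close>

lemma bad_detected:
  assumes "bad k z a m"
  shows "rsub (1 / real (k + 2)) {..<n} (\<lambda>Q. of_bool (F (Q \<inter> {a..<a + m}) < z)) \<le> 1 - 1 / (4 * real (k + 2))"
proof -
  let ?p = "1 / real (k + 2)" and ?Y = "{a..<a + m} \<inter> {..<n}"
  obtain S where S: "S \<subseteq> {a..<a + m}" "card S \<le> k + 1" "real (k + 2) * z < G ({a..<a + m} - S)"
    using assms by (auto simp: bad_def)
  let ?S = "S \<inter> {..<n}"
  have "G ({a..<a + m} - S) = G (?Y - ?S)"
  proof -
    have "({a..<a + m} - S) \<inter> {..<n} = ?Y - ?S" by auto
    then show ?thesis using G_restrict[of "{a..<a + m} - S"] by simp
  qed
  moreover have "card ?S \<le> card S" using S(1) finite_subset by (intro card_mono) auto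
  ultimately have det: "1 / (4 * real (k + 2)) \<le> rsub ?p {..<n} (\<lambda>Q. of_bool (z \<le> G (Q \<inter> ?Y)))"
    using S by (intro rsub_detects[OF submodular_G G_empty, where S = ?S]) auto
  have "rsub ?p {..<n} (\<lambda>Q. of_bool (F (Q \<inter> {a..<a + m}) < z)) + rsub ?p {..<n} (\<lambda>Q. of_bool (z \<le> G (Q \<inter> ?Y))) =
     rsub ?p {..<n} (\<lambda>Q. 1)"
  proof -
    have "F (Q \<inter> {a..<a + m}) = G (Q \<inter> ?Y)" if "Q \<subseteq> {..<n}" for Q
    proof -
      have "Q \<inter> {a..<a + m} = Q \<inter> ?Y" using that by auto
      then show ?thesis using F_eq_G[of "Q \<inter> ?Y"] by auto
    qed
    then have "rsub ?p {..<n} (\<lambda>Q. of_bool (F (Q \<inter> {a..<a + m}) < z)) = rsub ?p {..<n} (\<lambda>Q. of_bool (G (Q \<inter> ?Y) < z))"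
      by (intro rsub_cong) simp
    moreover have "rsub ?p {..<n} \<phi> + rsub ?p {..<n} \<psi> = rsub ?p {..<n} (\<lambda>Q. \<phi> Q + \<psi> Q)" for \<phi> \<psi>
      by (simp add: rsub_def sum.distrib distrib_left)
    moreover have "of_bool (G (Q \<inter> ?Y) < z) + of_bool (z \<le> G (Q \<inter> ?Y)) = (1::real)" for Q by auto
    ultimately show ?thesis by simp
  qed
  also have "\<dots> = 1" by (simp add: rsub_const)
  finally show ?thesis using det by linarith
qed

text \<open>The size array was 0 at \<open>a\<close>, so \<open>narr s' ''sz'' a = m\<close> tells
  acceptance from rejection. A bad node survives one test with probability at most \<open>q\<close>;
  as long as the flag is down, the potential is \<open>q\<close> to the number of tests still to
  come. A raised flag exhibits a subset of value at least \<open>z\<close>, which by subadditivity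
  and nonnegative singleton values bounds the singleton sum of the node from below: this is what a
  rejection can be charged to.\<close>

lemma Wp_visit:
  fixes k K a m :: nat and z :: real
  assumes nv: "nvar s ''n'' = n" "nvar s ''k'' = k" "nvar s ''a'' = a" "nvar s ''m'' = m" "rvar s ''z'' = z" "rvar s ''K'' = real K"
    and z: "0 < z" and m: "0 < m" and u: "\<And>x. 0 \<le> G {x}" and sza: "narr s ''sz'' a = 0"
  defines "q \<equiv> 1 - 1 / (4 * real (k + 2))"
  shows "Wp n F (6 * n + 5 * m + K * (8 * n + 20) + 40) visit s
    (\<lambda>s'. nvar s' ''v'' = Suc (nvar s ''v'') \<and> queries s' = queries s + (K + 1) \<and>
       (if narr s' ''sz'' a = m then (1 < m \<longrightarrow> G {a..<a + m} < z) \<and> narr s' ''sz'' = (narr s ''sz'')(a := m) \<and>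
            rarr s' ''U'' = (rarr s ''U'')(a := G {a..<a + m}) \<and> rvar s' ''S'' = rvar s ''S'' + G {a..<a + m} \<and>
            narr s' ''acc'' = (\<lambda>x. if a \<le> x \<and> x < a + m then 1 else narr s ''acc'' x)
        else 1 < m \<and> z \<le> (\<Sum>x\<in>{a..<a + m}. G {x}) \<and> narr s' ''sz'' = narr s ''sz'' \<and> rarr s' ''U'' = rarr s ''U'' \<and>
            rvar s' ''S'' = rvar s ''S'' \<and> narr s' ''acc'' = narr s ''acc''))
    (\<lambda>s'. ennreal (of_bool (narr s' ''sz'' a = m \<and> bad k z a m))) (ennreal (q ^ K))"
proof -
  let ?X = "{a..<a + m}"
  let ?post = "\<lambda>s'. nvar s' ''v'' = Suc (nvar s ''v'') \<and> queries s' = queries s + (K + 1) \<and>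
       (if narr s' ''sz'' a = m then (1 < m \<longrightarrow> G {a..<a + m} < z) \<and> narr s' ''sz'' = (narr s ''sz'')(a := m) \<and>
            rarr s' ''U'' = (rarr s ''U'')(a := G {a..<a + m}) \<and> rvar s' ''S'' = rvar s ''S'' + G {a..<a + m} \<and>
            narr s' ''acc'' = (\<lambda>x. if a \<le> x \<and> x < a + m then 1 else narr s ''acc'' x)
        else 1 < m \<and> z \<le> (\<Sum>x\<in>{a..<a + m}. G {x}) \<and> narr s' ''sz'' = narr s ''sz'' \<and> rarr s' ''U'' = rarr s ''U'' \<and>
            rvar s' ''S'' = rvar s ''S'' \<and> narr s' ''acc'' = narr s ''acc'')"
  let ?pot = "\<lambda>s'. ennreal (of_bool (narr s' ''sz'' a = m \<and> bad k z a m))"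
  have q01: "0 \<le> q" "q \<le> 1" by (auto simp: q_def field_simps)
  have GX: "G Q \<le> (\<Sum>x\<in>?X. G {x})" if "Q \<subseteq> ?X" for Q
  proof -
    have "finite Q" using that finite_subset by blast
    then have "G Q \<le> (\<Sum>x\<in>Q. G {x})" by (rule submodular_le_sum_singletons[OF submodular_G G_empty])
    also have "\<dots> \<le> (\<Sum>x\<in>?X. G {x})" using that u by (intro sum_mono2) auto
    finally show ?thesis .
  qed
  let ?B = "\<lambda>s'. nvar s' ''n'' = n \<and> nvar s' ''k'' = k \<and> nvar s' ''a'' = a \<and> nvar s' ''m'' = m \<and> rvar s' ''z'' = z \<and> rvar s' ''K'' = real K \<and>
     nvar s' ''v'' = Suc (nvar s ''v'') \<and> narr s' ''sz'' = narr s ''sz'' \<and> rarr s' ''U'' = rarr s ''U'' \<and>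
            rvar s' ''S'' = rvar s ''S'' \<and> narr s' ''acc'' = narr s ''acc'' \<and> rvar s' ''u'' = G ?X \<and>
     (nvar s' ''f'' \<noteq> 0 \<longrightarrow> z \<le> (\<Sum>x\<in>?X. G {x})) \<and> (z \<le> G ?X \<longrightarrow> nvar s' ''f'' \<noteq> 0)"
  let ?I = "\<lambda>t s'. ?B s' \<and> nvar s' ''t'' = t \<and> queries s' = queries s + 1 + t"
  let ?\<phi> = "\<lambda>t s'. ennreal (if nvar s' ''f'' = 0 \<and> bad k z a m then q ^ (K - t) else 0)"
  let ?body = "Seq ask_random (Seq note_heavy (NAssign ''t'' (NAdd (NVar ''t'') (NConst 1))))"
  have loop: "Wp n F (K * (8 * n + 5 + 1 + (2 + 1 + 1) + 2) + 1) (While (RLess (RNat (NVar ''t'')) (RVar ''K'')) ?body) s1 (?I K) (?\<phi> K) (?\<phi> 0 s1)"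
    if s1: "?I 0 s1" for s1 :: state
  proof (rule Wp_While[where I = ?I and \<phi> = ?\<phi>])
    fix t and s' :: state assume t: "t < K" and I: "?I t s'"
    let ?\<Psi> = "\<lambda>x. if nvar s' ''f'' = 0 \<and> bad k z a m \<and> x < z then q ^ (K - Suc t) else 0"
    let ?P1 = "\<lambda>s1. \<exists>A g Q. Q \<subseteq> ?X \<and> Q \<subseteq> {..<n} \<and> s1 = s'\<lparr>nvar := (nvar s')(''y'' := n, ''g'' := g), narr := (narr s')(''A'' := A),
       rvar := (rvar s')(''q'' := F Q), queries := queries s' + 1, ticks := 0\<rparr>"
    show "Wp n F (8 * n + 5 + 1 + (2 + 1 + 1)) ?body s' (?I (Suc t)) (?\<phi> (Suc t)) (?\<phi> t s')"
    proof (rule Wp_Seq[where P = ?P1 and \<psi> = "\<lambda>s1. ennreal (?\<Psi> (rvar s1 ''q''))"])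
      show "Wp n F (8 * n + 5) ask_random s' ?P1 (\<lambda>s1. ennreal (?\<Psi> (rvar s1 ''q''))) (?\<phi> t s')"
      proof (rule Wp_weaken[OF Wp_ask_random[where \<Psi> = ?\<Psi> and s = s' and k = k and a = a and m = m]])
        show "ennreal (rsub (1 / real (k + 2)) {..<n} (\<lambda>Q. ?\<Psi> (F (Q \<inter> ?X)))) \<le> ?\<phi> t s'"
        proof (cases "nvar s' ''f'' = 0 \<and> bad k z a m")
          case True
          have "rsub (1 / real (k + 2)) {..<n} (\<lambda>Q. ?\<Psi> (F (Q \<inter> ?X))) =
             rsub (1 / real (k + 2)) {..<n} (\<lambda>Q. q ^ (K - Suc t) * of_bool (F (Q \<inter> ?X) < z))"
            using True by (intro rsub_cong) auto
          also have "\<dots> \<le> q ^ (K - Suc t) * q"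
            unfolding rsub_scale using bad_detected[of k z a m] True q01 by (intro mult_left_mono) (auto simp: q_def)
          also have "\<dots> = q ^ (K - t)" using t by (metis Suc_diff_Suc power_Suc2)
          finally show ?thesis using True by (simp add: ennreal_leI)
        next
          case False
          then have "(\<lambda>Q. ?\<Psi> (F (Q \<inter> ?X))) = (\<lambda>_. 0)" by auto
          then show ?thesis by (simp only: rsub_const[OF finite_lessThan] ennreal_0) simp
        qed
      qed (use I q01 in auto)
    next
      fix s1 assume "?P1 s1"
      then obtain A g Q where Q: "Q \<subseteq> ?X" "Q \<subseteq> {..<n}" and s1: "s1 = s'\<lparr>nvar := (nvar s')(''y'' := n, ''g'' := g), narr := (narr s')(''A'' := A),
       rvar := (rvar s')(''q'' := F Q), queries := queries s' + 1, ticks := 0\<rparr>" by blast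
      have zQ: "z \<le> F Q \<Longrightarrow> z \<le> (\<Sum>x\<in>?X. G {x})" using GX[OF Q(1)] F_eq_G[OF Q(2)] by simp
      show "Wp n F (2 + 1 + 1) (Seq note_heavy (NAssign ''t'' (NAdd (NVar ''t'') (NConst 1)))) s1 (?I (Suc t)) (?\<phi> (Suc t)) (ennreal (?\<Psi> (rvar s1 ''q'')))"
      proof (rule Wp_Seq_Ws[OF Ws_note_heavy])
        fix s2 assume s2: "s2 = s1\<lparr>nvar := (nvar s1)(''f'' := (if rvar s1 ''z'' \<le> rvar s1 ''q'' then 1 else nvar s1 ''f'')), ticks := 0\<rparr>"
        show "Wp n F 1 (NAssign ''t'' (NAdd (NVar ''t'') (NConst 1))) s2 (?I (Suc t)) (?\<phi> (Suc t)) (ennreal (?\<Psi> (rvar s1 ''q'')))"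
          by (rule Wp_NAssign) (use I zQ in \<open>auto simp: s2 s1\<close>)
      qed
    qed
  qed (use s1 in auto)
  let ?mark = "For ''y'' (NVar ''m'') (NStore ''acc'' (NAdd (NVar ''a'') (NVar ''y'')) (NConst 1))"
  have mark: "Ws n F (m * (1 + 4) + 3) ?mark s1
     (\<lambda>s'. s' = s1\<lparr>nvar := (nvar s1)(''y'' := m), narr := (narr s1)(''acc'' := (\<lambda>x. if a \<le> x \<and> x < a + m then 1 else narr s1 ''acc'' x)), ticks := 0\<rparr>)"
    if s1: "nvar s1 ''a'' = a" "nvar s1 ''m'' = m" for s1 :: state
  proof -
    let ?I = "\<lambda>i s'. s' = s1\<lparr>nvar := (nvar s1)(''y'' := i), narr := (narr s1)(''acc'' := (\<lambda>x. if a \<le> x \<and> x < a + i then 1 else narr s1 ''acc'' x)), ticks := 0\<rparr>"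
    show ?thesis
    proof (rule Ws_For[where I = ?I])
      fix i and s' :: state assume I: "?I i s'"
      have e: "(\<lambda>x. if a \<le> x \<and> x < a + i then 1 else narr s1 ''acc'' x)(a + i := 1) =
        (\<lambda>x. if a \<le> x \<and> x < a + Suc i then 1 else narr s1 ''acc'' x)" by (auto simp: fun_eq_iff)
      show "Ws n F 1 (NStore ''acc'' (NAdd (NVar ''a'') (NVar ''y'')) (NConst 1)) s'
        (\<lambda>s'. nvar s' ''y'' = i \<and> ?I (Suc i) (s'\<lparr>nvar := (nvar s')(''y'' := Suc i), ticks := 0\<rparr>))"
        by (rule Wp_NStore) (use s1 I e in simp_all)
    qed (use s1 in \<open>auto simp: fun_eq_iff\<close>)
  qed
  let ?acc = "Seq (NStore ''sz'' (NVar ''a'') (NVar ''m'')) (Seq (RStore ''U'' (NVar ''a'') (RVar ''u''))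
        (Seq (RAssign ''S'' (RAdd (RVar ''S'') (RVar ''u''))) ?mark))"
  let ?fin = "If (BNot (BAnd (NLess (NConst 0) (NVar ''f'')) (NLess (NConst 1) (NVar ''m'')))) ?acc SKIP"
  have fin: "Wp n F (m * (1 + 4) + 3 + 2 + 2 + 2 + 1) ?fin s1 ?post ?pot (?\<phi> K s1)" if I: "?I K s1" for s1 :: state
  proof (rule Wp_If)
    assume c: "bval (BNot (BAnd (NLess (NConst 0) (NVar ''f'')) (NLess (NConst 1) (NVar ''m'')))) s1"
    have "Ws n F (m * (1 + 4) + 3 + 2 + 2 + 2) ?acc s1 (\<lambda>s'. ?post s' \<and> narr s' ''sz'' a = m)"
      by (rule Wp_Seq_NStore, rule Wp_Seq_RStore, rule Wp_Seq_RAssign, rule Ws_mono[OF mark]) (use I c in auto)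
    then show "Wp n F (m * (1 + 4) + 3 + 2 + 2 + 2) ?acc s1 ?post ?pot (?\<phi> K s1)"
    proof (rule Wp_weaken[OF Wp_of_Ws[where \<phi> = ?pot and r = "?\<phi> K s1"]])
      fix s' :: state
      show "?pot s' \<le> ?\<phi> K s1"
      proof (cases "bad k z a m")
        case True
        then have "m \<noteq> 1" using bad_1[OF z] by auto
        then have "nvar s1 ''f'' = 0" using c I m by auto
        then show ?thesis using True by (auto simp: of_bool_def)
      qed auto
    qed auto
  next
    assume c: "\<not> bval (BNot (BAnd (NLess (NConst 0) (NVar ''f'')) (NLess (NConst 1) (NVar ''m'')))) s1"
    show "Wp n F (m * (1 + 4) + 3 + 2 + 2 + 2) SKIP s1 ?post ?pot (?\<phi> K s1)"
      by (rule Wp_weaken[OF Wp_SKIP[where Q = ?post and \<phi> = ?pot and r = "?\<phi> K s1"]]) (use I c m sza in auto)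
  qed
  have "Wp n F (6 * n + 5 + 1 + (2 + 1 + (((K * (8 * n + 5 + 1 + (2 + 1 + 1) + 2) + 1) + 2) + 1 + (m * (1 + 4) + 3 + 2 + 2 + 2 + 1)) + 2 + 2) + 2) visit s ?post ?pot (ennreal (q ^ K))"
    unfolding visit_def
  proof (rule Wp_Seq_NAssign, rule Wp_Seq_Ws[OF Ws_ask[where E = "\<lambda>y. min (a + m - y) (y + 1 - a)"]], goal_cases)
    case (3 s1)
    let ?s0 = "s\<lparr>nvar := (nvar s)(''v'' := nval (NAdd (NVar ''v'') (NConst 1)) s), ticks := 0\<rparr>"
    from 3 obtain A where s1: "s1 = ?s0\<lparr>nvar := (nvar ?s0)(''y'' := n), narr := (narr ?s0)(''A'' := A),
       rvar := (rvar ?s0)(''q'' := F {y. y < n \<and> min (a + m - y) (y + 1 - a) \<noteq> 0}), queries := queries ?s0 + 1, ticks := 0\<rparr>" by blast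
    have "{y. y < n \<and> min (a + m - y) (y + 1 - a) \<noteq> 0} = ?X \<inter> {..<n}" by auto
    then have q1: "F {y. y < n \<and> min (a + m - y) (y + 1 - a) \<noteq> 0} = G ?X" by (simp add: G_def)
    note s1' = s1[unfolded q1]
    show ?case
    proof (rule Wp_Seq_RAssign, rule Wp_Seq_NAssign, rule Wp_Seq_Ws[OF Ws_note_heavy], goal_cases)
      case (1 s2)
      show ?case
      proof (rule Wp_Seq[where P = "?I K" and \<psi> = "?\<phi> K"])
        show "Wp n F (K * (8 * n + 5 + 1 + (2 + 1 + 1) + 2) + 1 + 2) (Seq (NAssign ''t'' (NConst 0)) (While (RLess (RNat (NVar ''t'')) (RVar ''K'')) ?body))
          s2 (?I K) (?\<phi> K) (ennreal (q ^ K))"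
        proof (rule Wp_Seq_NAssign, rule Wp_weaken[OF loop])
          show "?I 0 (s2\<lparr>nvar := (nvar s2)(''t'' := nval (NConst 0) s2), ticks := 0\<rparr>)"
            using 1 nv GX[of ?X] by (auto simp: s1')
          show "?\<phi> 0 (s2\<lparr>nvar := (nvar s2)(''t'' := nval (NConst 0) s2), ticks := 0\<rparr>) \<le> ennreal (q ^ K)"
            by simp
        qed auto
      qed (rule fin)
    qed
  qed (use nv in \<open>auto simp: in_block_def\<close>)
  then show ?thesis by (rule Wp_weaken) (auto simp: algebra_simps)
qed

end

section \<open>The dyadic partition\<close>

text \<open>Aligned dyadic intervals are nested or disjoint.\<close>

lemma aligned_block_contains_node:
  fixes h h' b i x :: nat
  assumes "h \<le> h'" "2 ^ h' dvd b" "b \<le> x" "x < b + 2 ^ h'" "i * 2 ^ h \<le> x" "x < i * 2 ^ h + 2 ^ h"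
  shows "b \<le> i * 2 ^ h" "i * 2 ^ h + 2 ^ h \<le> b + 2 ^ h'"
proof -
  obtain c where b: "b = 2 ^ h' * c" using assms(2) by auto
  define D where "D = (2::nat) ^ (h' - h)"
  have p: "(2::nat) ^ h' = D * 2 ^ h" using assms(1) by (simp add: D_def power_add[symmetric])
  have b': "b = (D * c) * 2 ^ h" by (simp add: b p)
  have "(D * c) * 2 ^ h < (i + 1) * 2 ^ h" using assms b' by simp
  then have 1: "D * c \<le> i" by (simp only: mult_less_cancel2) simp
  then show "b \<le> i * 2 ^ h" unfolding b' by simp
  have "i * 2 ^ h < (D * c + D) * 2 ^ h" using assms b' p by (simp add: add_mult_distrib)
  then have "i + 1 \<le> D * c + D" by (simp only: mult_less_cancel2) simp
  then have "(i + 1) * 2 ^ h \<le> (D * c + D) * 2 ^ h" by (rule mult_right_mono) simp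
  then show "i * 2 ^ h + 2 ^ h \<le> b + 2 ^ h'" unfolding b' p by (simp add: algebra_simps)
qed

text \<open>Each parent is counted once for each of its two children.\<close>

lemma sum_div_two: "(\<Sum>i<2 * (j::nat). g (i div 2)) = 2 * (\<Sum>i<j. g i :: real)"
  by (induction j) auto

context sfm begin

definition node_sum :: "nat \<Rightarrow> nat \<Rightarrow> real" where
  "node_sum h j = (\<Sum>x\<in>{j * 2 ^ h..<j * 2 ^ h + 2 ^ h}. G {x})"

text \<open>State of the partition after \<open>i\<close> nodes of height \<open>h\<close>. The bound on \<open>z * real cnt\<close> charges each visited
  node to its rejected parent, whose \<open>node_sum\<close> is at least \<open>z\<close>.\<close>

definition pst :: "nat \<Rightarrow> real \<Rightarrow> nat \<Rightarrow> nat \<Rightarrow> (nat \<Rightarrow> nat) \<Rightarrow> (nat \<Rightarrow> nat) \<Rightarrow> (nat \<Rightarrow> real) \<Rightarrow> real \<Rightarrow> nat \<Rightarrow> bool" where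
  "pst l z h i sz acc U S cnt \<longleftrightarrow> h \<le> l \<and>
    (\<forall>b. sz b > 0 \<longrightarrow> (\<exists>h'. h \<le> h' \<and> h' \<le> l \<and> sz b = 2 ^ h' \<and> 2 ^ h' dvd b \<and> b < 2 ^ l)) \<and>
    (\<forall>x. acc x \<noteq> 0 \<longleftrightarrow> (\<exists>b. b \<le> x \<and> x < b + sz b)) \<and>
    (\<forall>b c. b \<noteq> c \<longrightarrow> {b..<b + sz b} \<inter> {c..<c + sz c} = {}) \<and>
    (\<forall>b. (sz b = 0 \<longrightarrow> U b = 0) \<and> (sz b > 0 \<longrightarrow> U b = G {b..<b + sz b}) \<and> (sz b > 1 \<longrightarrow> U b < z)) \<and>
    S = (\<Sum>b<2 ^ l. U b) \<and>
    card {b. b < 2 ^ l \<and> sz b > 0} \<le> cnt \<and>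
    (\<forall>x<2 ^ l. acc x = 0 \<longrightarrow> (h < l \<longrightarrow> z \<le> node_sum (Suc h) (x div 2 ^ Suc h)) \<and>
       (x < i * 2 ^ h \<longrightarrow> z \<le> node_sum h (x div 2 ^ h) \<and> 0 < h)) \<and>
    z * real cnt \<le> z * of_bool (h < l \<or> 0 < i) + real (l - 1 - h) * (2 * (\<Sum>x<2 ^ l. G {x})) +
       (if h < l then \<Sum>j<i. node_sum (Suc h) (j div 2) else 0) \<and>
    cnt \<le> (l - h) * 2 ^ l + i"

lemma pstD:
  assumes "pst l z h i sz acc U S cnt"
  shows "h \<le> l"
    "\<And>b. sz b > 0 \<Longrightarrow> \<exists>h'. h \<le> h' \<and> h' \<le> l \<and> sz b = 2 ^ h' \<and> 2 ^ h' dvd b \<and> b < 2 ^ l"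
    "\<And>x. acc x \<noteq> 0 \<longleftrightarrow> (\<exists>b. b \<le> x \<and> x < b + sz b)"
    "\<And>b c. b \<noteq> c \<Longrightarrow> {b..<b + sz b} \<inter> {c..<c + sz c} = {}"
    "\<And>b. sz b = 0 \<Longrightarrow> U b = 0" "\<And>b. sz b > 0 \<Longrightarrow> U b = G {b..<b + sz b}" "\<And>b. sz b > 1 \<Longrightarrow> U b < z"
    "S = (\<Sum>b<2 ^ l. U b)"
    "card {b. b < 2 ^ l \<and> sz b > 0} \<le> cnt"
    "\<And>x. x < 2 ^ l \<Longrightarrow> acc x = 0 \<Longrightarrow> h < l \<Longrightarrow> z \<le> node_sum (Suc h) (x div 2 ^ Suc h)"
    "\<And>x. x < 2 ^ l \<Longrightarrow> acc x = 0 \<Longrightarrow> x < i * 2 ^ h \<Longrightarrow> z \<le> node_sum h (x div 2 ^ h) \<and> 0 < h"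
    "z * real cnt \<le> z * of_bool (h < l \<or> 0 < i) + real (l - 1 - h) * (2 * (\<Sum>x<2 ^ l. G {x})) +
       (if h < l then \<Sum>j<i. node_sum (Suc h) (j div 2) else 0)"
    "cnt \<le> (l - h) * 2 ^ l + i"
proof -
  note c1 = assms[unfolded pst_def]
  note c2 = conjunct2[OF c1] note c3 = conjunct2[OF c2] note c4 = conjunct2[OF c3] note c5 = conjunct2[OF c4]
  note c6 = conjunct2[OF c5] note c7 = conjunct2[OF c6] note c8 = conjunct2[OF c7] note c9 = conjunct2[OF c8]
  show "h \<le> l" by (rule conjunct1[OF c1])
  show "\<exists>h'. h \<le> h' \<and> h' \<le> l \<and> sz b = 2 ^ h' \<and> 2 ^ h' dvd b \<and> b < 2 ^ l" if "sz b > 0" for b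
    by (rule conjunct1[OF c2, rule_format, OF that])
  show "acc x \<noteq> 0 \<longleftrightarrow> (\<exists>b. b \<le> x \<and> x < b + sz b)" for x by (rule spec[OF conjunct1[OF c3]])
  show "{b..<b + sz b} \<inter> {c..<c + sz c} = {}" if "b \<noteq> c" for b c
    by (rule conjunct1[OF c4, rule_format, OF that])
  note u = spec[OF conjunct1[OF c5]]
  show "U b = 0" if "sz b = 0" for b by (rule conjunct1[OF u, THEN mp, OF that])
  show "U b = G {b..<b + sz b}" if "sz b > 0" for b by (rule conjunct1[OF conjunct2[OF u], THEN mp, OF that])
  show "U b < z" if "sz b > 1" for b by (rule conjunct2[OF conjunct2[OF u], THEN mp, OF that])
  show "S = (\<Sum>b<2 ^ l. U b)" by (rule conjunct1[OF c6])
  show "card {b. b < 2 ^ l \<and> sz b > 0} \<le> cnt" by (rule conjunct1[OF c7])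
  note w = conjunct1[OF c8, rule_format]
  show "z \<le> node_sum (Suc h) (x div 2 ^ Suc h)" if "x < 2 ^ l" "acc x = 0" "h < l" for x
    by (rule conjunct1[OF w[OF that(1,2)], THEN mp, OF that(3)])
  show "z \<le> node_sum h (x div 2 ^ h) \<and> 0 < h" if "x < 2 ^ l" "acc x = 0" "x < i * 2 ^ h" for x
    by (rule conjunct2[OF w[OF that(1,2)], THEN mp, OF that(3)])
  show "z * real cnt \<le> z * of_bool (h < l \<or> 0 < i) + real (l - 1 - h) * (2 * (\<Sum>x<2 ^ l. G {x})) +
       (if h < l then \<Sum>j<i. node_sum (Suc h) (j div 2) else 0)" by (rule conjunct1[OF c9])
  show "cnt \<le> (l - h) * 2 ^ l + i" by (rule conjunct2[OF c9])
qed

lemma pstI: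
  assumes "h \<le> l"
    "\<And>b. sz b > 0 \<Longrightarrow> \<exists>h'. h \<le> h' \<and> h' \<le> l \<and> sz b = 2 ^ h' \<and> 2 ^ h' dvd b \<and> b < 2 ^ l"
    "\<And>x. acc x \<noteq> 0 \<longleftrightarrow> (\<exists>b. b \<le> x \<and> x < b + sz b)"
    "\<And>b c. b \<noteq> c \<Longrightarrow> {b..<b + sz b} \<inter> {c..<c + sz c} = {}"
    "\<And>b. sz b = 0 \<Longrightarrow> U b = 0" "\<And>b. sz b > 0 \<Longrightarrow> U b = G {b..<b + sz b}" "\<And>b. sz b > 1 \<Longrightarrow> U b < z"
    "S = (\<Sum>b<2 ^ l. U b)"
    "card {b. b < 2 ^ l \<and> sz b > 0} \<le> cnt"
    "\<And>x. x < 2 ^ l \<Longrightarrow> acc x = 0 \<Longrightarrow> h < l \<Longrightarrow> z \<le> node_sum (Suc h) (x div 2 ^ Suc h)"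
    "\<And>x. x < 2 ^ l \<Longrightarrow> acc x = 0 \<Longrightarrow> x < i * 2 ^ h \<Longrightarrow> z \<le> node_sum h (x div 2 ^ h) \<and> 0 < h"
    "z * real cnt \<le> z * of_bool (h < l \<or> 0 < i) + real (l - 1 - h) * (2 * (\<Sum>x<2 ^ l. G {x})) +
       (if h < l then \<Sum>j<i. node_sum (Suc h) (j div 2) else 0)"
    "cnt \<le> (l - h) * 2 ^ l + i"
  shows "pst l z h i sz acc U S cnt"
  unfolding pst_def by (intro conjI allI impI) (fact assms | (rule assms, assumption+) | (rule assms(11)[THEN conjunct1], assumption+) |
    (rule assms(11)[THEN conjunct2], assumption+))+

lemma node_sum_nonneg: "(\<And>x. 0 \<le> G {x}) \<Longrightarrow> 0 \<le> node_sum h j"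
  unfolding node_sum_def by (intro sum_nonneg) auto

lemma sum_node_sum:
  assumes "h \<le> l" shows "(\<Sum>j<2 ^ (l - h). node_sum h j) = (\<Sum>x<2 ^ l. G {x})"
proof -
  have "(\<Sum>j<2 ^ (l - h). node_sum h j) = (\<Sum>x<2 ^ (l - h) * 2 ^ h. G {x})"
    unfolding node_sum_def by (rule sum.nat_group)
  then show ?thesis using assms by (simp add: power_add[symmetric])
qed

text \<open>Accepted blocks are at least as high as the current node, so a block covers the node
  entirely or misses it. This justifies testing \<open>''acc''\<close> only at the first
  element.\<close>

lemma pst_node_acc:
  assumes p: "pst l z h i sz acc U S cnt" and x: "i * 2 ^ h \<le> x" "x < i * 2 ^ h + 2 ^ h" and y: "i * 2 ^ h \<le> y" "y < i * 2 ^ h + 2 ^ h"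
    and a: "acc x \<noteq> 0"
  shows "acc y \<noteq> 0"
proof -
  obtain b where b: "b \<le> x" "x < b + sz b" using pstD(3)[OF p] a by blast
  then have "sz b > 0" by simp
  then obtain h' where h': "h \<le> h'" "sz b = 2 ^ h'" "2 ^ h' dvd b" using pstD(2)[OF p] by blast
  from aligned_block_contains_node[OF h'(1,3) b(1), of i] b h' x
  have "b \<le> i * 2 ^ h" "i * 2 ^ h + 2 ^ h \<le> b + sz b" by auto
  then have "b \<le> y \<and> y < b + sz b" using y by linarith
  then show ?thesis using pstD(3)[OF p] by blast
qed

lemma pst_bound_step:
  assumes p: "pst l z h i sz acc U S cnt" and u: "\<And>x. 0 \<le> G {x}" and z: "0 < z"
  shows "z * real cnt \<le> z * of_bool (h < l \<or> 0 < Suc i) + real (l - 1 - h) * (2 * (\<Sum>x<2 ^ l. G {x})) +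
       (if h < l then \<Sum>j<Suc i. node_sum (Suc h) (j div 2) else 0)"
proof -
  have B: "z * real cnt \<le> z * of_bool (h < l \<or> 0 < i) + real (l - 1 - h) * (2 * (\<Sum>x<2 ^ l. G {x})) +
       (if h < l then \<Sum>j<i. node_sum (Suc h) (j div 2) else 0)" by (rule pstD(12)[OF p])
  have "z * of_bool (h < l \<or> 0 < i) \<le> z * of_bool (h < l \<or> 0 < Suc i)" using z by simp
  moreover have "(if h < l then \<Sum>j<i. node_sum (Suc h) (j div 2) else 0) \<le> (if h < l then \<Sum>j<Suc i. node_sum (Suc h) (j div 2) else 0)"
    using node_sum_nonneg[OF u] by simp
  ultimately show ?thesis using B by linarith
qed

text \<open>Below the root an uncovered node has a rejected parent, whose \<open>node_sum\<close> is
  at least \<open>z\<close> and is the new summand for \<open>j = i\<close>. The root is paid for by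
  the term with \<open>of_bool\<close>.\<close>

lemma pst_bound_visit:
  assumes p: "pst l z h i sz acc U S cnt" and u: "\<And>x. 0 \<le> G {x}" and z: "0 < z" and i: "i < 2 ^ (l - h)" and a: "acc (i * 2 ^ h) = 0"
  shows "z * real (Suc cnt) \<le> z * of_bool (h < l \<or> 0 < Suc i) + real (l - 1 - h) * (2 * (\<Sum>x<2 ^ l. G {x})) +
       (if h < l then \<Sum>j<Suc i. node_sum (Suc h) (j div 2) else 0)"
proof -
  have B: "z * real cnt \<le> z * of_bool (h < l \<or> 0 < i) + real (l - 1 - h) * (2 * (\<Sum>x<2 ^ l. G {x})) +
       (if h < l then \<Sum>j<i. node_sum (Suc h) (j div 2) else 0)" and hl: "h \<le> l" by (rule pstD[OF p])+
  show ?thesis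
  proof (cases "h < l")
    case True
    have "i * 2 ^ h < 2 ^ (l - h) * 2 ^ h" using i by simp
    also have "\<dots> = 2 ^ l" using hl by (simp add: power_add[symmetric])
    finally have "i * 2 ^ h < 2 ^ l" .
    then have "z \<le> node_sum (Suc h) (i * 2 ^ h div 2 ^ Suc h)" using pstD(10)[OF p] a True by blast
    also have "i * 2 ^ h div 2 ^ Suc h = i div 2" by (simp add: power_Suc2 div_mult2_eq del: power_Suc)
    finally show ?thesis using B True by (simp add: algebra_simps)
  next
    case False
    then have "i = 0" using i hl by simp
    then show ?thesis using B False z by (simp add: algebra_simps)
  qed
qed

lemma node_div: "x div 2 ^ h = i" if "i * 2 ^ h \<le> x" "x < i * 2 ^ h + 2 ^ h" for x h i :: nat
proof (rule div_nat_eqI)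
  show "2 ^ h * i \<le> x" using that by (simp add: mult.commute)
  show "x < 2 ^ h * Suc i" using that by (simp add: algebra_simps)
qed

lemma pst_skip:
  assumes p: "pst l z h i sz acc U S cnt" and u: "\<And>x. 0 \<le> G {x}" and z: "0 < z" and a: "acc (i * 2 ^ h) \<noteq> 0"
  shows "pst l z h (Suc i) sz acc U S cnt"
proof -
  have 1: "x < i * 2 ^ h" if "acc x = 0" "x < Suc i * 2 ^ h" for x
  proof (rule ccontr)
    assume "\<not> x < i * 2 ^ h"
    then show False using pst_node_acc[OF p, of "i * 2 ^ h" x] a that by simp
  qed
  show ?thesis
    using pstD(13)[OF p] pstD(11)[OF p] 1 by (intro pstI pstD[OF p] pst_bound_step[OF p u z]) auto
qed

text \<open>A rejected node has more than one element, hence \<open>0 < h\<close>; this is what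
  forces every element to be covered in the end.\<close>

lemma pst_reject:
  assumes p: "pst l z h i sz acc U S cnt" and u: "\<And>x. 0 \<le> G {x}" and z: "0 < z" and i: "i < 2 ^ (l - h)" and a: "acc (i * 2 ^ h) = 0"
    and rej: "1 < (2::nat) ^ h" "z \<le> (\<Sum>x\<in>{i * 2 ^ h..<i * 2 ^ h + 2 ^ h}. G {x})"
  shows "pst l z h (Suc i) sz acc U S (Suc cnt)"
proof -
  have h: "0 < h" using rej(1) by (cases h) auto
  have 1: "z \<le> node_sum h (x div 2 ^ h) \<and> 0 < h" if x: "x < 2 ^ l" "acc x = 0" "x < Suc i * 2 ^ h" for x
  proof (cases "x < i * 2 ^ h")
    case True then show ?thesis using pstD(11)[OF p] x by blast
  next
    case False
    then have "x div 2 ^ h = i" using x by (intro node_div) auto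
    then show ?thesis using rej(2) h by (simp add: node_sum_def)
  qed
  show ?thesis
    using pstD(9)[OF p] pstD(13)[OF p] 1 by (intro pstI pstD(1-8,10)[OF p] pst_bound_visit[OF p u z i a]) auto
qed

text \<open>The first element is uncovered, hence by \<open>pst_node_acc\<close> the whole node is,
  and the new block is disjoint from the old ones.\<close>

lemma pst_accept:
  assumes p: "pst l z h i sz acc U S cnt" and u: "\<And>x. 0 \<le> G {x}" and z: "0 < z" and i: "i < 2 ^ (l - h)" and a: "acc (i * 2 ^ h) = 0"
    and ok: "1 < (2::nat) ^ h \<Longrightarrow> G {i * 2 ^ h..<i * 2 ^ h + 2 ^ h} < z"
  defines "A \<equiv> i * 2 ^ h" and "m \<equiv> 2 ^ h"
  shows "pst l z h (Suc i) (sz(A := m)) (\<lambda>x. if A \<le> x \<and> x < A + m then 1 else acc x) (U(A := G {A..<A + m}))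
     (S + G {A..<A + m}) (Suc cnt)"
proof -
  have hl: "h \<le> l" by (rule pstD[OF p])
  have m0: "0 < m" by (simp add: m_def)
  have "i * 2 ^ h < 2 ^ (l - h) * 2 ^ h" using i by simp
  also have "\<dots> = 2 ^ l" using hl by (simp add: power_add[symmetric])
  finally have Al: "A < 2 ^ l" by (simp add: A_def)
  have accnode: "acc x = 0" if "A \<le> x" "x < A + m" for x
    using pst_node_acc[OF p, of x A] that a by (auto simp: A_def m_def)
  have acciff: "acc x \<noteq> 0 \<longleftrightarrow> (\<exists>b. b \<le> x \<and> x < b + sz b)" for x by (rule pstD[OF p])
  have szA: "sz A = 0"
  proof (rule ccontr)
    assume "sz A \<noteq> 0"
    then have "A < A + sz A" by simp
    then show False using acciff[of A] accnode[of A] m0 by auto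
  qed
  have UA: "U A = 0" using pstD(5)[OF p] szA by blast
  have dis: "{b..<b + sz b} \<inter> {A..<A + m} = {}" for b
  proof (rule ccontr)
    assume "\<not> ?thesis"
    then obtain x where "x \<in> {b..<b + sz b} \<inter> {A..<A + m}" by blast
    then have x: "b \<le> x" "x < b + sz b" "A \<le> x" "x < A + m" by simp_all
    then show False using accnode[of x] acciff[of x] by blast
  qed
  have S1: "\<forall>b. (sz(A := m)) b > 0 \<longrightarrow> (\<exists>h'. h \<le> h' \<and> h' \<le> l \<and> (sz(A := m)) b = 2 ^ h' \<and> 2 ^ h' dvd b \<and> b < 2 ^ l)"
  proof (intro allI impI)
    fix b assume b: "(sz(A := m)) b > 0"
    show "\<exists>h'. h \<le> h' \<and> h' \<le> l \<and> (sz(A := m)) b = 2 ^ h' \<and> 2 ^ h' dvd b \<and> b < 2 ^ l"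
    proof (cases "b = A")
      case True
      then show ?thesis using hl Al by (intro exI[of _ h]) (auto simp: A_def m_def)
    next
      case False
      then show ?thesis using b pstD(2)[OF p, of b] by simp
    qed
  qed
  have S2: "\<forall>x. (if A \<le> x \<and> x < A + m then 1 else acc x) \<noteq> 0 \<longleftrightarrow> (\<exists>b. b \<le> x \<and> x < b + (sz(A := m)) b)"
  proof
    fix x
    show "(if A \<le> x \<and> x < A + m then 1 else acc x) \<noteq> 0 \<longleftrightarrow> (\<exists>b. b \<le> x \<and> x < b + (sz(A := m)) b)"
    proof (cases "A \<le> x \<and> x < A + m")
      case True then show ?thesis by (auto intro!: exI[of _ A])
    next
      case False
      have "(\<exists>b. b \<le> x \<and> x < b + (sz(A := m)) b) \<longleftrightarrow> (\<exists>b. b \<le> x \<and> x < b + sz b)"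
      proof
        assume "\<exists>b. b \<le> x \<and> x < b + (sz(A := m)) b"
        then obtain b where b: "b \<le> x" "x < b + (sz(A := m)) b" by blast
        then have "b \<noteq> A" using False by auto
        then show "\<exists>b. b \<le> x \<and> x < b + sz b" using b by auto
      next
        assume "\<exists>b. b \<le> x \<and> x < b + sz b"
        then obtain b where b: "b \<le> x" "x < b + sz b" by blast
        then have "b \<noteq> A" using szA by auto
        then show "\<exists>b. b \<le> x \<and> x < b + (sz(A := m)) b" using b by auto
      qed
      moreover have "(if A \<le> x \<and> x < A + m then 1 else acc x) = acc x" using False by (rule if_not_P)
      ultimately show ?thesis using acciff[of x] by (simp only:)
    qed
  qed
  have S3: "\<forall>b c. b \<noteq> c \<longrightarrow> {b..<b + (sz(A := m)) b} \<inter> {c..<c + (sz(A := m)) c} = {}"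
  proof (intro allI impI)
    fix b c :: nat assume bc: "b \<noteq> c"
    have old: "{b..<b + sz b} \<inter> {c..<c + sz c} = {}" by (rule pstD(4)[OF p bc])
    show "{b..<b + (sz(A := m)) b} \<inter> {c..<c + (sz(A := m)) c} = {}"
      using old dis[of b] dis[of c] bc by (cases "b = A"; cases "c = A") (simp_all add: Int_commute)
  qed
  have S4: "\<forall>b. ((sz(A := m)) b = 0 \<longrightarrow> (U(A := G {A..<A + m})) b = 0) \<and> ((sz(A := m)) b > 0 \<longrightarrow> (U(A := G {A..<A + m})) b = G {b..<b + (sz(A := m)) b}) \<and>
     ((sz(A := m)) b > 1 \<longrightarrow> (U(A := G {A..<A + m})) b < z)"
  proof
    fix b
    show "((sz(A := m)) b = 0 \<longrightarrow> (U(A := G {A..<A + m})) b = 0) \<and> ((sz(A := m)) b > 0 \<longrightarrow> (U(A := G {A..<A + m})) b = G {b..<b + (sz(A := m)) b}) \<and>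
     ((sz(A := m)) b > 1 \<longrightarrow> (U(A := G {A..<A + m})) b < z)"
    proof (cases "b = A")
      case True then show ?thesis using ok m0 by (simp add: A_def m_def)
    next
      case False then show ?thesis using pstD(5-7)[OF p, of b] by simp
    qed
  qed
  have S5: "S + G {A..<A + m} = (\<Sum>b<2 ^ l. (U(A := G {A..<A + m})) b)"
  proof -
    have "S = (\<Sum>b<2 ^ l. U b)" by (rule pstD(8)[OF p])
    moreover have "(\<Sum>b<2 ^ l. (U(A := G {A..<A + m})) b) = (\<Sum>b<2 ^ l. U b + (if b = A then G {A..<A + m} else 0))"
      by (intro sum.cong) (auto simp: UA)
    ultimately show ?thesis using Al by (simp add: sum.distrib)
  qed
  have S6: "card {b. b < 2 ^ l \<and> (sz(A := m)) b > 0} \<le> Suc cnt"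
  proof -
    have "{b. b < 2 ^ l \<and> (sz(A := m)) b > 0} \<subseteq> insert A {b. b < 2 ^ l \<and> sz b > 0}" by auto
    then have "card {b. b < 2 ^ l \<and> (sz(A := m)) b > 0} \<le> card (insert A {b. b < 2 ^ l \<and> sz b > 0})" by (intro card_mono) auto
    also have "\<dots> \<le> Suc (card {b. b < 2 ^ l \<and> sz b > 0})" by (rule card_insert_le_m1[THEN le_trans]) auto
    also have "\<dots> \<le> Suc cnt" using pstD(9)[OF p] by simp
    finally show ?thesis .
  qed
  have S7: "\<forall>x<2 ^ l. (if A \<le> x \<and> x < A + m then 1 else acc x) = 0 \<longrightarrow> (h < l \<longrightarrow> z \<le> node_sum (Suc h) (x div 2 ^ Suc h)) \<and>
       (x < Suc i * 2 ^ h \<longrightarrow> z \<le> node_sum h (x div 2 ^ h) \<and> 0 < h)"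
  proof (intro allI impI)
    fix x :: nat assume x: "x < 2 ^ l" "(if A \<le> x \<and> x < A + m then 1 else acc x) = 0"
    then have x': "acc x = 0" "\<not> (A \<le> x \<and> x < A + m)" by (auto split: if_splits)
    then have "x < Suc i * 2 ^ h \<longrightarrow> x < i * 2 ^ h" by (auto simp: A_def m_def)
    then show "(h < l \<longrightarrow> z \<le> node_sum (Suc h) (x div 2 ^ Suc h)) \<and> (x < Suc i * 2 ^ h \<longrightarrow> z \<le> node_sum h (x div 2 ^ h) \<and> 0 < h)"
      using pstD(10,11)[OF p x(1) x'(1)] by blast
  qed
  have S9: "Suc cnt \<le> (l - h) * 2 ^ l + Suc i" using pstD(13)[OF p] by simp
  show ?thesis unfolding pst_def
    using hl S1 S2 S3 S4 S5 S6 S7 pst_bound_visit[OF p u z i a] S9 by (intro conjI) assumption+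
qed

text \<open>The nodes rejected on the finished level become the parents of the next one. The charges
  of a full level below the root add up to twice the total singleton weight, each parent being
  charged by two children, and move into the term with factor \<open>l - 1 - h\<close>.\<close>

lemma pst_level:
  assumes p: "pst l z (Suc h) (2 ^ (l - Suc h)) sz acc U S cnt" and u: "\<And>x. 0 \<le> G {x}"
  shows "pst l z h 0 sz acc U S cnt"
proof -
  have hl: "Suc h \<le> l" by (rule pstD[OF p])
  have tot: "2 ^ (l - Suc h) * 2 ^ Suc h = (2::nat) ^ l" using hl by (simp only: power_add[symmetric]) simp
  have B: "z * real cnt \<le> z * of_bool (Suc h < l \<or> 0 < (2::nat) ^ (l - Suc h)) + real (l - 1 - Suc h) * (2 * (\<Sum>x<2 ^ l. G {x})) +
       (if Suc h < l then \<Sum>j<2 ^ (l - Suc h). node_sum (Suc (Suc h)) (j div 2) else 0)" by (rule pstD(12)[OF p])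
  have B': "z * real cnt \<le> z * of_bool (h < l \<or> (0::nat) < 0) + real (l - 1 - h) * (2 * (\<Sum>x<2 ^ l. G {x})) +
       (if h < l then \<Sum>j<0. node_sum (Suc h) (j div 2) else 0)"
  proof (cases "Suc h < l")
    case True
    have "(2::nat) ^ (l - Suc h) = 2 * 2 ^ (l - Suc (Suc h))" using True by (simp add: power_Suc[symmetric] Suc_diff_Suc del: power_Suc)
    then have "(\<Sum>j<2 ^ (l - Suc h). node_sum (Suc (Suc h)) (j div 2)) = 2 * (\<Sum>x<2 ^ l. G {x})"
      using True by (simp only: sum_div_two) (simp add: sum_node_sum)
    moreover have "real (l - 1 - h) = real (l - 1 - Suc h) + 1" using True by (simp add: of_nat_diff)
    ultimately show ?thesis using B True by (simp add: algebra_simps)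
  next
    case False
    then have "l = Suc h" using hl by simp
    then show ?thesis using B by simp
  qed
  have 7: "z \<le> node_sum (Suc h) (x div 2 ^ Suc h)" if "x < 2 ^ l" "acc x = 0" for x
    using pstD(11)[OF p that] that unfolding tot by blast
  have cnt: "cnt \<le> (l - h) * 2 ^ l + 0"
  proof -
    have "cnt \<le> (l - Suc h) * 2 ^ l + 2 ^ (l - Suc h)" by (rule pstD(13)[OF p])
    also have "\<dots> \<le> (l - Suc h) * 2 ^ l + 2 ^ l" by (simp add: power_increasing)
    also have "\<dots> = (l - h) * 2 ^ l" using hl by (simp add: Suc_diff_Suc[symmetric] algebra_simps)
    finally show ?thesis by simp
  qed
  show ?thesis
  proof (rule pstI)
    show "\<exists>h'. h \<le> h' \<and> h' \<le> l \<and> sz b = 2 ^ h' \<and> 2 ^ h' dvd b \<and> b < 2 ^ l" if "sz b > 0" for b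
      using pstD(2)[OF p that] by (meson Suc_leD)
    show "acc x \<noteq> 0 \<longleftrightarrow> (\<exists>b. b \<le> x \<and> x < b + sz b)" for x by (rule pstD(3)[OF p])
    show "{b..<b + sz b} \<inter> {c..<c + sz c} = {}" if "b \<noteq> c" for b c by (rule pstD(4)[OF p that])
  qed (use 7 B' cnt hl in \<open>auto intro: pstD(3-9)[OF p]\<close>)
qed

lemma pst_init: "pst l z l 0 (\<lambda>_. 0) (\<lambda>_. 0) (\<lambda>_. 0) 0 0"
  unfolding pst_def by auto

end

section \<open>Expected number of bad blocks in the partition\<close>

lemma Wp_add_const:
  assumes "Wp n F t c s Q \<phi> r"
  shows "Wp n F t c s Q (\<lambda>s'. d + \<phi> s') (d + r)"
  unfolding Wp_def
proof
  fix x
  obtain D where D: "run n F t (c, s\<lparr>ticks := x\<rparr>) = map_pmf (Pair SKIP) D"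
     "\<forall>s'\<in>set_pmf D. Q (s'\<lparr>ticks := 0\<rparr>) \<and> ticks s' \<le> x + t"
     "(\<integral>\<^sup>+s'. \<phi> (s'\<lparr>ticks := 0\<rparr>) \<partial>measure_pmf D) \<le> r"
    using assms unfolding Wp_def by blast
  have "(\<integral>\<^sup>+s'. d + \<phi> (s'\<lparr>ticks := 0\<rparr>) \<partial>measure_pmf D) = d + (\<integral>\<^sup>+s'. \<phi> (s'\<lparr>ticks := 0\<rparr>) \<partial>measure_pmf D)"
    by (subst nn_integral_add) auto
  also have "\<dots> \<le> d + r" using D(3) by (rule add_left_mono)
  finally show "\<exists>D. run n F t (c, s\<lparr>ticks := x\<rparr>) = map_pmf (Pair SKIP) D \<and>
     (\<forall>s'\<in>set_pmf D. Q (s'\<lparr>ticks := 0\<rparr>) \<and> ticks s' \<le> x + t) \<and>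
     (\<integral>\<^sup>+s'. d + \<phi> (s'\<lparr>ticks := 0\<rparr>) \<partial>measure_pmf D) \<le> d + r"
    using D by blast
qed

lemma mods_visit:
  "nmod visit = {''v'', ''y'', ''f'', ''t'', ''g''}" "namod visit = {''A'', ''sz'', ''acc''}"
  "rmod visit = {''q'', ''u'', ''S''}" "ramod visit = {''U''}" "\<not> emits visit"
  by (auto simp: visit_def ask_def ask_random_def note_heavy_def)

context sfm begin

definition pconst :: "nat \<Rightarrow> nat \<Rightarrow> real \<Rightarrow> nat \<Rightarrow> real \<Rightarrow> state \<Rightarrow> bool" where
  "pconst k l z K J s \<longleftrightarrow> nvar s ''n'' = n \<and> nvar s ''k'' = k \<and> nvar s ''N'' = 2 ^ l \<and> nvar s ''l'' = l \<and>
     (\<forall>d\<le>l. narr s ''p'' d = 2 ^ d) \<and> rvar s ''z'' = z \<and> rvar s ''K'' = real K \<and> rvar s ''J'' = J \<and>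
     rarr s ''Y'' = (\<lambda>_. 0) \<and> out s = []"

abbreviation pst_of :: "nat \<Rightarrow> real \<Rightarrow> nat \<Rightarrow> nat \<Rightarrow> state \<Rightarrow> bool" where
  "pst_of l z h i s \<equiv> pst l z h i (narr s ''sz'') (narr s ''acc'') (rarr s ''U'') (rvar s ''S'') (nvar s ''v'')"

text \<open>Dominates the indicator that some bad block was accepted, so bounding its expectation
  plays the role of a union bound.\<close>

definition bad_count :: "nat \<Rightarrow> real \<Rightarrow> nat \<Rightarrow> (nat \<Rightarrow> nat) \<Rightarrow> real" where
  "bad_count k z l sz = (\<Sum>b<2 ^ l. of_bool (sz b > 0 \<and> bad k z b (sz b)))"

lemma bad_count_update:
  assumes "sz A = 0" "0 < m" "A < 2 ^ l"
  shows "bad_count k z l (sz(A := m)) = bad_count k z l sz + of_bool (bad k z A m)"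
proof -
  have "bad_count k z l (sz(A := m)) = (\<Sum>b<2 ^ l. of_bool (sz b > 0 \<and> bad k z b (sz b)) + (if b = A then of_bool (bad k z A m) else 0))"
    unfolding bad_count_def using assms by (intro sum.cong) auto
  then show ?thesis using assms by (simp add: sum.distrib bad_count_def)
qed

lemma bad_count_nonneg: "0 \<le> bad_count k z l sz" unfolding bad_count_def by (intro sum_nonneg) auto

context
  fixes k l K :: nat and z J q :: real
  assumes z: "0 < z" and u: "\<And>x. 0 \<le> G {x}" and q_def: "q = 1 - 1 / (4 * real (k + 2))"
begin

definition visit_cost :: nat where "visit_cost = 6 * n + 5 * 2 ^ l + K * (8 * n + 20) + 40"

definition node_inv :: "nat \<Rightarrow> nat \<Rightarrow> state \<Rightarrow> bool" where
  "node_inv h i s \<longleftrightarrow> pconst k l z K J s \<and> nvar s ''h'' = h \<and> nvar s ''m'' = 2 ^ h \<and> nvar s ''a'' = i * 2 ^ h \<and>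
     pst_of l z h i s \<and> queries s = nvar s ''v'' * (K + 1)"

text \<open>Every node still to come has a budget \<open>q ^ K\<close> for being accepted though
  bad; each of the \<open>h + 1\<close> remaining levels is counted with \<open>2 ^ l\<close>
  nodes.\<close>

definition node_pot :: "nat \<Rightarrow> nat \<Rightarrow> state \<Rightarrow> ennreal" where
  "node_pot h i s = ennreal (bad_count k z l (narr s ''sz'') + q ^ K * (real ((h + 1) * 2 ^ l) - real i))"

lemma q01: "0 \<le> q" "q \<le> 1" unfolding q_def by (auto simp: field_simps)

lemma Wp_node:
  assumes I: "node_inv h i s" and i: "i < 2 ^ (l - h)"
  shows "Wp n F (visit_cost + 3) (Seq (If (NLess (NArr ''acc'' (NVar ''a'')) (NConst 1)) visit SKIP)
        (NAssign ''a'' (NAdd (NVar ''a'') (NVar ''m'')))) s (node_inv h (Suc i)) (node_pot h (Suc i)) (node_pot h i s)"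
proof -
  let ?A = "i * 2 ^ h" and ?m = "2 ^ h :: nat"
  have c: "pconst k l z K J s" "nvar s ''h'' = h" "nvar s ''m'' = ?m" "nvar s ''a'' = ?A" and p: "pst_of l z h i s" and qs: "queries s = nvar s ''v'' * (K + 1)"
    using I by (auto simp: node_inv_def)
  have hl: "h \<le> l" by (rule pstD[OF p])
  have "i * 2 ^ h < 2 ^ (l - h) * 2 ^ h" using i by simp
  also have "\<dots> = 2 ^ l" using hl by (simp add: power_add[symmetric])
  finally have Al: "?A < 2 ^ l" .
  let ?P = "\<lambda>s1. pconst k l z K J s1 \<and> nvar s1 ''h'' = h \<and> nvar s1 ''m'' = ?m \<and> nvar s1 ''a'' = ?A \<and>
     pst_of l z h (Suc i) s1 \<and> queries s1 = nvar s1 ''v'' * (K + 1)"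
  define rest where "rest = real ((h + 1) * 2 ^ l) - real (Suc i)"
  have rest0: "0 \<le> rest"
  proof -
    have "Suc i \<le> 2 ^ (l - h)" using i by simp
    also have "\<dots> \<le> (2::nat) ^ l" by (rule power_increasing) auto
    also have "\<dots> \<le> (h + 1) * 2 ^ l" by simp
    finally show ?thesis unfolding rest_def by (simp only: of_nat_le_iff diff_ge_0_iff_ge)
  qed
  have qr: "0 \<le> q ^ K * rest" using q01 rest0 by simp
  have e: "q ^ K * (real ((h + 1) * 2 ^ l) - real i) = q ^ K + q ^ K * rest" by (simp add: rest_def algebra_simps)
  have pot_i: "node_pot h i s = ennreal (bad_count k z l (narr s ''sz'') + q ^ K * rest) + ennreal (q ^ K)"
    unfolding node_pot_def e using bad_count_nonneg qr q01 by (simp add: ennreal_plus[symmetric] ac_simps del: ennreal_plus)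
  have "Wp n F (visit_cost + 1) (If (NLess (NArr ''acc'' (NVar ''a'')) (NConst 1)) visit SKIP) s ?P (node_pot h (Suc i)) (node_pot h i s)"
  proof (rule Wp_If)
    assume "\<not> bval (NLess (NArr ''acc'' (NVar ''a'')) (NConst 1)) s"
    then have a: "narr s ''acc'' ?A \<noteq> 0" using c by simp
    show "Wp n F visit_cost SKIP s ?P (node_pot h (Suc i)) (node_pot h i s)"
    proof (rule Wp_weaken[OF Wp_SKIP[where Q = ?P and \<phi> = "node_pot h (Suc i)" and r = "node_pot h i s"]])
      show "?P (s\<lparr>ticks := 0\<rparr>)" using c qs pst_skip[OF p u z a] by (simp add: pconst_def)
      show "node_pot h (Suc i) (s\<lparr>ticks := 0\<rparr>) \<le> node_pot h i s"
        unfolding pot_i by (simp add: node_pot_def rest_def)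
    qed auto
  next
    assume "bval (NLess (NArr ''acc'' (NVar ''a'')) (NConst 1)) s"
    then have a: "narr s ''acc'' ?A = 0" using c by simp
    have sza: "narr s ''sz'' ?A = 0"
    proof (rule ccontr)
      assume "narr s ''sz'' ?A \<noteq> 0"
      then have "?A < ?A + narr s ''sz'' ?A" by simp
      then show False using pstD(3)[OF p, of ?A] a by blast
    qed
    let ?R = "\<lambda>s'. nvar s' ''v'' = Suc (nvar s ''v'') \<and> queries s' = queries s + (K + 1) \<and>
       (if narr s' ''sz'' ?A = ?m then (1 < ?m \<longrightarrow> G {?A..<?A + ?m} < z) \<and> narr s' ''sz'' = (narr s ''sz'')(?A := ?m) \<and>
            rarr s' ''U'' = (rarr s ''U'')(?A := G {?A..<?A + ?m}) \<and> rvar s' ''S'' = rvar s ''S'' + G {?A..<?A + ?m} \<and>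
            narr s' ''acc'' = (\<lambda>x. if ?A \<le> x \<and> x < ?A + ?m then 1 else narr s ''acc'' x)
        else 1 < ?m \<and> z \<le> (\<Sum>x\<in>{?A..<?A + ?m}. G {x}) \<and> narr s' ''sz'' = narr s ''sz'' \<and> rarr s' ''U'' = rarr s ''U'' \<and>
            rvar s' ''S'' = rvar s ''S'' \<and> narr s' ''acc'' = narr s ''acc'')"
    let ?vp = "\<lambda>s'. ennreal (of_bool (narr s' ''sz'' ?A = ?m \<and> bad k z ?A ?m))"
    have 1: "Wp n F (6 * n + 5 * ?m + K * (8 * n + 20) + 40) visit s ?R ?vp (ennreal (q ^ K))"
      unfolding q_def by (rule Wp_visit[where k = k and z = z and K = K and a = ?A and m = ?m]) (use c z u sza in \<open>auto simp: pconst_def\<close>)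
    have 2: "Wp n F (6 * n + 5 * ?m + K * (8 * n + 20) + 40) visit s (\<lambda>s'. ?R s' \<and> frm visit s s')
       (\<lambda>s'. ennreal (bad_count k z l (narr s ''sz'') + q ^ K * rest) + ?vp s') (ennreal (bad_count k z l (narr s ''sz'') + q ^ K * rest) + ennreal (q ^ K))"
      by (rule Wp_add_const[OF Wp_frame[OF 1]])
    show "Wp n F visit_cost visit s ?P (node_pot h (Suc i)) (node_pot h i s)"
    proof (rule Wp_weaken[OF 2])
      have "?m \<le> 2 ^ l" using hl by (intro power_increasing) auto
      then show "6 * n + 5 * ?m + K * (8 * n + 20) + 40 \<le> visit_cost" by (simp add: visit_cost_def)
      fix s' :: state assume A: "?R s' \<and> frm visit s s'"
      then have fr: "pconst k l z K J s'" "nvar s' ''h'' = h" "nvar s' ''m'' = ?m" "nvar s' ''a'' = ?A"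
        using c unfolding frm_def mods_visit pconst_def by (simp_all add: mods_visit)
      have R: "?R s'" using A by blast
      have v: "nvar s' ''v'' = Suc (nvar s ''v'')" "queries s' = nvar s' ''v'' * (K + 1)" using R qs by simp_all
      show "?P s'"
      proof (cases "narr s' ''sz'' ?A = ?m")
        case True
        note Q = R[THEN conjunct2, THEN conjunct2, unfolded if_P[OF True]]
        note Q2 = Q[THEN conjunct2] note Q3 = Q2[THEN conjunct2] note Q4 = Q3[THEN conjunct2]
        note R' = Q[THEN conjunct1] Q2[THEN conjunct1] Q3[THEN conjunct1] Q4[THEN conjunct1] Q4[THEN conjunct2]
        have "pst_of l z h (Suc i) s'" unfolding R'(2-5) v(1)
          by (rule pst_accept[OF p u z i a]) (use R'(1) in blast)
        then show ?thesis using fr v by blast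
      next
        case False
        note Q = R[THEN conjunct2, THEN conjunct2, unfolded if_not_P[OF False]]
        note Q2 = Q[THEN conjunct2] note Q3 = Q2[THEN conjunct2] note Q4 = Q3[THEN conjunct2] note Q5 = Q4[THEN conjunct2]
        note R' = Q[THEN conjunct1] Q2[THEN conjunct1] Q3[THEN conjunct1] Q4[THEN conjunct1] Q5[THEN conjunct1] Q5[THEN conjunct2]
        have "pst_of l z h (Suc i) s'" unfolding R'(3-6) v(1)
          by (rule pst_reject[OF p u z i a R'(1,2)])
        then show ?thesis using fr v by blast
      qed
      show "node_pot h (Suc i) s' \<le> ennreal (bad_count k z l (narr s ''sz'') + q ^ K * rest) + ?vp s'"
      proof (cases "narr s' ''sz'' ?A = ?m")
        case True
        then have "narr s' ''sz'' = (narr s ''sz'')(?A := ?m)"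
          using R[THEN conjunct2, THEN conjunct2, unfolded if_P[OF True]] by blast
        then have "bad_count k z l (narr s' ''sz'') = bad_count k z l (narr s ''sz'') + of_bool (bad k z ?A ?m)"
          using bad_count_update[where sz = "narr s ''sz''" and A = ?A and m = ?m and l = l] sza Al by simp
        then show ?thesis using True bad_count_nonneg qr
          by (simp add: node_pot_def rest_def ennreal_plus[symmetric] ac_simps del: ennreal_plus)
      next
        case False
        then have "narr s' ''sz'' = narr s ''sz''"
          using R[THEN conjunct2, THEN conjunct2, unfolded if_not_P[OF False]] by blast
        then show ?thesis by (simp add: node_pot_def rest_def)
      qed
    next
      show "ennreal (bad_count k z l (narr s ''sz'') + q ^ K * rest) + ennreal (q ^ K) \<le> node_pot h i s" by (simp only: pot_i)
    qed
  qed
  then have "Wp n F (visit_cost + 1 + 1 + 1) (Seq (If (NLess (NArr ''acc'' (NVar ''a'')) (NConst 1)) visit SKIP)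
        (NAssign ''a'' (NAdd (NVar ''a'') (NVar ''m'')))) s (node_inv h (Suc i)) (node_pot h (Suc i)) (node_pot h i s)"
  proof (rule Wp_Seq)
    fix s1 assume "?P s1"
    then show "Wp n F 1 (NAssign ''a'' (NAdd (NVar ''a'') (NVar ''m''))) s1 (node_inv h (Suc i)) (node_pot h (Suc i)) (node_pot h (Suc i) s1)"
      by (intro Wp_NAssign) (simp_all add: node_inv_def pconst_def node_pot_def)
  qed
  then show ?thesis by (rule Wp_weaken) auto
qed

text \<open>After the last level there is no smaller height to move on to; the state then records
  that the pass over height 0 is complete.\<close>

definition lev_inv :: "nat \<Rightarrow> state \<Rightarrow> bool" where
  "lev_inv j s \<longleftrightarrow> pconst k l z K J s \<and> nvar s ''h'' = l + 1 - j \<and> queries s = nvar s ''v'' * (K + 1) \<and>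
     (if j \<le> l then pst_of l z (l - j) 0 s else pst_of l z 0 (2 ^ l) s)"

definition lev_pot :: "nat \<Rightarrow> state \<Rightarrow> ennreal" where
  "lev_pot j s = ennreal (bad_count k z l (narr s ''sz'') + q ^ K * real ((l + 1 - j) * 2 ^ l))"

definition level_cost :: nat where "level_cost = 2 ^ l * (visit_cost + 5) + 7"

lemma Wp_level:
  assumes I: "lev_inv j s" and j: "j \<le> l"
  shows "Wp n F level_cost level s (lev_inv (Suc j)) (lev_pot (Suc j)) (lev_pot j s)"
proof -
  define h where "h = l - j"
  have hl: "h \<le> l" and h1: "l + 1 - j = Suc h" using j by (auto simp: h_def)
  have I': "pconst k l z K J s" "nvar s ''h'' = Suc h" "queries s = nvar s ''v'' * (K + 1)" "pst_of l z h 0 s"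
    using I j h1 by (auto simp: lev_inv_def h_def)
  have ph: "narr s ''p'' h = 2 ^ h" using I'(1) hl by (simp add: pconst_def)
  have Npow: "2 ^ (l - h) * 2 ^ h = (2::nat) ^ l" using hl by (simp add: power_add[symmetric])
  let ?s0 = "s\<lparr>nvar := (nvar s)(''h'' := h, ''m'' := 2 ^ h, ''a'' := 0), ticks := 0\<rparr>"
  have 1: "Wp n F (2 ^ (l - h) * ((visit_cost + 3) + 2) + 1) (While (NLess (NVar ''a'') (NVar ''N''))
      (Seq (If (NLess (NArr ''acc'' (NVar ''a'')) (NConst 1)) visit SKIP)
        (NAssign ''a'' (NAdd (NVar ''a'') (NVar ''m''))))) ?s0 (node_inv h (2 ^ (l - h))) (node_pot h (2 ^ (l - h))) (node_pot h 0 ?s0)"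
  proof (rule Wp_While[where I = "node_inv h" and \<phi> = "node_pot h"])
    fix i and s :: state assume i: "i < 2 ^ (l - h)" "node_inv h i s"
    have "i * 2 ^ h < 2 ^ (l - h) * 2 ^ h" using i by simp
    then show "bval (NLess (NVar ''a'') (NVar ''N'')) s" using i Npow by (simp add: node_inv_def pconst_def)
    show "Wp n F (visit_cost + 3) (Seq (If (NLess (NArr ''acc'' (NVar ''a'')) (NConst 1)) visit SKIP)
        (NAssign ''a'' (NAdd (NVar ''a'') (NVar ''m'')))) s (node_inv h (Suc i)) (node_pot h (Suc i)) (node_pot h i s)"
      by (rule Wp_node[OF i(2,1)])
  next
    fix s assume "node_inv h (2 ^ (l - h)) s"
    then show "\<not> bval (NLess (NVar ''a'') (NVar ''N'')) s" using Npow by (simp add: node_inv_def pconst_def)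
  next
    show "node_inv h 0 ?s0" using I' by (simp add: node_inv_def pconst_def)
  qed (auto simp: node_inv_def pconst_def node_pot_def)
  have "Wp n F (2 ^ (l - h) * ((visit_cost + 3) + 2) + 1 + 2 + 2 + 2) level s (node_inv h (2 ^ (l - h))) (node_pot h (2 ^ (l - h))) (node_pot h 0 ?s0)"
    unfolding level_def
  proof (rule Wp_Seq_NAssign, rule Wp_Seq_NAssign, rule Wp_Seq_NAssign, goal_cases)
    case 1
    have e: "nval (NSub (NVar ''h'') (NConst 1)) s = h" using I' by simp
    show ?case using \<open>Wp n F (2 ^ (l - h) * ((visit_cost + 3) + 2) + 1) _ _ _ _ _\<close> by (simp add: I'(2) ph)
  qed
  then show ?thesis
  proof (rule Wp_weaken)
    have "(2::nat) ^ (l - h) \<le> 2 ^ l" by (rule power_increasing) auto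
    then have "2 ^ (l - h) * (visit_cost + 5) \<le> 2 ^ l * (visit_cost + 5)" by (rule mult_right_mono) simp
    then show "2 ^ (l - h) * ((visit_cost + 3) + 2) + 1 + 2 + 2 + 2 \<le> level_cost"
      unfolding level_cost_def by (simp add: add.commute)
    \<comment> \<open>Level \<open>h\<close> has only \<open>2 ^ (l - h)\<close> nodes; the rest of
      its budget is dropped.\<close>
    have e: "real ((h + 1) * 2 ^ l) - real (2 ^ (l - h)) \<ge> real ((l + 1 - Suc j) * 2 ^ l)"
    proof -
      have "real (2 ^ (l - h)) \<le> real (2 ^ l)" unfolding of_nat_le_iff by (rule power_increasing) auto
      moreover have "l + 1 - Suc j = h" by (simp add: h_def)
      ultimately show ?thesis by (simp add: algebra_simps)
    qed
    fix s' assume N: "node_inv h (2 ^ (l - h)) s'"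
    show "lev_inv (Suc j) s'"
    proof (cases "Suc j \<le> l")
      case True
      then have hS: "h = Suc (l - Suc j)" by (simp add: h_def)
      have "pst_of l z (Suc (l - Suc j)) (2 ^ (l - Suc (l - Suc j))) s'" using N unfolding node_inv_def hS by blast
      then have "pst_of l z (l - Suc j) 0 s'" by (rule pst_level[OF _ u])
      then show ?thesis using N True hS by (simp add: lev_inv_def node_inv_def)
    next
      case False
      then have "h = 0" "j = l" using j by (auto simp: h_def)
      then show ?thesis using N by (simp add: lev_inv_def node_inv_def)
    qed
    show "lev_pot (Suc j) s' \<le> node_pot h (2 ^ (l - h)) s'"
      unfolding lev_pot_def node_pot_def using e q01 by (intro ennreal_leI add_left_mono mult_left_mono) auto
  next
    show "node_pot h 0 ?s0 \<le> lev_pot j s" unfolding lev_pot_def h1 node_pot_def by simp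
  qed
qed

definition partition_cost :: nat where "partition_cost = (l + 1) * (level_cost + 2) + 3"

lemma Wp_partition:
  assumes s: "pconst k l z K J s" "narr s ''sz'' = (\<lambda>_. 0)" "narr s ''acc'' = (\<lambda>_. 0)" "rarr s ''U'' = (\<lambda>_. 0)"
     "rvar s ''S'' = 0" "nvar s ''v'' = 0" "queries s = 0"
  shows "Wp n F partition_cost partition_com s
    (\<lambda>s'. pconst k l z K J s' \<and> pst_of l z 0 (2 ^ l) s' \<and> queries s' = nvar s' ''v'' * (K + 1))
    (\<lambda>s'. ennreal (bad_count k z l (narr s' ''sz''))) (ennreal (q ^ K * real ((l + 1) * 2 ^ l)))"
proof -
  let ?s0 = "s\<lparr>nvar := (nvar s)(''h'' := l + 1), ticks := 0\<rparr>"
  have 1: "Wp n F ((l + 1) * (level_cost + 2) + 1) (While (NLess (NConst 0) (NVar ''h'')) level) ?s0 (lev_inv (l + 1)) (lev_pot (l + 1)) (lev_pot 0 ?s0)"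
  proof (rule Wp_While[where I = lev_inv and \<phi> = lev_pot])
    fix j and s :: state assume "j < l + 1" "lev_inv j s"
    then show "Wp n F level_cost level s (lev_inv (Suc j)) (lev_pot (Suc j)) (lev_pot j s)" by (intro Wp_level) auto
    from \<open>j < l + 1\<close> \<open>lev_inv j s\<close> show "bval (NLess (NConst 0) (NVar ''h'')) s" by (simp add: lev_inv_def)
  next
    show "lev_inv 0 ?s0" using s pst_init by (simp add: lev_inv_def pconst_def)
  qed (auto simp: lev_inv_def lev_pot_def pconst_def)
  have "Wp n F ((l + 1) * (level_cost + 2) + 1 + 2) partition_com s (lev_inv (l + 1)) (lev_pot (l + 1)) (lev_pot 0 ?s0)"
    unfolding partition_com_def by (rule Wp_Seq_NAssign) (use 1 s in \<open>simp add: pconst_def\<close>)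
  then show ?thesis
    by (rule Wp_weaken) (use s in \<open>auto simp: lev_inv_def lev_pot_def partition_cost_def bad_count_def\<close>)
qed

end

end

section \<open>One iteration of the sampler\<close>

lemma mods_phase2:
  "nmod rank_com = {''i'', ''c'', ''t''}" "namod rank_com = {''ord''}" "rmod rank_com = {}" "ramod rank_com = {}"
  "\<not> asks rank_com" "\<not> emits rank_com"
  "nmod build_com = {''x'', ''i'', ''b'', ''t''}" "namod build_com = {''W'', ''rk''}" "rmod build_com = {}" "ramod build_com = {''up''}"
  "\<not> asks build_com" "\<not> emits build_com"
  "nmod sample_com = {''lo'', ''d'', ''c'', ''y'', ''g''}" "namod sample_com = {''A''}" "rmod sample_com = {''Sl'', ''Sh'', ''Sm'', ''q''}"
  "ramod sample_com = {}" "\<not> emits sample_com"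
  "nmod update_com = {''i''}" "namod update_com = {}" "rmod update_com = {}" "ramod update_com = {''Y''}"
  "\<not> asks update_com" "\<not> emits update_com"
  by (auto simp: rank_com_def build_com_def sample_com_def update_com_def ask_def)

text \<open>A finished partition together with parameters for which neither potential increases in
  expectation. Indices without a block have \<open>sz b = 0\<close> and
  \<open>U b = G {} = 0\<close>, so all \<open>2 ^ l\<close> indices can be treated alike.\<close>

locale sampler = sfm V f v + mwu_params Kb Zb \<epsilon> \<eta>
  for V :: "'a set" and f v and Kb Zb \<epsilon> \<eta> :: real +
  fixes sz :: "nat \<Rightarrow> nat" and U :: "nat \<Rightarrow> real" and l :: nat and Z \<gamma> \<nu> \<theta> :: real
  assumes n_le: "card V \<le> 2 ^ l"
    and blk_disjoint: "\<And>b c. b \<noteq> c \<Longrightarrow> set (blk sz b) \<inter> set (blk sz c) = {}"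
    and sz_le: "\<And>b. sz b \<le> 2 ^ l"
    and blk_union: "(\<Union>b<2 ^ l. set (blk sz b)) = {..<2 ^ l}"
    and U_eq: "\<And>b. U b = G (set (blk sz b))"
    and Z_eq: "Z = (\<Sum>b<2 ^ l. U b) - G {..<2 ^ l}" and Z_le: "Z \<le> Zb"
    and U_bound: "\<And>b. \<bar>U b\<bar> \<le> Kb" and fs_bound: "- Kb \<le> min_value V f"
    and \<gamma>: "0 \<le> \<gamma>" "\<gamma> * Zb = 2 * \<nu>" "\<nu> \<le> 1 / 2"
begin

abbreviation H :: "nat set \<Rightarrow> real" where "H \<equiv> \<lambda>I. G (\<Union>c\<in>I. set (blk sz c))"
abbreviation fs :: real where "fs \<equiv> min_value V f"

definition gain :: "nat list \<Rightarrow> nat \<Rightarrow> real" where "gain bs p = U p - marg H {} bs p"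

text \<open>The first potential bounds sums of few scores from below, the second one bounds the true gains \<open>A\<close>
  by the estimated gains \<open>T * U q - Y q\<close>.\<close>

definition P1 :: "(nat \<Rightarrow> real) \<Rightarrow> real \<Rightarrow> real" where
  "P1 Y T = (\<Prod>q<2 ^ l. 1 + exp (- \<eta> * (Y q + \<epsilon> * T + \<theta>))) * exp (\<eta> * T * (fs - \<epsilon>))"

definition P2 :: "(nat \<Rightarrow> real) \<Rightarrow> (nat \<Rightarrow> real) \<Rightarrow> real \<Rightarrow> real" where
  "P2 Y A T = (\<Sum>q<2 ^ l. exp (\<gamma> * (1 - \<nu>) * A q - \<gamma> * (T * U q - Y q)))"

definition upd :: "(nat \<Rightarrow> real) \<Rightarrow> nat \<Rightarrow> nat \<Rightarrow> real" where
  "upd Y p q = Y q + U q - (if q = p then Z else 0)"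

lemma submodular_H: "submodular_on UNIV H"
  by (rule submodular_on_union_blocks[OF submodular_G blk_disjoint])

lemma H_empty: "H {} = 0" by simp

lemma gain_nonneg:
  assumes "distinct bs" "p \<in> set bs" shows "0 \<le> gain bs p"
  using marg_le_singleton[OF submodular_H assms(1) _ H_empty assms(2)] by (simp add: gain_def U_eq)

lemma gain_sum:
  assumes "distinct bs" "set bs = {..<2 ^ l}" shows "(\<Sum>p<2 ^ l. gain bs p) = Z"
  using sum_marg[OF assms(1), of H "{}"] assms(2) by (simp add: gain_def sum_subtractf Z_eq blk_union)

text \<open>\<open>w q\<close> is the probability that \<open>q\<close> belongs to a random set of
  blocks drawn with weights equal to the terms of the expanded product. Shifting the scores
  multiplies each factor by a mixture of 1 and \<open>exp (- \<eta> * d q)\<close> with this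
  weight.\<close>

lemma P1_factor:
  fixes x :: "nat \<Rightarrow> real"
  defines "w \<equiv> \<lambda>q. exp (- \<eta> * x q) / (1 + exp (- \<eta> * x q))"
  shows "(\<Prod>q\<in>I. 1 + exp (- \<eta> * (x q + d q))) =
    (\<Prod>q\<in>I. 1 + exp (- \<eta> * x q)) * (\<Prod>q\<in>I. 1 - w q + w q * exp (- \<eta> * d q))"
  unfolding prod.distrib[symmetric]
proof (rule prod.cong[OF refl])
  fix q
  have "1 + exp (- \<eta> * x q) \<noteq> 0" using exp_gt_zero[of "- \<eta> * x q"] by linarith
  then have "(1 + exp (- \<eta> * x q)) * (1 - w q + w q * exp (- \<eta> * d q)) = 1 + exp (- \<eta> * x q) * exp (- \<eta> * d q)"
    unfolding w_def by (simp add: field_simps)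
  also have "\<dots> = 1 + exp (- \<eta> * (x q + d q))" by (simp add: exp_add[symmetric] algebra_simps)
  finally show "1 + exp (- \<eta> * (x q + d q)) = (1 + exp (- \<eta> * x q)) * (1 - w q + w q * exp (- \<eta> * d q))" by simp
qed

text \<open>Low scores get high weights. Since the order is increasing in \<open>Y\<close>, the
  weights decrease along it, and \<open>marg_sorted_ge\<close> bounds the weighted sum of the greedy
  vector below by the minimum value: this is the reason for ordering blocks by score.\<close>

lemma P1_step:
  assumes bs: "distinct bs" "set bs = {..<2 ^ l}" "sorted_wrt (\<lambda>x y. Y x \<le> Y y) bs"
  shows "(\<Sum>p<2 ^ l. gain bs p * P1 (upd Y p) (T + 1)) \<le> Z * P1 Y T"
    and "Z = 0 \<Longrightarrow> p < 2 ^ l \<Longrightarrow> P1 (upd Y p) (T + 1) \<le> P1 Y T"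
proof -
  let ?I = "{..<2 ^ l :: nat}"
  define x where "x q = Y q + \<epsilon> * T + \<theta>" for q
  define w where "w q = exp (- \<eta> * x q) / (1 + exp (- \<eta> * x q))" for q
  define P where "P p = (\<Prod>q\<in>?I. (1 - w q + w q * exp (- \<eta> * (U q + \<epsilon> - (if q = p then Z else 0)))))" for p
  have w01: "0 \<le> w q \<and> w q \<le> 1" for q using exp_gt_zero[of "- \<eta> * x q"] by (simp add: w_def add_pos_pos divide_le_eq)
  have wmono: "w q' \<le> w q" if "Y q \<le> Y q'" for q q'
  proof -
    define e e' where "e = exp (- \<eta> * x q)" "e' = exp (- \<eta> * x q')"
    have "\<eta> * x q \<le> \<eta> * x q'" using that \<eta>_pos by (intro mult_left_mono) (auto simp: x_def)
    then have e: "e' \<le> e" "0 < e'" by (auto simp: \<open>e = _\<close> \<open>e' = _\<close>)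
    then have "e' * (1 + e) \<le> e * (1 + e')" by (simp add: algebra_simps)
    then have "e' / (1 + e') \<le> e / (1 + e)" using e by (simp add: field_simps)
    then show ?thesis by (simp add: w_def \<open>e = _\<close> \<open>e' = _\<close>)
  qed
  have "1 * (fs - H {}) \<le> (\<Sum>q\<in>set bs. w q * marg H {} bs q)"
  proof (rule marg_sorted_ge)
    show "sorted_wrt (\<lambda>x y. w y \<le> w x) bs" by (rule sorted_wrt_mono_rel[OF _ bs(3)]) (rule wmono)
  qed (use w01 bs min_value_le_G in auto)
  then have fs: "fs \<le> (\<Sum>q\<in>?I. w q * (U q - gain bs q))" using bs(2) by (simp add: gain_def)
  have a0: "0 \<le> gain bs q" if "q \<in> ?I" for q using gain_nonneg[OF bs(1)] that bs(2) by simp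
  have 1: "(\<Sum>p\<in>?I. gain bs p * P p) \<le> Z * exp (\<eta> * (\<epsilon> - fs))"
    unfolding P_def by (rule mwu_step(1)[OF finite_lessThan w01 a0 gain_sum[OF bs(1,2)] Z_le U_bound fs fs_bound])
  have 2: "P p \<le> exp (\<eta> * (\<epsilon> - fs))" if "Z = 0" "p < 2 ^ l" for p
    unfolding P_def using mwu_step(2)[OF finite_lessThan w01 a0 gain_sum[OF bs(1,2)] Z_le U_bound fs fs_bound that(1)] that(2) by simp
  have e: "P1 (upd Y p) (T + 1) = P1 Y T * (exp (\<eta> * (fs - \<epsilon>)) * P p)" for p
  proof -
    have "(\<Prod>q\<in>?I. 1 + exp (- \<eta> * (upd Y p q + \<epsilon> * (T + 1) + \<theta>))) = (\<Prod>q\<in>?I. 1 + exp (- \<eta> * (x q + (U q + \<epsilon> - (if q = p then Z else 0)))))"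
      by (rule prod.cong) (auto simp: upd_def x_def algebra_simps)
    also have "\<dots> = (\<Prod>q\<in>?I. 1 + exp (- \<eta> * x q)) * P p" unfolding P_def w_def by (rule P1_factor)
    finally have "P1 (upd Y p) (T + 1) = (\<Prod>q\<in>?I. 1 + exp (- \<eta> * x q)) * P p * exp (\<eta> * (T + 1) * (fs - \<epsilon>))" by (simp add: P1_def)
    also have "exp (\<eta> * (T + 1) * (fs - \<epsilon>)) = exp (\<eta> * T * (fs - \<epsilon>)) * exp (\<eta> * (fs - \<epsilon>))"
      by (simp add: exp_add[symmetric] algebra_simps)
    finally show ?thesis by (simp add: P1_def x_def)
  qed
  have P10: "0 \<le> P1 Y T" unfolding P1_def by (intro mult_nonneg_nonneg prod_nonneg) (auto intro: add_nonneg_nonneg)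
  have canc: "exp (\<eta> * (fs - \<epsilon>)) * exp (\<eta> * (\<epsilon> - fs)) = 1" by (simp add: exp_add[symmetric] algebra_simps)
  have "(\<Sum>p<2 ^ l. gain bs p * P1 (upd Y p) (T + 1)) = P1 Y T * exp (\<eta> * (fs - \<epsilon>)) * (\<Sum>p\<in>?I. gain bs p * P p)"
    unfolding e sum_distrib_left by (intro sum.cong) auto
  also have "\<dots> \<le> P1 Y T * exp (\<eta> * (fs - \<epsilon>)) * (Z * exp (\<eta> * (\<epsilon> - fs)))"
    using 1 P10 by (intro mult_left_mono) auto
  also have "\<dots> = Z * P1 Y T * (exp (\<eta> * (fs - \<epsilon>)) * exp (\<eta> * (\<epsilon> - fs)))" by (simp add: ac_simps)
  finally show "(\<Sum>p<2 ^ l. gain bs p * P1 (upd Y p) (T + 1)) \<le> Z * P1 Y T" unfolding canc by simp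
  show "P1 (upd Y p) (T + 1) \<le> P1 Y T" if "Z = 0" "p < 2 ^ l"
  proof -
    have "exp (\<eta> * (fs - \<epsilon>)) * P p \<le> exp (\<eta> * (fs - \<epsilon>)) * exp (\<eta> * (\<epsilon> - fs))" using 2[OF that] by (intro mult_left_mono) auto
    then have "exp (\<eta> * (fs - \<epsilon>)) * P p \<le> 1" unfolding canc .
    then show ?thesis unfolding e using P10 mult_left_le by blast
  qed
qed

text \<open>For a fixed \<open>q\<close> it only matters whether \<open>q\<close> itself is sampled,
  so after exchanging the sums each term is an instance of \<open>sampling_step\<close>.\<close>

lemma P2_step:
  assumes bs: "distinct bs" "set bs = {..<2 ^ l}"
  shows "(\<Sum>p<2 ^ l. gain bs p * P2 (upd Y p) (\<lambda>q. A q + gain bs q) (T + 1)) \<le> Z * P2 Y A T"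
    and "Z = 0 \<Longrightarrow> p < 2 ^ l \<Longrightarrow> P2 (upd Y p) (\<lambda>q. A q + gain bs q) (T + 1) \<le> P2 Y A T"
proof -
  let ?I = "{..<2 ^ l :: nat}"
  have a0: "0 \<le> gain bs q" if "q \<in> ?I" for q using gain_nonneg[OF bs(1)] that bs(2) by simp
  have tot: "(\<Sum>q\<in>?I. gain bs q) = Z" by (rule gain_sum[OF bs])
  have aZ: "gain bs q \<le> Z" if "q \<in> ?I" for q
    unfolding tot[symmetric] using that a0 by (intro member_le_sum) auto
  define E where "E q = exp (\<gamma> * (1 - \<nu>) * A q - \<gamma> * (T * U q - Y q))" for q
  have ex: "exp (\<gamma> * (1 - \<nu>) * (A q + gain bs q) - \<gamma> * ((T + 1) * U q - upd Y p q)) =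
    E q * (if q = p then exp (\<gamma> * (1 - \<nu>) * gain bs q - \<gamma> * Z) else exp (\<gamma> * (1 - \<nu>) * gain bs q))" for p q
    by (simp add: E_def upd_def exp_add[symmetric] algebra_simps)
  have "(\<Sum>p\<in>?I. gain bs p * P2 (upd Y p) (\<lambda>q. A q + gain bs q) (T + 1)) =
     (\<Sum>q\<in>?I. \<Sum>p\<in>?I. gain bs p * (E q * (if q = p then exp (\<gamma> * (1 - \<nu>) * gain bs q - \<gamma> * Z) else exp (\<gamma> * (1 - \<nu>) * gain bs q))))"
    unfolding P2_def ex sum_distrib_left by (rule sum.swap)
  also have "\<dots> \<le> (\<Sum>q\<in>?I. Z * E q)"
  proof (rule sum_mono)
    fix q assume q: "q \<in> ?I"
    let ?e1 = "exp (\<gamma> * (1 - \<nu>) * gain bs q - \<gamma> * Z)" and ?e0 = "exp (\<gamma> * (1 - \<nu>) * gain bs q)"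
    have "(\<Sum>p\<in>?I. gain bs p * (E q * (if q = p then ?e1 else ?e0))) =
       gain bs q * (E q * ?e1) + (\<Sum>p\<in>?I - {q}. gain bs p * (E q * ?e0))"
      using q by (subst sum.remove[OF _ q]) (auto intro!: sum.cong)
    also have "(\<Sum>p\<in>?I - {q}. gain bs p * (E q * ?e0)) = (Z - gain bs q) * (E q * ?e0)"
      using q tot by (simp add: sum_distrib_right[symmetric] sum_diff1)
    also have "gain bs q * (E q * ?e1) + (Z - gain bs q) * (E q * ?e0) = E q * (gain bs q * ?e1 + (Z - gain bs q) * ?e0)"
      by (simp add: algebra_simps)
    also have "\<dots> \<le> E q * Z"
      using sampling_step[OF a0[OF q] aZ[OF q] Z_le \<gamma>] by (intro mult_left_mono) (auto simp: E_def)
    finally show "(\<Sum>p\<in>?I. gain bs p * (E q * (if q = p then ?e1 else ?e0))) \<le> Z * E q" by (simp add: mult.commute)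
  qed
  also have "\<dots> = Z * P2 Y A T" by (simp add: P2_def E_def sum_distrib_left)
  finally show "(\<Sum>p<2 ^ l. gain bs p * P2 (upd Y p) (\<lambda>q. A q + gain bs q) (T + 1)) \<le> Z * P2 Y A T" .
  show "P2 (upd Y p) (\<lambda>q. A q + gain bs q) (T + 1) \<le> P2 Y A T" if "Z = 0" "p < 2 ^ l"
  proof -
    have "gain bs q = 0" if "q \<in> ?I" for q using a0[OF that] aZ[OF that] \<open>Z = 0\<close> by simp
    then show ?thesis unfolding P2_def ex using \<open>Z = 0\<close> by (intro sum_mono) (simp add: E_def)
  qed
qed

text \<open>The program does not store the accumulated true gains. They are read off the emitted
  orders, which makes the second potential a function of the state.\<close>

definition bsum :: "nat list \<Rightarrow> nat \<Rightarrow> real" where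
  "bsum w p = (\<Sum>x\<in>set (blk sz p) \<inter> {..<n}. marg G {} w x)"

definition Acc :: "nat list list \<Rightarrow> nat \<Rightarrow> real" where
  "Acc ws p = (\<Sum>w\<leftarrow>ws. U p - bsum w p)"

lemma concat_blk:
  assumes "distinct bs" "set bs = {..<2 ^ l}"
  shows "distinct (concat (map (blk sz) bs))" "set (concat (map (blk sz) bs)) = {..<2 ^ l}"
proof -
  show "set (concat (map (blk sz) bs)) = {..<2 ^ l}" using assms(2) blk_union by simp
  have "distinct (concat (map (blk sz) xs))" if "distinct xs" for xs
    using that
  proof (induction xs)
    case (Cons x xs)
    have "set (blk sz x) \<inter> set (concat (map (blk sz) xs)) = {}" 
    proof (rule equals0I)
      fix y assume "y \<in> set (blk sz x) \<inter> set (concat (map (blk sz) xs))"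
      then obtain c where c: "c \<in> set xs" "y \<in> set (blk sz x) \<inter> set (blk sz c)" by auto
      then have "x \<noteq> c" using Cons.prems by auto
      from blk_disjoint[OF this] c(2) show False by blast
    qed
    then show ?case using Cons by (simp add: blk_def)
  qed simp
  then show "distinct (concat (map (blk sz) bs))" using assms(1) by blast
qed

lemma flat_perm:
  assumes "distinct bs" "set bs = {..<2 ^ l}"
  shows "distinct (flat n sz bs)" "set (flat n sz bs) = {..<n}" "length (flat n sz bs) = n"
proof -
  show d: "distinct (flat n sz bs)" unfolding flat_def using concat_blk[OF assms] by simp
  show s: "set (flat n sz bs) = {..<n}"
    unfolding flat_def set_filter concat_blk(2)[OF assms] using n_le by auto
  show "length (flat n sz bs) = n" using distinct_card[OF d] s by simp
qed

text \<open>The emitted order lacks the padding, whose marginals are 0, so block sums agree with the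
  greedy vector of the contracted function \<open>H\<close>.\<close>

lemma bsum_flat:
  assumes "distinct bs" "set bs = {..<2 ^ l}" "p < 2 ^ l"
  shows "bsum (flat n sz bs) p = marg H {} bs p"
proof -
  let ?L = "concat (map (blk sz) bs)"
  have irr: "marg G {} (flat n sz bs) x = marg G {} ?L x" if "x < n" for x
    unfolding flat_def using marg_filter_irrelevant[of G "{..<n}" x "{}" "{}" ?L] G_restrict that by simp
  have zero: "marg G {} ?L x = 0" if nx: "n \<le> x" and xL: "x \<in> set ?L" for x
  proof -
    obtain i where i: "i < length ?L" "x = ?L ! i" using xL unfolding in_set_conv_nth by blast
    have "set (take (Suc i) ?L) \<inter> {..<n} = set (take i ?L) \<inter> {..<n}"
      using i nx by (auto simp: take_Suc_conv_app_nth)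
    then have "G (set (take (Suc i) ?L)) = G (set (take i ?L))"
      using G_restrict[of "set (take (Suc i) ?L)"] G_restrict[of "set (take i ?L)"] by (simp only:)
    then show ?thesis unfolding i(2) using marg_nth[OF concat_blk(1)[OF assms(1,2)] i(1), of G "{}"] by simp
  qed
  have sub: "set (blk sz p) \<subseteq> set ?L" using assms by auto
  have "bsum (flat n sz bs) p = (\<Sum>x\<in>set (blk sz p) \<inter> {..<n}. marg G {} ?L x)"
    unfolding bsum_def using irr by (intro sum.cong) auto
  also have "\<dots> = (\<Sum>x\<in>set (blk sz p). marg G {} ?L x)"
  proof (rule sum.mono_neutral_left)
    show "\<forall>x\<in>set (blk sz p) - set (blk sz p) \<inter> {..<n}. marg G {} ?L x = 0"
    proof
      fix x assume x: "x \<in> set (blk sz p) - set (blk sz p) \<inter> {..<n}"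
      then have "n \<le> x" by auto
      moreover have "x \<in> set ?L" using x sub by blast
      ultimately show "marg G {} ?L x = 0" by (rule zero)
    qed
  qed auto
  also have "\<dots> = marg H {} bs p"
    using marg_concat[OF concat_blk(1)[OF assms(1,2)] assms(1), of p G "{}"] assms by simp
  finally show ?thesis .
qed

lemma Acc_snoc:
  assumes "distinct bs" "set bs = {..<2 ^ l}" "p < 2 ^ l"
  shows "Acc (ws @ [flat n sz bs]) p = Acc ws p + gain bs p"
  using bsum_flat[OF assms] by (simp add: Acc_def gain_def)

lemma P2_cong: "(\<And>q. q < 2 ^ l \<Longrightarrow> Y q = Y' q) \<Longrightarrow> (\<And>q. q < 2 ^ l \<Longrightarrow> A q = A' q) \<Longrightarrow> P2 Y A T = P2 Y' A' T"
  unfolding P2_def by (intro sum.cong) auto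
lemma P1_cong: "(\<And>q. q < 2 ^ l \<Longrightarrow> Y q = Y' q) \<Longrightarrow> P1 Y T = P1 Y' T"
  unfolding P1_def by (intro arg_cong2[where f = times] prod.cong) auto

definition pot :: "state \<Rightarrow> real" where
  "pot s = P1 (rarr s ''Y'') (real (length (out s))) + P2 (rarr s ''Y'') (Acc (out s)) (real (length (out s)))"

text \<open>The bound on \<open>Y\<close> says that the estimated gains are nonnegative.\<close>

definition sinv :: "nat \<Rightarrow> state \<Rightarrow> bool" where
  "sinv q0 s \<longleftrightarrow> nvar s ''n'' = n \<and> nvar s ''l'' = l \<and> nvar s ''N'' = 2 ^ l \<and> (\<forall>d\<le>l. narr s ''p'' d = 2 ^ d) \<and>
    narr s ''sz'' = sz \<and> rarr s ''U'' = U \<and> rvar s ''Z'' = Z \<and>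
    (\<forall>w\<in>set (out s). \<exists>bs. distinct bs \<and> set bs = {..<2 ^ l} \<and> w = flat n sz bs) \<and>
    (\<forall>p<2 ^ l. rarr s ''Y'' p \<le> real (length (out s)) * U p) \<and>
    queries s = q0 + l * length (out s)"

definition iter_cost :: nat where
  "iter_cost = 2 ^ l * (6 * 2 ^ l + 12) + 2 ^ l * (10 * 2 ^ l + 12) + l * (6 * n + 22) + 5 * 2 ^ l + n + 40"

lemma Z_nonneg: "0 \<le> Z"
  using gain_sum[of "[0..<2 ^ l]"] gain_nonneg[of "[0..<2 ^ l]"]
  by (metis atLeast_upt distinct_upt lessThan_iff set_upt atLeastLessThan_iff sum_nonneg)

lemma Wp_iter:
  assumes I: "sinv q0 s"
  shows "Wp n F iter_cost iter_com s
    (\<lambda>s'. sinv q0 s' \<and> length (out s') = Suc (length (out s)) \<and> nvar s' ''v'' = nvar s ''v'' \<and> nvar s' ''r'' = nvar s ''r'' \<and>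
       nvar s' ''e'' = nvar s ''e'' \<and> rvar s' ''J'' = rvar s ''J'')
    (\<lambda>s'. ennreal (pot s')) (ennreal (pot s))"
proof -
  define Y where "Y = rarr s ''Y''"
  define ws where "ws = out s"
  define T where "T = real (length ws)"
  let ?N = "2 ^ l :: nat"
  let ?C = "\<lambda>s'. nvar s' ''n'' = n \<and> nvar s' ''l'' = l \<and> nvar s' ''N'' = ?N \<and> (\<forall>d\<le>l. narr s' ''p'' d = 2 ^ d) \<and>
    narr s' ''sz'' = sz \<and> rarr s' ''U'' = U \<and> rvar s' ''Z'' = Z \<and> nvar s' ''v'' = nvar s ''v'' \<and> nvar s' ''r'' = nvar s ''r'' \<and>
       nvar s' ''e'' = nvar s ''e'' \<and> rvar s' ''J'' = rvar s ''J''"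
  have Cs: "?C s" "\<forall>w\<in>set ws. \<exists>bs. distinct bs \<and> set bs = {..<?N} \<and> w = flat n sz bs" "\<forall>p<?N. Y p \<le> T * U p" "queries s = q0 + l * length ws"
    using I by (auto simp: sinv_def Y_def ws_def T_def)
  let ?Post = "\<lambda>s'. sinv q0 s' \<and> length (out s') = Suc (length (out s)) \<and> nvar s' ''v'' = nvar s ''v'' \<and> nvar s' ''r'' = nvar s ''r'' \<and>
       nvar s' ''e'' = nvar s ''e'' \<and> rvar s' ''J'' = rvar s ''J''"
  let ?pot = "\<lambda>s'. ennreal (pot s')"
  show ?thesis
    unfolding iter_com_def
  proof (rule Wp_weaken)
    show "Wp n F (?N * (6 * ?N + 12) + 3 + 1 + (?N * (10 * ?N + 12) + 10 + 1 + (n + 1 + 1 + (l * (6 * n + 22) + 12 + 1 + (5 * ?N + 5)))))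
      (Seq rank_com (Seq build_com (Seq (Emit ''W'') (Seq sample_com update_com)))) s ?Post ?pot (ennreal (pot s))"
    proof (rule Wp_Seq_Ws[OF Wp_frame[OF Ws_rank_com[where N = ?N]]])
      show "nvar s ''N'' = ?N" using Cs by simp
      fix s1 :: state
      assume A1: "(\<forall>i<?N. narr s1 ''ord'' (rank (rarr s ''Y'') ?N i) = i) \<and> frm rank_com s s1"
      define bs where "bs = map (narr s1 ''ord'') [0..<?N]"
      have bs: "distinct bs" "set bs = {..<?N}" "sorted_wrt (\<lambda>x y. Y x \<le> Y y) bs"
        using sorted_by_rank[of ?N "narr s1 ''ord''" Y] A1 unfolding bs_def Y_def by blast+
      have len: "length bs = ?N" by (simp add: bs_def)
      have bij: "bij_betw ((!) bs) {..<?N} {..<?N}"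
        by (rule bij_betw_nth[OF bs(1)]) (simp_all only: len bs(2))
      have C1: "?C s1" "rarr s1 ''Y'' = Y" "out s1 = ws" "queries s1 = q0 + l * length ws"
        using Cs A1 unfolding frm_def mods_phase2 by (simp_all add: mods_phase2 Y_def ws_def)
      let ?w = "flat n sz bs"
      note fl = flat_perm[OF bs(1,2)]
      let ?B = "\<lambda>s'. map (narr s' ''W'') [0..<length ?w] = ?w \<and>
        (\<forall>i<?N. \<forall>y\<in>set (blk sz (bs ! i)). narr s' ''rk'' y = i) \<and>
        (\<forall>i\<le>?N. rarr s' ''up'' i = (\<Sum>j<i. rarr s1 ''U'' (bs ! j)))"
      show "Wp n F (?N * (10 * ?N + 12) + 10 + 1 + (n + 1 + 1 + (l * (6 * n + 22) + 12 + 1 + (5 * ?N + 5))))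
        (Seq build_com (Seq (Emit ''W'') (Seq sample_com update_com))) s1 ?Post ?pot (ennreal (pot s))"
      proof (rule Wp_Seq_Ws[OF Wp_frame[OF Ws_build_com[where N = ?N and bs = bs and sz = sz]]])
        show "map (narr s1 ''ord'') [0..<?N] = bs" by (simp add: bs_def)
        fix s2 :: state assume A2: "?B s2 \<and> frm build_com s1 s2"
        have C2: "?C s2" "rarr s2 ''Y'' = Y" "out s2 = ws" "queries s2 = q0 + l * length ws" "narr s2 ''ord'' = narr s1 ''ord''"
          using C1 A2 unfolding frm_def mods_phase2 by (simp_all add: mods_phase2)
        have W: "map (narr s2 ''W'') [0..<n] = ?w" using A2 fl(3) by simp
        have rk: "narr s2 ''rk'' y = i" if "i < ?N" "y \<in> set (blk sz (bs ! i))" for i y using A2 that by blast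
        have up: "rarr s2 ''up'' i = (\<Sum>j<i. U (bs ! j))" if "i \<le> ?N" for i using A2 that C1(1) by simp
        let ?s3 = "s2\<lparr>out := ws @ [?w], ticks := 0\<rparr>"
        \<comment> \<open>\<open>Sf\<close> accumulates the gains along the order;
          \<open>g i\<close> is the potential after this round if position \<open>i\<close> is
          drawn.\<close>
        define Sf where "Sf c = (\<Sum>j<c. U (bs ! j)) - H (set (take c bs))" for c
        define g where "g i = P1 (upd Y (bs ! i)) (T + 1) + P2 (upd Y (bs ! i)) (\<lambda>q. Acc ws q + gain bs q) (T + 1)" for i
        have Sstep: "Sf (Suc i) - Sf i = gain bs (bs ! i)" if "i < ?N" for i
          unfolding Sf_def gain_def using marg_nth[OF bs(1), of i H "{}"] that len by simp
        have g0: "0 \<le> g i" for i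
          unfolding g_def P1_def P2_def by (intro add_nonneg_nonneg mult_nonneg_nonneg prod_nonneg sum_nonneg) (auto intro: add_nonneg_nonneg)
        have pots: "pot s = P1 Y T + P2 Y (Acc ws) T" by (simp add: pot_def Y_def ws_def T_def)
        have pot0: "0 \<le> pot s"
          unfolding pots P1_def P2_def by (intro add_nonneg_nonneg mult_nonneg_nonneg prod_nonneg sum_nonneg) (auto intro: add_nonneg_nonneg)
        have bsl: "bs ! i < ?N" if "i < ?N" for i using bs(2) len that by (metis lessThan_iff nth_mem)
        have samp: "Wp n F (l * (6 * n + 22) + 12) sample_com ?s3 (\<lambda>s'. nvar s' ''lo'' < 2 ^ l \<and> queries s' = queries ?s3 + l)
           (\<lambda>s'. ennreal (g (nvar s' ''lo''))) (ennreal (pot s))"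
        proof (rule Wp_sample_com[where S = Sf])
          fix c :: nat assume c: "c \<le> 2 ^ l"
          have "{y. y < n \<and> c - narr s2 ''rk'' y \<noteq> 0} = (\<Union>b\<in>set (take c bs). set (blk sz b)) \<inter> {..<n}"
          proof (intro equalityI subsetI)
            fix y assume y: "y \<in> {y. y < n \<and> c - narr s2 ''rk'' y \<noteq> 0}"
            then have "y \<in> {..<?N}" using n_le by auto
            then have "y \<in> (\<Union>b<?N. set (blk sz b))" using blk_union by simp
            then obtain b where b: "b \<in> set bs" "y \<in> set (blk sz b)" using bs(2) by auto
            then obtain i where i: "i < ?N" "bs ! i = b" using len by (metis in_set_conv_nth)
            have "narr s2 ''rk'' y = i" using rk[OF i(1)] i b by simp
            then have "i < c" using y by simp
            then have "b \<in> set (take c bs)" using i len by (auto simp: in_set_conv_nth)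
            then show "y \<in> (\<Union>b\<in>set (take c bs). set (blk sz b)) \<inter> {..<n}" using b y by auto
          next
            fix y assume y: "y \<in> (\<Union>b\<in>set (take c bs). set (blk sz b)) \<inter> {..<n}"
            then obtain b where b: "b \<in> set (take c bs)" "y \<in> set (blk sz b)" by auto
            then obtain i where i: "i < c" "i < ?N" "bs ! i = b" using len by (auto simp: in_set_conv_nth)
            have "narr s2 ''rk'' y = i" using rk[OF i(2)] i b by simp
            then show "y \<in> {y. y < n \<and> c - narr s2 ''rk'' y \<noteq> 0}" using y i by simp
          qed
          then have "F {y. y < n \<and> c - narr s2 ''rk'' y \<noteq> 0} = H (set (take c bs))" by (simp add: G_def)
          then show "rarr ?s3 ''up'' c - F {y. y < n \<and> c - narr ?s3 ''rk'' y \<noteq> 0} = Sf c" using up[OF c] by (simp add: Sf_def)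
        next
          show "Sf 0 = 0" by (simp add: Sf_def)
          have "(\<Sum>j<?N. U (bs ! j)) = (\<Sum>b<?N. U b)"
            by (rule sum.reindex_bij_betw[OF bij])
          then show "Sf (2 ^ l) = rvar ?s3 ''Z''" using C2(1) len bs(2) by (simp add: Sf_def Z_eq blk_union)
        next
          fix i :: nat assume i: "i < 2 ^ l"
          have "0 \<le> gain bs (bs ! i)" using gain_nonneg[OF bs(1)] bs(2) bsl[OF i] by simp
          then show "Sf i \<le> Sf (Suc i)" using Sstep[OF i] by simp
        next
          have "(\<Sum>i<2 ^ l. (Sf (Suc i) - Sf i) * g i) = (\<Sum>i<?N. gain bs (bs ! i) * g i)" by (intro sum.cong) (auto simp: Sstep)
          also have "\<dots> = (\<Sum>p<?N. gain bs p * (P1 (upd Y p) (T + 1) + P2 (upd Y p) (\<lambda>q. Acc ws q + gain bs q) (T + 1)))"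
            unfolding g_def
            by (rule sum.reindex_bij_betw[OF bij])
          also have "\<dots> \<le> Z * pot s"
            using P1_step(1)[OF bs, of T] P2_step(1)[OF bs(1,2), of Y "Acc ws" T] by (simp add: pots distrib_left sum.distrib)
          finally show "(\<Sum>i<2 ^ l. (Sf (Suc i) - Sf i) * g i) \<le> rvar ?s3 ''Z'' * pot s" using C2(1) by simp
        next
          fix i :: nat assume "rvar ?s3 ''Z'' = 0" and i: "i < 2 ^ l"
          then have "Z = 0" using C2(1) by simp
          then show "g i \<le> pot s"
            unfolding g_def pots using P1_step(2)[OF bs _ bsl[OF i], of T] P2_step(2)[OF bs(1,2) _ bsl[OF i], of Y "Acc ws" T] by simp
        qed (use C2(1) g0 pot0 in auto)
        show "Wp n F (n + 1 + 1 + (l * (6 * n + 22) + 12 + 1 + (5 * ?N + 5))) (Seq (Emit ''W'') (Seq sample_com update_com)) s2 ?Post ?pot (ennreal (pot s))"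
        proof (rule Wp_Seq_Ws[where P = "\<lambda>s'. s' = ?s3"])
          show "Ws n F (n + 1) (Emit ''W'') s2 (\<lambda>s'. s' = ?s3)"
            by (rule Wp_Emit) (use W C2(3) in simp_all)
          fix s3' assume "s3' = ?s3"
          then show "Wp n F (l * (6 * n + 22) + 12 + 1 + (5 * ?N + 5)) (Seq sample_com update_com) s3' ?Post ?pot (ennreal (pot s))"
          proof (simp only:, intro Wp_Seq[OF Wp_frame[OF samp]])
            fix s4 assume A4: "(nvar s4 ''lo'' < 2 ^ l \<and> queries s4 = queries ?s3 + l) \<and> frm sample_com ?s3 s4"
            have C4: "?C s4" "rarr s4 ''Y'' = Y" "out s4 = ws @ [?w]" "queries s4 = q0 + l * Suc (length ws)" "narr s4 ''ord'' = narr s1 ''ord''"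
              using C2 A4 unfolding frm_def mods_phase2 by (simp_all add: mods_phase2)
            let ?lo = "nvar s4 ''lo''"
            define p where "p = bs ! ?lo"
            have lo: "?lo < ?N" using A4 by blast
            have pN: "p < ?N" unfolding p_def by (rule bsl[OF lo])
            have ordp: "narr s4 ''ord'' ?lo = p" using lo by (simp add: C4(5) p_def bs_def)
            show "Wp n F (5 * ?N + 5) update_com s4 ?Post ?pot (ennreal (g ?lo))"
            proof (rule Wp_weaken[OF Wp_of_Ws[OF Wp_frame[OF Ws_update_com[where N = ?N and p = p]], where \<phi> = ?pot and r = "ennreal (g ?lo)"]])
              show "nvar s4 ''N'' = ?N" using C4 by simp
            next
              fix s5 assume A5: "(\<forall>i<?N. rarr s5 ''Y'' i = rarr s4 ''Y'' i + rarr s4 ''U'' i - (if i = p then rvar s4 ''Z'' else 0)) \<and> frm update_com s4 s5"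
              have C5: "?C s5" "out s5 = ws @ [?w]" "queries s5 = q0 + l * Suc (length ws)"
                using C4 A5 unfolding frm_def mods_phase2 by (simp_all add: mods_phase2)
              have Y5: "rarr s5 ''Y'' q = upd Y p q" if "q < ?N" for q using A5 that C4 by (simp add: upd_def)
              show "?Post s5"
                unfolding sinv_def
              proof (intro conjI)
                show "\<forall>w\<in>set (out s5). \<exists>bs. distinct bs \<and> set bs = {..<2 ^ l} \<and> w = flat n sz bs"
                  using C5(2) Cs(2) bs by auto
                show "\<forall>p<2 ^ l. rarr s5 ''Y'' p \<le> real (length (out s5)) * U p"
                proof (intro allI impI)
                  fix q :: nat assume q: "q < 2 ^ l"
                  have "upd Y p q \<le> Y q + U q" using Z_nonneg by (simp add: upd_def)
                  also have "\<dots> \<le> T * U q + U q" using Cs(3) q by simp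
                  finally show "rarr s5 ''Y'' q \<le> real (length (out s5)) * U q" using Y5[OF q] C5(2) by (simp add: T_def algebra_simps)
                qed
              qed (use C5 in \<open>simp_all add: ws_def\<close>)
              show "?pot s5 \<le> ennreal (g ?lo)"
              proof (rule ennreal_leI)
                have "pot s5 = P1 (rarr s5 ''Y'') (T + 1) + P2 (rarr s5 ''Y'') (Acc (ws @ [?w])) (T + 1)"
                  by (simp add: pot_def C5(2) T_def add.commute)
                also have "\<dots> = g ?lo"
                  unfolding g_def p_def[symmetric]
                  using P1_cong[of "rarr s5 ''Y''" "upd Y p" "T + 1"] P2_cong[of "rarr s5 ''Y''" "upd Y p" "Acc (ws @ [?w])" "\<lambda>q. Acc ws q + gain bs q" "T + 1"] Y5 Acc_snoc[OF bs(1,2)]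
                  by simp
                finally show "pot s5 \<le> g ?lo" by simp
              qed
            qed (use lo ordp pN in auto)
          qed
        qed
      qed (use C1 bs blk_disjoint sz_le in auto)
    qed
  qed (auto simp: iter_cost_def)
qed

end

section \<open>Correctness of the algorithm\<close>

text \<open>The binary logarithm rounded up, with value 0 for \<open>n \<le> 1\<close>: the number
  of doublings made by \<open>init_com\<close>.\<close>

definition lg :: "nat \<Rightarrow> nat" where "lg n = (LEAST l. n \<le> 2 ^ l)"

lemma le_pow_lg: "n \<le> 2 ^ lg n"
  unfolding lg_def by (rule LeastI[of _ n]) (simp add: less_imp_le)

lemma pow_less_iff_lg: "2 ^ i < n \<longleftrightarrow> i < lg n"
proof
  assume "2 ^ i < n"
  then have "(2::nat) ^ i < 2 ^ lg n" using le_pow_lg[of n] by linarith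
  then show "i < lg n" by simp
next
  assume "i < lg n"
  then show "2 ^ i < n" unfolding lg_def using not_less_Least[of i "\<lambda>l. n \<le> 2 ^ l"] by simp
qed

lemma pow_lg_le: "2 ^ lg n \<le> 2 * n + 1"
proof (cases "lg n")
  case (Suc i)
  then have "2 ^ i < n" using pow_less_iff_lg[of i n] by simp
  then show ?thesis by (simp add: Suc)
qed simp

definition init_post :: "nat \<Rightarrow> nat \<Rightarrow> nat \<Rightarrow> nat \<Rightarrow> real \<Rightarrow> real \<Rightarrow> state \<Rightarrow> bool" where
  "init_post C0 C1 n k \<phi> \<delta> s \<longleftrightarrow> (let l = lg n in
      nvar s ''n'' = n \<and> nvar s ''k'' = k \<and> nvar s ''N'' = 2 ^ l \<and> nvar s ''l'' = l \<and> (\<forall>d\<le>l. narr s ''p'' d = 2 ^ d) \<and>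
      rvar s ''z'' = \<delta> / (2 * (real (k + 1) * real (k + 2))) \<and> rvar s ''K'' = real (C1 * ((l + 1) * k)) \<and>
      rvar s ''J'' = real C0 * (real l + 1) * (real k ^ 4 * \<phi>\<^sup>2) / \<delta>\<^sup>2 \<and> rarr s ''Y'' = (\<lambda>_. 0) \<and> out s = [] \<and>
      narr s ''sz'' = (\<lambda>_. 0) \<and> narr s ''acc'' = (\<lambda>_. 0) \<and> rarr s ''U'' = (\<lambda>_. 0) \<and> rvar s ''S'' = 0 \<and> nvar s ''v'' = 0 \<and> queries s = 0)"

lemma Ws_While:
  assumes "\<And>i s. i < m \<Longrightarrow> I i s \<Longrightarrow> bval b s"
    "\<And>i s. i < m \<Longrightarrow> I i s \<Longrightarrow> Ws n F t c s (I (Suc i))"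
    "\<And>s. I m s \<Longrightarrow> \<not> bval b s" "I 0 s" "\<And>i s. I i s \<Longrightarrow> I i (s\<lparr>ticks := 0\<rparr>)"
  shows "Ws n F (m * (t + 2) + 1) (While b c) s (I m)"
  using Wp_While[where I = I and \<phi> = "\<lambda>_ _. 0" and m = m and b = b and n = n and F = F and t = t and c = c and s = s] assms
  by simp

lemma Ws_init: "Ws n F (8 * lg n + 20) (init_com C0 C1) (init_state n k \<phi> \<delta>) (init_post C0 C1 n k \<phi> \<delta>)"
proof -
  define l where "l = lg n"
  define I where "I = (\<lambda>i (s' :: state). nvar s' ''n'' = n \<and> nvar s' ''k'' = k \<and> nvar s' ''v'' = 0 \<and> nvar s' ''N'' = 2 ^ i \<and> nvar s' ''l'' = i \<and>
     (\<forall>d\<le>i. narr s' ''p'' d = 2 ^ d) \<and> narr s' ''sz'' = (\<lambda>_. 0) \<and> narr s' ''acc'' = (\<lambda>_. 0) \<and>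
     rvar s' ''phi'' = \<phi> \<and> rvar s' ''delta'' = \<delta> \<and> rvar s' ''S'' = 0 \<and> rarr s' = (\<lambda>_ _. 0) \<and> out s' = [] \<and> queries s' = 0)"
  let ?Q = "init_post C0 C1 n k \<phi> \<delta>"
  define s0 where "s0 = init_state n k \<phi> \<delta>"
  let ?body = "Seq (NAssign ''N'' (NAdd (NVar ''N'') (NVar ''N''))) (Seq (NAssign ''l'' (NAdd (NVar ''l'') (NConst 1)))
         (NStore ''p'' (NVar ''l'') (NVar ''N'')))"
  have loop: "Ws n F (l * ((1 + 2 + 2) + 2) + 1) (While (NLess (NVar ''N'') (NVar ''n'')) ?body) s1 (I l)" if s1: "I 0 s1" for s1 :: state
  proof (rule Ws_While[where I = I])
    fix i and s :: state assume i: "i < l" "I i s"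
    have "2 ^ i < n" using i(1) pow_less_iff_lg[of i n] unfolding l_def by blast
    then show "bval (NLess (NVar ''N'') (NVar ''n'')) s" using i(2) by (simp add: I_def)
    show "Ws n F (1 + 2 + 2) ?body s (I (Suc i))"
    proof (rule Wp_Seq_NAssign, rule Wp_Seq_NAssign, rule Wp_NStore, goal_cases)
      case 1
      show ?case using i(2) by (simp add: I_def mult_2 le_Suc_eq)
    qed simp
  next
    fix s assume "I l s"
    then show "\<not> bval (NLess (NVar ''N'') (NVar ''n'')) s" using le_pow_lg[of n] by (simp add: l_def I_def)
  qed (use s1 in \<open>auto simp: I_def\<close>)
  have fin: "Ws n F (1 + 2 + 2) (Seq (RAssign ''z'' (RDiv (RVar ''delta'') (RMul (RNat (NConst 2)) (RMul (RNat (NAdd (NVar ''k'') (NConst 1))) (RNat (NAdd (NVar ''k'') (NConst 2)))))))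
    (Seq (RAssign ''K'' (RMul (RNat (NConst C1)) (RMul (RNat (NAdd (NVar ''l'') (NConst 1))) (RNat (NVar ''k'')))))
      (RAssign ''J'' (RDiv (RMul (RMul (RNat (NConst C0)) (RNat (NAdd (NVar ''l'') (NConst 1))))
         (RMul (RMul (RMul (RNat (NVar ''k'')) (RNat (NVar ''k''))) (RMul (RNat (NVar ''k'')) (RNat (NVar ''k''))))
           (RMul (RVar ''phi'') (RVar ''phi'')))) (RMul (RVar ''delta'') (RVar ''delta'')))))) s1 ?Q" if I: "I l s1" for s1 :: state
    by (rule Wp_Seq_RAssign, rule Wp_Seq_RAssign, rule Wp_RAssign)
         (use I in \<open>simp_all add: I_def init_post_def l_def[symmetric] Let_def power2_eq_square power4_eq_xxxx distrib_right\<close>)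
  have "Ws n F ((l * ((1 + 2 + 2) + 2) + 1) + 1 + (1 + 2 + 2) + 2 + 2 + 2) (init_com C0 C1) s0 ?Q"
    unfolding init_com_def
  proof (rule Wp_Seq_NAssign, rule Wp_Seq_NAssign, rule Wp_Seq_NStore, rule Ws_Seq[where P = "I l"], goal_cases)
    case 1
    show ?case by (rule loop) (simp add: I_def s0_def init_state_def)
  next
    case (2 s1) then show ?case by (rule fin)
  qed
  then show ?thesis unfolding s0_def by (rule Ws_mono) (auto simp: l_def)
qed

context sfm begin

lemma Ws_total:
  assumes "nvar s ''n'' = n"
  shows "Ws n F (6 * n + 7) total_com s (\<lambda>s'. \<exists>y A q. s' = s\<lparr>nvar := (nvar s)(''y'' := y), narr := (narr s)(''A'' := A),
     rvar := (rvar s)(''q'' := q, ''Z'' := rvar s ''S'' - f V), queries := queries s + 1, ticks := 0\<rparr>)"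
proof -
  have "Ws n F (6 * n + 5 + 1 + 1) total_com s (\<lambda>s'. \<exists>y A q. s' = s\<lparr>nvar := (nvar s)(''y'' := y), narr := (narr s)(''A'' := A),
     rvar := (rvar s)(''q'' := q, ''Z'' := rvar s ''S'' - f V), queries := queries s + 1, ticks := 0\<rparr>)"
    unfolding total_com_def
  proof (rule Ws_Seq[OF Ws_ask[where E = "\<lambda>_. 1"]])
    fix s1 :: state assume "\<exists>A. s1 = s\<lparr>nvar := (nvar s)(''y'' := n), narr := (narr s)(''A'' := A),
             rvar := (rvar s)(''q'' := F {y. y < n \<and> 1 \<noteq> (0::nat)}), queries := queries s + 1, ticks := 0\<rparr>"
    then obtain A where s1: "s1 = s\<lparr>nvar := (nvar s)(''y'' := n), narr := (narr s)(''A'' := A),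
             rvar := (rvar s)(''q'' := F {y. y < n \<and> 1 \<noteq> (0::nat)}), queries := queries s + 1, ticks := 0\<rparr>" by blast
    have "{y. y < n \<and> 1 \<noteq> (0::nat)} = {..<n}" by auto
    then have "F {y. y < n \<and> 1 \<noteq> (0::nat)} = f V" using v_image by simp
    note s1' = s1[unfolded this]
    show "Ws n F 1 (RAssign ''Z'' (RSub (RVar ''S'') (RVar ''q''))) s1 (\<lambda>s'. \<exists>y A q. s' = s\<lparr>nvar := (nvar s)(''y'' := y), narr := (narr s)(''A'' := A),
     rvar := (rvar s)(''q'' := q, ''Z'' := rvar s ''S'' - f V), queries := queries s + 1, ticks := 0\<rparr>)"
      by (rule Wp_RAssign, rule exI[of _ n], rule exI[of _ A], rule exI[of _ "f V"]) (simp_all add: s1')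
  qed (use assms in auto)
  then show ?thesis by (rule Ws_mono) auto
qed

end

section \<open>The main loop and its final potential\<close>

context sampler begin

lemma Wp_main:
  fixes cnt :: nat and J :: real
  assumes I: "sinv q0 s" "out s = []" "nvar s ''v'' = cnt" "rvar s ''J'' = J"
  defines "Jn \<equiv> nat \<lceil>J\<rceil>"
  shows "Wp n F (cnt * (Jn * (iter_cost + 4) + 7) + 3) main_com s
    (\<lambda>s'. sinv q0 s' \<and> length (out s') = cnt * Jn) (\<lambda>s'. ennreal (pot s')) (ennreal (pot s))"
proof -
  let ?I = "\<lambda>r e s'. sinv q0 s' \<and> length (out s') = r * Jn + e \<and> nvar s' ''v'' = cnt \<and> rvar s' ''J'' = J \<and> nvar s' ''r'' = r"
  let ?pot = "\<lambda>s'. ennreal (pot s')"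
  have pot_t: "pot (s'\<lparr>ticks := 0\<rparr>) = pot s'" "pot (s'\<lparr>nvar := a\<rparr>) = pot s'" for s' a by (simp_all add: pot_def)
  have sinv_t: "sinv q0 (s'\<lparr>ticks := 0\<rparr>) = sinv q0 s'" for s' by (simp add: sinv_def)
  have sinv_n: "sinv q0 (s'\<lparr>nvar := (nvar s')(a := y), ticks := 0\<rparr>) = sinv q0 s'" "sinv q0 (s'\<lparr>nvar := (nvar s')(a := y)\<rparr>) = sinv q0 s'" if "a = ''e'' \<or> a = ''r''" for s' a y
    using that by (auto simp: sinv_def)
  \<comment> \<open>Comparing the counter with the real \<open>J\<close> stops after exactly
    \<open>nat \<lceil>J\<rceil>\<close> rounds.\<close>
  have lt: "real e < J \<longleftrightarrow> e < Jn" for e :: nat unfolding Jn_def by linarith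
  let ?inner = "Seq iter_com (NAssign ''e'' (NAdd (NVar ''e'') (NConst 1)))"
  have inner: "Wp n F (Jn * ((iter_cost + 1 + 1) + 2) + 1 + 2) (Seq (NAssign ''e'' (NConst 0)) (While (RLess (RNat (NVar ''e'')) (RVar ''J'')) ?inner))
     s1 (?I r Jn) ?pot (?pot s1)" if s1: "?I r 0 s1" for s1 :: state and r
  proof (rule Wp_Seq_NAssign)
    let ?s2 = "s1\<lparr>nvar := (nvar s1)(''e'' := nval (NConst 0) s1), ticks := 0\<rparr>"
    have "Wp n F (Jn * ((iter_cost + 1 + 1) + 2) + 1) (While (RLess (RNat (NVar ''e'')) (RVar ''J'')) ?inner) ?s2
       (\<lambda>s'. ?I r Jn s' \<and> nvar s' ''e'' = Jn) ?pot (?pot ?s2)"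
    proof (rule Wp_While[where I = "\<lambda>e s'. ?I r e s' \<and> nvar s' ''e'' = e" and \<phi> = "\<lambda>_. ?pot"])
      fix e and s' :: state assume e: "e < Jn" "?I r e s' \<and> nvar s' ''e'' = e"
      show "bval (RLess (RNat (NVar ''e'')) (RVar ''J'')) s'" using e lt[of e] by simp
      show "Wp n F (iter_cost + 1 + 1) ?inner s' (\<lambda>s'. ?I r (Suc e) s' \<and> nvar s' ''e'' = Suc e) ?pot (?pot s')"
      proof (rule Wp_Seq[OF Wp_iter])
        show "sinv q0 s'" using e by blast
        fix s2 :: state assume "sinv q0 s2 \<and> length (out s2) = Suc (length (out s')) \<and> nvar s2 ''v'' = nvar s' ''v'' \<and> nvar s2 ''r'' = nvar s' ''r'' \<and>
           nvar s2 ''e'' = nvar s' ''e'' \<and> rvar s2 ''J'' = rvar s' ''J''"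
        then show "Wp n F 1 (NAssign ''e'' (NAdd (NVar ''e'') (NConst 1))) s2 (\<lambda>s'. ?I r (Suc e) s' \<and> nvar s' ''e'' = Suc e) ?pot (?pot s2)"
          by (intro Wp_NAssign) (use e in \<open>simp_all add: sinv_n pot_def\<close>)
      qed
    next
      fix s' assume "?I r Jn s' \<and> nvar s' ''e'' = Jn"
      then show "\<not> bval (RLess (RNat (NVar ''e'')) (RVar ''J'')) s'" using lt[of Jn] by simp
    qed (use s1 in \<open>auto simp: sinv_n sinv_t pot_def\<close>)
    then show "Wp n F (Jn * ((iter_cost + 1 + 1) + 2) + 1) (While (RLess (RNat (NVar ''e'')) (RVar ''J'')) ?inner) ?s2 (?I r Jn) ?pot (?pot s1)"
      by (rule Wp_weaken) (auto simp: pot_def)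
  qed
  let ?s0 = "s\<lparr>nvar := (nvar s)(''r'' := nval (NConst 0) s), ticks := 0\<rparr>"
  let ?ct = "Jn * ((iter_cost + 1 + 1) + 2) + 1 + 2"
  have "Wp n F (cnt * ((?ct + 1 + 1) + 2) + 1 + 2) main_com s (?I cnt 0) ?pot (?pot s)"
    unfolding main_com_def
  proof (rule Wp_Seq_NAssign)
    have "Wp n F (cnt * ((?ct + 1 + 1) + 2) + 1) (While (NLess (NVar ''r'') (NVar ''v''))
     (Seq (Seq (NAssign ''e'' (NConst 0)) (While (RLess (RNat (NVar ''e'')) (RVar ''J'')) ?inner))
      (NAssign ''r'' (NAdd (NVar ''r'') (NConst 1))))) ?s0 (?I cnt 0) ?pot (?pot ?s0)"
    proof (rule Wp_While[where I = "\<lambda>r. ?I r 0" and \<phi> = "\<lambda>_. ?pot"])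
      fix r and s' :: state assume r: "r < cnt" "?I r 0 s'"
      then show "bval (NLess (NVar ''r'') (NVar ''v'')) s'" by simp
      show "Wp n F (?ct + 1 + 1) (Seq (Seq (NAssign ''e'' (NConst 0)) (While (RLess (RNat (NVar ''e'')) (RVar ''J'')) ?inner))
      (NAssign ''r'' (NAdd (NVar ''r'') (NConst 1)))) s' (?I (Suc r) 0) ?pot (?pot s')"
      proof (rule Wp_Seq[OF inner[OF r(2)]])
        fix s2 :: state assume "?I r Jn s2"
        then show "Wp n F 1 (NAssign ''r'' (NAdd (NVar ''r'') (NConst 1))) s2 (?I (Suc r) 0) ?pot (?pot s2)"
          by (intro Wp_NAssign) (simp_all add: sinv_n pot_def)
      qed
    qed (use I in \<open>auto simp: sinv_n sinv_t pot_def\<close>)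
    then show "Wp n F (cnt * ((?ct + 1 + 1) + 2) + 1) (While (NLess (NVar ''r'') (NVar ''v''))
     (Seq (Seq (NAssign ''e'' (NConst 0)) (While (RLess (RNat (NVar ''e'')) (RVar ''J'')) ?inner))
      (NAssign ''r'' (NAdd (NVar ''r'') (NConst 1))))) ?s0 (?I cnt 0) ?pot (?pot s)" by (simp only: pot_t)
  qed
  then show ?thesis by (rule Wp_weaken) (auto simp: algebra_simps)
qed

end

lemma Wp_scale:
  assumes "Wp n F t c s Q \<phi> r"
  shows "Wp n F t c s Q (\<lambda>s'. d * \<phi> s') (d * r)"
  unfolding Wp_def
proof
  fix x
  obtain D where D: "run n F t (c, s\<lparr>ticks := x\<rparr>) = map_pmf (Pair SKIP) D"
     "\<forall>s'\<in>set_pmf D. Q (s'\<lparr>ticks := 0\<rparr>) \<and> ticks s' \<le> x + t"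
     "(\<integral>\<^sup>+s'. \<phi> (s'\<lparr>ticks := 0\<rparr>) \<partial>measure_pmf D) \<le> r"
    using assms unfolding Wp_def by blast
  have "(\<integral>\<^sup>+s'. d * \<phi> (s'\<lparr>ticks := 0\<rparr>) \<partial>measure_pmf D) = d * (\<integral>\<^sup>+s'. \<phi> (s'\<lparr>ticks := 0\<rparr>) \<partial>measure_pmf D)"
    by (subst nn_integral_cmult) auto
  also have "\<dots> \<le> d * r" using D(3) by (rule mult_left_mono) simp
  finally show "\<exists>D. run n F t (c, s\<lparr>ticks := x\<rparr>) = map_pmf (Pair SKIP) D \<and>
     (\<forall>s'\<in>set_pmf D. Q (s'\<lparr>ticks := 0\<rparr>) \<and> ticks s' \<le> x + t) \<and>
     (\<integral>\<^sup>+s'. d * \<phi> (s'\<lparr>ticks := 0\<rparr>) \<partial>measure_pmf D) \<le> d * r"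
    using D(1,2) by blast
qed

context sampler begin

lemma P1_nonneg: "0 \<le> P1 Y T" and P2_nonneg: "0 \<le> P2 Y A T"
  unfolding P1_def P2_def by (intro mult_nonneg_nonneg prod_nonneg sum_nonneg; auto intro: add_nonneg_nonneg)+

lemma pot_nonneg: "0 \<le> pot s" unfolding pot_def using P1_nonneg P2_nonneg by (intro add_nonneg_nonneg)

text \<open>\<open>\<theta>\<close> makes every factor \<open>1 + 1 / 2 ^ l\<close>, so the product
  over \<open>2 ^ l\<close> factors is at most \<open>exp 1\<close>; the second potential starts
  with \<open>2 ^ l\<close> terms equal to 1.\<close>

lemma pot_start:
  assumes "rarr s ''Y'' = (\<lambda>_. 0)" "out s = []" and \<theta>: "\<theta> = real l * ln 2 / \<eta>"
  shows "pot s \<le> 3 + 2 ^ l"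
proof -
  have "- \<eta> * \<theta> = - (real l * ln 2)" using \<eta>_pos by (simp add: \<theta>)
  then have e: "exp (- \<eta> * \<theta>) = 1 / 2 ^ l"
    by (simp add: exp_minus exp_of_nat_mult inverse_eq_divide)
  have "P1 (\<lambda>_. 0) 0 = (1 + 1 / 2 ^ l) ^ (2 ^ l)" using e by (simp add: P1_def)
  also have "\<dots> \<le> exp (1 / 2 ^ l) ^ (2 ^ l)" by (intro power_mono) (auto simp: add_nonneg_nonneg)
  also have "\<dots> = exp 1" by (simp add: exp_of_nat_mult[symmetric])
  also have "\<dots> \<le> 3" using e_less_272 by simp
  finally have "P1 (\<lambda>_. 0) 0 \<le> 3" .
  moreover have "P2 (\<lambda>_. 0) (Acc []) 0 = 2 ^ l" by (simp add: P2_def Acc_def)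
  ultimately show ?thesis using assms(1,2) by (simp add: pot_def)
qed

lemma certificate:
  fixes k :: nat and m \<delta> \<phi> \<sigma> h :: real
  assumes I: "sinv q0 s" "out s \<noteq> []" and k: "k > 0" and m: "m > 0" and \<delta>: "0 < \<delta>" "\<delta> \<le> \<phi>" "\<phi> \<le> Kb" and fs: "- \<phi> \<le> fs" and \<sigma>: "\<sigma> \<ge> 0"
    and T: "2688 * (\<sigma> + 2) * (real l + 1) * m * k\<^sup>2 * Kb\<^sup>2 / \<delta>\<^sup>2 \<le> real (length (out s))"
    and \<epsilon>: "\<epsilon> = \<delta> / (24 * k)" and Zb: "Zb = 2 * m * Kb" and \<nu>: "\<nu> = \<delta> / (64 * k * Kb)"
    and \<theta>: "\<theta> = real l * ln 2 / \<eta>"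
    and ev: "pot s < exp (\<sigma> * (real l + 1))"
    and light: "\<And>b S. b < 2 ^ l \<Longrightarrow> S \<noteq> {} \<Longrightarrow> S \<subseteq> set (blk sz b) \<Longrightarrow> card S \<le> k + 1 \<Longrightarrow> G (set (blk sz b) - S) \<le> h"
    and h: "real (k + 1) * h \<le> \<delta> / 2" "0 \<le> h"
  shows "dual_certificate V f \<delta> k (average_greedy V f v (out s))"
proof -
  define ws where "ws = out s"
  define T where "T = length ws"
  define Y where "Y = rarr s ''Y''"
  have inv: "\<forall>w\<in>set ws. \<exists>bs. distinct bs \<and> set bs = {..<2 ^ l} \<and> w = flat n sz bs" "\<forall>p<2 ^ l. Y p \<le> real T * U p"
    using I by (auto simp: sinv_def ws_def T_def Y_def)
  have "\<forall>t. \<exists>bs. t < T \<longrightarrow> distinct bs \<and> set bs = {..<2 ^ l} \<and> ws ! t = flat n sz bs"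
    using inv(1) by (auto simp: T_def)
  then obtain bs where bs: "\<And>t. t < T \<Longrightarrow> distinct (bs t) \<and> set (bs t) = {..<2 ^ l} \<and> ws ! t = flat n sz (bs t)" by metis
  have Acc: "real T * U p - Acc ws p = (\<Sum>t<T. marg H {} (bs t) p)" if "p < 2 ^ l" for p
  proof -
    have "Acc ws p = (\<Sum>t<T. U p - bsum (ws ! t) p)"
      unfolding Acc_def T_def by (simp add: sum_list_sum_nth atLeast0LessThan)
    also have "\<dots> = (\<Sum>t<T. U p - marg H {} (bs t) p)"
      by (intro sum.cong refl) (use bs bsum_flat that in auto)
    finally show ?thesis by (simp add: sum_subtractf)
  qed
  have \<gamma>': "\<gamma> = 2 * \<nu> / Zb" using \<gamma>(2) Zb_pos by (simp add: field_simps)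
  show ?thesis
    unfolding ws_def[symmetric]
  proof (rule dual_certificate_from_blocks[where N = "2 ^ l" and el = "blk sz" and bs = bs and T = T])
    show "0 < T" using I(2) by (simp add: T_def ws_def)
    show "real T * (fs - \<delta> / 2) \<le> (\<Sum>b\<in>S. \<Sum>t<T. marg H {} (bs t) b)" if S: "S \<subseteq> {..<2 ^ l}" "card S \<le> k + 1" for S
    proof -
      have "real T * (fs - \<delta> / 2) \<le> (\<Sum>p\<in>S. real T * U p - Acc ws p)"
      proof (rule certificate_from_event[where I = "{..<2 ^ l}" and U = U and c = "\<lambda>p. real T * U p - Y p" and v = m and \<phi> = \<phi> and K = Kb and
          \<sigma> = \<sigma> and l = l and k = k and \<theta> = \<theta>, OF k m \<delta> fs \<sigma> _ \<epsilon> Zb \<eta>_def \<nu> \<gamma>' \<theta>])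
        show "2688 * (\<sigma> + 2) * (real l + 1) * m * real (k\<^sup>2) * Kb\<^sup>2 / \<delta>\<^sup>2 \<le> real T" using assms(10) by (simp add: T_def ws_def)
        have ps: "pot s = P1 Y (real T) + P2 Y (Acc ws) (real T)" by (simp add: pot_def Y_def T_def ws_def)
        show "(\<Prod>p<2 ^ l. 1 + exp (- \<eta> * (real T * U p - (real T * U p - Y p) + \<epsilon> * real T + \<theta>))) * exp (\<eta> * real T * (fs - \<epsilon>))
            < exp (\<sigma> * (real l + 1))"
          using ev P2_nonneg[of Y "Acc ws" "real T"] unfolding ps P1_def by simp
        show "exp (\<gamma> * (1 - \<nu>) * Acc ws p - \<gamma> * (real T * U p - Y p)) < exp (\<sigma> * (real l + 1))" if "p \<in> {..<2 ^ l}" for p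
        proof -
          have "exp (\<gamma> * (1 - \<nu>) * Acc ws p - \<gamma> * (real T * U p - Y p)) \<le> P2 Y (Acc ws) (real T)"
            unfolding P2_def by (rule member_le_sum[OF that]) auto
          then show ?thesis using ev P1_nonneg[of Y "real T"] unfolding ps by linarith
        qed
        show "U p \<le> Kb" for p using U_bound[of p] by linarith
      qed (use inv S in auto)
      also have "\<dots> = (\<Sum>b\<in>S. \<Sum>t<T. marg H {} (bs t) b)" by (rule sum.cong) (use Acc S in auto)
      finally show ?thesis .
    qed
    show "ws ! t = filter (\<lambda>y. y < n) (concat (map (blk sz) (bs t)))" if "t < T" for t
      using bs[OF that] by (simp add: flat_def)
  qed (use n_le blk_disjoint blk_union bs light h in \<open>auto simp: blk_def T_def\<close>)
qed

end

section \<open>Sampler parameters from a finished partition\<close>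

context sfm begin

text \<open>Singletons have value at most \<open>Kb\<close>, larger blocks less than
  \<open>z \<le> \<phi> \<le> Kb\<close>, and no value lies below the minimum, so \<open>U\<close>
  is bounded by \<open>Kb\<close> in absolute value. With at most \<open>cnt\<close> blocks,
  \<open>S \<le> cnt * Kb\<close>; subtracting \<open>f V\<close> adds at most \<open>Kb\<close>,
  which is where the 2 in \<open>Zb\<close> comes from.\<close>

lemma sampler_of_pst:
  assumes l: "n \<le> 2 ^ l" and p: "pst l z 0 (2 ^ l) sz acc U S cnt" and z: "z \<le> \<phi>"
    and u: "\<And>x. 0 \<le> G {x}" "\<And>x. G {x} \<le> Kb" and fs: "- \<phi> \<le> min_value V f" and \<phi>: "\<phi> \<le> Kb"
    and \<epsilon>: "0 < \<epsilon>" "\<epsilon> \<le> Kb" and Zb: "Zb = 2 * real cnt * Kb" and \<eta>: "\<eta> = \<epsilon> / (7 * Zb * Kb)"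
    and \<nu>: "0 \<le> \<nu>" "\<nu> \<le> 1 / 2" and \<gamma>: "\<gamma> = 2 * \<nu> / Zb"
  shows "sampler V f v Kb Zb \<epsilon> \<eta> sz U l (S - f V) \<gamma> \<nu>" "1 \<le> cnt"
proof -
  have K0: "0 < Kb" using \<epsilon> by linarith
  have inb: "b + sz b \<le> 2 ^ l" if sb: "sz b > 0" for b
  proof -
    obtain h where h: "h \<le> l" "sz b = 2 ^ h" "2 ^ h dvd b" "b < 2 ^ l" using pstD(2)[OF p sb] by blast
    obtain c where c: "b = 2 ^ h * c" using h(3) by blast
    have N: "(2::nat) ^ l = 2 ^ h * 2 ^ (l - h)" using h(1) by (simp add: power_add[symmetric])
    have "c < 2 ^ (l - h)" using h(4) unfolding N c by simp
    then have "c + 1 \<le> 2 ^ (l - h)" by simp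
    then have "2 ^ h * (c + 1) \<le> 2 ^ h * (2::nat) ^ (l - h)" by (rule mult_left_mono) simp
    then have "2 ^ h * c + 2 ^ h \<le> 2 ^ h * (2::nat) ^ (l - h)" by simp
    then show ?thesis unfolding h(2) by (simp only: N c)
  qed
  have un: "(\<Union>b<2 ^ l. set (blk sz b)) = {..<2 ^ l}"
  proof (intro equalityI subsetI)
    fix x assume "x \<in> (\<Union>b<2 ^ l. set (blk sz b))"
    then obtain b where b: "b \<le> x" "x < b + sz b" by (auto simp: blk_def)
    then have "b + sz b \<le> 2 ^ l" by (intro inb) simp
    then show "x \<in> {..<2 ^ l}" using b by simp
  next
    fix x :: nat assume x: "x \<in> {..<2 ^ l}"
    \<comment> \<open>An uncovered element would be a rejected node of height 0, and rejected nodes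
      have \<open>0 < h\<close>.\<close>
    then have "acc x \<noteq> 0" using pstD(11)[OF p, of x] by auto
    then obtain b where b: "b \<le> x" "x < b + sz b" using pstD(3)[OF p] by blast
    then show "x \<in> (\<Union>b<2 ^ l. set (blk sz b))" using x by (auto simp: blk_def intro!: bexI[of _ b])
  qed
  have Ueq: "U b = G (set (blk sz b))" for b
    using pstD(5,6)[OF p, of b] by (cases "sz b = 0") (simp_all add: blk_def)
  have Ule: "U b \<le> Kb" for b
  proof -
    consider "sz b = 0" | "sz b = 1" | "sz b > 1" by linarith
    then show ?thesis
    proof cases
      case 2
      then have "{b..<b + sz b} = {b}" by auto
      then show ?thesis using Ueq[of b] u(2)[of b] by (simp add: blk_def)
    qed (use pstD(5,7)[OF p, of b] z \<phi> K0 in auto)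
  qed
  have Ub: "\<bar>U b\<bar> \<le> Kb" for b
    using Ule[of b] min_value_le_G[of "set (blk sz b)"] fs \<phi> by (simp add: Ueq)
  let ?B = "{b. b < 2 ^ l \<and> sz b > 0}"
  have cc: "card ?B \<le> cnt" by (rule pstD(9)[OF p])
  have "0 \<in> (\<Union>b<2 ^ l. set (blk sz b))" unfolding un by simp
  then have "?B \<noteq> {}" by (auto simp: blk_def intro!: exI[of _ 0])
  then have "card ?B > 0" by (simp add: card_gt_0_iff)
  then show c1: "1 \<le> cnt" using cc by simp
  have Sle: "S \<le> real cnt * Kb"
  proof -
    have "S = (\<Sum>b<2 ^ l. U b)" by (rule pstD(8)[OF p])
    also have "\<dots> = (\<Sum>b\<in>?B. U b)" using pstD(5)[OF p] by (intro sum.mono_neutral_right) auto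
    also have "\<dots> \<le> (\<Sum>b\<in>?B. Kb)" by (intro sum_mono Ule)
    also have "\<dots> = real (card ?B) * Kb" by simp
    also have "\<dots> \<le> real cnt * Kb" using cc K0 by (intro mult_right_mono) auto
    finally show ?thesis .
  qed
  have fV: "G {..<2 ^ l} = f V"
  proof -
    have "{..<2 ^ l} \<inter> {..<n} = {..<n}" using l by auto
    then show ?thesis by (simp add: G_def v_image)
  qed
  have K1: "Kb \<le> real cnt * Kb" using c1 K0 by simp
  have Zb0: "0 < Zb" using K0 c1 by (simp add: Zb)
  show "sampler V f v Kb Zb \<epsilon> \<eta> sz U l (S - f V) \<gamma> \<nu>"
  proof unfold_locales
    show "set (blk sz b) \<inter> set (blk sz c) = {}" if "b \<noteq> c" for b c using pstD(4)[OF p that] by (simp add: blk_def)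
    show "sz b \<le> 2 ^ l" for b using inb[of b] by (cases "sz b = 0") auto
    show "S - f V = (\<Sum>b<2 ^ l. U b) - G {..<2 ^ l}" using pstD(8)[OF p] fV by simp
    show "S - f V \<le> Zb" using Sle K1 min_value_le_G[of "{..<2 ^ l}"] fs \<phi> unfolding fV Zb by linarith
    show "2 * Kb \<le> Zb" using K1 by (simp add: Zb)
    show "\<gamma> * Zb = 2 * \<nu>" using Zb0 by (simp add: \<gamma>)
    show "0 \<le> \<gamma>" using Zb0 \<nu> by (simp add: \<gamma>)
    show "- Kb \<le> min_value V f" using fs \<phi> by simp
  qed (use l un Ueq Ub \<epsilon> \<eta> \<nu> in auto)
qed

end

text \<open>From \<open>k + 2 \<le> 3 * k\<close> and \<open>C1 \<ge> 12 * (C + 2)\<close> the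
  survival probability of a bad node is at most \<open>exp (- (C + 2) * (l + 1))\<close>. The
  factors in front cost \<open>exp (2 * (l + 1))\<close>, and \<open>ln n \<le> l + 1\<close> turns
  the remaining \<open>exp (- C * (l + 1))\<close> into the power of \<open>n\<close>.\<close>

lemma failure_bound:
  fixes C :: real
  assumes k: "k > 0" and C1: "12 * (C + 2) \<le> real C1" and C: "0 < C" and n: "1 \<le> n" "n \<le> 2 ^ l"
  shows "(1 - 1 / (4 * real (k + 2))) ^ (C1 * ((l + 1) * k)) * real ((l + 1) * 2 ^ l) + (3 + 2 ^ l) * exp (- (C + 2) * (real l + 1))
    \<le> real n powr - C"
proof -
  let ?e = "exp (- (C + 2) * (real l + 1))"
  let ?K = "C1 * ((l + 1) * k)"
  have "(1 - 1 / (4 * real (k + 2))) ^ ?K \<le> exp (- (1 / (4 * real (k + 2)))) ^ ?K"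
    using exp_ge_add_one_self[of "- (1 / (4 * real (k + 2)))"] by (intro power_mono) (auto simp: field_simps)
  also have "\<dots> = exp (- (real ?K / (4 * real (k + 2))))" by (simp only: exp_of_nat_mult[symmetric]) simp
  also have "\<dots> \<le> ?e"
  proof -
    have "12 * (C + 2) * (real (l + 1) * real k) \<le> real C1 * (real (l + 1) * real k)"
      using C1 by (intro mult_right_mono) auto
    moreover have "(C + 2) * (real l + 1) * (4 * real (k + 2)) \<le> (C + 2) * (real l + 1) * (12 * real k)"
      using k C by (intro mult_left_mono) auto
    ultimately have "(C + 2) * (real l + 1) * (4 * real (k + 2)) \<le> real ?K" by (simp add: algebra_simps)
    then have "(C + 2) * (real l + 1) \<le> real ?K / (4 * real (k + 2))" by (simp add: pos_le_divide_eq)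
    then show ?thesis by (simp only: exp_le_cancel_iff mult_minus_left neg_le_iff_le)
  qed
  finally have "(1 - 1 / (4 * real (k + 2))) ^ ?K * real ((l + 1) * 2 ^ l) \<le> ?e * real ((l + 1) * 2 ^ l)"
    by (rule mult_right_mono) simp
  then have "(1 - 1 / (4 * real (k + 2))) ^ ?K * real ((l + 1) * 2 ^ l) + (3 + 2 ^ l) * ?e \<le> (real (l + 1) * 2 ^ l + 3 + 2 ^ l) * ?e"
    by (simp add: algebra_simps)
  also have "\<dots> \<le> exp (2 * (real l + 1)) * ?e"
  proof (rule mult_right_mono)
    have l1: "real (l + 1) \<le> 2 ^ l"
    proof -
      have "l + 1 \<le> 2 ^ l" by (simp only: Suc_eq_plus1[symmetric] Suc_le_eq less_exp)
      then have "real (l + 1) \<le> real (2 ^ l)" by (rule of_nat_mono)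
      then show ?thesis by simp
    qed
    have e2: "2 \<le> exp (1::real)" using exp_ge_add_one_self[of 1] by simp
    have aux: "a * x + 3 + x \<le> 5 * (x * x)" if "1 \<le> x" "a \<le> x" for a x :: real
    proof -
      have "a * x \<le> x * x" "1 * x \<le> x * x" using that by (auto intro!: mult_right_mono)
      then show ?thesis using that by linarith
    qed
    have "real (l + 1) * 2 ^ l + 3 + 2 ^ l \<le> 5 * (2 ^ l * 2 ^ l)" by (rule aux[OF _ l1]) simp
    also have "\<dots> \<le> exp 2 * (exp (real l) * exp (real l))"
    proof (intro mult_mono)
      have "(5::real) \<le> 1 + 2 + 2\<^sup>2 / 2" by simp
      also have "\<dots> \<le> exp 2" by (rule exp_lower_Taylor_quadratic) simp
      finally show "(5::real) \<le> exp 2" .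
      have "(2::real) ^ l \<le> exp 1 ^ l" using e2 by (intro power_mono) auto
      then show "(2::real) ^ l \<le> exp (real l)" "(2::real) ^ l \<le> exp (real l)" by (simp_all add: exp_of_nat_mult[symmetric])
    qed auto
    also have "\<dots> = exp (2 * (real l + 1))" by (simp add: exp_add[symmetric] algebra_simps)
    finally show "real (l + 1) * 2 ^ l + 3 + 2 ^ l \<le> exp (2 * (real l + 1))" .
  qed simp
  also have "\<dots> = exp (- C * (real l + 1))" by (simp add: exp_add[symmetric] algebra_simps)
  also have "\<dots> \<le> exp (- C * ln (real n))"
  proof -
    have "real n \<le> real (2 ^ l)" using n(2) by (rule of_nat_mono)
    then have "ln (real n) \<le> ln (2 ^ l)" using n(1) by (subst ln_le_cancel_iff) auto
    also have "\<dots> = real l * ln 2" by (simp add: ln_realpow)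
    also have "\<dots> \<le> real l * 1" using ln_le_minus_one[of 2] by (intro mult_left_mono) auto
    finally have "ln (real n) \<le> real l + 1" by simp
    then show ?thesis using C by simp
  qed
  also have "\<dots> = real n powr - C" using n(1) by (simp add: powr_def)
  finally show ?thesis .
qed

section \<open>Running time, number of visits, and the union bound\<close>

context sfm begin

lemma cost_bound:
  assumes u: "\<And>x. 0 \<le> G {x}" and n: "n \<le> 2 ^ l" and J: "K + 1 \<le> J"
    and ic: "ic = 2 ^ l * (6 * 2 ^ l + 12) + 2 ^ l * (10 * 2 ^ l + 12) + l * (6 * n + 22) + 5 * 2 ^ l + n + 40"
  shows "8 * l + 20 + 1 + (partition_cost l K + 1 + (6 * n + 7 + 1 + ((l + 1) * 2 ^ l * (J * (ic + 4) + 7) + 3))) \<le> 1000 * J * (2 ^ l) ^ 4"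
proof -
  define N where "N = (2::nat) ^ l"
  \<comment> \<open>All costs are compared with the monomials \<open>J * N ^ i\<close>.\<close>
  define P where "P i = J * N ^ i" for i
  have N1: "1 \<le> N" and nN: "n \<le> N" using n by (simp_all add: N_def)
  have lN: "l + 1 \<le> N" by (simp only: N_def Suc_eq_plus1[symmetric] Suc_le_eq less_exp)
  have Ps: "N * P i = P (Suc i)" for i by (simp add: P_def)
  have J1: "1 \<le> J" using J by simp
  have Pm: "P i \<le> P (Suc i)" for i unfolding Ps[symmetric] using N1 by simp
  have P0: "1 \<le> P 0" "N \<le> P 1" using J1 by (simp_all add: P_def)
  have m: "P 0 \<le> P 1" "P 1 \<le> P 2" "P 2 \<le> P 3" "P 3 \<le> P 4" using Pm[of 0] Pm[of 1] Pm[of 2] Pm[of 3] by (simp_all add: eval_nat_numeral)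
  have s: "N * P 1 = P 2" "N * P 2 = P 3" "N * P 3 = P 4" using Ps[of 1] Ps[of 2] Ps[of 3] by (simp_all add: eval_nat_numeral)
  have "K * (8 * n + 20) \<le> J * (28 * N)" using J nN N1 by (intro mult_le_mono) auto
  also have "\<dots> = 28 * P 1" by (simp add: P_def)
  \<comment> \<open>Outside their context the cost definitions carry its premises; the instance
    \<open>z = 1\<close> discharges them.\<close>
  finally have v: "visit_cost l K \<le> 79 * P 1" unfolding visit_cost_def[OF zero_less_one u refl] N_def[symmetric] using P0 m nN by linarith
  have "N * (visit_cost l K + 5) \<le> N * (84 * P 1)" using v P0 m by (intro mult_le_mono2) linarith
  also have "\<dots> = 84 * P 2" using s by simp
  finally have lv: "level_cost l K \<le> 91 * P 2" unfolding level_cost_def[OF zero_less_one u refl] N_def[symmetric] using P0 m by linarith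
  have "(l + 1) * (level_cost l K + 2) \<le> N * (93 * P 2)" using lv lN P0 m by (intro mult_le_mono) auto
  also have "\<dots> = 93 * P 3" using s by simp
  finally have pc: "partition_cost l K \<le> 96 * P 3" unfolding partition_cost_def[OF zero_less_one u refl] using P0 m by linarith
  have NN: "N \<le> N * N" "1 \<le> N * N" using N1 by auto
  have "N * (6 * N + 12) \<le> N * (18 * N)" "N * (10 * N + 12) \<le> N * (22 * N)" "l * (6 * n + 22) \<le> N * (28 * N)"
    using N1 lN nN by (intro mult_le_mono; simp)+
  then have "ic \<le> 114 * (N * N)" unfolding ic N_def[symmetric] using NN nN by linarith
  then have "J * (ic + 4) \<le> J * (118 * (N * N))" using NN by (intro mult_le_mono2) linarith
  also have "\<dots> = 118 * P 2" by (simp add: P_def power2_eq_square)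
  finally have "J * (ic + 4) + 7 \<le> 125 * P 2" using P0 m by linarith
  then have "(l + 1) * N * (J * (ic + 4) + 7) \<le> N * N * (125 * P 2)" using lN by (intro mult_le_mono) auto
  also have "\<dots> = 125 * (N * (N * P 2))" by (simp add: algebra_simps)
  also have "\<dots> = 125 * P 4" using s by simp
  finally have "8 * l + 20 + 1 + (partition_cost l K + 1 + (6 * n + 7 + 1 + ((l + 1) * N * (J * (ic + 4) + 7) + 3))) \<le> 1000 * P 4"
    using pc P0 m lN nN by linarith
  then show ?thesis by (simp add: P_def N_def)
qed

lemma G_singleton:
  assumes "\<forall>p\<in>V. 0 \<le> singleton_vec f p"
  shows "0 \<le> G {x}" "G {x} \<le> norm_inf V (singleton_vec f)"
proof -
  have fin: "finite (insert 0 ((\<lambda>p. \<bar>singleton_vec f p\<bar>) ` V))" using finite_V by simp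
  have "0 \<le> norm_inf V (singleton_vec f)" unfolding norm_inf_def using Max_ge[OF fin, of 0] by simp
  moreover have "singleton_vec f p \<le> norm_inf V (singleton_vec f)" if "p \<in> V" for p
    unfolding norm_inf_def using Max_ge[OF fin, of "\<bar>singleton_vec f p\<bar>"] that by auto
  moreover have "v x \<in> V" if "x < n" using that v_image by auto
  moreover have "G {x} = (if x < n then singleton_vec f (v x) else 0)" by (simp add: G_def singleton_vec_def f_empty)
  ultimately show "0 \<le> G {x}" "G {x} \<le> norm_inf V (singleton_vec f)" using assms by auto
qed

lemma sum_G_singleton:
  assumes "\<forall>p\<in>V. 0 \<le> singleton_vec f p" "n \<le> N"
  shows "(\<Sum>x<N. G {x}) = norm1 V (singleton_vec f)"
proof -
  have "(\<Sum>x<N. G {x}) = (\<Sum>x<n. G {x})"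
    using assms(2) by (intro sum.mono_neutral_right) (auto simp: G_def f_empty)
  also have "\<dots> = (\<Sum>x<n. singleton_vec f (v x))" by (intro sum.cong) (auto simp: G_def singleton_vec_def)
  also have "\<dots> = (\<Sum>p\<in>V. singleton_vec f p)" by (rule sum.reindex_bij_betw[OF bij_v])
  also have "\<dots> = norm1 V (singleton_vec f)" unfolding norm1_def using assms(1) by (intro sum.cong) auto
  finally show ?thesis .
qed

text \<open>The last level is charged with twice the total weight, like the finished ones; this
  turns the factor \<open>l - 1\<close> into \<open>l\<close>.\<close>

lemma pst_final_count:
  assumes p: "pst l z 0 (2 ^ l) sz acc U S cnt" and z: "0 < z" and u: "\<And>x. 0 \<le> G {x}"
  shows "z * real cnt \<le> z + 2 * real l * (\<Sum>x<2 ^ l. G {x})" "cnt \<le> (l + 1) * 2 ^ l"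
proof -
  have S0: "0 \<le> (\<Sum>x<2 ^ l. G {x})" using u by (intro sum_nonneg) auto
  have B: "z * real cnt \<le> z * of_bool (0 < l \<or> 0 < (2::nat) ^ l) + real (l - 1 - 0) * (2 * (\<Sum>x<2 ^ l. G {x})) +
       (if 0 < l then \<Sum>j<2 ^ l. node_sum (Suc 0) (j div 2) else 0)" by (rule pstD(12)[OF p])
  show "z * real cnt \<le> z + 2 * real l * (\<Sum>x<2 ^ l. G {x})"
  proof (cases l)
    case 0 then show ?thesis using B z by simp
  next
    case (Suc l')
    have "(\<Sum>j<2 ^ l. node_sum (Suc 0) (j div 2)) = 2 * (\<Sum>j<2 ^ (l - 1). node_sum (Suc 0) j)"
      by (simp add: Suc sum_div_two)
    also have "\<dots> = 2 * (\<Sum>x<2 ^ l. G {x})" using sum_node_sum[of "Suc 0" l] Suc by simp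
    finally show ?thesis using B Suc by (simp add: algebra_simps)
  qed
  show "cnt \<le> (l + 1) * 2 ^ l" using pstD(13)[OF p] by simp
qed

text \<open>A pointwise union bound: without a certificate either a bad block was accepted and
  \<open>bad_count\<close> is at least 1, or the potential has reached
  \<open>exp (\<sigma> * (l + 1))\<close> and its scaled value is at least 1, as in Markov's
  inequality.\<close>

lemma certificate_or_bad:
  fixes k :: nat and m \<delta> \<phi> \<sigma> z Kb Zb \<epsilon> \<eta> Z \<gamma> \<nu> \<theta> :: real
  assumes samp: "sampler V f v Kb Zb \<epsilon> \<eta> sz U l Z \<gamma> \<nu>"
    and I: "sampler.sinv V sz U l Z q0 s" "out s \<noteq> []" and k: "k > 0" and m: "m > 0"
    and \<delta>: "0 < \<delta>" "\<delta> \<le> \<phi>" "\<phi> \<le> Kb" and fs: "- \<phi> \<le> min_value V f" and \<sigma>: "\<sigma> \<ge> 0"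
    and T: "2688 * (\<sigma> + 2) * (real l + 1) * m * real (k\<^sup>2) * Kb\<^sup>2 / \<delta>\<^sup>2 \<le> real (length (out s))"
    and eps: "\<epsilon> = \<delta> / (24 * k)" and Zb_eq: "Zb = 2 * m * Kb" and nu: "\<nu> = \<delta> / (64 * k * Kb)"
    and theta: "\<theta> = real l * ln 2 / \<eta>" and z: "z = \<delta> / (2 * (real (k + 1) * real (k + 2)))"
  shows "of_bool (\<not> dual_certificate V f \<delta> k (average_greedy V f v (out s))) \<le>
    bad_count k z l sz + exp (- \<sigma> * (real l + 1)) * sampler.pot V f v \<epsilon> \<eta> sz U l \<gamma> \<nu> \<theta> s"
proof -
  interpret sampler V f v Kb Zb \<epsilon> \<eta> sz U l Z \<gamma> \<nu> \<theta> by (rule samp)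
  let ?e = "exp (- \<sigma> * (real l + 1))"
  have b0: "0 \<le> bad_count k z l sz" by (rule bad_count_nonneg)
  have ep0: "0 \<le> ?e * pot s" using pot_nonneg by simp
  consider "\<exists>b<2 ^ l. sz b > 0 \<and> bad k z b (sz b)" | "exp (\<sigma> * (real l + 1)) \<le> pot s"
    | "\<not> (\<exists>b<2 ^ l. sz b > 0 \<and> bad k z b (sz b))" "pot s < exp (\<sigma> * (real l + 1))" using not_less by blast
  then show ?thesis
  proof cases
    case 1
    then obtain b where b: "b < 2 ^ l" "sz b > 0 \<and> bad k z b (sz b)" by blast
    have "of_bool (sz b > 0 \<and> bad k z b (sz b)) \<le> bad_count k z l sz"
      unfolding bad_count_def by (rule member_le_sum) (use b in auto)
    then show ?thesis using b ep0 by (auto simp: of_bool_def)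
  next
    case 2
    have "1 = ?e * exp (\<sigma> * (real l + 1))" by (simp add: exp_add[symmetric])
    also have "\<dots> \<le> ?e * pot s" using 2 by (intro mult_left_mono) auto
    finally show ?thesis using b0 by (auto simp: of_bool_def)
  next
    case 3
    have c: "a * (b * (\<delta> / (2 * (a * b)))) = \<delta> / 2" if "a \<noteq> 0" "b \<noteq> 0" for a b using that by simp
    have h: "real (k + 1) * (real (k + 2) * z) = \<delta> / 2"
      unfolding z by (rule c) (simp_all only: of_nat_eq_0_iff add_is_0 one_neq_zero zero_neq_numeral[symmetric] simp_thms)
    have "dual_certificate V f \<delta> k (average_greedy V f v (out s))"
    proof (rule certificate[where h = "real (k + 2) * z", OF I k m \<delta> fs \<sigma> T eps Zb_eq nu theta 3(2)])
      fix b S assume b: "b < 2 ^ l" "S \<noteq> {}" "S \<subseteq> set (blk sz b)" "card S \<le> k + 1"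
      then have "sz b > 0" by (auto simp: blk_def)
      then have "\<not> bad k z b (sz b)" using 3(1) b by blast
      then show "G (set (blk sz b) - S) \<le> real (k + 2) * z" using b by (auto simp: bad_def blk_def not_less)
    qed (use h \<delta> z in auto)
    then show ?thesis using b0 ep0 by simp
  qed
qed

end

section \<open>Composition of the phases\<close>

context sfm begin

text \<open>The parameters depend on the number of visits and on the blocks, which are random. The
  sampler is therefore interpreted for one fixed state after the partition, and the bad blocks of
  that state enter its failure bound as a constant.\<close>

lemma Wp_main_from_pst:
  fixes k cnt K l :: nat and \<phi> \<delta> Kb \<sigma> z J :: real
  assumes k: "k > 0" and \<delta>: "0 < \<delta>" "\<delta> \<le> \<phi>" "\<phi> \<le> Kb" and fs: "- \<phi> \<le> min_value V f" and \<sigma>: "\<sigma> \<ge> 0"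
    and u: "\<And>x. 0 \<le> G {x}" "\<And>x. G {x} \<le> Kb" and l: "n \<le> 2 ^ l"
    and z: "z = \<delta> / (2 * (real (k + 1) * real (k + 2)))"
    and J: "2688 * (\<sigma> + 2) * (real l + 1) * real (k\<^sup>2) * Kb\<^sup>2 / \<delta>\<^sup>2 \<le> J" "0 < J"
    and s: "pconst k l z K J s" "pst_of l z 0 (2 ^ l) s" "rvar s ''Z'' = rvar s ''S'' - f V"
    and ic: "ic = 2 ^ l * (6 * 2 ^ l + 12) + 2 ^ l * (10 * 2 ^ l + 12) + l * (6 * n + 22) + 5 * 2 ^ l + n + 40"
  defines "cnt \<equiv> nvar s ''v''" and "Jn \<equiv> nat \<lceil>J\<rceil>"
  shows "Wp n F ((l + 1) * 2 ^ l * (Jn * (ic + 4) + 7) + 3) main_com s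
    (\<lambda>s'. 1 \<le> cnt \<and> z * real cnt \<le> z + 2 * real l * (\<Sum>x<2 ^ l. G {x}) \<and> length (out s') = cnt * Jn \<and>
       queries s' = queries s + l * length (out s') \<and> (\<forall>w\<in>set (out s'). distinct w \<and> set w = {..<n}))
    (\<lambda>s'. of_bool (\<not> dual_certificate V f \<delta> k (average_greedy V f v (out s'))))
    (ennreal (bad_count k z l (narr s ''sz'')) + ennreal ((3 + 2 ^ l) * exp (- \<sigma> * (real l + 1))))"
proof -
  let ?e = "exp (- \<sigma> * (real l + 1))"
  define \<epsilon> where "\<epsilon> = \<delta> / (24 * real k)"
  define Zb where "Zb = 2 * real cnt * Kb"
  define \<eta> where "\<eta> = \<epsilon> / (7 * Zb * Kb)"
  define \<nu> where "\<nu> = \<delta> / (64 * real k * Kb)"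
  define \<gamma> where "\<gamma> = 2 * \<nu> / Zb"
  define \<theta> where "\<theta> = real l * ln 2 / \<eta>"
  define sz where "sz = narr s ''sz''"
  define U where "U = rarr s ''U''"
  have k1: "1 \<le> real k" using k by simp
  have K0: "0 < Kb" using \<delta> by linarith
  have kK: "Kb \<le> real k * Kb" using k1 K0 by simp
  have z0: "0 < z" unfolding z using \<delta> by simp
  have z\<phi>: "z \<le> \<phi>"
  proof -
    define X where "X = real (k + 1) * real (k + 2)"
    have "1 * 1 \<le> X" unfolding X_def by (intro mult_mono) auto
    then have X: "1 \<le> 2 * X" by linarith
    then have "\<delta> * 1 \<le> \<delta> * (2 * X)" by (rule mult_left_mono) (use \<delta>(1) in simp)
    then have "z \<le> \<delta>" unfolding z X_def[symmetric] using X by (subst pos_divide_le_eq) auto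
    then show ?thesis using \<delta> by simp
  qed
  have \<epsilon>: "0 < \<epsilon>" "\<epsilon> \<le> Kb"
  proof -
    show "0 < \<epsilon>" using \<delta> k by (simp add: \<epsilon>_def)
    have "\<delta> \<le> 24 * real k * Kb" using \<delta> kK K0 by linarith
    then show "\<epsilon> \<le> Kb" using k by (simp add: \<epsilon>_def pos_divide_le_eq mult.commute)
  qed
  have \<nu>: "0 \<le> \<nu>" "\<nu> \<le> 1 / 2"
  proof -
    show "0 \<le> \<nu>" using \<delta> K0 by (simp add: \<nu>_def)
    have "\<delta> \<le> 1 / 2 * (64 * real k * Kb)" using \<delta> kK K0 by linarith
    then show "\<nu> \<le> 1 / 2" unfolding \<nu>_def using k K0 by (subst pos_divide_le_eq) auto
  qed
  note samp = sampler_of_pst[OF l s(2) z\<phi> u fs \<delta>(3) \<epsilon> Zb_def[unfolded cnt_def] \<eta>_def \<nu> \<gamma>_def, folded s(3) sz_def U_def]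
  have c1: "1 \<le> cnt" using samp(2) by (simp add: cnt_def)
  interpret P: sampler V f v Kb Zb \<epsilon> \<eta> sz U l "rvar s ''Z''" \<gamma> \<nu> \<theta> by (rule samp(1))
  have ic': "P.iter_cost = ic" by (simp add: P.iter_cost_def ic)
  have inv: "P.sinv (queries s) s"
    unfolding P.sinv_def using s(1) by (simp add: pconst_def sz_def U_def)
  note cb = pst_final_count[OF s(2) z0 u(1), folded cnt_def]
  have out: "out s = []" "rvar s ''J'' = J" "rarr s ''Y'' = (\<lambda>_. 0)" using s(1) by (simp_all add: pconst_def)
  have 1: "Wp n F (cnt * (Jn * (ic + 4) + 7) + 3) main_com s
    (\<lambda>s'. P.sinv (queries s) s' \<and> length (out s') = cnt * Jn) (\<lambda>s'. ennreal (P.pot s')) (ennreal (P.pot s))"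
    using P.Wp_main[OF inv out(1) cnt_def[THEN meta_eq_to_obj_eq, symmetric] out(2)] unfolding ic' Jn_def by simp
  have b0: "0 \<le> bad_count k z l sz" by (rule bad_count_nonneg)
  have Jn0: "0 < Jn" using J(2) by (simp add: Jn_def)
  show ?thesis
  proof (rule Wp_weaken[OF Wp_add_const[OF Wp_scale[OF 1, of "ennreal ?e"], of "ennreal (bad_count k z l sz)"]])
    show "cnt * (Jn * (ic + 4) + 7) + 3 \<le> (l + 1) * 2 ^ l * (Jn * (ic + 4) + 7) + 3"
      using cb(2) by (intro add_right_mono mult_le_mono1)
    show "ennreal (bad_count k z l sz) + ennreal ?e * ennreal (P.pot s) \<le> ennreal (bad_count k z l (narr s ''sz'')) + ennreal ((3 + 2 ^ l) * ?e)"
    proof -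
      have "?e * P.pot s \<le> ?e * (3 + 2 ^ l)" using P.pot_start[OF out(3,1) \<theta>_def] by (intro mult_left_mono) auto
      then show ?thesis unfolding sz_def by (intro add_left_mono) (simp add: ennreal_mult'[symmetric] mult.commute ennreal_leI)
    qed
  next
    fix s' assume s': "P.sinv (queries s) s' \<and> length (out s') = cnt * Jn"
    have sv: "queries s' = queries s + l * length (out s')"
      "\<forall>w\<in>set (out s'). \<exists>bs. distinct bs \<and> set bs = {..<2 ^ l} \<and> w = flat n sz bs"
      using conjunct1[OF s'] unfolding P.sinv_def by - (elim conjE, assumption)+
    have w: "distinct w \<and> set w = {..<n}" if "w \<in> set (out s')" for w
    proof -
      obtain bs where "distinct bs" "set bs = {..<2 ^ l}" "w = flat n sz bs" using sv(2) \<open>w \<in> set (out s')\<close> by blast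
      then show ?thesis using P.flat_perm[of bs] by simp
    qed
    show "1 \<le> cnt \<and> z * real cnt \<le> z + 2 * real l * (\<Sum>x<2 ^ l. G {x}) \<and> length (out s') = cnt * Jn \<and>
       queries s' = queries s + l * length (out s') \<and> (\<forall>w\<in>set (out s'). distinct w \<and> set w = {..<n})"
      using c1 cb(1) conjunct2[OF s'] sv(1) w by (intro conjI ballI) auto
    have T: "2688 * (\<sigma> + 2) * (real l + 1) * real cnt * real (k\<^sup>2) * Kb\<^sup>2 / \<delta>\<^sup>2 \<le> real (length (out s'))"
    proof -
      have "real cnt * (2688 * (\<sigma> + 2) * (real l + 1) * real (k\<^sup>2) * Kb\<^sup>2 / \<delta>\<^sup>2) \<le> real cnt * real Jn"
        using J(1) real_nat_ceiling_ge[of J] unfolding Jn_def by (intro mult_left_mono) linarith+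
      then show ?thesis using s' by (simp add: ac_simps)
    qed
    have ne: "out s' \<noteq> []" using s' c1 Jn0 by auto
    have "of_bool (\<not> dual_certificate V f \<delta> k (average_greedy V f v (out s'))) \<le> bad_count k z l sz + ?e * P.pot s'"
    proof (rule certificate_or_bad[OF samp(1) conjunct1[OF s'] ne k _ \<delta> fs \<sigma> T])
      show "0 < real cnt" using c1 by simp
      show "\<epsilon> = \<delta> / real (24 * k)" "\<nu> = \<delta> / (real (64 * k) * Kb)" by (simp_all add: \<epsilon>_def \<nu>_def)
    qed (simp_all add: Zb_def \<theta>_def z)
    then have "ennreal (of_bool (\<not> dual_certificate V f \<delta> k (average_greedy V f v (out s')))) \<le> ennreal (bad_count k z l sz + ?e * P.pot s')"
      by (rule ennreal_leI)
    also have "\<dots> = ennreal (bad_count k z l sz) + ennreal ?e * ennreal (P.pot s')"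
      using b0 P.pot_nonneg[of s'] by (simp add: ennreal_mult' ennreal_plus)
    finally show "of_bool (\<not> dual_certificate V f \<delta> k (average_greedy V f v (out s'))) \<le> ennreal (bad_count k z l sz) + ennreal ?e * ennreal (P.pot s')"
      by (simp add: of_bool_def split: if_splits)
  qed
qed

lemma Wp_sfm_alg:
  fixes k C0 C1 :: nat and \<phi> \<delta> Kb \<sigma> :: real
  defines "l \<equiv> lg n" and "z \<equiv> \<delta> / (2 * (real (k + 1) * real (k + 2)))" and "K \<equiv> C1 * ((lg n + 1) * k)"
    and "J \<equiv> real C0 * (real (lg n) + 1) * (real k ^ 4 * \<phi>\<^sup>2) / \<delta>\<^sup>2" 
  defines "Jn \<equiv> nat \<lceil>J\<rceil>"
  assumes k: "k > 0" and \<delta>: "0 < \<delta>" "\<delta> \<le> \<phi>" "\<phi> \<le> Kb" and fs: "- \<phi> \<le> min_value V f" and \<sigma>: "\<sigma> \<ge> 0"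
    and u: "\<forall>p\<in>V. 0 \<le> singleton_vec f p" "norm_inf V (singleton_vec f) \<le> Kb"
    and J: "2688 * (\<sigma> + 2) * (real l + 1) * real (k\<^sup>2) * Kb\<^sup>2 / \<delta>\<^sup>2 \<le> J" "real K + 1 \<le> J"
  shows "Wp n F (1000 * Jn * (2 ^ l) ^ 4) (sfm_alg C0 C1) (init_state n k \<phi> \<delta>)
    (\<lambda>s. \<exists>cnt. 1 \<le> cnt \<and> z * real cnt \<le> z + 2 * real l * norm1 V (singleton_vec f) \<and> length (out s) = cnt * Jn \<and>
       queries s = cnt * (K + 1) + 1 + l * length (out s) \<and> (\<forall>w\<in>set (out s). distinct w \<and> set w = {..<n}))
    (\<lambda>s. of_bool (\<not> dual_certificate V f \<delta> k (average_greedy V f v (out s))))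
    (ennreal ((1 - 1 / (4 * real (k + 2))) ^ K * real ((l + 1) * 2 ^ l) + (3 + 2 ^ l) * exp (- \<sigma> * (real l + 1))))"
proof -
  define ic where "ic = 2 ^ l * (6 * 2 ^ l + 12) + 2 ^ l * (10 * 2 ^ l + 12) + l * (6 * n + 22) + 5 * 2 ^ l + n + 40"
  define q where "q = 1 - 1 / (4 * real (k + 2))"
  define d where "d = (3 + 2 ^ l) * exp (- \<sigma> * (real l + 1))"
  let ?Q = "\<lambda>s. \<exists>cnt. 1 \<le> cnt \<and> z * real cnt \<le> z + 2 * real l * norm1 V (singleton_vec f) \<and> length (out s) = cnt * Jn \<and>
       queries s = cnt * (K + 1) + 1 + l * length (out s) \<and> (\<forall>w\<in>set (out s). distinct w \<and> set w = {..<n})"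
  let ?\<Phi> = "\<lambda>s. of_bool (\<not> dual_certificate V f \<delta> k (average_greedy V f v (out s))) :: ennreal"
  let ?bc = "\<lambda>s. ennreal (bad_count k z l (narr s ''sz''))"
  have ln: "n \<le> 2 ^ l" unfolding l_def by (rule le_pow_lg)
  have u0: "0 \<le> G {x}" "G {x} \<le> Kb" for x using G_singleton[OF u(1), of x] u(2) by auto
  have z0: "0 < z" unfolding z_def using \<delta> by simp
  have KJ: "K + 1 \<le> Jn" unfolding Jn_def using J(2) real_nat_ceiling_ge[of J] by linarith
  have J0: "0 < J" using J(2) by linarith
  have q0: "0 \<le> q" unfolding q_def by (simp add: field_simps)
  let ?P1 = "\<lambda>s1. pconst k l z K J s1 \<and> narr s1 ''sz'' = (\<lambda>_. 0) \<and> narr s1 ''acc'' = (\<lambda>_. 0) \<and> rarr s1 ''U'' = (\<lambda>_. 0) \<and>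
     rvar s1 ''S'' = 0 \<and> nvar s1 ''v'' = 0 \<and> queries s1 = 0"
  let ?tm = "(l + 1) * 2 ^ l * (Jn * (ic + 4) + 7) + 3"
  have init: "Ws n F (8 * l + 20) (init_com C0 C1) (init_state n k \<phi> \<delta>) ?P1"
    using Ws_init[of n F C0 C1 k \<phi> \<delta>, folded l_def]
    by (rule Ws_mono) (auto simp: init_post_def pconst_def Let_def l_def z_def K_def J_def)
  have main: "Wp n F (6 * n + 7 + 1 + ?tm) (Seq total_com main_com) s ?Q ?\<Phi> (ennreal d + ?bc s)"
    if s: "pconst k l z K J s \<and> pst_of l z 0 (2 ^ l) s \<and> queries s = nvar s ''v'' * (K + 1)" for s
  proof (rule Wp_Seq_Ws[OF Ws_total])
    show "nvar s ''n'' = n" using s by (simp add: pconst_def)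
    fix s1 assume "\<exists>y A q. s1 = s\<lparr>nvar := (nvar s)(''y'' := y), narr := (narr s)(''A'' := A),
       rvar := (rvar s)(''q'' := q, ''Z'' := rvar s ''S'' - f V), queries := queries s + 1, ticks := 0\<rparr>"
    then obtain y A q where s1: "s1 = s\<lparr>nvar := (nvar s)(''y'' := y), narr := (narr s)(''A'' := A),
       rvar := (rvar s)(''q'' := q, ''Z'' := rvar s ''S'' - f V), queries := queries s + 1, ticks := 0\<rparr>" by (elim exE)
    have c: "pconst k l z K J s1" "pst_of l z 0 (2 ^ l) s1" "rvar s1 ''Z'' = rvar s1 ''S'' - f V"
      "?bc s1 = ?bc s" "queries s1 = nvar s1 ''v'' * (K + 1) + 1"
      using s by (simp_all add: s1 pconst_def)
    note m = Wp_main_from_pst[OF k \<delta> fs \<sigma> u0 ln z_def[THEN meta_eq_to_obj_eq] J(1) J0 c(1-3) ic_def, folded Jn_def]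
    show "Wp n F ?tm main_com s1 ?Q ?\<Phi> (ennreal d + ?bc s)"
    proof (rule Wp_weaken[OF m])
      fix s' assume s': "1 \<le> nvar s1 ''v'' \<and> z * real (nvar s1 ''v'') \<le> z + 2 * real l * (\<Sum>x<2 ^ l. G {x}) \<and> length (out s') = nvar s1 ''v'' * Jn \<and>
         queries s' = queries s1 + l * length (out s') \<and> (\<forall>w\<in>set (out s'). distinct w \<and> set w = {..<n})"
      show "?Q s'"
        by (rule exI[of _ "nvar s1 ''v''"]) (use s' c(5) sum_G_singleton[OF u(1) ln] in simp)
    qed (simp_all add: c(4) d_def add.commute)
  qed
  \<comment> \<open>The main phase requires the potential \<open>d + bad_count\<close> in front of
    it; the partition bounds the expectation of that sum.\<close>
  note part = Wp_add_const[OF Wp_partition[OF z0 u0(1) q_def, where K = K and l = l and J = J], of _ "ennreal d"]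
  have "Wp n F (8 * l + 20 + 1 + (partition_cost l K + 1 + (6 * n + 7 + 1 + ?tm))) (sfm_alg C0 C1) (init_state n k \<phi> \<delta>) ?Q ?\<Phi>
     (ennreal d + ennreal (q ^ K * real ((l + 1) * 2 ^ l)))"
    unfolding sfm_alg_def
  proof (rule Wp_Seq_Ws[OF init])
    fix s1 assume s1: "?P1 s1"
    have t: "pconst k l z K J s1" "narr s1 ''sz'' = (\<lambda>_. 0)" "narr s1 ''acc'' = (\<lambda>_. 0)" "rarr s1 ''U'' = (\<lambda>_. 0)"
      "rvar s1 ''S'' = 0" "nvar s1 ''v'' = 0" "queries s1 = 0"
      using s1 by - (elim conjE, assumption)+
    show "Wp n F (partition_cost l K + 1 + (6 * n + 7 + 1 + ?tm)) (Seq partition_com (Seq total_com main_com)) s1 ?Q ?\<Phi>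
     (ennreal d + ennreal (q ^ K * real ((l + 1) * 2 ^ l)))"
      by (rule Wp_Seq[OF part[OF t(1-7)] main])
  qed
  then show ?thesis
  proof (rule Wp_weaken)
    show "8 * l + 20 + 1 + (partition_cost l K + 1 + (6 * n + 7 + 1 + ?tm)) \<le> 1000 * Jn * (2 ^ l) ^ 4"
      by (rule cost_bound[OF u0(1) ln KJ ic_def])
    have "0 \<le> d" "0 \<le> q ^ K * real ((l + 1) * 2 ^ l)" using q0 by (simp_all add: d_def)
    then show "ennreal d + ennreal (q ^ K * real ((l + 1) * 2 ^ l)) \<le>
       ennreal ((1 - 1 / (4 * real (k + 2))) ^ K * real ((l + 1) * 2 ^ l) + (3 + 2 ^ l) * exp (- \<sigma> * (real l + 1)))"
      unfolding q_def[symmetric] d_def[symmetric] by (simp add: ennreal_plus add.commute)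
  qed auto
qed

end

section \<open>The theorem\<close>

lemma lg_le_ln:
  assumes "1 < n" shows "real (lg n) \<le> 1 + 2 * ln (real n)"
proof (cases "lg n")
  case 0 then show ?thesis using assms by simp
next
  case (Suc i)
  then have "2 ^ i < n" using pow_less_iff_lg[of i n] by simp
  then have "real (2 ^ i) < real n" by (rule of_nat_less_iff[THEN iffD2])
  then have "ln (2 ^ i) < ln (real n)" using assms by (subst ln_less_cancel_iff) auto
  then have "real i * ln 2 < ln (real n)" by (simp add: ln_realpow)
  moreover have "real i * (1 / 2) \<le> real i * ln 2"
    using ln_one_minus_pos_upper_bound[of "1 / 2"] by (intro mult_left_mono) (auto simp: ln_div)
  ultimately show ?thesis by (simp add: Suc)
qed

lemma polylog_lg: "polylog (\<lambda>n. d * (real (lg n) + 3) ^ a)"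
  unfolding polylog_def
proof (intro exI bigoI[where c = "\<bar>d\<bar> * 6 ^ a"])
  show "\<forall>\<^sub>F n in sequentially. norm (d * (real (lg n) + 3) ^ a) \<le> \<bar>d\<bar> * 6 ^ a * norm (ln (real n) ^ a)"
    using eventually_ge_at_top[of 3]
  proof eventually_elim
    case (elim n)
    have "exp 1 \<le> real n" using e_less_272 elim by simp
    then have "1 \<le> ln (real n)" using elim by (subst ln_ge_iff) auto
    then have "real (lg n) + 3 \<le> 6 * ln (real n)" using lg_le_ln[of n] elim by linarith
    then have "(real (lg n) + 3) ^ a \<le> (6 * ln (real n)) ^ a" by (intro power_mono) auto
    also have "\<dots> = 6 ^ a * \<bar>ln (real n) ^ a\<bar>" using \<open>1 \<le> ln (real n)\<close> by (simp add: power_mult_distrib)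
    finally show ?case by (simp add: abs_mult mult_left_mono mult.assoc)
  qed
qed

lemma poly_bounded_fourth_power: "poly_bounded (\<lambda>n. d * (2 * real n + 1) ^ 4)"
  unfolding poly_bounded_def
proof (intro exI bigoI[where c = "\<bar>d\<bar> * 3 ^ 4"])
  show "\<forall>\<^sub>F n in sequentially. norm (d * (2 * real n + 1) ^ 4) \<le> \<bar>d\<bar> * 3 ^ 4 * norm (real n ^ 4)"
    using eventually_ge_at_top[of 1]
  proof eventually_elim
    case (elim n)
    then have "(2 * real n + 1) ^ 4 \<le> (3 * real n) ^ 4" by (intro power_mono) auto
    also have "\<dots> = 3 ^ 4 * \<bar>real n ^ 4\<bar>" by (simp add: power_mult_distrib)
    finally show ?case by (simp only: real_norm_def abs_mult mult.assoc) (intro mult_left_mono, auto)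
  qed
qed

lemma prob_ge_of_nn_integral:
  assumes "(\<integral>\<^sup>+s. of_bool (\<not> P s) \<partial>measure_pmf D) \<le> ennreal r" "0 \<le> r"
  shows "1 - r \<le> measure_pmf.prob D {s. P s}"
proof -
  have "emeasure (measure_pmf D) {s. \<not> P s} = (\<integral>\<^sup>+s. indicator {s. \<not> P s} s \<partial>measure_pmf D)" by simp
  also have "\<dots> = (\<integral>\<^sup>+s. of_bool (\<not> P s) \<partial>measure_pmf D)" by (intro nn_integral_cong) (auto simp: indicator_def)
  finally have "ennreal (measure_pmf.prob D {s. \<not> P s}) \<le> ennreal r"
    using assms(1) by (simp add: measure_pmf.emeasure_eq_measure)
  then have "measure_pmf.prob D {s. \<not> P s} \<le> r" using assms(2) by (simp add: ennreal_le_iff)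
  moreover have "measure_pmf.prob D {s. P s} = 1 - measure_pmf.prob D {s. \<not> P s}"
  proof -
    have "{s. P s} = space (measure_pmf D) - {s. \<not> P s}" by auto
    then show ?thesis using measure_pmf.prob_compl[of "{s. \<not> P s}" D] by (simp only: sets_measure_pmf UNIV_I)
  qed
  ultimately show ?thesis by linarith
qed

text \<open>With \<open>z\<close> of order \<open>\<delta> / k\<^sup>2\<close> the number of visits
  is of order \<open>(l + 1) * k\<^sup>2 * (S + \<phi>) / \<delta>\<close>, and \<open>J\<close>
  contributes \<open>(l + 1) * k ^ 4 * \<phi>\<^sup>2 / \<delta>\<^sup>2\<close>. The product has
  \<delta> only to the third power; the factor \<open>(U + \<phi>) / \<delta> \<ge> 1\<close> brings
  it to the stated form.\<close>

lemma length_bound: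
  fixes k cnt l C0 :: nat and \<delta> \<phi> S U z J :: real
  assumes k: "k > 0" and \<delta>: "0 < \<delta>" "\<delta> \<le> \<phi>" and S: "0 \<le> S" and U: "0 \<le> U" and z: "z = \<delta> / (2 * (real (k + 1) * real (k + 2)))"
    and cnt: "z * real cnt \<le> z + 2 * real l * S" and J: "J = real C0 * (real l + 1) * (real k ^ 4 * \<phi>\<^sup>2) / \<delta>\<^sup>2" "1 \<le> J"
  shows "real (cnt * nat \<lceil>J\<rceil>) \<le> 48 * real C0 * (real l + 3)\<^sup>2 * (real k ^ 6 * (1 / \<delta> ^ 4) * \<phi>\<^sup>2 * (U + \<phi>) * (S + \<phi>))"
proof -
  define D where "D = 2 * (real (k + 1) * real (k + 2))"
  have k1: "1 \<le> real k" using k by simp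
  have D0: "0 < D" unfolding D_def by (intro mult_pos_pos) auto
  have D: "D \<le> 12 * (real k)\<^sup>2"
  proof -
    have "real (k + 1) * real (k + 2) \<le> (2 * real k) * (3 * real k)" using k1 by (intro mult_mono) auto
    then show ?thesis by (simp add: D_def power2_eq_square)
  qed
  have zD: "D * z = \<delta>" using D0 unfolding z D_def[symmetric] by simp
  have "D * (z * real cnt) \<le> D * (z + 2 * real l * S)" using cnt D0 by (intro mult_left_mono) auto
  then have "\<delta> * real cnt \<le> \<delta> + D * (2 * real l * S)" by (simp only: mult.assoc[symmetric] zD distrib_left)
  also have "\<dots> \<le> \<delta> + 12 * (real k)\<^sup>2 * (2 * real l * S)" using D S by (intro add_left_mono mult_right_mono) auto
  also have "\<dots> \<le> 24 * ((real k)\<^sup>2 * (real l + 1) * (S + \<phi>))"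
  proof -
    have "1 * 1 * \<phi> \<le> (real k)\<^sup>2 * (real l + 1) * \<phi>" using k1 \<delta> by (intro mult_mono) auto
    moreover have "(real k)\<^sup>2 * real l * S \<le> (real k)\<^sup>2 * (real l + 1) * S" using S by (intro mult_right_mono mult_left_mono) auto
    moreover have "(real k)\<^sup>2 * (real l + 1) * (S + \<phi>) = (real k)\<^sup>2 * (real l + 1) * S + (real k)\<^sup>2 * (real l + 1) * \<phi>" by (simp add: algebra_simps)
    moreover have "12 * (real k)\<^sup>2 * (2 * real l * S) = 24 * ((real k)\<^sup>2 * real l * S)" by simp
    ultimately show ?thesis using \<delta> by linarith
  qed
  finally have c: "\<delta> * real cnt \<le> 24 * ((real k)\<^sup>2 * (real l + 1) * (S + \<phi>))" .
  have "real (nat \<lceil>J\<rceil>) \<le> 2 * J" using J(2) by linarith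
  then have "\<delta>\<^sup>2 * real (nat \<lceil>J\<rceil>) \<le> \<delta>\<^sup>2 * (2 * J)" by (intro mult_left_mono) auto
  also have "\<dots> = 2 * (real C0 * (real l + 1) * (real k ^ 4 * \<phi>\<^sup>2))" using \<delta> by (simp add: J(1))
  finally have j: "\<delta>\<^sup>2 * real (nat \<lceil>J\<rceil>) \<le> 2 * (real C0 * (real l + 1) * (real k ^ 4 * \<phi>\<^sup>2))" .
  have "\<delta> * ((\<delta> * real cnt) * (\<delta>\<^sup>2 * real (nat \<lceil>J\<rceil>))) \<le>
     (U + \<phi>) * ((24 * ((real k)\<^sup>2 * (real l + 1) * (S + \<phi>))) * (2 * (real C0 * (real l + 1) * (real k ^ 4 * \<phi>\<^sup>2))))"
    by (rule mult_mono[OF _ mult_mono[OF c j]]) (use \<delta> S U in auto)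
  also have "\<dots> = 48 * real C0 * (real l + 1)\<^sup>2 * (real k ^ 6 * \<phi>\<^sup>2 * (U + \<phi>) * (S + \<phi>))"
    by (simp add: power2_eq_square power_numeral_reduce)
  also have "\<dots> \<le> 48 * real C0 * (real l + 3)\<^sup>2 * (real k ^ 6 * \<phi>\<^sup>2 * (U + \<phi>) * (S + \<phi>))"
    using \<delta> S U by (intro mult_right_mono mult_left_mono power_mono mult_nonneg_nonneg) auto
  finally have "\<delta> ^ 4 * real (cnt * nat \<lceil>J\<rceil>) \<le> 48 * real C0 * (real l + 3)\<^sup>2 * (real k ^ 6 * \<phi>\<^sup>2 * (U + \<phi>) * (S + \<phi>))"
    by (simp add: power2_eq_square power_numeral_reduce mult_ac)
  then have "real (cnt * nat \<lceil>J\<rceil>) \<le> (48 * real C0 * (real l + 3)\<^sup>2 * (real k ^ 6 * \<phi>\<^sup>2 * (U + \<phi>) * (S + \<phi>))) / \<delta> ^ 4"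
    using \<delta> by (subst pos_le_divide_eq) (auto simp: mult.commute)
  then show ?thesis by simp
qed

lemma dual_certificate_empty: "f {} = 0 \<Longrightarrow> 0 < \<delta> \<Longrightarrow> dual_certificate {} f \<delta> k y"
  by (simp add: dual_certificate_def min_value_def neg_sum_def)

context sfm begin

lemma sfm_alg_correct:
  fixes C c \<phi> \<delta> eo :: real and k C0 C1 :: nat
  assumes C: "0 < C" and c: "0 < c" and C1: "12 * (C + 2) \<le> real C1"
    and C0: "2688 * (C + 4) * (1 / c + 2)\<^sup>2 + real C1 + 1 \<le> real C0"
    and u: "\<forall>p\<in>V. 0 \<le> singleton_vec f p" and k: "k > 0" and \<phi>: "\<bar>min_value V f\<bar> \<le> \<phi>" "c * (norm_inf V (singleton_vec f) / real k) \<le> \<phi>"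
    and \<delta>: "0 < \<delta>" "\<delta> \<le> \<phi>" and eo: "0 \<le> eo"
  shows "\<exists>N D. run n F N (sfm_alg C0 C1, init_state n k \<phi> \<delta>) = map_pmf (Pair SKIP) D \<and>
    (\<forall>s\<in>set_pmf D. out s \<noteq> [] \<and> (\<forall>w\<in>set (out s). bij_betw (perm_of v w) {1..n} V) \<and>
       real (length (out s)) \<le> 48 * real C0 * (real (lg n) + 3)\<^sup>2 * (real k ^ 6 * (1 / \<delta> ^ 4) * \<phi>\<^sup>2 *
          (norm_inf V (singleton_vec f) + \<phi>) * (norm1 V (singleton_vec f) + \<phi>)) \<and>
       running_time eo s \<le> (real (lg n) + 3) * real (length (out s)) * (eo + 1000 * (2 * real n + 1) ^ 4)) \<and>
    1 - real n powr - C \<le> measure_pmf.prob D {s. dual_certificate V f \<delta> k (average_greedy V f v (out s))}"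
proof -
  define l where "l = lg n"
  \<comment> \<open>\<open>c0 * k * \<phi>\<close> dominates both the largest singleton value, which
    is at most \<open>k * \<phi> / c\<close>, and \<phi> itself.\<close>
  define c0 where "c0 = 1 / c + 2"
  define Kb where "Kb = c0 * real k * \<phi>"
  define z where "z = \<delta> / (2 * (real (k + 1) * real (k + 2)))"
  define K where "K = C1 * ((l + 1) * k)"
  define J where "J = real C0 * (real l + 1) * (real k ^ 4 * \<phi>\<^sup>2) / \<delta>\<^sup>2"
  define Jn where "Jn = nat \<lceil>J\<rceil>"
  define r where "r = (1 - 1 / (4 * real (k + 2))) ^ K * real ((l + 1) * 2 ^ l) + (3 + 2 ^ l) * exp (- (C + 2) * (real l + 1))"
  let ?cert = "\<lambda>s. dual_certificate V f \<delta> k (average_greedy V f v (out s))"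
  have k1: "1 \<le> real k" using k by simp
  have c0: "1 \<le> c0" using c by (simp add: c0_def)
  have \<phi>0: "0 < \<phi>" using \<delta> by simp
  have uinf: "0 \<le> norm_inf V (singleton_vec f)" unfolding norm_inf_def using finite_V by (intro Max_ge) auto
  have u1: "0 \<le> norm1 V (singleton_vec f)" unfolding norm1_def by (intro sum_nonneg) auto
  have Kb1: "norm_inf V (singleton_vec f) \<le> Kb"
  proof -
    have "c * norm_inf V (singleton_vec f) \<le> \<phi> * real k" using \<phi>(2) k by (simp add: pos_divide_le_eq)
    then have "norm_inf V (singleton_vec f) \<le> 1 / c * real k * \<phi>" using c by (simp add: pos_le_divide_eq mult.commute)
    also have "\<dots> \<le> Kb" unfolding Kb_def c0_def using \<phi>0 by (intro mult_right_mono) auto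
    finally show ?thesis .
  qed
  have Kb2: "\<phi> \<le> Kb"
  proof -
    have "1 * 1 * \<phi> \<le> c0 * real k * \<phi>" using c0 k1 \<phi>0 by (intro mult_mono) auto
    then show ?thesis by (simp add: Kb_def)
  qed
  have J1: "2688 * (C + 2 + 2) * (real l + 1) * real (k\<^sup>2) * Kb\<^sup>2 / \<delta>\<^sup>2 \<le> J"
  proof -
    have "2688 * (C + 2 + 2) * (real l + 1) * real (k\<^sup>2) * Kb\<^sup>2 = (2688 * (C + 4) * c0\<^sup>2) * ((real l + 1) * (real k ^ 4 * \<phi>\<^sup>2))"
      by (simp add: Kb_def power2_eq_square power_numeral_reduce mult_ac)
    also have "\<dots> \<le> real C0 * ((real l + 1) * (real k ^ 4 * \<phi>\<^sup>2))"
      using C0 unfolding c0_def[symmetric] by (intro mult_right_mono) auto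
    finally show ?thesis unfolding J_def by (intro divide_right_mono) (simp_all add: mult.assoc)
  qed
  have J2: "real K + 1 \<le> J"
  proof -
    have C01: "real C1 + 1 \<le> real C0"
    proof -
      have "0 \<le> 2688 * (C + 4) * (1 / c + 2)\<^sup>2" using C by simp
      then show ?thesis using C0 by linarith
    qed
    have lk: "1 * 1 \<le> (real l + 1) * real k" using k1 by (intro mult_mono) auto
    have "real K + 1 \<le> (real C1 + 1) * ((real l + 1) * real k)" using lk by (simp add: K_def algebra_simps)
    also have "\<dots> \<le> real C0 * ((real l + 1) * real k)" using C01 by (intro mult_right_mono) auto
    also have "\<dots> \<le> real C0 * ((real l + 1) * (real k ^ 4 * (\<phi>\<^sup>2 / \<delta>\<^sup>2)))"
    proof (intro mult_left_mono)
      have "real k ^ 1 \<le> real k ^ 4" using k1 by (intro power_increasing) auto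
      moreover have "1 \<le> \<phi>\<^sup>2 / \<delta>\<^sup>2" using \<delta> by (simp add: power_mono)
      ultimately have "real k ^ 1 * 1 \<le> real k ^ 4 * (\<phi>\<^sup>2 / \<delta>\<^sup>2)" by (intro mult_mono) auto
      then show "real k \<le> real k ^ 4 * (\<phi>\<^sup>2 / \<delta>\<^sup>2)" by simp
    qed auto
    also have "\<dots> = J" by (simp add: J_def)
    finally show ?thesis .
  qed
  have KJ: "K + 1 \<le> Jn" unfolding Jn_def using J2 real_nat_ceiling_ge[of J] by linarith
  have fs: "- \<phi> \<le> min_value V f" and \<sigma>: "0 \<le> C + 2" using \<phi>(1) C by linarith+
  have W: "Wp n F (1000 * Jn * (2 ^ l) ^ 4) (sfm_alg C0 C1) (init_state n k \<phi> \<delta>)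
    (\<lambda>s. \<exists>cnt. 1 \<le> cnt \<and> z * real cnt \<le> z + 2 * real l * norm1 V (singleton_vec f) \<and> length (out s) = cnt * Jn \<and>
       queries s = cnt * (K + 1) + 1 + l * length (out s) \<and> (\<forall>w\<in>set (out s). distinct w \<and> set w = {..<n}))
    (\<lambda>s. of_bool (\<not> ?cert s)) (ennreal r)"
    using Wp_sfm_alg[OF k \<delta> Kb2 fs \<sigma> u Kb1, of C0 C1, folded l_def, folded J_def K_def z_def, folded Jn_def r_def] J1 J2 by blast
  have init: "(init_state n k \<phi> \<delta>)\<lparr>ticks := 0\<rparr> = init_state n k \<phi> \<delta>" by (simp add: init_state_def)
  obtain D where D: "run n F (1000 * Jn * (2 ^ l) ^ 4) (sfm_alg C0 C1, init_state n k \<phi> \<delta>) = map_pmf (Pair SKIP) D"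
    "\<And>s'. s' \<in> set_pmf D \<Longrightarrow> (\<exists>cnt. 1 \<le> cnt \<and> z * real cnt \<le> z + 2 * real l * norm1 V (singleton_vec f) \<and> length (out s') = cnt * Jn \<and>
       queries s' = cnt * (K + 1) + 1 + l * length (out s') \<and> (\<forall>w\<in>set (out s'). distinct w \<and> set w = {..<n})) \<and>
       ticks s' \<le> 1000 * Jn * (2 ^ l) ^ 4"
    "(\<integral>\<^sup>+s'. of_bool (\<not> ?cert s') \<partial>measure_pmf D) \<le> ennreal r"
    using W[unfolded Wp_def, rule_format, of 0] unfolding init by auto
  have det: "out s \<noteq> [] \<and> (\<forall>w\<in>set (out s). bij_betw (perm_of v w) {1..n} V) \<and>
       real (length (out s)) \<le> 48 * real C0 * (real l + 3)\<^sup>2 * (real k ^ 6 * (1 / \<delta> ^ 4) * \<phi>\<^sup>2 *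
          (norm_inf V (singleton_vec f) + \<phi>) * (norm1 V (singleton_vec f) + \<phi>)) \<and>
       running_time eo s \<le> (real l + 3) * real (length (out s)) * (eo + 1000 * (2 * real n + 1) ^ 4)" if s: "s \<in> set_pmf D" for s
  proof -
    obtain cnt where cnt: "1 \<le> cnt" "z * real cnt \<le> z + 2 * real l * norm1 V (singleton_vec f)" "length (out s) = cnt * Jn"
       "queries s = cnt * (K + 1) + 1 + l * length (out s)" "\<forall>w\<in>set (out s). distinct w \<and> set w = {..<n}" "ticks s \<le> 1000 * Jn * (2 ^ l) ^ 4"
      using D(2)[OF s] by (elim exE conjE)
    define m where "m = length (out s)"
    have JnM: "Jn \<le> m" using cnt(1) unfolding m_def cnt(3) by simp
    \<comment> \<open>The \<open>K + 1\<close> queries of a visit are charged to the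
      \<open>Jn\<close> rounds run on its account; this is the reason for
      \<open>K + 1 \<le> J\<close>.\<close>
    have KM: "cnt * (K + 1) \<le> m" unfolding m_def cnt(3) using KJ by (rule mult_le_mono2)
    have m1: "1 \<le> m" using JnM KJ by simp
    have len: "real m \<le> 48 * real C0 * (real l + 3)\<^sup>2 * (real k ^ 6 * (1 / \<delta> ^ 4) * \<phi>\<^sup>2 *
          (norm_inf V (singleton_vec f) + \<phi>) * (norm1 V (singleton_vec f) + \<phi>))"
      unfolding m_def cnt(3) Jn_def
      by (rule length_bound[OF k \<delta> u1 uinf z_def cnt(2) J_def]) (use J2 in simp)
    have q: "real (queries s) \<le> (real l + 3) * real m"
    proof -
      have "queries s \<le> m + m + l * m" using cnt(4) KM m1 unfolding m_def[symmetric] by linarith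
      then have "real (queries s) \<le> real (m + m + l * m)" by (rule of_nat_mono)
      also have "\<dots> \<le> (real l + 3) * real m" by (simp add: algebra_simps)
      finally show ?thesis .
    qed
    have t: "real (ticks s) \<le> (real l + 3) * real m * (1000 * (2 * real n + 1) ^ 4)"
    proof -
      have "(2::nat) ^ l \<le> 2 * n + 1" unfolding l_def by (rule pow_lg_le)
      then have "1000 * Jn * (2 ^ l) ^ 4 \<le> 1000 * m * (2 * n + 1) ^ 4" using JnM by (intro mult_le_mono power_mono) auto
      then have "ticks s \<le> 1000 * m * (2 * n + 1) ^ 4" using cnt(6) by linarith
      then have "real (ticks s) \<le> real (1000 * m * (2 * n + 1) ^ 4)" by (rule of_nat_mono)
      also have "\<dots> = 1 * real m * (1000 * (2 * real n + 1) ^ 4)" by (simp add: add.commute)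
      also have "\<dots> \<le> (real l + 3) * real m * (1000 * (2 * real n + 1) ^ 4)" by (intro mult_right_mono) auto
      finally show ?thesis .
    qed
    have "eo * real (queries s) \<le> eo * ((real l + 3) * real m)" using q eo by (rule mult_left_mono)
    then have "running_time eo s \<le> (real l + 3) * real m * (eo + 1000 * (2 * real n + 1) ^ 4)"
      using t by (simp add: running_time_def distrib_left mult.commute mult.left_commute)
    moreover have "out s \<noteq> []" using m1 by (auto simp: m_def)
    ultimately show ?thesis using len cnt(5) perm_of_bij unfolding m_def by blast
  qed
  have r0: "0 \<le> r" unfolding r_def by (intro add_nonneg_nonneg mult_nonneg_nonneg zero_le_power) (auto simp: field_simps)
  have "1 - real n powr - C \<le> measure_pmf.prob D {s. ?cert s}"
  proof (cases "n = 0")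
    \<comment> \<open>\<open>0 powr - C\<close> is 0, so for empty \<open>V\<close> the certificate
      must hold surely.\<close>
    case True
    then have "V = {}" using finite_V by simp
    then have e: "{s. ?cert s} = UNIV" using dual_certificate_empty[of f, OF f_empty \<delta>(1)] by auto
    show ?thesis unfolding e using True measure_pmf.prob_space[of D] by simp
  next
    case False
    have "r \<le> real n powr - C"
      unfolding r_def K_def by (rule failure_bound[OF k C1 C]) (use False le_pow_lg[of n] in \<open>simp_all add: l_def\<close>)
    then show ?thesis using prob_ge_of_nn_integral[OF D(3) r0] by linarith
  qed
  then show ?thesis using D(1) det unfolding l_def by blast
qed

end

theorem theorem6p1:
  fixes C c :: real
  assumes "C > 0" and "c > 0"
  shows "\<exists>alg L1 L2 q.
    polylog L1 \<and> polylog L2 \<and> poly_bounded q \<and>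
    (\<forall>(V :: 'a set) f v (k :: nat) \<phi> \<delta> eo.
      finite V \<longrightarrow>
      bij_betw v {..<card V} V \<longrightarrow>
      submodular_on V f \<longrightarrow>
      f {} = 0 \<longrightarrow>
      (\<forall>p\<in>V. singleton_vec f p \<ge> 0) \<longrightarrow>
      k > 0 \<longrightarrow>
      \<phi> \<ge> \<bar>min_value V f\<bar> \<longrightarrow>
      0 < \<delta> \<longrightarrow> \<delta> \<le> \<phi> \<longrightarrow>
      \<phi> \<ge> c * (norm_inf V (singleton_vec f) / real k) \<longrightarrow>
      eo \<ge> 0 \<longrightarrow>
      (\<exists>N.
        let n = card V;
            D = run n (\<lambda>I. f (v ` I)) N (alg, init_state n k \<phi> \<delta>)
        in
          (\<forall>(c', s) \<in> set_pmf D.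
             c' = SKIP \<and>
             out s \<noteq> [] \<and>
             (\<forall>w \<in> set (out s). bij_betw (perm_of v w) {1..n} V) \<and>
             real (length (out s)) \<le>
               L1 n * (real k ^ 6 * (1 / \<delta> ^ 4) * \<phi>\<^sup>2 *
                 (norm_inf V (singleton_vec f) + \<phi>) * (norm1 V (singleton_vec f) + \<phi>)) \<and>
             running_time eo s \<le> L2 n * real (length (out s)) * (eo + q n)) \<and>
          measure_pmf.prob D
            {(c', s). dual_certificate V f \<delta> k (average_greedy V f v (out s))}
            \<ge> 1 - real n powr (- C)))"
proof -
  \<comment> \<open>\<open>C1\<close> makes the tests of a node reliable enough; \<open>C0\<close>
    gives enough rounds per visit, both for the potentials and to outnumber the queries of a
    visit.\<close>
  define C1 where "C1 = nat \<lceil>12 * (C + 2)\<rceil>"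
  define C0 where "C0 = nat \<lceil>2688 * (C + 4) * (1 / c + 2)\<^sup>2 + real C1 + 1\<rceil>"
  have C1: "12 * (C + 2) \<le> real C1" unfolding C1_def by (rule real_nat_ceiling_ge)
  have C0: "2688 * (C + 4) * (1 / c + 2)\<^sup>2 + real C1 + 1 \<le> real C0" unfolding C0_def by (rule real_nat_ceiling_ge)
  show ?thesis
  proof (rule exI[of _ "sfm_alg C0 C1"], rule exI[of _ "\<lambda>n. 48 * real C0 * (real (lg n) + 3)\<^sup>2"],
      rule exI[of _ "\<lambda>n. real (lg n) + 3"], rule exI[of _ "\<lambda>n. 1000 * (2 * real n + 1) ^ 4"], intro conjI allI impI)
    show "polylog (\<lambda>n. 48 * real C0 * (real (lg n) + 3)\<^sup>2)" by (rule polylog_lg)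
    show "polylog (\<lambda>n. real (lg n) + 3)" using polylog_lg[of 1 1] by simp
    show "poly_bounded (\<lambda>n. 1000 * (2 * real n + 1) ^ 4)" by (rule poly_bounded_fourth_power)
  next
    fix V :: "'a set" and f v and k :: nat and \<phi> \<delta> eo :: real
    assume a: "finite V" "bij_betw v {..<card V} V" "submodular_on V f" "f {} = 0" and u: "\<forall>p\<in>V. 0 \<le> singleton_vec f p"
      and k: "0 < k" and \<phi>: "\<bar>min_value V f\<bar> \<le> \<phi>" and \<delta>: "0 < \<delta>" "\<delta> \<le> \<phi>"
      and \<phi>c: "c * (norm_inf V (singleton_vec f) / real k) \<le> \<phi>" and eo: "0 \<le> eo"
    interpret sfm V f v by unfold_locales (use a in auto)
    obtain N D where D: "run (card V) (\<lambda>I. f (v ` I)) N (sfm_alg C0 C1, init_state (card V) k \<phi> \<delta>) = map_pmf (Pair SKIP) D"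
      and det: "\<And>s. s \<in> set_pmf D \<Longrightarrow> out s \<noteq> [] \<and> (\<forall>w\<in>set (out s). bij_betw (perm_of v w) {1..card V} V) \<and>
       real (length (out s)) \<le> 48 * real C0 * (real (lg (card V)) + 3)\<^sup>2 * (real k ^ 6 * (1 / \<delta> ^ 4) * \<phi>\<^sup>2 *
          (norm_inf V (singleton_vec f) + \<phi>) * (norm1 V (singleton_vec f) + \<phi>)) \<and>
       running_time eo s \<le> (real (lg (card V)) + 3) * real (length (out s)) * (eo + 1000 * (2 * real (card V) + 1) ^ 4)"
      and pr: "1 - real (card V) powr - C \<le> measure_pmf.prob D {s. dual_certificate V f \<delta> k (average_greedy V f v (out s))}"
      using sfm_alg_correct[OF assms C1 C0 u k \<phi> \<phi>c \<delta> eo] by blast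
    have pre: "Pair SKIP -` {(c', s). dual_certificate V f \<delta> k (average_greedy V f v (out s))} =
       {s. dual_certificate V f \<delta> k (average_greedy V f v (out s))}" by auto
    show "\<exists>N. let n = card V; D = run n (\<lambda>I. f (v ` I)) N (sfm_alg C0 C1, init_state n k \<phi> \<delta>)
        in (\<forall>(c', s) \<in> set_pmf D. c' = SKIP \<and> out s \<noteq> [] \<and> (\<forall>w \<in> set (out s). bij_betw (perm_of v w) {1..n} V) \<and>
             real (length (out s)) \<le> 48 * real C0 * (real (lg n) + 3)\<^sup>2 * (real k ^ 6 * (1 / \<delta> ^ 4) * \<phi>\<^sup>2 *
                 (norm_inf V (singleton_vec f) + \<phi>) * (norm1 V (singleton_vec f) + \<phi>)) \<and>
             running_time eo s \<le> (real (lg n) + 3) * real (length (out s)) * (eo + 1000 * (2 * real n + 1) ^ 4)) \<and>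
          measure_pmf.prob D {(c', s). dual_certificate V f \<delta> k (average_greedy V f v (out s))} \<ge> 1 - real n powr (- C)"
      unfolding Let_def
    proof (rule exI[of _ N], unfold D, intro conjI)
      show "\<forall>(c', s) \<in> set_pmf (map_pmf (Pair SKIP) D). c' = SKIP \<and> out s \<noteq> [] \<and> (\<forall>w \<in> set (out s). bij_betw (perm_of v w) {1..card V} V) \<and>
             real (length (out s)) \<le> 48 * real C0 * (real (lg (card V)) + 3)\<^sup>2 * (real k ^ 6 * (1 / \<delta> ^ 4) * \<phi>\<^sup>2 *
                 (norm_inf V (singleton_vec f) + \<phi>) * (norm1 V (singleton_vec f) + \<phi>)) \<and>
             running_time eo s \<le> (real (lg (card V)) + 3) * real (length (out s)) * (eo + 1000 * (2 * real (card V) + 1) ^ 4)"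
        by (simp only: set_map_pmf Set.ball_simps split_conv simp_thms) (intro ballI, erule det)
      show "1 - real (card V) powr - C \<le>
        measure_pmf.prob (map_pmf (Pair SKIP) D) {(c', s). dual_certificate V f \<delta> k (average_greedy V f v (out s))}"
        unfolding measure_map_pmf pre by (rule pr)
    qed
  qed
qed

end
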